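(* Let $m\le n$ be positive integers, let $U$ be an open subset of $\mathbb R^n$, and let $V$ be an $m$-dimensional rectifiable varifold in $U$ such that $\|\delta V\|$ is a Radon measure. Then there exists a decomposition of $V$.
   Context: $\mathbf G(n,m)$ is the set of $m$-dimensional linear subspaces of $\mathbb R^n$; $S_\natural$ is the orthogonal projection onto $S$; $\sigma\bullet\tau=\operatorname{trace}(\sigma^*\circ\tau)$. An $m$-dimensional varifold $V$ in $U$ is a Radon measure over $U\times\mathbf G(n,m)$, with weight $\|V\|(A)=V(A\times\mathbf G(n,m))$. It is rectifiable if $V(k)=\sum_{i=1}^\infty c_i\int_{E_i}k(z,\operatorname{Tan}(M_i,z))\,d\mathscr H^m z$ for continuous compactly supported $k$, with $0<c_i<\infty$ and $E_i$ Borel subsets of $m$-dimensional $C^1$ submanifolds $M_i$. First variation: $\delta V(g)=\int Dg(z)\bullet S_\natural\,dV(z,S)$ for $g\in C_c^\infty(U,\mathbb R^n)$; $\|\delta V\|$ is its total variation measure. If $\|\delta V\|$ is a Radon measure, there is a $\|\delta V\|$ measurable unit vector field $\eta(V,\cdot)$ with $\delta V(g)=\int g\bullet\eta(V,\cdot)\,d\|\delta V\|$; for $\|\delta V\|$ measurable $E$, $((\delta V)\llcorner E)(g)=\int_E g\bullet\eta(V,\cdot)\,d\|\delta V\|$. $V\llcorner(E\times\mathbf G(n,m))$ denotes restriction of the measure. For a varifold $V$ with $\|\delta V\|$ Radon and a $\|V\|+\|\delta V\|$ measurable set $E$, the distributional $V$ boundary of $E$ is $V\,\partial E=(\delta V)\llcorner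 E-\delta(V\llcorner (E\times\mathbf G(n,m)))$. Such $V$ is indecomposable if there is no $\|V\|+\|\delta V\|$ measurable set $B$ with $\|V\|(B)>0$, $\|V\|(U\setminus B)>0$ and $V\,\partial B=0$. $W$ is a component of $V$ if $W$ is a nonzero indecomposable $m$-dimensional varifold in $U$ and there is a $\|V\|+\|\delta V\|$ measurable set $A$ with $W=V\llcorner(A\times\mathbf G(n,m))$ and $V\,\partial A=0$. A set $G$ of $m$-dimensional varifolds in $U$ is a decomposition of $V$ if: (i) each member of $G$ is a component of $V$; (ii) whenever $W,X$ are distinct members of $G$ there are disjoint $\|V\|+\|\delta V\|$ measurable sets $A,B$ with $V\,\partial A=0=V\,\partial B$, $W=V\llcorner(A\times\mathbf G(n,m))$ and $X=V\llcorner(B\times\mathbf G(n,m))$; (iii) $V(f)=\sum_{W\in G}W(f)$ for every continuous compactly supported $f:U\times\mathbf G(n,m)\to\mathbb R$. *)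

theory Defs
  imports "HOL-Analysis.Analysis"
begin

section \<open>Measures\<close>

definition borel_on :: "'a topology \<Rightarrow> 'a measure" where
  "borel_on X = sigma (topspace X) {S. openin X S}"

text \<open>
  Radon measures in the sense of Federer. His measures are outer measures defined on all subsets;
  here a Radon measure is stored as its restriction to the Borel sets. By outer regularity, its
  measurable sets in the sense of Caratheodory are the sets of the completion, so
  ``\<open>\<mu>\<close> measurable'' is rendered below by membership in \<^term>\<open>sets (completion \<mu>)\<close>.
\<close>

definition radon_measure :: "'a topology \<Rightarrow> 'a measure \<Rightarrow> bool" where
  "radon_measure X \<mu> \<longleftrightarrow>
     sets \<mu> = sets (borel_on X) \<and>
     (\<forall>K. compactin X K \<longrightarrow> emeasure \<mu> K < \<infinity>) \<and>
     (\<forall>S. openin X S \<longrightarrow> emeasure \<mu> S = (SUP K\<in>{K. compactin X K \<and> K \<subseteq> S}. emeasure \<mu> K)) \<and>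
     (\<forall>A\<in>sets \<mu>. emeasure \<mu> A = (INF S\<in>{S. openin X S \<and> A \<subseteq> S}. emeasure \<mu> S))"

definition cc_functions :: "'a topology \<Rightarrow> ('a \<Rightarrow> real) set" where
  "cc_functions X =
     {f. continuous_map X euclideanreal f \<and> compactin X (X closure_of {x \<in> topspace X. f x \<noteq> 0})}"

definition sum_measure :: "'a measure \<Rightarrow> 'a measure \<Rightarrow> 'a measure" where
  "sum_measure \<mu> \<nu> = measure_of (space \<mu>) (sets \<mu>) (\<lambda>A. emeasure \<mu> A + emeasure \<nu> A)"

text \<open>The measure \<open>B \<mapsto> \<mu>(B \<inter> A)\<close>, where \<open>A\<close> need only be measurable for the completion of \<open>\<mu>\<close>.\<close>

definition measure_restriction :: "'a measure \<Rightarrow> 'a set \<Rightarrow> 'a measure" where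
  "measure_restriction \<mu> A =
     measure_of (space \<mu>) (sets \<mu>) (\<lambda>B. emeasure (completion \<mu>) (B \<inter> A))"

text \<open>
  Hausdorff measure with Federer's normalisation, for \<open>m \<ge> 1\<close> only: for \<open>m = 0\<close> the
  convention \<open>0 ^ 0 = 1\<close> would charge the empty members of a covering.
\<close>

definition hausdorff_outer :: "nat \<Rightarrow> 'a::metric_space set \<Rightarrow> ennreal" where
  "hausdorff_outer m A =
     (SUP \<delta>\<in>{0<..}. INF C\<in>{C :: nat \<Rightarrow> 'a set.
          A \<subseteq> (\<Union>i. C i) \<and> (\<forall>i. bounded (C i) \<and> diameter (C i) \<le> \<delta>)}.
        \<Sum>i. ennreal (unit_ball_vol (real m) * (diameter (C i) / 2) ^ m))"

definition hausdorff :: "nat \<Rightarrow> 'a::metric_space measure" where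
  "hausdorff m = measure_of UNIV (sets borel) (hausdorff_outer m)"

section \<open>Differentiability classes, submanifolds and tangent cones\<close>

text \<open>
  Class \<open>k\<close> on an open subset of a finite-dimensional space: the \<open>k\<close>-fold iterated directional
  derivatives exist and are continuous.
\<close>

primrec Ck_on :: "nat \<Rightarrow> 'a::euclidean_space set \<Rightarrow> ('a \<Rightarrow> 'b::real_normed_vector) \<Rightarrow> bool" where
  "Ck_on 0 S f \<longleftrightarrow> continuous_on S f"
| "Ck_on (Suc k) S f \<longleftrightarrow>
     (\<forall>x\<in>S. f differentiable (at x)) \<and> (\<forall>v. Ck_on k S (\<lambda>x. frechet_derivative f (at x) v))"

definition C1_submanifold :: "nat \<Rightarrow> 'a::euclidean_space set \<Rightarrow> bool" where
  "C1_submanifold m M \<longleftrightarrow>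
     (\<forall>a\<in>M. \<exists>T W \<phi> \<psi> Z. open T \<and> a \<in> T \<and> open W \<and> homeomorphism T W \<phi> \<psi> \<and>
        Ck_on 1 T \<phi> \<and> Ck_on 1 W \<psi> \<and>
        subspace (Z :: 'a set) \<and> dim Z = m \<and> \<phi> ` (M \<inter> T) = Z \<inter> W)"

definition tangent_cone :: "'a::real_normed_vector set \<Rightarrow> 'a \<Rightarrow> 'a set" where
  "tangent_cone M a =
     {v. \<forall>\<epsilon>>0. \<exists>x\<in>M. \<exists>r>0. norm (x - a) < \<epsilon> \<and> norm (r *\<^sub>R (x - a) - v) < \<epsilon>}"

text \<open>Members of \<open>C\<^sub>c\<^sup>\<infinity>(U, \<real>\<^sup>n)\<close>, extended by zero to the whole space.\<close>

definition test_fields :: "'a::euclidean_space set \<Rightarrow> ('a \<Rightarrow> 'a) set" where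
  "test_fields U =
     {g. (\<forall>k. Ck_on k UNIV g) \<and> compact (closure {z. g z \<noteq> 0}) \<and> closure {z. g z \<noteq> 0} \<subseteq> U}"

section \<open>The Grassmannian\<close>

definition grassmannian :: "nat \<Rightarrow> (real^'n) set set" where
  "grassmannian m = {S. subspace S \<and> dim S = m}"

definition orth_proj :: "(real^'n) set \<Rightarrow> real^'n \<Rightarrow> real^'n" where
  "orth_proj S x = (THE y. y \<in> S \<and> (\<forall>w\<in>S. orthogonal (x - y) w))"

text \<open>The usual topology of the Grassmannian, induced by \<open>S \<mapsto> S\<^sub>\<natural>\<close>.\<close>

definition grassmannian_topology :: "nat \<Rightarrow> (real^'n) set topology" where
  "grassmannian_topology m =
     pullback_topology (grassmannian m) (\<lambda>S. matrix (orth_proj S)) euclidean"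

definition hom_inner :: "(real^'n \<Rightarrow> real^'n) \<Rightarrow> (real^'n \<Rightarrow> real^'n) \<Rightarrow> real" where
  "hom_inner \<sigma> \<tau> = trace (matrix (adjoint \<sigma> \<circ> \<tau>))"

section \<open>Varifolds\<close>

type_synonym 'n varifold = "((real^'n) \<times> (real^'n) set) measure"

definition varifold_space :: "nat \<Rightarrow> (real^'n) set \<Rightarrow> ((real^'n) \<times> (real^'n) set) topology" where
  "varifold_space m U = prod_topology (top_of_set U) (grassmannian_topology m)"

definition varifold :: "nat \<Rightarrow> (real^'n) set \<Rightarrow> 'n::finite varifold \<Rightarrow> bool" where
  "varifold m U V \<longleftrightarrow> radon_measure (varifold_space m U) V"

definition weight :: "(real^'n) set \<Rightarrow> 'n::finite varifold \<Rightarrow> (real^'n) measure" where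
  "weight U V = distr V (restrict_space borel U) fst"

text \<open>
  The integrability clause is implicit in the displayed series: without it, the Bochner integral
  over some \<open>E i\<close> could take the default value \<open>0\<close>.
\<close>

definition rectifiable_varifold :: "nat \<Rightarrow> (real^'n) set \<Rightarrow> 'n::finite varifold \<Rightarrow> bool" where
  "rectifiable_varifold m U V \<longleftrightarrow>
     varifold m U V \<and>
     (\<exists>(c :: nat \<Rightarrow> real) E M.
        (\<forall>i. 0 < c i \<and> C1_submanifold m (M i) \<and> E i \<in> sets borel \<and> E i \<subseteq> M i \<inter> U) \<and>
        (\<forall>k\<in>cc_functions (varifold_space m U).
           (\<forall>i. set_integrable (hausdorff m) (E i) (\<lambda>z. k (z, tangent_cone (M i) z))) \<and>
           (\<lambda>i. c i * (LINT z:E i|hausdorff m. k (z, tangent_cone (M i) z))) sums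
             (LINT p|V. k p)))"

definition first_variation :: "'n::finite varifold \<Rightarrow> (real^'n \<Rightarrow> real^'n) \<Rightarrow> real" where
  "first_variation V g =
     (LINT (z, S)|V. hom_inner (frechet_derivative g (at z)) (orth_proj S))"

text \<open>
  The total variation measure of a linear functional \<open>T\<close> on the test fields in \<open>U\<close>: on open sets
  it is the supremum of \<open>T\<close> over admissible fields, and it is extended to the other sets by outer
  regularity.
\<close>

definition variation_open ::
    "(real^'n) set \<Rightarrow> ((real^'n \<Rightarrow> real^'n) \<Rightarrow> real) \<Rightarrow> (real^'n) set \<Rightarrow> ennreal" where
  "variation_open U T S =
     (SUP g\<in>{g \<in> test_fields U. closure {z. g z \<noteq> 0} \<subseteq> S \<and> (\<forall>z. norm (g z) \<le> 1)}. ennreal (T g))"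

definition total_variation ::
    "(real^'n) set \<Rightarrow> ((real^'n::finite \<Rightarrow> real^'n) \<Rightarrow> real) \<Rightarrow> (real^'n) measure" where
  "total_variation U T =
     measure_of U (sets (restrict_space borel U))
       (\<lambda>A. INF S\<in>{S. openin (top_of_set U) S \<and> A \<subseteq> S}. variation_open U T S)"

definition variation_measure :: "(real^'n) set \<Rightarrow> 'n::finite varifold \<Rightarrow> (real^'n) measure" where
  "variation_measure U V = total_variation U (first_variation V)"

definition radon_first_variation :: "(real^'n) set \<Rightarrow> 'n::finite varifold \<Rightarrow> bool" where
  "radon_first_variation U V \<longleftrightarrow> radon_measure (top_of_set U) (variation_measure U V)"

definition measurable_sets :: "(real^'n) set \<Rightarrow> 'n::finite varifold \<Rightarrow> (real^'n) set set" where
  "measurable_sets U V = sets (completion (sum_measure (weight U V) (variation_measure U V)))"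

text \<open>
  The unit field \<open>\<eta>(V, \<cdot>)\<close>; it exists when the total variation is Radon, and is then unique almost
  everywhere with respect to it.
\<close>

definition variation_direction :: "(real^'n) set \<Rightarrow> 'n::finite varifold \<Rightarrow> real^'n \<Rightarrow> real^'n" where
  "variation_direction U V =
     (SOME \<eta>. \<eta> \<in> borel_measurable (completion (variation_measure U V)) \<and>
        (\<forall>z\<in>U. norm (\<eta> z) = 1) \<and>
        (\<forall>g\<in>test_fields U.
           first_variation V g = (LINT z|completion (variation_measure U V). g z \<bullet> \<eta> z)))"

definition restricted_variation ::
    "(real^'n) set \<Rightarrow> 'n::finite varifold \<Rightarrow> (real^'n) set \<Rightarrow> (real^'n \<Rightarrow> real^'n) \<Rightarrow> real" where
  "restricted_variation U V E g =
     (LINT z:E|completion (variation_measure U V). g z \<bullet> variation_direction U V z)"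

definition varifold_restriction ::
    "nat \<Rightarrow> 'n::finite varifold \<Rightarrow> (real^'n) set \<Rightarrow> 'n varifold" where
  "varifold_restriction m V E = measure_restriction V (E \<times> grassmannian m)"

definition distributional_boundary ::
    "nat \<Rightarrow> (real^'n) set \<Rightarrow> 'n::finite varifold \<Rightarrow> (real^'n) set \<Rightarrow> (real^'n \<Rightarrow> real^'n) \<Rightarrow> real" where
  "distributional_boundary m U V E g =
     restricted_variation U V E g - first_variation (varifold_restriction m V E) g"

definition zero_boundary :: "nat \<Rightarrow> (real^'n) set \<Rightarrow> 'n::finite varifold \<Rightarrow> (real^'n) set \<Rightarrow> bool" where
  "zero_boundary m U V E \<longleftrightarrow> (\<forall>g\<in>test_fields U. distributional_boundary m U V E g = 0)"

section \<open>Decompositions\<close>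

definition indecomposable :: "nat \<Rightarrow> (real^'n) set \<Rightarrow> 'n::finite varifold \<Rightarrow> bool" where
  "indecomposable m U V \<longleftrightarrow>
     varifold m U V \<and> radon_first_variation U V \<and>
     \<not> (\<exists>B\<in>measurable_sets U V.
          emeasure (completion (weight U V)) B > 0 \<and>
          emeasure (completion (weight U V)) (U - B) > 0 \<and>
          zero_boundary m U V B)"

definition varifold_component ::
    "nat \<Rightarrow> (real^'n) set \<Rightarrow> 'n::finite varifold \<Rightarrow> 'n varifold \<Rightarrow> bool" where
  "varifold_component m U V W \<longleftrightarrow>
     emeasure W (space W) \<noteq> 0 \<and> indecomposable m U W \<and>
     (\<exists>A\<in>measurable_sets U V. W = varifold_restriction m V A \<and> zero_boundary m U V A)"

definition decomposition ::
    "nat \<Rightarrow> (real^'n) set \<Rightarrow> 'n::finite varifold \<Rightarrow> 'n varifold set \<Rightarrow> bool" where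
  "decomposition m U V G \<longleftrightarrow>
     (\<forall>W\<in>G. varifold_component m U V W) \<and>
     (\<forall>W\<in>G. \<forall>X\<in>G. W \<noteq> X \<longrightarrow>
        (\<exists>A\<in>measurable_sets U V. \<exists>B\<in>measurable_sets U V.
           A \<inter> B = {} \<and> zero_boundary m U V A \<and> zero_boundary m U V B \<and>
           W = varifold_restriction m V A \<and> X = varifold_restriction m V B)) \<and>
     (\<forall>f\<in>cc_functions (varifold_space m U).
        ((\<lambda>W. LINT p|W. f p) has_sum (LINT p|V. f p)) G)"

end

theory Submission
  imports Defs
begin

text \<open>
  A set is called balanced if its distributional boundary vanishes. Balanced sets are closed under
  complements, countable disjoint unions and decreasing intersections, but not under intersections,
  and the restriction of the varifold to a balanced set has the restricted variation measure; hence
  the components correspond to the balanced sets of positive weight which are atoms among the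
  balanced sets. Rectifiability enters only through a lower bound: at almost every point of a
  balanced set, the restricted weight has upper density bounded below by a multiple of the
  coefficient of the rectifiable piece, and the variation measure has finite upper density. The
  monotonicity formula, applied to the restricted varifold, turns the density at small scales into
  a lower bound for the weight at a fixed scale, which does not depend on the balanced set. So a
  balanced set charging a given piece cannot be split indefinitely into balanced sets doing so; a
  minimal one is an atom, and a maximal disjoint family of atoms exhausts the weight.

  The unit field representing the first variation is obtained by extending it to integrable fields
  and applying the Radon-Nikodym theorem.
\<close>

section \<open>Smooth functions and cutoffs\<close>

text \<open>A balanced set that cannot be split into two balanced parts charging a given piece may
  still contain balanced subsets that miss the piece. Hence there are two minimisations: one of the
  weight in a fixed compact set, stopped within the uniform lower bound of the infimum, and one, for
  a finite measure with the same null sets, among the balanced subsets that keep all of the charge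
  on the piece. The lower bound is uniform because the error term of the monotonicity formula
  involves only the variation measure of the whole varifold. Points are sorted by a constant
  bounding the growth of that measure in small balls, and a Vitali covering shows that almost no
  point is left over. A radius depending only on the constants lets half of the density survive the
  error. The argument runs on Borel sets, completions and the choice of the unit field being removed
  beforehand. The integral bound that extends the functional to integrable fields has the crude
  constant 8, from dyadic layers of a field; the norm 1 of the representing field is recovered
  afterwards by comparing variations on open sets.\<close>

lemma Ck_on_SucI:
  assumes "\<And>x. (f has_derivative f' x) (at x)" "\<And>v. Ck_on k UNIV (\<lambda>x. f' x v)"
  shows "Ck_on (Suc k) UNIV f"
proof -
  have "frechet_derivative f (at x) = f' x" for x
    using frechet_derivative_at[OF assms(1)] by simp
  then show ?thesis
    using assms by (auto simp: differentiable_def)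
qed

lemma Ck_on_Suc_has_derivative:
  assumes "Ck_on (Suc k) UNIV f"
  shows "(f has_derivative frechet_derivative f (at x)) (at x)"
  using assms frechet_derivative_works by auto

lemma Ck_on_SucD: "Ck_on (Suc k) S f \<Longrightarrow> Ck_on k S f"
proof (induction k arbitrary: f)
  case 0
  then show ?case
    by (auto intro!: continuous_at_imp_continuous_on differentiable_imp_continuous_within)
qed auto

lemma Ck_on_Suc_derivative: "Ck_on (Suc k) UNIV f \<Longrightarrow> Ck_on k UNIV (\<lambda>x. frechet_derivative f (at x) v)"
  by simp

lemmas Ck_on_SucDs = Ck_on_SucD Ck_on_Suc_derivative

lemma Ck_on_const [simp]: "Ck_on k UNIV (\<lambda>x. c)"
proof (induction k arbitrary: c)
  case (Suc k)
  show ?case by (rule Ck_on_SucI[where f' = "\<lambda>x v. 0"]) (auto intro: Suc)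
qed simp

lemma Ck_on_bounded_linear:
  assumes "bounded_linear f" shows "Ck_on k UNIV f"
proof (cases k)
  case 0
  then show ?thesis using assms by (simp add: linear_continuous_on)
next
  case (Suc j)
  then show ?thesis
    using assms unfolding Suc
    by (intro Ck_on_SucI[where f' = "\<lambda>x. f"] bounded_linear_imp_has_derivative Ck_on_const)
qed

lemma Ck_on_add:
  "Ck_on k UNIV f \<Longrightarrow> Ck_on k UNIV g \<Longrightarrow> Ck_on k UNIV (\<lambda>x. f x + g x)"
proof (induction k arbitrary: f g)
  case 0
  then show ?case by (auto intro: continuous_intros)
next
  case (Suc k)
  show ?case
    by (rule Ck_on_SucI[where f' = "\<lambda>x v. frechet_derivative f (at x) v + frechet_derivative g (at x) v"])
       (use Suc in \<open>auto intro!: has_derivative_add Ck_on_Suc_has_derivative\<close>)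
qed

text \<open>Leibniz' rule leaves one factor undifferentiated, so the induction hypothesis is applied
  to mixed pairs and needs \<open>f\<close> and \<open>g\<close> also at the lower order. One proof
  serves scaling, inner products and real products.\<close>

lemma (in bounded_bilinear) Ck_on:
  "Ck_on k UNIV f \<Longrightarrow> Ck_on k UNIV g \<Longrightarrow> Ck_on k UNIV (\<lambda>x. prod (f x) (g x))"
proof (induction k arbitrary: f g)
  case 0
  then show ?case by (auto intro: continuous_on)
next
  case (Suc k)
  show ?case
  proof (rule Ck_on_SucI[where f' = "\<lambda>x v. prod (f x) (frechet_derivative g (at x) v)
        + prod (frechet_derivative f (at x) v) (g x)"])
    show "((\<lambda>x. prod (f x) (g x)) has_derivative (\<lambda>v. prod (f x) (frechet_derivative g (at x) v)
        + prod (frechet_derivative f (at x) v) (g x))) (at x)" for x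
      by (rule FDERIV[OF Ck_on_Suc_has_derivative[OF Suc.prems(1)] Ck_on_Suc_has_derivative[OF Suc.prems(2)]])
    show "Ck_on k UNIV (\<lambda>x. prod (f x) (frechet_derivative g (at x) v)
        + prod (frechet_derivative f (at x) v) (g x))" for v
      by (intro Ck_on_add Suc.IH Ck_on_SucDs[OF Suc.prems(1)] Ck_on_SucDs[OF Suc.prems(2)])
  qed
qed

lemmas Ck_on_scaleR = bounded_bilinear.Ck_on[OF bounded_bilinear_scaleR]
lemmas Ck_on_inner = bounded_bilinear.Ck_on[OF bounded_bilinear_inner]
lemmas Ck_on_mult = bounded_bilinear.Ck_on[OF bounded_bilinear_mult]

lemma Ck_on_diff:
  fixes f :: "'a::euclidean_space \<Rightarrow> 'b::real_normed_vector"
  shows "Ck_on k UNIV f \<Longrightarrow> Ck_on k UNIV g \<Longrightarrow> Ck_on k UNIV (\<lambda>x. f x - g x)"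
  using Ck_on_add[of k f "\<lambda>x. (-1) *\<^sub>R g x"] Ck_on_scaleR[of k "\<lambda>x. -1" g] by simp

lemma Ck_on_prod:
  fixes f :: "'i \<Rightarrow> 'a::euclidean_space \<Rightarrow> real"
  shows "(\<And>i. i \<in> I \<Longrightarrow> Ck_on k UNIV (f i)) \<Longrightarrow> Ck_on k UNIV (\<lambda>x. \<Prod>i\<in>I. f i x)"
  by (induction I rule: infinite_finite_induct) (auto intro: Ck_on_mult)

lemma Ck_on_inverse:
  fixes f :: "'a::euclidean_space \<Rightarrow> real"
  assumes nz: "\<And>x. f x \<noteq> 0"
  shows "Ck_on k UNIV f \<Longrightarrow> Ck_on k UNIV (\<lambda>x. inverse (f x))"
proof (induction k)
  case 0
  then show ?case using nz by (auto intro: continuous_intros)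
next
  case (Suc k)
  show ?case
  proof (rule Ck_on_SucI[where f' = "\<lambda>x v. - (inverse (f x) * frechet_derivative f (at x) v * inverse (f x))"])
    show "((\<lambda>x. inverse (f x)) has_derivative
        (\<lambda>v. - (inverse (f x) * frechet_derivative f (at x) v * inverse (f x)))) (at x)" for x
      by (rule Deriv.has_derivative_inverse[OF nz Ck_on_Suc_has_derivative[OF Suc.prems]])
    have "Ck_on k UNIV (\<lambda>x. 0 - inverse (f x) * frechet_derivative f (at x) v * inverse (f x))" for v
      by (intro Ck_on_diff Ck_on_const Ck_on_mult Suc.IH Ck_on_SucDs[OF Suc.prems])
    then show "Ck_on k UNIV (\<lambda>x. - (inverse (f x) * frechet_derivative f (at x) v * inverse (f x)))" for v
      by simp
  qed
qed

text \<open>\<open>F\<close> is generalised in the induction because the chain rule produces the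
  composition of the derivative of \<open>F\<close> with the same \<open>q\<close>.\<close>

lemma Ck_on_compose:
  fixes F :: "real \<Rightarrow> real" and q :: "'a::euclidean_space \<Rightarrow> real"
  shows "Ck_on k UNIV F \<Longrightarrow> Ck_on k UNIV q \<Longrightarrow> Ck_on k UNIV (\<lambda>x. F (q x))"
proof (induction k arbitrary: F)
  case 0
  then show ?case by (auto intro: continuous_on_compose2)
next
  case (Suc k)
  let ?F' = "\<lambda>t. frechet_derivative F (at t) 1"
  show ?case
  proof (rule Ck_on_SucI[where f' = "\<lambda>x v. ?F' (q x) * frechet_derivative q (at x) v"])
    show "((\<lambda>x. F (q x)) has_derivative (\<lambda>v. ?F' (q x) * frechet_derivative q (at x) v)) (at x)" for x
    proof -
      have "linear (frechet_derivative F (at (q x)))"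
        using Suc.prems Ck_on_Suc_has_derivative has_derivative_linear by blast
      \<comment> \<open>On the reals a derivative is multiplication by its value at 1, which turns
        the composed derivative into a product of real functions.\<close>
      then have lin: "frechet_derivative F (at (q x)) t = ?F' (q x) * t" for t
        using linear_scale[of "frechet_derivative F (at (q x))" t 1] by simp
      have "((\<lambda>x. F (q x)) has_derivative
          (\<lambda>v. frechet_derivative F (at (q x)) (frechet_derivative q (at x) v))) (at x)"
        by (rule has_derivative_compose[OF Ck_on_Suc_has_derivative[OF Suc.prems(2)]
              Ck_on_Suc_has_derivative[OF Suc.prems(1)]])
      then show ?thesis
        by (rule has_derivative_eq_rhs) (rule ext, rule lin)
    qed
    show "Ck_on k UNIV (\<lambda>x. ?F' (q x) * frechet_derivative q (at x) v)" for v
      by (rule Ck_on_mult[OF Suc.IH[OF Ck_on_Suc_derivative[OF Suc.prems(1)] Ck_on_SucD[OF Suc.prems(2)]]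
            Ck_on_Suc_derivative[OF Suc.prems(2)]])
  qed
qed

definition smooth :: "('a::euclidean_space \<Rightarrow> 'b::real_normed_vector) \<Rightarrow> bool" where
  "smooth f \<longleftrightarrow> (\<forall>k. Ck_on k UNIV f)"

lemma smooth_const [simp]: "smooth (\<lambda>x. c)"
  and smooth_bounded_linear: "bounded_linear l \<Longrightarrow> smooth l"
  and smooth_add: "smooth f \<Longrightarrow> smooth g \<Longrightarrow> smooth (\<lambda>x. f x + g x)"
  and smooth_diff: "smooth f \<Longrightarrow> smooth g \<Longrightarrow> smooth (\<lambda>x. f x - g x)"
  and smooth_scaleR: "smooth u \<Longrightarrow> smooth f \<Longrightarrow> smooth (\<lambda>x. u x *\<^sub>R f x)"
  by (simp_all add: smooth_def Ck_on_bounded_linear Ck_on_add Ck_on_diff Ck_on_scaleR)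

lemma smooth_mult: "smooth u \<Longrightarrow> smooth v \<Longrightarrow> smooth (\<lambda>x. u x * v x :: real)"
  and smooth_inverse: "smooth u \<Longrightarrow> (\<And>x. u x \<noteq> 0) \<Longrightarrow> smooth (\<lambda>x. inverse (u x))"
  and smooth_compose: "smooth F \<Longrightarrow> smooth u \<Longrightarrow> smooth (\<lambda>x. F (u x))"
  and smooth_prod: "(\<And>i. i \<in> I \<Longrightarrow> smooth (w i)) \<Longrightarrow> smooth (\<lambda>x. \<Prod>i\<in>I. w i x :: real)"
  for u v :: "'a::euclidean_space \<Rightarrow> real" and F :: "real \<Rightarrow> real"
  by (simp_all add: smooth_def Ck_on_mult Ck_on_inverse Ck_on_compose Ck_on_prod)

lemma smooth_inner: "smooth f \<Longrightarrow> smooth g \<Longrightarrow> smooth (\<lambda>x. f x \<bullet> g x)"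
  for f g :: "'a::euclidean_space \<Rightarrow> 'b::real_inner"
  by (simp add: smooth_def Ck_on_inner)

lemma smooth_id: "smooth (\<lambda>x. x)"
  by (rule smooth_bounded_linear) simp

lemma smooth_has_derivative:
  "smooth f \<Longrightarrow> (f has_derivative frechet_derivative f (at x)) (at x)"
  unfolding smooth_def using Ck_on_Suc_has_derivative by blast

lemma smooth_continuous_on: "smooth f \<Longrightarrow> continuous_on S f"
  using continuous_on_subset[of UNIV f S] by (metis smooth_def Ck_on.simps(1) subset_UNIV)

lemma smooth_derivative: "smooth f \<Longrightarrow> smooth (\<lambda>x. frechet_derivative f (at x) v)"
  unfolding smooth_def by (metis Ck_on.simps(2))

section \<open>A flat function, smooth transition functions and cutoffs\<close>

definition flat :: "nat \<Rightarrow> real \<Rightarrow> real" where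
  "flat j x = (if x > 0 then exp (- inverse x) * inverse x ^ j else 0)"

lemma flat_nonneg: "0 \<le> flat j x" and flat_pos: "0 < x \<Longrightarrow> 0 < flat j x"
  and flat_neg: "x \<le> 0 \<Longrightarrow> flat j x = 0"
  by (auto simp: flat_def)

text \<open>The single term of degree \<open>j + 2\<close> of the exponential series at
  \<open>inverse x\<close> already beats \<open>inverse x ^ j\<close> by two powers of
  \<open>x\<close>. These make the difference quotient at 0 tend to 0.\<close>

lemma flat_le: "flat j x \<le> fact (j + 2) * x\<^sup>2"
proof (cases "x > 0")
  case True
  let ?u = "inverse x"
  have u: "?u > 0" using True by simp
  have "?u ^ (j + 2) / fact (j + 2) \<le> exp ?u"
  proof -
    have "(\<Sum>n\<in>{j+2}. ?u ^ n /\<^sub>R fact n) \<le> exp ?u"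
      unfolding exp_def using u
      by (intro sum_le_suminf summable_exp_generic) auto
    then show ?thesis by (simp add: field_simps)
  qed
  then have "?u ^ (j + 2) \<le> fact (j + 2) * exp ?u"
    by (simp add: divide_le_eq mult.commute)
  then have "?u ^ j \<le> fact (j + 2) * exp ?u * x\<^sup>2"
    using True by (simp add: power_add power2_eq_square field_simps del: fact_Suc fact_2)
  then have "?u ^ j * exp (- ?u) \<le> fact (j + 2) * exp ?u * x\<^sup>2 * exp (- ?u)"
    by (intro mult_right_mono) auto
  also have "\<dots> = fact (j + 2) * x\<^sup>2 * (exp ?u * exp (- ?u))"
    by (simp only: mult_ac)
  also have "exp ?u * exp (- ?u) = 1"
    by (simp flip: exp_add)
  finally have "exp (- ?u) * ?u ^ j \<le> fact (j + 2) * x\<^sup>2"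
    by (simp add: mult.commute)
  then show ?thesis using True by (simp add: flat_def)
qed (simp add: flat_def)

lemma flat_has_derivative:
  "(flat j has_real_derivative flat (j + 2) x - real j * flat (j + 1) x) (at x)"
proof -
  consider "x > 0" | "x < 0" | "x = 0" by linarith
  then show ?thesis
  proof cases
    case 1
    \<comment> \<open>The power rule yields \<open>x ^ (j - Suc 0)\<close> with truncated
      subtraction; for \<open>j = 0\<close> its factor is 0, otherwise \<open>x ^ j\<close> is
      restored.\<close>
    have "j = 0 \<or> x ^ j = x * x ^ (j - Suc 0)"
      by (cases j) auto
    then have "((\<lambda>x. exp (- inverse x) * inverse x ^ j) has_real_derivative
        flat (j + 2) x - real j * flat (j + 1) x) (at x)"
      using 1 by (auto intro!: derivative_eq_intros simp: flat_def field_simps power2_eq_square)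
    moreover have ev: "\<forall>\<^sub>F y in nhds x. flat j y = exp (- inverse y) * inverse y ^ j"
      using eventually_nhds_in_open[of "{0<..}" x] 1
      by (auto simp: flat_def elim: eventually_mono)
    ultimately show ?thesis by (simp only: DERIV_cong_ev[OF refl ev refl])
  next
    case 2
    have "\<forall>\<^sub>F y in nhds x. flat j y = 0"
      using eventually_nhds_in_open[of "{..<0}" x] 2
      by (auto simp: flat_def elim: eventually_mono)
    then show ?thesis using DERIV_cong_ev[of x x "flat j" "\<lambda>_. 0" 0 0] 2 by (simp add: flat_neg)
  next
    case 3
    have "((\<lambda>h. (flat j (0 + h) - flat j 0) / h) \<longlongrightarrow> 0) (at 0)"
    proof (rule Lim_null_comparison)
      show "\<forall>\<^sub>F h in at 0. norm ((flat j (0 + h) - flat j 0) / h) \<le> fact (j + 2) * \<bar>h\<bar>"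
      proof (rule always_eventually, rule allI)
        fix h :: real
        show "norm ((flat j (0 + h) - flat j 0) / h) \<le> fact (j + 2) * \<bar>h\<bar>"
          using flat_le[of j h] flat_nonneg[of j h]
          by (cases "h = 0") (auto simp: flat_neg divide_le_eq power2_eq_square abs_mult)
      qed
      show "((\<lambda>h. fact (j + 2) * \<bar>h\<bar>) \<longlongrightarrow> (0::real)) (at 0)"
        by (auto intro!: tendsto_eq_intros)
    qed
    then show ?thesis using 3 by (simp add: DERIV_def flat_neg)
  qed
qed

lemma smooth_real_I:
  fixes F :: "real \<Rightarrow> real"
  assumes "\<And>x. (F has_real_derivative F' x) (at x)" "Ck_on k UNIV F'"
  shows "Ck_on (Suc k) UNIV F"
proof (rule Ck_on_SucI[where f' = "\<lambda>x v. F' x * v"])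
  show "(F has_derivative (\<lambda>v. F' x * v)) (at x)" for x
    using assms(1) by (simp add: has_field_derivative_def)
qed (use assms(2) in \<open>auto intro: Ck_on_mult\<close>)

text \<open>Derivatives of members of the family are linear combinations of members with larger
  index, so an induction on the order with \<open>j\<close> arbitrary avoids formulas for higher
  derivatives.\<close>

lemma smooth_flat: "smooth (flat j)"
proof -
  have "Ck_on k UNIV (flat j)" for k
  proof (induction k arbitrary: j)
    case 0
    then show ?case
      using DERIV_isCont[OF flat_has_derivative] by (auto intro!: continuous_at_imp_continuous_on)
  next
    case (Suc k)
    show ?case
      by (rule smooth_real_I[OF flat_has_derivative]) (intro Ck_on_diff Ck_on_mult Ck_on_const Suc)
  qed
  then show ?thesis by (simp add: smooth_def)
qed

text \<open>The classical transition from 0 to 1 made from \<open>exp (- inverse t)\<close>; the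
  denominator is positive because \<open>t\<close> or \<open>1 - t\<close> is.\<close>

definition smooth_step :: "real \<Rightarrow> real" where
  "smooth_step t = flat 0 t * inverse (flat 0 t + flat 0 (1 - t))"

lemma smooth_step_denom: "0 < flat 0 t + flat 0 (1 - t)"
  using flat_pos[of t 0] flat_pos[of "1 - t" 0] flat_nonneg[of 0 t] flat_nonneg[of 0 "1 - t"]
  by (cases "t > 0") auto

lemma smooth_step: "smooth smooth_step"
proof -
  have "smooth (\<lambda>t. flat 0 (1 - t))"
    by (rule smooth_compose[OF smooth_flat]) (intro smooth_diff smooth_const smooth_id)
  then have "smooth (\<lambda>t. flat 0 t * inverse (flat 0 t + flat 0 (1 - t)))"
    using smooth_step_denom
    by (intro smooth_mult smooth_inverse smooth_add smooth_flat) (auto simp: less_le)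
  then show ?thesis by (simp add: smooth_step_def[abs_def])
qed

lemma smooth_step_range: "0 \<le> smooth_step t" "smooth_step t \<le> 1"
  and smooth_step_0: "t \<le> 0 \<Longrightarrow> smooth_step t = 0"
  and smooth_step_1: "1 \<le> t \<Longrightarrow> smooth_step t = 1"
  using smooth_step_denom[of t] flat_nonneg[of 0 t] flat_nonneg[of 0 "1 - t"] flat_pos[of t 0]
  by (auto simp: smooth_step_def divide_inverse[symmetric] flat_neg divide_le_eq)

text \<open>In the quotient rule the terms \<open>flat 0 t * flat 2 t\<close> cancel and only
  nonnegative mixed products remain. The sign is what later allows the projection onto a plane to be
  discarded in the monotonicity formula.\<close>

lemma smooth_step_deriv_nonneg: "\<exists>d\<ge>0. (smooth_step has_real_derivative d) (at t)"
proof -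
  let ?D = "flat 0 t + flat 0 (1 - t)"
  have d: "(flat 0 has_real_derivative flat 2 t) (at t)" for t
    using flat_has_derivative[of 0 t] by (simp add: numeral_2_eq_2)
  have d1: "((\<lambda>t. flat 0 (1 - t)) has_real_derivative (flat 2 (1 - t) * (-1))) (at t)"
    by (rule DERIV_chain2[OF d]) (auto intro!: derivative_eq_intros)
  have "(smooth_step has_real_derivative
     (flat 2 t * flat 0 (1 - t) + flat 0 t * flat 2 (1 - t)) / (?D * ?D)) (at t)"
    unfolding smooth_step_def[abs_def]
    using smooth_step_denom[of t]
    by (auto intro!: derivative_eq_intros d d1 simp: field_simps)
  then show ?thesis
    using flat_nonneg by (intro exI conjI) (auto intro!: divide_nonneg_nonneg add_nonneg_nonneg mult_nonneg_nonneg)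
qed

text \<open>The argument stands for a squared ratio of distances, so that radial functions stay
  smooth at their centre. The factor \<open>4/3\<close> places the transition between
  \<open>1/4\<close> and 1: value 1 up to half the radius, value 0 from the full radius on.\<close>

definition profile :: "real \<Rightarrow> real" where
  "profile t = smooth_step ((1 - t) * (4/3))"

definition profile' :: "real \<Rightarrow> real" where
  "profile' t = frechet_derivative profile (at t) 1"

lemma smooth_profile: "smooth profile"
  unfolding profile_def
  by (rule smooth_compose[OF smooth_step]) (intro smooth_diff smooth_const smooth_id smooth_mult)

lemma profile_range: "0 \<le> profile t" "profile t \<le> 1"
  and profile_1: "t \<le> 1/4 \<Longrightarrow> profile t = 1"
  and profile_0: "1 \<le> t \<Longrightarrow> profile t = 0"
  by (auto simp: profile_def smooth_step_range intro!: smooth_step_0 smooth_step_1)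

lemma profile_has_derivative: "(profile has_real_derivative profile' t) (at t)"
proof -
  have *: "(profile has_derivative frechet_derivative profile (at t)) (at t)"
    by (rule smooth_has_derivative[OF smooth_profile])
  then have "frechet_derivative profile (at t) v = profile' t * v" for v
    using linear_scale[OF has_derivative_linear, of profile _ "at t" v 1] by (simp add: profile'_def mult.commute)
  then have "frechet_derivative profile (at t) = (*) (profile' t)"
    by blast
  with * show ?thesis
    by (simp add: has_field_derivative_def)
qed

lemma profile'_nonpos: "profile' t \<le> 0"
proof -
  obtain d where d: "d \<ge> 0" "(smooth_step has_real_derivative d) (at ((1 - t) * (4/3)))"
    using smooth_step_deriv_nonneg by blast
  have "(profile has_real_derivative d * (-4/3)) (at t)"
    unfolding profile_def[abs_def]
    by (rule DERIV_chain2[where g = "\<lambda>t. (1 - t) * (4/3)", OF d(2)]) (auto intro!: derivative_eq_intros)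
  then show ?thesis using DERIV_unique[OF profile_has_derivative] d(1) by fastforce
qed

lemma profile'_continuous: "continuous_on S profile'"
  using smooth_continuous_on[OF smooth_derivative[OF smooth_profile, of 1]]
  by (simp add: profile'_def[abs_def])

lemma profile'_0: "1 < t \<Longrightarrow> profile' t = 0"
proof -
  assume t: "1 < t"
  have "\<forall>\<^sub>F y in nhds t. profile y = 0"
    using eventually_nhds_in_open[of "{1<..}" t] t by (auto simp: profile_0 elim: eventually_mono)
  then have "(profile has_real_derivative 0) (at t)"
    using DERIV_cong_ev[of t t profile "\<lambda>_. 0" 0 0] by simp
  then show ?thesis using DERIV_unique[OF profile_has_derivative] by blast
qed

lemma smooth_radial:
  fixes a :: "'a::euclidean_space" and F :: "real \<Rightarrow> real"
  assumes "smooth F" shows "smooth (\<lambda>z. F ((z - a) \<bullet> (z - a) * c))"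
  by (intro smooth_compose[OF assms] smooth_mult smooth_inner smooth_diff smooth_id smooth_const)

text \<open>A product over a finite subcover replaces mollification. The value 1 is attained on a
  whole neighbourhood \<open>N\<close> of \<open>K\<close>, so that \<open>1 - \<theta>\<close> is
  supported away from \<open>K\<close>.\<close>

lemma smooth_cutoff:
  fixes K Q :: "'a::euclidean_space set"
  assumes "compact K" "open Q" "K \<subseteq> Q"
  obtains \<theta> :: "'a \<Rightarrow> real" and N C where "smooth \<theta>" "\<And>z. 0 \<le> \<theta> z" "\<And>z. \<theta> z \<le> 1"
    "open N" "K \<subseteq> N" "N \<subseteq> C" "compact C" "C \<subseteq> Q" "\<And>z. z \<in> N \<Longrightarrow> \<theta> z = 1" "\<And>z. z \<notin> C \<Longrightarrow> \<theta> z = 0"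
proof -
  \<comment> \<open>The doubled ball leaves room for \<open>profile\<close>, which is sure to be 1
    only up to half of its radius.\<close>
  have "\<exists>r>0. cball x (2 * r) \<subseteq> Q" if x: "x \<in> K" for x
  proof -
    obtain e where "e > 0" "cball x e \<subseteq> Q"
      using assms x open_contains_cball by blast
    then show ?thesis by (intro exI[of _ "e/2"]) auto
  qed
  then have "\<forall>x. \<exists>r. x \<in> K \<longrightarrow> r > 0 \<and> cball x (2 * r) \<subseteq> Q"
    by blast
  from choice[OF this] obtain r where r: "\<And>x. x \<in> K \<Longrightarrow> r x > 0" "\<And>x. x \<in> K \<Longrightarrow> cball x (2 * r x) \<subseteq> Q"
    by blast
  have "K \<subseteq> (\<Union>x\<in>K. ball x (r x))"
    using r(1) by force
  then obtain I where I: "I \<subseteq> K" "finite I" "K \<subseteq> (\<Union>x\<in>I. ball x (r x))"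
    using compactE_image[OF assms(1), of K "\<lambda>x. ball x (r x)"] by auto
  define \<beta> where "\<beta> x z = profile ((z - x) \<bullet> (z - x) * inverse ((2 * r x)\<^sup>2))" for x z
  \<comment> \<open>The product is 0 as soon as one bump is 1, and 1 where all bumps are 0.\<close>
  define \<theta> where "\<theta> z = 1 - (\<Prod>x\<in>I. 1 - \<beta> x z)" for z
  have \<beta>1: "\<beta> x z = 1" if "x \<in> I" "z \<in> ball x (r x)" for x z
  proof -
    have rx: "r x > 0" using r I that by auto
    have "(z - x) \<bullet> (z - x) = (dist x z)\<^sup>2"
      by (simp add: dot_square_norm dist_norm norm_minus_commute)
    also have "\<dots> \<le> (r x)\<^sup>2" using that by (intro power_mono) auto
    finally show ?thesis unfolding \<beta>_def using rx
      by (intro profile_1) (simp add: field_simps)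
  qed
  have \<beta>0: "\<beta> x z = 0" if "x \<in> I" "z \<notin> cball x (2 * r x)" for x z
  proof -
    have rx: "r x > 0" using r I that by auto
    have "(2 * r x)\<^sup>2 \<le> (dist x z)\<^sup>2" using that rx by (intro power_mono) auto
    also have "(dist x z)\<^sup>2 = (z - x) \<bullet> (z - x)"
      by (simp add: dot_square_norm dist_norm norm_minus_commute)
    finally show ?thesis unfolding \<beta>_def using rx
      by (intro profile_0) (simp add: field_simps)
  qed
  have \<beta>r: "0 \<le> 1 - \<beta> x z" "1 - \<beta> x z \<le> 1" for x z
    by (auto simp: \<beta>_def profile_range)
  show ?thesis
  proof (rule that[of \<theta> "\<Union>x\<in>I. ball x (r x)" "\<Union>x\<in>I. cball x (2 * r x)"])
    show "smooth \<theta>"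
      unfolding \<theta>_def \<beta>_def by (intro smooth_diff smooth_const smooth_prod smooth_radial[OF smooth_profile])
    show "0 \<le> \<theta> z" "\<theta> z \<le> 1" for z
      unfolding \<theta>_def using \<beta>r by (auto intro!: prod_le_1 prod_nonneg)
    show "\<theta> z = 1" if "z \<in> (\<Union>x\<in>I. ball x (r x))" for z
    proof -
      from that obtain x where "x \<in> I" "1 - \<beta> x z = 0" using \<beta>1 by fastforce
      then have "(\<Prod>x\<in>I. 1 - \<beta> x z) = 0" using I(2) by (intro prod_zero) auto
      then show ?thesis by (simp add: \<theta>_def)
    qed
    show "\<theta> z = 0" if "z \<notin> (\<Union>x\<in>I. cball x (2 * r x))" for z
      using that \<beta>0 by (simp add: \<theta>_def)
    show "(\<Union>x\<in>I. ball x (r x)) \<subseteq> (\<Union>x\<in>I. cball x (2 * r x))"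
    proof (rule UN_mono[OF order.refl])
      fix x assume "x \<in> I"
      then have "r x > 0" using r(1) I(1) by blast
      then show "ball x (r x) \<subseteq> cball x (2 * r x)" by (auto simp: subset_iff)
    qed
    show "(\<Union>x\<in>I. cball x (2 * r x)) \<subseteq> Q"
      using r(2) I(1) by blast
  qed (use I in \<open>auto intro!: compact_UN\<close>)
qed

section \<open>Test fields\<close>

lemma test_fieldI:
  assumes "smooth g" "compact C" "C \<subseteq> U" "\<And>z. z \<notin> C \<Longrightarrow> g z = 0"
  shows "g \<in> test_fields U" "closure {z. g z \<noteq> 0} \<subseteq> C"
proof -
  have "{z. g z \<noteq> 0} \<subseteq> C" using assms(4) by blast
  then have c: "closure {z. g z \<noteq> 0} \<subseteq> C"
    by (simp add: assms(2) closure_minimal compact_imp_closed)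
  moreover have "compact (closure {z. g z \<noteq> 0})"
    using c assms(2) by (metis closed_closure compact_Int_closed inf.absorb_iff2)
  ultimately show "g \<in> test_fields U" "closure {z. g z \<noteq> 0} \<subseteq> C"
    using assms by (auto simp: test_fields_def smooth_def)
qed

lemma test_field_smooth: "g \<in> test_fields U \<Longrightarrow> smooth g"
  and test_field_compact: "g \<in> test_fields U \<Longrightarrow> compact (closure {z. g z \<noteq> 0})"
  and test_field_subset: "g \<in> test_fields U \<Longrightarrow> closure {z. g z \<noteq> 0} \<subseteq> U"
  by (auto simp: test_fields_def smooth_def)

lemma test_field_outside: "z \<notin> closure {z. g z \<noteq> 0} \<Longrightarrow> g z = 0"
  using closure_subset[of "{z. g z \<noteq> 0}"] by auto

lemma test_field_zero: "(\<lambda>z. 0) \<in> test_fields U"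
  by (rule test_fieldI[of _ "{}"]) auto

lemma test_field_add:
  assumes "f \<in> test_fields U" "g \<in> test_fields U"
  shows "(\<lambda>z. f z + g z) \<in> test_fields U"
    and "closure {z. f z + g z \<noteq> 0} \<subseteq> closure {z. f z \<noteq> 0} \<union> closure {z. g z \<noteq> 0}"
proof -
  let ?C = "closure {z. f z \<noteq> 0} \<union> closure {z. g z \<noteq> 0}"
  have z: "f z + g z = 0" if "z \<notin> ?C" for z
    using that test_field_outside[of z f] test_field_outside[of z g] by simp
  have sm: "smooth (\<lambda>z. f z + g z)"
    by (intro smooth_add assms[THEN test_field_smooth])
  have C: "compact ?C" "?C \<subseteq> U"
    by (intro compact_Un Un_least assms[THEN test_field_compact] assms[THEN test_field_subset])+
  show "(\<lambda>z. f z + g z) \<in> test_fields U" "closure {z. f z + g z \<noteq> 0} \<subseteq> ?C"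
    by (rule test_fieldI[OF sm C z], assumption)+
qed

lemma test_field_scale:
  fixes u :: "'a::euclidean_space \<Rightarrow> real"
  assumes "smooth u" "g \<in> test_fields U"
  shows "(\<lambda>z. u z *\<^sub>R g z) \<in> test_fields U"
    and "closure {z. u z *\<^sub>R g z \<noteq> 0} \<subseteq> closure {z. g z \<noteq> 0}"
proof -
  let ?C = "closure {z. g z \<noteq> 0}"
  have z: "u z *\<^sub>R g z = 0" if "z \<notin> ?C" for z
    using that test_field_outside[of z g] by simp
  have sm: "smooth (\<lambda>z. u z *\<^sub>R g z)"
    by (intro smooth_scaleR assms(1) test_field_smooth[OF assms(2)])
  have C: "compact ?C" "?C \<subseteq> U"
    by (rule test_field_compact[OF assms(2)] test_field_subset[OF assms(2)])+
  show "(\<lambda>z. u z *\<^sub>R g z) \<in> test_fields U" "closure {z. u z *\<^sub>R g z \<noteq> 0} \<subseteq> ?C"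
    by (rule test_fieldI[OF sm C z], assumption)+
qed

lemma test_field_uminus: "g \<in> test_fields U \<Longrightarrow> (\<lambda>z. - g z) \<in> test_fields U"
  using test_field_scale(1)[of "\<lambda>_. -1"] by simp

lemma test_field_diff:
  "f \<in> test_fields U \<Longrightarrow> g \<in> test_fields U \<Longrightarrow> (\<lambda>z. f z - g z) \<in> test_fields U"
  using test_field_add(1)[of f U "\<lambda>z. - g z"] test_field_uminus by fastforce

lemma test_field_bounded:
  assumes "g \<in> test_fields U"
  obtains B where "B > 0" "\<And>z. norm (g z) \<le> B"
proof -
  have "compact (g ` closure {z. g z \<noteq> 0})"
    using assms test_field_compact smooth_continuous_on[OF test_field_smooth] by (intro compact_continuous_image)
  then obtain B where B: "B > 0" "\<And>x. x \<in> g ` closure {z. g z \<noteq> 0} \<Longrightarrow> norm x \<le> B"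
    using compact_imp_bounded bounded_pos by metis
  then have "norm (g z) \<le> B" for z
    using test_field_outside[of z g] by (cases "z \<in> closure {z. g z \<noteq> 0}") auto
  then show ?thesis using B(1) that by blast
qed

lemma test_field_measurable [measurable]: "g \<in> test_fields U \<Longrightarrow> g \<in> borel_measurable borel"
  using smooth_continuous_on[OF test_field_smooth] borel_measurable_continuous_onI by blast

lemma test_field_derivative_outside:
  assumes "z \<notin> closure {z. g z \<noteq> 0}"
  shows "frechet_derivative g (at z) = (\<lambda>v. 0)"
proof -
  have "(g has_derivative (\<lambda>v. 0)) (at z)"
  proof (rule has_derivative_transform_within_open[of "\<lambda>_. 0"])
    show "open (- closure {z. g z \<noteq> 0})" by auto
    show "0 = g x" if "x \<in> - closure {z. g z \<noteq> 0}" for x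
      using that test_field_outside by fastforce
  qed (use assms in auto)
  then show ?thesis using frechet_derivative_at by force
qed

section \<open>The Grassmannian\<close>

lemma orth_proj_eq:
  assumes "subspace S" "y \<in> S" "\<And>w. w \<in> S \<Longrightarrow> orthogonal (x - y) w"
  shows "orth_proj S x = y"
  unfolding orth_proj_def
proof (rule the_equality)
  fix y' assume y': "y' \<in> S \<and> (\<forall>w\<in>S. orthogonal (x - y') w)"
  have d: "y' - y \<in> S" using assms y' by (simp add: subspace_diff)
  have "(y' - y) \<bullet> (y' - y) = (x - y) \<bullet> (y' - y) - (x - y') \<bullet> (y' - y)"
    by (simp add: inner_diff_left)
  also have "\<dots> = 0" using d assms(3) y' by (simp add: orthogonal_def)
  finally show "y' = y" by simp
qed (use assms in auto)

text \<open>An orthonormal basis gives an explicit formula for the projection, from which linearity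
  and the trace are read off.\<close>

lemma orth_proj_basis:
  fixes S :: "(real^'n::finite) set"
  assumes "subspace S"
  obtains B where "finite B" "card B = dim S" "\<forall>b\<in>B. b \<bullet> b = 1"
    "orth_proj S = (\<lambda>x. \<Sum>b\<in>B. (b \<bullet> x) *\<^sub>R b)"
proof -
  obtain B where B: "B \<subseteq> S" "pairwise orthogonal B" "\<And>x. x \<in> B \<Longrightarrow> norm x = 1"
     "independent B" "card B = dim S" "span B = S"
    using orthonormal_basis_subspace[OF assms] by metis
  have fin: "finite B" using B(4) independent_imp_finite by blast
  have one: "b \<bullet> b = 1" if "b \<in> B" for b using B(3) that by (simp add: dot_square_norm)
  have "orth_proj S x = (\<Sum>b\<in>B. (b \<bullet> x) *\<^sub>R b)" for x
  proof (rule orth_proj_eq[OF assms])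
    show "(\<Sum>b\<in>B. (b \<bullet> x) *\<^sub>R b) \<in> S"
      using B(1) assms by (intro subspace_sum subspace_scale) auto
    have "orthogonal (x - (\<Sum>b\<in>B. (b \<bullet> x) *\<^sub>R b)) w" if "w \<in> B" for w
    proof -
      have "(\<Sum>b\<in>B. (b \<bullet> x) *\<^sub>R b) \<bullet> w = (\<Sum>b\<in>B. if b = w then w \<bullet> x else 0)"
        unfolding inner_sum_left
        using B(2) that one by (intro sum.cong) (auto simp: pairwise_def orthogonal_def)
      also have "\<dots> = w \<bullet> x" using that fin by simp
      finally show ?thesis by (simp add: orthogonal_def inner_diff_left inner_diff_right inner_commute)
    qed
    then show "orthogonal (x - (\<Sum>b\<in>B. (b \<bullet> x) *\<^sub>R b)) w" if "w \<in> S" for w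
      using that B(6) orthogonal_to_span by blast
  qed
  then show ?thesis using that[OF fin B(5)] one by auto
qed

lemma orth_proj_spec:
  fixes S :: "(real^'n::finite) set"
  assumes "subspace S"
  shows "orth_proj S x \<in> S" "w \<in> S \<Longrightarrow> orthogonal (x - orth_proj S x) w"
proof -
  obtain y z where yz: "y \<in> span S" "\<And>w. w \<in> span S \<Longrightarrow> orthogonal z w" "x = y + z"
    using orthogonal_subspace_decomp_exists by metis
  have sp: "span S = S" using assms by (simp add: span_eq_iff)
  note yz = yz[unfolded sp]
  have "orth_proj S x = y"
    using yz by (intro orth_proj_eq[OF assms]) auto
  with yz show "orth_proj S x \<in> S" "w \<in> S \<Longrightarrow> orthogonal (x - orth_proj S x) w"
    by auto
qed

lemma orth_proj_linear:
  fixes S :: "(real^'n::finite) set"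
  assumes "subspace S"
  shows "linear (orth_proj S)"
proof -
  obtain B where "orth_proj S = (\<lambda>x. \<Sum>b\<in>B. (b \<bullet> x) *\<^sub>R b)"
    using orth_proj_basis[OF assms] by auto
  then show ?thesis
    by (auto intro!: linear_compose_sum linearI simp: inner_add_right scaleR_add_left)
qed

lemma orth_proj_inner:
  fixes S :: "(real^'n::finite) set"
  assumes "subspace S"
  shows "orth_proj S x \<bullet> y = orth_proj S x \<bullet> orth_proj S y"
    and "norm (orth_proj S x) \<le> norm x"
    and "0 \<le> x \<bullet> orth_proj S x" "x \<bullet> orth_proj S x \<le> x \<bullet> x"
proof -
  have eq: "orth_proj S x \<bullet> y = orth_proj S x \<bullet> orth_proj S y" for x y
    using orth_proj_spec(2)[OF assms orth_proj_spec(1)[OF assms], of y x]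
    by (simp add: orthogonal_def inner_diff_left inner_diff_right inner_commute)
  show "orth_proj S x \<bullet> y = orth_proj S x \<bullet> orth_proj S y" by (rule eq)
  have "orth_proj S x \<bullet> orth_proj S x \<le> norm (orth_proj S x) * norm x"
    using norm_cauchy_schwarz[of "orth_proj S x" x] eq[of x x] by simp
  then show le: "norm (orth_proj S x) \<le> norm x"
    by (cases "orth_proj S x = 0") (auto simp: dot_square_norm power2_eq_square)
  have "x \<bullet> orth_proj S x = orth_proj S x \<bullet> orth_proj S x"
    using eq[of x x] by (simp add: inner_commute)
  then show "0 \<le> x \<bullet> orth_proj S x" "x \<bullet> orth_proj S x \<le> x \<bullet> x"
    using le by (auto simp: norm_le)
qed

lemma matrix_orth_proj:
  "subspace S \<Longrightarrow> matrix (orth_proj S) *v x = orth_proj S x"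
  using matrix_works orth_proj_linear linear_matrix_vector_mul_eq by blast

text \<open>In an orthonormal basis \<open>B\<close> the trace is a double sum of squared
  coordinates; summed over the coordinates first, each member of \<open>B\<close> contributes
  1.\<close>

lemma axis_trace_orth_proj:
  fixes S :: "(real^'n::finite) set"
  assumes "subspace S"
  shows "(\<Sum>i\<in>UNIV. axis i 1 \<bullet> orth_proj S (axis i 1)) = real (dim S)"
proof -
  obtain B where B: "finite B" "card B = dim S" "\<forall>b\<in>B. b \<bullet> b = 1"
    "orth_proj S = (\<lambda>x. \<Sum>b\<in>B. (b \<bullet> x) *\<^sub>R b)"
    using orth_proj_basis[OF assms] by auto
  have "(\<Sum>i\<in>UNIV. axis i 1 \<bullet> orth_proj S (axis i 1)) = (\<Sum>i\<in>UNIV. \<Sum>b\<in>B. b $ i * b $ i)"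
    by (simp add: B(4) inner_sum_right inner_axis inner_axis')
  also have "\<dots> = (\<Sum>b\<in>B. b \<bullet> b)"
    by (subst sum.swap) (simp add: inner_vec_def)
  also have "\<dots> = real (dim S)" using B by simp
  finally show ?thesis .
qed

lemma hom_inner_axis:
  fixes \<sigma> \<tau> :: "real^'n::finite \<Rightarrow> real^'n"
  assumes "linear \<sigma>"
  shows "hom_inner \<sigma> \<tau> = (\<Sum>i\<in>UNIV. \<sigma> (axis i 1) \<bullet> \<tau> (axis i 1))"
proof -
  have "adjoint \<sigma> y $ i = \<sigma> (axis i 1) \<bullet> y" for y i
    using adjoint_works[OF assms, of "axis i 1" y] by (simp add: inner_axis')
  then show ?thesis by (simp add: hom_inner_def trace_def matrix_def)
qed

text \<open>The matrices of the projections onto \<open>m\<close>-dimensional subspaces. Symmetry,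
  idempotence and trace are equations in the entries, so closedness is immediate, and the dimension
  enters through the trace.\<close>

definition projections :: "nat \<Rightarrow> (real^'n^'n) set" where
  "projections m = {P. (\<forall>x y. (P *v x) \<bullet> y = x \<bullet> (P *v y)) \<and> (\<forall>x. P *v (P *v x) = P *v x) \<and>
     trace P = real m}"

lemma matrix_orth_proj_projections:
  fixes S :: "(real^'n::finite) set"
  assumes "S \<in> grassmannian m"
  shows "matrix (orth_proj S) \<in> projections m" "range ((*v) (matrix (orth_proj S))) = S"
proof -
  have S: "subspace S" "dim S = m" using assms by (auto simp: grassmannian_def)
  have id: "orth_proj S x = x" if "x \<in> S" for x
    using that S by (intro orth_proj_eq) (auto simp: orthogonal_def)
  have tr: "trace (matrix (orth_proj S)) = real m"
    using axis_trace_orth_proj[OF S(1)] S(2) by (simp add: trace_def matrix_def inner_axis')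
  have "orth_proj S x \<bullet> y = x \<bullet> orth_proj S y" for x y
    using orth_proj_inner(1)[OF S(1), of x y] orth_proj_inner(1)[OF S(1), of y x]
    by (simp add: inner_commute)
  then show "matrix (orth_proj S) \<in> projections m"
    using tr id orth_proj_spec(1)[OF S(1)] by (auto simp: projections_def matrix_orth_proj[OF S(1)])
  have "orth_proj S ` UNIV = S"
    using id orth_proj_spec(1)[OF S(1)] by (metis (no_types, lifting) UNIV_I image_eqI image_subsetI subsetI subset_antisym)
  then show "range ((*v) (matrix (orth_proj S))) = S"
    by (simp add: matrix_orth_proj[OF S(1)] image_def)
qed

text \<open>Symmetry and idempotence make \<open>x - P *v x\<close> orthogonal to the range, so
  \<open>P\<close> projects onto its range, whose dimension is then the trace.\<close>

lemma projections_range: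
  fixes P :: "real^'n::finite^'n"
  assumes "P \<in> projections m"
  shows "range ((*v) P) \<in> grassmannian m" "matrix (orth_proj (range ((*v) P))) = P"
proof -
  let ?S = "range ((*v) P)"
  have P: "\<And>x y. (P *v x) \<bullet> y = x \<bullet> (P *v y)" "\<And>x. P *v (P *v x) = P *v x" "trace P = real m"
    using assms by (auto simp: projections_def)
  have sub: "subspace ?S"
    by (simp add: linear_subspace_image)
  have "orth_proj ?S x = P *v x" for x
  proof (rule orth_proj_eq[OF sub])
    show "orthogonal (x - P *v x) w" if "w \<in> ?S" for w
    proof -
      from that obtain y where "w = P *v y" by blast
      then show ?thesis
        using P(1)[of x "P *v y"] P(1)[of x y] P(2)
        by (simp add: orthogonal_def inner_diff_left)
    qed
  qed auto
  then have "orth_proj ?S = (*v) P" by auto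
  then show eq: "matrix (orth_proj ?S) = P" by simp
  have "real (dim ?S) = trace P"
    using axis_trace_orth_proj[OF sub] \<open>orth_proj ?S = (*v) P\<close>
    by (simp add: trace_def inner_axis' matrix_vector_mult_basis column_def)
  then show "?S \<in> grassmannian m" using sub P(3) by (simp add: grassmannian_def)
qed

text \<open>Projections do not increase norms, so no entry exceeds 1 in absolute value; closedness
  comes from the defining equations.\<close>

lemma compact_projections: "compact (projections m :: (real^'n::finite^'n) set)"
proof -
  have "closed (projections m :: (real^'n^'n) set)"
    unfolding projections_def matrix_vector_mult_def trace_def
    by (intro closed_Collect_conj closed_Collect_all closed_Collect_eq continuous_intros)
  moreover have "bounded (projections m :: (real^'n^'n) set)"
  proof -
    have "norm P \<le> real CARD('n) * real CARD('n)" if P: "P \<in> projections m" for P :: "real^'n^'n"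
    proof -
      have sub: "subspace (range ((*v) P))" by (simp add: linear_subspace_image)
      have "norm (P *v x) \<le> norm x" for x
        using orth_proj_inner(2)[OF sub, of x] matrix_orth_proj[OF sub, of x] projections_range(2)[OF P]
        by simp
      then have ij: "\<bar>P $ i $ j\<bar> \<le> 1" for i j
        using component_le_norm_cart[of "P *v axis j 1" i]
        by (metis matrix_vector_mult_basis column_def norm_axis_1 order_trans vec_lambda_beta)
      have "norm (P $ i) \<le> real CARD('n)" for i
      proof -
        have "norm (P $ i) \<le> (\<Sum>j\<in>UNIV. \<bar>P $ i $ j\<bar>)" by (rule norm_le_l1_cart)
        also have "\<dots> \<le> (\<Sum>j\<in>(UNIV::'n set). 1)" by (intro sum_mono ij)
        finally show ?thesis by simp
      qed
      then have "(\<Sum>i\<in>UNIV. norm (P $ i)) \<le> (\<Sum>i\<in>(UNIV::'n set). real CARD('n))"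
        by (intro sum_mono)
      then show ?thesis
        using L2_set_le_sum[of UNIV "\<lambda>i. norm (P $ i)"] by (simp add: norm_vec_def)
    qed
    then show ?thesis unfolding bounded_iff by blast
  qed
  ultimately show ?thesis by (simp add: compact_eq_bounded_closed)
qed

lemma topspace_grassmannian [simp]: "topspace (grassmannian_topology m) = grassmannian m"
  by (simp add: grassmannian_topology_def topspace_pullback_topology)

text \<open>The topology is pulled back along \<open>S \<mapsto> matrix (orth_proj S)\<close>, so a
  map into the Grassmannian is continuous once its composition with this map is; for the range map
  on \<open>projections\<close> the composition is the identity. Compactness makes the weight finite
  on compact sets.\<close>

lemma compact_grassmannian: "compact_space (grassmannian_topology m :: (real^'n::finite) set topology)"
proof -
  let ?r = "\<lambda>P :: real^'n^'n. range ((*v) P)"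
  have cm: "continuous_map (top_of_set (projections m)) (grassmannian_topology m) ?r"
    unfolding grassmannian_topology_def
  proof (rule continuous_map_pullback')
    have "continuous_map (top_of_set (projections m)) euclidean (\<lambda>P::real^'n^'n. P)"
      by (simp add: continuous_map_iff_continuous)
    then show "continuous_map (top_of_set (projections m)) euclidean ((\<lambda>S. matrix (orth_proj S)) \<circ> ?r)"
      by (rule continuous_map_eq) (simp add: projections_range(2))
  qed (auto simp: projections_range(1))
  have "compactin (grassmannian_topology m) (?r ` projections m)"
    by (rule image_compactin[OF _ cm]) (simp add: compactin_subtopology compact_projections)
  moreover have "?r ` projections m = grassmannian m"
  proof
    show "grassmannian m \<subseteq> ?r ` projections m"
    proof
      fix S :: "(real^'n) set" assume "S \<in> grassmannian m"
      note S = matrix_orth_proj_projections[OF this]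
      show "S \<in> ?r ` projections m"
        by (rule image_eqI[where f = ?r, OF S(2)[symmetric] S(1)])
    qed
  qed (use projections_range(1) in blast)
  ultimately show ?thesis by (simp add: compact_space_def)
qed

section \<open>Functions on the domain of a varifold\<close>

lemma topspace_varifold_space [simp]: "topspace (varifold_space m U) = U \<times> grassmannian m"
  by (simp add: varifold_space_def)

lemma continuous_map_varifold_fst: "continuous_map (varifold_space m U) (top_of_set U) fst"
  by (simp add: varifold_space_def continuous_map_fst)

lemma compactin_varifold_space:
  fixes K :: "(real^'n::finite) set"
  assumes "compact K" "K \<subseteq> U"
  shows "compactin (varifold_space m U) (K \<times> grassmannian m)"
proof -
  have "compactin (grassmannian_topology m) (grassmannian m :: (real^'n) set set)"
    using compact_grassmannian by (simp add: compact_space_def)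
  then show ?thesis
    unfolding varifold_space_def compactin_Times using assms by (simp add: compactin_subtopology)
qed

text \<open>The divergence of \<open>g\<close> along a plane, which is the integrand of the first
  variation.\<close>

definition vdiv :: "(real^'n \<Rightarrow> real^'n::finite) \<Rightarrow> (real^'n) \<times> (real^'n) set \<Rightarrow> real" where
  "vdiv g p = hom_inner (frechet_derivative g (at (fst p))) (orth_proj (snd p))"

lemma first_variation_vdiv: "first_variation V g = (LINT p|V. vdiv g p)"
  by (simp add: first_variation_def vdiv_def case_prod_unfold)

lemma vdiv_axis:
  assumes "smooth g"
  shows "vdiv g p = (\<Sum>i\<in>UNIV. frechet_derivative g (at (fst p)) (axis i 1) \<bullet> orth_proj (snd p) (axis i 1))"
  unfolding vdiv_def
  by (rule hom_inner_axis[OF has_derivative_linear[OF smooth_has_derivative[OF assms]]])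

lemma vdiv_add:
  assumes "smooth f" "smooth g"
  shows "vdiv (\<lambda>z. f z + g z) p = vdiv f p + vdiv g p"
proof -
  have "frechet_derivative (\<lambda>z. f z + g z) (at (fst p)) =
      (\<lambda>v. frechet_derivative f (at (fst p)) v + frechet_derivative g (at (fst p)) v)"
    by (rule frechet_derivative_at[symmetric]) (intro has_derivative_add smooth_has_derivative assms)
  then show ?thesis
    by (simp add: vdiv_axis assms smooth_add inner_add_left sum.distrib)
qed

lemma vdiv_scale:
  assumes "smooth g"
  shows "vdiv (\<lambda>z. c *\<^sub>R g z) p = c * vdiv g p"
proof -
  have "frechet_derivative (\<lambda>z. c *\<^sub>R g z) (at (fst p)) = (\<lambda>v. c *\<^sub>R frechet_derivative g (at (fst p)) v)"
    by (rule frechet_derivative_at[symmetric]) (intro has_derivative_scaleR_right smooth_has_derivative assms)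
  then show ?thesis
    by (simp add: vdiv_axis assms smooth_scaleR sum_distrib_left)
qed

text \<open>Expanding over the coordinate axes leaves finitely many continuous functions of the
  point and of the matrix of the projection.\<close>

lemma vdiv_continuous:
  fixes g :: "real^'n::finite \<Rightarrow> real^'n"
  assumes "smooth g"
  shows "continuous_map (varifold_space m U) euclideanreal (vdiv g)"
proof -
  define \<iota> where "\<iota> = (\<lambda>p :: (real^'n) \<times> (real^'n) set. (fst p, matrix (orth_proj (snd p))))"
  define h where "h = (\<lambda>q. \<Sum>i\<in>UNIV. frechet_derivative g (at (fst q)) (axis i 1) \<bullet> (snd q *v axis i 1))"
  have m: "continuous_map (grassmannian_topology m) euclidean (\<lambda>S::(real^'n) set. matrix (orth_proj S))"
    using continuous_map_pullback[of euclidean euclidean "\<lambda>x. x" "grassmannian m" "\<lambda>S::(real^'n) set. matrix (orth_proj S)"]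
    by (simp add: grassmannian_topology_def o_def)
  have "continuous_map (varifold_space m U) (prod_topology euclidean euclidean) \<iota>"
    unfolding \<iota>_def varifold_space_def
  proof (rule continuous_map_pairedI)
    show "continuous_map (prod_topology (top_of_set U) (grassmannian_topology m :: (real^'n) set topology)) euclidean fst"
      by (rule continuous_map_into_fulltopology[OF continuous_map_fst])
    show "continuous_map (prod_topology (top_of_set U) (grassmannian_topology m)) euclidean
       (\<lambda>x :: (real^'n) \<times> (real^'n) set. matrix (orth_proj (snd x)))"
      by (rule continuous_map_compose[OF continuous_map_snd m, unfolded o_def])
  qed
  then have \<iota>: "continuous_map (varifold_space m U) euclidean \<iota>" by simp
  have "continuous_on UNIV h"
  proof -
    have 1: "continuous_on UNIV (\<lambda>q :: (real^'n) \<times> (real^'n^'n). frechet_derivative g (at (fst q)) v)" for v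
      using smooth_continuous_on[OF smooth_derivative[OF assms, of v]]
      by (rule continuous_on_compose2[of UNIV _ UNIV fst]) (auto intro: continuous_intros)
    have 2: "continuous_on UNIV (\<lambda>q :: (real^'n) \<times> (real^'n^'n). snd q *v v)" for v
      unfolding matrix_vector_mult_def by (intro continuous_intros)
    show ?thesis unfolding h_def by (intro continuous_on_sum continuous_on_inner 1 2)
  qed
  then have "continuous_map (varifold_space m U) euclideanreal (h \<circ> \<iota>)"
    using \<iota> by (intro continuous_map_compose[of _ euclidean]) auto
  then show ?thesis
  proof (rule continuous_map_eq)
    fix p assume "p \<in> topspace (varifold_space m U)"
    then have "subspace (snd p)" by (auto simp: grassmannian_def)
    then show "(h \<circ> \<iota>) p = vdiv g p"
      by (simp add: h_def \<iota>_def vdiv_axis[OF assms] matrix_orth_proj)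
  qed
qed

lemma vdiv_outside: "fst p \<notin> closure {z. g z \<noteq> 0} \<Longrightarrow> vdiv g p = 0"
  using test_field_derivative_outside[of "fst p" g]
  by (simp add: vdiv_def hom_inner_axis[OF linear_zero])

lemma vdiv_bounded:
  fixes g :: "real^'n::finite \<Rightarrow> real^'n"
  assumes "g \<in> test_fields U"
  obtains B where "\<And>p. snd p \<in> grassmannian m \<Longrightarrow> \<bar>vdiv g p\<bar> \<le> B"
proof -
  define C where "C = closure {z. g z \<noteq> 0}"
  have g: "smooth g" "compact C" using assms test_field_smooth test_field_compact unfolding C_def by auto
  define h where "h z = (\<Sum>i\<in>UNIV. norm (frechet_derivative g (at z) (axis i 1)))" for z
  have "continuous_on C h"
    unfolding h_def by (intro continuous_on_sum continuous_on_norm smooth_continuous_on smooth_derivative g)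
  then have "bounded (h ` C)"
    using g(2) compact_continuous_image compact_imp_bounded by blast
  then obtain B where B: "B > 0" "\<And>z. z \<in> C \<Longrightarrow> norm (h z) \<le> B"
    unfolding bounded_pos by auto
  have "\<bar>vdiv g p\<bar> \<le> B" if "snd p \<in> grassmannian m" for p
  proof (cases "fst p \<in> C")
    case True
    have sub: "subspace (snd p)" using that by (simp add: grassmannian_def)
    have "\<bar>vdiv g p\<bar> \<le> (\<Sum>i\<in>UNIV. \<bar>frechet_derivative g (at (fst p)) (axis i 1) \<bullet> orth_proj (snd p) (axis i 1)\<bar>)"
      unfolding vdiv_axis[OF g(1)] by (rule sum_abs)
    also have "\<dots> \<le> h (fst p)"
      unfolding h_def
    proof (rule sum_mono)
      fix i :: 'n
      have "norm (orth_proj (snd p) (axis i 1)) \<le> 1"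
        using orth_proj_inner(2)[OF sub, of "axis i 1"] by simp
      then show "\<bar>frechet_derivative g (at (fst p)) (axis i 1) \<bullet> orth_proj (snd p) (axis i 1)\<bar>
          \<le> norm (frechet_derivative g (at (fst p)) (axis i 1))"
        using Cauchy_Schwarz_ineq2[of "frechet_derivative g (at (fst p)) (axis i 1)" "orth_proj (snd p) (axis i 1)"]
        by (meson mult_left_le norm_ge_zero order_trans)
    qed
    also have "\<dots> \<le> B" using B(2)[OF True] by simp
    finally show ?thesis .
  next
    case False
    then show ?thesis using vdiv_outside[of p g] B(1) by (simp add: C_def)
  qed
  then show ?thesis using that by blast
qed

text \<open>The derivative of the field is a multiple of the identity, whose trace over
  \<open>S\<close> is \<open>m\<close>, plus a rank one term from the radial factor, which sees only
  the part of \<open>z - a\<close> along \<open>S\<close>. With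
  \<open>c = inverse (r\<^sup>2)\<close> this is the field behind the monotonicity formula.\<close>

lemma vdiv_radial:
  fixes a :: "real^'n::finite" and F :: "real \<Rightarrow> real"
  assumes F: "smooth F" "\<And>t. (F has_real_derivative F' t) (at t)" and S: "S \<in> grassmannian m"
  shows "vdiv (\<lambda>z. F ((z - a) \<bullet> (z - a) * c) *\<^sub>R (z - a)) (z, S) =
    real m * F ((z - a) \<bullet> (z - a) * c)
    + 2 * c * F' ((z - a) \<bullet> (z - a) * c) * ((z - a) \<bullet> orth_proj S (z - a))"
proof -
  let ?g = "\<lambda>z. F ((z - a) \<bullet> (z - a) * c) *\<^sub>R (z - a)"
  let ?x = "z - a" and ?q = "(z - a) \<bullet> (z - a) * c"
  have sub: "subspace S" "dim S = m" using S by (auto simp: grassmannian_def)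
  have F1: "(F has_derivative (\<lambda>h. F' t * h)) (at t)" for t
    using F(2)[of t] by (simp add: has_field_derivative_def)
  have q: "((\<lambda>z. (z - a) \<bullet> (z - a) * c) has_derivative (\<lambda>v. 2 * (?x \<bullet> v) * c)) (at z)"
    by (auto intro!: derivative_eq_intros simp: inner_commute)
  have "((\<lambda>z. F ((z - a) \<bullet> (z - a) * c)) has_derivative (\<lambda>v. F' ?q * (2 * (?x \<bullet> v) * c))) (at z)"
    by (rule has_derivative_compose[OF q F1])
  then have "(?g has_derivative (\<lambda>v. F ?q *\<^sub>R v + (F' ?q * (2 * (?x \<bullet> v) * c)) *\<^sub>R ?x)) (at z)"
    by (rule has_derivative_eq_rhs[OF has_derivative_scaleR])
       (auto intro!: derivative_eq_intros)
  then have fd: "frechet_derivative ?g (at z) = (\<lambda>v. F ?q *\<^sub>R v + (F' ?q * (2 * (?x \<bullet> v) * c)) *\<^sub>R ?x)"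
    by (rule frechet_derivative_at[symmetric])
  have sm: "smooth ?g"
    by (intro smooth_scaleR smooth_radial F(1) smooth_diff smooth_id smooth_const)
  have lin: "linear (orth_proj S)" by (rule orth_proj_linear[OF sub(1)])
  have x: "(\<Sum>i\<in>UNIV. (?x $ i) *\<^sub>R axis i 1) = ?x"
    using basis_expansion[of ?x] by (simp add: scalar_mult_eq_scaleR)
  have "(\<Sum>i\<in>UNIV. ?x $ i * (?x \<bullet> orth_proj S (axis i 1))) = ?x \<bullet> orth_proj S (\<Sum>i\<in>UNIV. (?x $ i) *\<^sub>R axis i 1)"
    by (simp add: linear_sum[OF lin] linear_scale[OF lin] inner_sum_right)
  then have px: "(\<Sum>i\<in>UNIV. ?x $ i * (?x \<bullet> orth_proj S (axis i 1))) = ?x \<bullet> orth_proj S ?x"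
    by (simp only: x)
  have "vdiv ?g (z, S) = (\<Sum>i\<in>UNIV. F ?q * (axis i 1 \<bullet> orth_proj S (axis i 1))
      + F' ?q * 2 * c * (?x $ i * (?x \<bullet> orth_proj S (axis i 1))))"
    unfolding vdiv_axis[OF sm] fst_conv snd_conv fd
    by (simp add: inner_add_left inner_axis algebra_simps)
  also have "\<dots> = F ?q * real (dim S) + F' ?q * 2 * c * (?x \<bullet> orth_proj S ?x)"
    by (simp only: sum.distrib sum_distrib_left[symmetric] px axis_trace_orth_proj[OF sub(1)])
  finally show ?thesis using sub(2) by (simp add: algebra_simps)
qed

section \<open>Radon measures\<close>

lemma space_borel_on [simp]: "space (borel_on X) = topspace X"
  and sets_borel_on: "sets (borel_on X) = sigma_sets (topspace X) {S. openin X S}"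
proof -
  have "{S. openin X S} \<subseteq> Pow (topspace X)" using openin_subset by auto
  then show "space (borel_on X) = topspace X"
    and "sets (borel_on X) = sigma_sets (topspace X) {S. openin X S}"
    by (simp_all add: borel_on_def space_measure_of sets_measure_of)
qed

lemma radon_space: "radon_measure X \<mu> \<Longrightarrow> space \<mu> = topspace X"
  and radon_sets: "radon_measure X \<mu> \<Longrightarrow> sets \<mu> = sets (borel_on X)"
  and radon_openin: "radon_measure X \<mu> \<Longrightarrow> openin X S \<Longrightarrow> S \<in> sets \<mu>"
  using sets_eq_imp_space_eq[of \<mu> "borel_on X"]
  by (auto simp: radon_measure_def sets_borel_on)

lemma sets_borel_on_open:
  fixes U :: "'a::topological_space set"
  assumes "open U"
  shows "sets (borel_on (top_of_set U)) = sets (restrict_space borel U)"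
proof -
  have "{S. openin (top_of_set U) S} = (\<inter>) U ` {S. open S}"
    by (auto simp: openin_open)
  then show ?thesis
    using sigma_sets_Int[of U UNIV "{S. open S}"]
    by (simp add: sets_borel_on sets_restrict_space borel_def assms)
qed

lemma sets_restrict_borel_iff:
  "open U \<Longrightarrow> A \<in> sets (restrict_space borel U) \<longleftrightarrow> A \<in> sets borel \<and> A \<subseteq> U"
  by (auto simp: sets_restrict_space_iff)

text \<open>An abstract sigma-finiteness by open sets, shared by \<open>U\<close> and by its product
  with the Grassmannian, so that restriction of Radon measures is treated once.\<close>

definition finite_exhaustion :: "'a topology \<Rightarrow> 'a measure \<Rightarrow> (nat \<Rightarrow> 'a set) \<Rightarrow> bool" where
  "finite_exhaustion X \<mu> Q \<longleftrightarrow>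
     (\<forall>k. openin X (Q k) \<and> emeasure \<mu> (Q k) < \<infinity>) \<and> incseq Q \<and> (\<Union>k. Q k) = topspace X"

text \<open>Outer regularity as an infimum says nothing about a set of infinite measure; it is
  applied to the finite pieces \<open>A \<inter> Q k\<close>, with errors adding up to
  \<open>\<epsilon>\<close>.\<close>

lemma radon_open_superset:
  assumes \<mu>: "radon_measure X \<mu>" and Q: "finite_exhaustion X \<mu> Q"
    and A: "A \<in> sets \<mu>" and \<epsilon>: "\<epsilon> > 0"
  obtains S where "openin X S" "A \<subseteq> S" "emeasure \<mu> (S - A) \<le> ennreal \<epsilon>"
proof -
  have sub: "A \<subseteq> topspace X" using A sets.sets_into_space radon_space[OF \<mu>] by blast
  have Qs: "Q k \<in> sets \<mu>" for k using Q radon_openin[OF \<mu>] by (simp add: finite_exhaustion_def)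
  have "\<exists>S. openin X S \<and> A \<inter> Q k \<subseteq> S \<and> emeasure \<mu> (S - A \<inter> Q k) \<le> ennreal (\<epsilon> * (1/2) ^ Suc k)" for k
  proof -
    let ?A = "A \<inter> Q k" and ?e = "\<epsilon> * (1/2) ^ Suc k"
    have As: "?A \<in> sets \<mu>" using A Qs by auto
    have "emeasure \<mu> ?A \<le> emeasure \<mu> (Q k)" by (intro emeasure_mono Qs) auto
    then have fin: "emeasure \<mu> ?A < \<infinity>" using Q by (auto simp: finite_exhaustion_def less_top elim: le_less_trans)
    have eq: "emeasure \<mu> ?A = (INF S\<in>{S. openin X S \<and> ?A \<subseteq> S}. emeasure \<mu> S)"
      using \<mu> As by (auto simp: radon_measure_def)
    have "emeasure \<mu> ?A < emeasure \<mu> ?A + ennreal ?e"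
      using fin \<epsilon> by (cases "emeasure \<mu> ?A") (auto simp: ennreal_less_iff simp flip: ennreal_plus)
    then have "(INF S\<in>{S. openin X S \<and> ?A \<subseteq> S}. emeasure \<mu> S) < emeasure \<mu> ?A + ennreal ?e"
      by (simp only: eq[symmetric])
    then obtain S where S: "openin X S" "?A \<subseteq> S" "emeasure \<mu> S < emeasure \<mu> ?A + ennreal ?e"
      unfolding INF_less_iff by blast
    have "emeasure \<mu> (S - ?A) = emeasure \<mu> S - emeasure \<mu> ?A"
      using fin S As radon_openin[OF \<mu>] by (intro emeasure_Diff) auto
    also have "\<dots> \<le> ennreal ?e"
      using S(3) fin by (auto simp add: ennreal_minus_le_iff add.commute less_imp_le)
    finally show ?thesis using S by blast
  qed
  then obtain S where S: "\<And>k. openin X (S k)" "\<And>k. A \<inter> Q k \<subseteq> S k"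
    "\<And>k. emeasure \<mu> (S k - A \<inter> Q k) \<le> ennreal (\<epsilon> * (1/2) ^ Suc k)"
    by metis
  have Ss: "S k \<in> sets \<mu>" for k using S(1) radon_openin[OF \<mu>] by blast
  show ?thesis
  proof (rule that[of "\<Union>k. S k"])
    show "openin X (\<Union>k. S k)" using S(1) by blast
    show "A \<subseteq> (\<Union>k. S k)" using S(2) Q sub by (fastforce simp: finite_exhaustion_def)
    have "emeasure \<mu> ((\<Union>k. S k) - A) \<le> emeasure \<mu> (\<Union>k. S k - A \<inter> Q k)"
      using Ss A Qs by (intro emeasure_mono) auto
    also have "\<dots> \<le> (\<Sum>k. emeasure \<mu> (S k - A \<inter> Q k))"
      using Ss A Qs by (intro emeasure_subadditive_countably) auto
    also have "\<dots> \<le> (\<Sum>k. ennreal (\<epsilon> * (1/2) ^ Suc k))"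
      by (intro suminf_le S) auto
    also have "\<dots> = ennreal \<epsilon>"
    proof -
      have "(\<lambda>k. \<epsilon> * (1/2) ^ Suc k) sums (\<epsilon> * 1)"
        by (intro sums_mult power_half_series)
      then show ?thesis using \<epsilon> by (intro suminf_ennreal_eq) auto
    qed
    finally show "emeasure \<mu> ((\<Union>k. S k) - A) \<le> ennreal \<epsilon>" .
  qed
qed

lemma emeasure_density_indicator:
  assumes "A \<in> sets \<mu>" "B \<in> sets \<mu>"
  shows "emeasure (density \<mu> (indicator A)) B = emeasure \<mu> (A \<inter> B)"
proof -
  have "emeasure (density \<mu> (indicator A)) B = (\<integral>\<^sup>+x. indicator (A \<inter> B) x \<partial>\<mu>)"
    using assms by (auto simp: emeasure_density indicator_inter_arith intro!: nn_integral_cong)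
  then show ?thesis using assms by simp
qed

text \<open>A compact or open set that approximates well for \<open>\<mu>\<close> does so for the
  restricted measure, which is smaller on the error set. Errors are measured by differences, hence
  the pieces \<open>Q k\<close> of finite measure.\<close>

lemma radon_density_indicator:
  assumes \<mu>: "radon_measure X \<mu>" and Q: "finite_exhaustion X \<mu> Q" and A: "A \<in> sets \<mu>"
  shows "radon_measure X (density \<mu> (indicator A))" (is "radon_measure X ?D")
proof -
  note dens = emeasure_density_indicator[OF A]
  have Qs: "Q k \<in> sets \<mu>" for k using Q radon_openin[OF \<mu>] by (simp add: finite_exhaustion_def)
  have le: "emeasure ?D B \<le> emeasure \<mu> B" if "B \<in> sets \<mu>" for B
    using that dens[OF that] by (simp add: emeasure_mono)
  \<comment> \<open>In a general topology a compact set need not be Borel; its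
    \<open>emeasure\<close> is then 0 by convention.\<close>
  have sub: "K \<notin> sets \<mu> \<Longrightarrow> emeasure ?D K = 0" for K
    by (simp add: emeasure_notin_sets)
  have "emeasure ?D K < \<infinity>" if "compactin X K" for K
    using le[of K] sub[of K] \<mu> that by (cases "K \<in> sets \<mu>") (auto simp: radon_measure_def elim: le_less_trans)
  moreover have "emeasure ?D S = (SUP K\<in>{K. compactin X K \<and> K \<subseteq> S}. emeasure ?D K)" (is "_ = ?s")
    if S: "openin X S" for S
  proof (rule antisym)
    have Ss: "S \<in> sets \<mu>" using S radon_openin[OF \<mu>] by blast
    have "emeasure ?D (S \<inter> Q k) \<le> ?s" for k
    proof (rule ennreal_le_epsilon)
      fix e :: real assume e: "0 < e"
      have op: "openin X (S \<inter> Q k)" using S Q by (auto simp: finite_exhaustion_def)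
      have "emeasure \<mu> (S \<inter> Q k) \<le> emeasure \<mu> (Q k)" by (intro emeasure_mono Qs) auto
      then have fin: "emeasure \<mu> (S \<inter> Q k) < \<infinity>" using Q by (auto simp: finite_exhaustion_def less_top elim: le_less_trans)
      have eq: "emeasure \<mu> (S \<inter> Q k) = (SUP K\<in>{K. compactin X K \<and> K \<subseteq> S \<inter> Q k}. emeasure \<mu> K)"
        using \<mu> op by (auto simp: radon_measure_def)
      show "emeasure ?D (S \<inter> Q k) \<le> ?s + ennreal e"
      proof (cases "emeasure \<mu> (S \<inter> Q k) = 0")
        case True
        then show ?thesis using le[of "S \<inter> Q k"] Ss Qs by auto
      next
        case False
        then have "emeasure \<mu> (S \<inter> Q k) - ennreal e < emeasure \<mu> (S \<inter> Q k)"
          using fin e by (intro ennreal_between) (auto simp: less_top zero_less_iff_neq_zero)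
        then have "emeasure \<mu> (S \<inter> Q k) - ennreal e < (SUP K\<in>{K. compactin X K \<and> K \<subseteq> S \<inter> Q k}. emeasure \<mu> K)"
          by (simp only: eq[symmetric])
        then obtain K where K: "compactin X K" "K \<subseteq> S \<inter> Q k" "emeasure \<mu> (S \<inter> Q k) - ennreal e < emeasure \<mu> K"
          unfolding less_SUP_iff by blast
        \<comment> \<open>A set of positive \<open>emeasure\<close> is measurable, the default value
          being 0.\<close>
        have Ks: "K \<in> sets \<mu>" using K(3) emeasure_notin_sets by fastforce
        have fK: "emeasure \<mu> K < \<infinity>" using K \<mu> by (auto simp: radon_measure_def)
        have "emeasure ?D (S \<inter> Q k) = emeasure ?D K + emeasure ?D (S \<inter> Q k - K)"
          using K Ss Qs Ks by (subst plus_emeasure) (auto simp: Un_absorb1)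
        also have "\<dots> \<le> emeasure ?D K + emeasure \<mu> (S \<inter> Q k - K)"
          using Ss Qs Ks by (intro add_left_mono le) auto
        also have "emeasure \<mu> (S \<inter> Q k - K) = emeasure \<mu> (S \<inter> Q k) - emeasure \<mu> K"
          using K Ks Ss Qs fK by (intro emeasure_Diff) auto
        also have "\<dots> \<le> ennreal e"
        proof -
          have "emeasure \<mu> (S \<inter> Q k) \<le> emeasure \<mu> K + ennreal e"
            using less_imp_le[OF K(3)] by (simp add: ennreal_minus_le_iff add.commute)
          then show ?thesis using fin by (auto simp: ennreal_minus_le_iff add.commute)
        qed
        also have "emeasure ?D K \<le> ?s" using K by (intro SUP_upper) auto
        finally show ?thesis by simp
      qed
    qed
    moreover have "emeasure ?D S = (SUP k. emeasure ?D (S \<inter> Q k))"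
    proof -
      have "S = (\<Union>k. S \<inter> Q k)" using Q S openin_subset by (fastforce simp: finite_exhaustion_def)
      moreover have "(SUP k. emeasure ?D (S \<inter> Q k)) = emeasure ?D (\<Union>k. S \<inter> Q k)"
      proof (rule SUP_emeasure_incseq)
        show "incseq (\<lambda>k. S \<inter> Q k)" using Q unfolding finite_exhaustion_def incseq_def by blast
      qed (use Ss Qs in auto)
      ultimately show ?thesis by simp
    qed
    ultimately show "emeasure ?D S \<le> ?s" by (simp add: SUP_le_iff)
    show "?s \<le> emeasure ?D S" using Ss by (intro SUP_least emeasure_mono) auto
  qed
  moreover have "emeasure ?D B = (INF S\<in>{S. openin X S \<and> B \<subseteq> S}. emeasure ?D S)" (is "_ = ?i")
    if B: "B \<in> sets \<mu>" for B
  proof (rule antisym)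
    show "emeasure ?D B \<le> ?i"
      using radon_openin[OF \<mu>] by (intro INF_greatest emeasure_mono) auto
    show "?i \<le> emeasure ?D B"
    proof (rule ennreal_le_epsilon)
      fix e :: real assume e: "0 < e"
      obtain S where S: "openin X S" "B \<subseteq> S" "emeasure \<mu> (S - B) \<le> ennreal e"
        using radon_open_superset[OF \<mu> Q B e] by metis
      have Ss: "S \<in> sets \<mu>" using S radon_openin[OF \<mu>] by blast
      have "?i \<le> emeasure ?D S" using S by (intro INF_lower) auto
      also have "\<dots> = emeasure ?D B + emeasure ?D (S - B)"
        using S B Ss by (subst plus_emeasure) (auto simp: Un_absorb1)
      also have "\<dots> \<le> emeasure ?D B + ennreal e"
        using S(3) le[of "S - B"] B Ss by (intro add_left_mono) auto
      finally show "?i \<le> emeasure ?D B + ennreal e" .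
    qed
  qed
  ultimately show ?thesis using radon_sets[OF \<mu>] by (auto simp: radon_measure_def)
qed

section \<open>Radon measures on open sets\<close>

lemma open_compact_exhaustion:
  fixes S :: "'a::euclidean_space set"
  assumes "open S"
  shows "\<exists>C. (\<forall>n. compact (C n)) \<and> (\<forall>n. C n \<subseteq> S) \<and> (\<forall>n. C n \<subseteq> interior (C (Suc n))) \<and> (\<Union>n::nat. C n) = S"
  by (rule open_Union_compact_subsets[OF assms]) blast

locale radon_on_open =
  fixes U :: "(real^'n::finite) set" and \<nu> :: "(real^'n) measure"
  assumes U: "open U" and radon: "radon_measure (top_of_set U) \<nu>"
begin

lemma sets_eq: "sets \<nu> = sets (restrict_space borel U)"
  using radon_sets[OF radon] sets_borel_on_open[OF U] by simp

lemma space_eq [simp]: "space \<nu> = U"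
  using radon_space[OF radon] by simp

lemma sets_iff: "A \<in> sets \<nu> \<longleftrightarrow> A \<in> sets borel \<and> A \<subseteq> U"
  by (simp add: sets_eq sets_restrict_borel_iff[OF U])

lemma finite_compact: "compact K \<Longrightarrow> K \<subseteq> U \<Longrightarrow> emeasure \<nu> K < \<infinity>"
  using radon by (simp add: radon_measure_def compactin_subtopology)

lemma compact_sets: "compact K \<Longrightarrow> K \<subseteq> U \<Longrightarrow> K \<in> sets \<nu>"
  by (simp add: sets_iff borel_compact)

lemma borel_measurable: "f \<in> borel_measurable borel \<Longrightarrow> f \<in> borel_measurable \<nu>"
  by (simp only: measurable_cong_sets[OF sets_eq refl] measurable_restrict_space1)

lemma exhaustion:
  shows "\<exists>C Q. (\<forall>k. compact (C k) \<and> C k \<subseteq> U \<and> Q k \<subseteq> C k \<and> open (Q k)) \<and>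
    incseq Q \<and> (\<Union>k. Q k) = U \<and> finite_exhaustion (top_of_set U) \<nu> Q"
proof -
  obtain C where C: "\<And>n. compact (C n)" "\<And>n. C n \<subseteq> U" "\<And>n. C n \<subseteq> interior (C (Suc n))" "(\<Union>n. C n) = U"
    using open_compact_exhaustion[OF U] by metis
  have inc: "incseq (\<lambda>n. interior (C n))"
    using order_trans[OF interior_subset C(3)] by (intro incseq_SucI)
  have un: "(\<Union>k. interior (C k)) = U"
    using C interior_subset by blast
  have "emeasure \<nu> (interior (C k)) \<le> emeasure \<nu> (C k)" for k
    using C(1,2) compact_sets interior_subset[of "C k"] by (intro emeasure_mono) auto
  then have "emeasure \<nu> (interior (C k)) < \<infinity>" for k
    using finite_compact[OF C(1) C(2)] le_less_trans by blast
  then have "finite_exhaustion (top_of_set U) \<nu> (\<lambda>k. interior (C k))"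
    using inc un C finite_compact U unfolding finite_exhaustion_def
    by (auto intro: le_less_trans intro!: openin_open_subtopology[THEN iffD2] dest: subsetD[OF interior_subset] simp: openin_open_eq)
  with C inc un show ?thesis
    by (intro exI[of _ C] exI[of _ "\<lambda>k. interior (C k)"]) (auto simp: subsetD[OF interior_subset])
qed

sublocale sigma_finite_measure \<nu>
proof
  obtain C where C: "\<And>n. compact (C n)" "\<And>n. C n \<subseteq> U" "(\<Union>n::nat. C n) = U"
    using open_compact_exhaustion[OF U] by metis
  show "\<exists>A. countable A \<and> A \<subseteq> sets \<nu> \<and> \<Union> A = space \<nu> \<and> (\<forall>a\<in>A. emeasure \<nu> a \<noteq> \<infinity>)"
    using C compact_sets finite_compact by (intro exI[of _ "range C"]) (auto simp: less_top)
qed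

lemma restrict: "A \<in> sets \<nu> \<Longrightarrow> radon_on_open U (density \<nu> (indicator A))"
proof -
  assume A: "A \<in> sets \<nu>"
  obtain Q where "finite_exhaustion (top_of_set U) \<nu> Q" using exhaustion by metis
  then show ?thesis
    by (intro radon_on_open.intro U radon_density_indicator[OF radon _ A])
qed

lemma open_superset:
  assumes "A \<in> sets \<nu>" "\<epsilon> > 0"
  obtains S where "open S" "A \<subseteq> S" "S \<subseteq> U" "emeasure \<nu> (S - A) \<le> ennreal \<epsilon>"
proof -
  obtain Q where "finite_exhaustion (top_of_set U) \<nu> Q" using exhaustion by metis
  then show ?thesis
    using radon_open_superset[OF radon _ assms] that U by (metis openin_open_eq)
qed

text \<open>Inner regularity by complements: from a compact \<open>C k\<close> containing almost all
  of \<open>A\<close>, an open \<open>S\<close> covering \<open>C k - A\<close> with little excess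
  is removed; \<open>C k - S\<close> is compact and lies in \<open>A\<close>.\<close>

lemma compact_subset:
  assumes A: "A \<in> sets \<nu>" "emeasure \<nu> A < \<infinity>" and \<epsilon>: "\<epsilon> > 0"
  obtains K where "compact K" "K \<subseteq> A" "emeasure \<nu> (A - K) \<le> ennreal \<epsilon>"
proof -
  obtain C Q where C: "\<And>k. compact (C k)" "\<And>k. C k \<subseteq> U" "\<And>k. Q k \<subseteq> C k" "\<And>k. open (Q k)"
    "incseq Q" "(\<Union>k. Q k) = U"
    using exhaustion by metis
  have AB: "A \<in> sets borel" "A \<subseteq> U" using A sets_iff by auto
  have Qs: "Q k \<in> sets \<nu>" "C k \<in> sets \<nu>" for k using C by (auto simp: sets_iff intro: borel_compact)
  have "(\<lambda>k. emeasure \<nu> (A - Q k)) \<longlonglongrightarrow> emeasure \<nu> (\<Inter>k. A - Q k)"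
  proof (rule Lim_emeasure_decseq)
    show "decseq (\<lambda>k. A - Q k)" using C(5) by (auto simp: decseq_def incseq_def dest: subsetD)
    have "emeasure \<nu> (A - Q k) \<le> emeasure \<nu> A" for k using A by (intro emeasure_mono) auto
    then show "emeasure \<nu> (A - Q k) \<noteq> \<infinity>" for k using A(2) by (metis infinity_ennreal_def leD)
  qed (use A Qs in auto)
  moreover have "(\<Inter>k. A - Q k) = {}" using AB C(6) by blast
  ultimately have "(\<lambda>k. emeasure \<nu> (A - Q k)) \<longlonglongrightarrow> 0" by (simp only: emeasure_empty)
  then have "\<forall>\<^sub>F k in sequentially. emeasure \<nu> (A - Q k) < ennreal (\<epsilon>/2)"
    using \<epsilon> by (intro order_tendstoD) auto
  then obtain k where k: "emeasure \<nu> (A - Q k) < ennreal (\<epsilon>/2)"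
    using eventually_happens by force
  obtain S where S: "open S" "C k - A \<subseteq> S" "S \<subseteq> U" "emeasure \<nu> (S - (C k - A)) \<le> ennreal (\<epsilon>/2)"
    using open_superset[of "C k - A" "\<epsilon>/2"] A Qs \<epsilon> by auto
  have Ss: "S \<in> sets \<nu>" using S sets_iff by auto
  show ?thesis
  proof (rule that[of "C k - S"])
    show "compact (C k - S)" using C S by (simp add: compact_diff)
    show "C k - S \<subseteq> A" using S by blast
    have "emeasure \<nu> (A - (C k - S)) \<le> emeasure \<nu> ((A - Q k) \<union> (S - (C k - A)))"
      using A(1) Qs Ss C(3)[of k] by (intro emeasure_mono) auto
    also have "\<dots> \<le> emeasure \<nu> (A - Q k) + emeasure \<nu> (S - (C k - A))"
      using A Qs Ss by (intro emeasure_subadditive) auto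
    also have "\<dots> \<le> ennreal (\<epsilon>/2) + ennreal (\<epsilon>/2)"
      using k S(4) by (intro add_mono) auto
    also have "\<dots> = ennreal \<epsilon>" using \<epsilon> by (simp flip: ennreal_plus)
    finally show "emeasure \<nu> (A - (C k - S)) \<le> ennreal \<epsilon>" .
  qed
qed

lemma integrable_compact_support:
  fixes f :: "real^'n \<Rightarrow> 'b::{banach, second_countable_topology}"
  assumes "f \<in> borel_measurable \<nu>" "compact K" "K \<subseteq> U" "\<And>z. z \<in> U \<Longrightarrow> norm (f z) \<le> B"
    "\<And>z. z \<in> U - K \<Longrightarrow> f z = 0"
  shows "integrable \<nu> f"
  using assms finite_compact[OF assms(2,3)] compact_sets[OF assms(2,3)]
  by (intro integrableI_bounded_set[of K _ _ B]) (auto simp: less_top)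

lemma test_field_integrable:
  assumes "g \<in> test_fields U" shows "integrable \<nu> g"
proof -
  obtain B where "\<And>z. norm (g z) \<le> B" using test_field_bounded[OF assms] by metis
  note B = this
  show ?thesis
  proof (rule integrable_compact_support[OF borel_measurable[OF test_field_measurable[OF assms]]
        test_field_compact[OF assms] test_field_subset[OF assms]])
    show "norm (g z) \<le> B" for z by (rule B)
    show "g z = 0" if "z \<in> U - closure {z. g z \<noteq> 0}" for z
      using that test_field_outside[of z g] by simp
  qed
qed

text \<open>A set of finite measure lies between a compact and an open set of nearly equal measure,
  and a cutoff between these approximates its indicator in the mean; sums and limits follow by the
  triangle inequality.\<close>

lemma test_fields_dense:
  fixes f :: "real^'n \<Rightarrow> real^'n"
  assumes "integrable \<nu> f"
  shows "\<And>\<epsilon>. \<epsilon> > 0 \<Longrightarrow> \<exists>g\<in>test_fields U. (LINT z|\<nu>. norm (f z - g z)) < \<epsilon>"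
  using assms
proof (induction rule: integrable_induct)
  case (base A c)
  \<comment> \<open>The error comes to at most \<open>norm c * (2 * \<epsilon>')\<close>; the
    summand 1 covers \<open>c = 0\<close>.\<close>
  define \<epsilon>' where "\<epsilon>' = \<epsilon> / (4 * (1 + norm c))"
  have \<epsilon>': "\<epsilon>' > 0" using base unfolding \<epsilon>'_def by (auto intro!: divide_pos_pos add_pos_nonneg)
  obtain K where K: "compact K" "K \<subseteq> A" "emeasure \<nu> (A - K) \<le> ennreal \<epsilon>'"
    using compact_subset[OF base(1) _ \<epsilon>'] base(2) by auto
  obtain S where S: "open S" "A \<subseteq> S" "S \<subseteq> U" "emeasure \<nu> (S - A) \<le> ennreal \<epsilon>'"
    using open_superset[OF base(1) \<epsilon>'] by auto
  obtain \<theta> :: "real^'n \<Rightarrow> real" and N C where \<theta>: "smooth \<theta>" "\<And>z. 0 \<le> \<theta> z" "\<And>z. \<theta> z \<le> 1"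
    "open N" "K \<subseteq> N" "N \<subseteq> C" "compact C" "C \<subseteq> S" "\<And>z. z \<in> N \<Longrightarrow> \<theta> z = 1" "\<And>z. z \<notin> C \<Longrightarrow> \<theta> z = 0"
    using smooth_cutoff[OF K(1) S(1) order_trans[OF K(2) S(2)]] by blast
  let ?g = "\<lambda>z. \<theta> z *\<^sub>R c"
  have g: "?g \<in> test_fields U"
    using \<theta> S by (intro test_fieldI[of _ C] smooth_scaleR) auto
  have Ks: "K \<in> sets \<nu>" "S \<in> sets \<nu>" using K S base(1) by (auto simp: sets_iff intro: borel_compact)
  have SK: "emeasure \<nu> (S - K) \<le> ennreal (2 * \<epsilon>')"
  proof -
    have "emeasure \<nu> (S - K) \<le> emeasure \<nu> ((S - A) \<union> (A - K))"
      using Ks base(1) by (intro emeasure_mono) auto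
    also have "\<dots> \<le> emeasure \<nu> (S - A) + emeasure \<nu> (A - K)"
      using Ks base(1) by (intro emeasure_subadditive) auto
    also have "\<dots> \<le> ennreal \<epsilon>' + ennreal \<epsilon>'" using K S by (intro add_mono) auto
    finally show ?thesis using \<epsilon>' by (simp flip: ennreal_plus)
  qed
  have le: "norm (indicator A z *\<^sub>R c - ?g z) \<le> norm c * indicator (S - K) z" for z
  proof -
    have "indicator A z *\<^sub>R c - ?g z = (indicator A z - \<theta> z) *\<^sub>R c" by (simp add: scaleR_diff_left)
    moreover have "\<bar>indicator A z - \<theta> z\<bar> \<le> (indicator (S - K) z :: real)"
      using \<theta>(2,3)[of z] \<theta>(5,8,9,10) K(2) S(2)
      by (cases "z \<in> K"; cases "z \<in> S"; cases "z \<in> A") (auto simp: indicator_def)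
    ultimately show ?thesis by (metis mult.commute mult_right_mono norm_ge_zero norm_scaleR real_norm_def)
  qed
  have int: "integrable \<nu> (\<lambda>z. norm c * indicator (S - K) z)"
    using SK Ks by (intro integrable_mult_right integrable_real_indicator) (auto intro: le_less_trans)
  have "(LINT z|\<nu>. norm (indicator A z *\<^sub>R c - ?g z)) \<le> (LINT z|\<nu>. norm c * indicator (S - K) z)"
    using base le int test_field_integrable[OF g]
    by (intro integral_mono integrable_norm Bochner_Integration.integrable_diff) (auto simp: less_top)
  also have "\<dots> = norm c * measure \<nu> (S - K)"
  proof -
    have "(S - K) \<inter> U = S - K" using S(3) by auto
    then show ?thesis by simp
  qed
  also have "\<dots> \<le> norm c * (2 * \<epsilon>')"
    using SK \<epsilon>' by (intro mult_left_mono) (auto simp: measure_def enn2real_leI)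
  also have "\<dots> < \<epsilon>"
  proof -
    have "norm c * 2 * \<epsilon> < \<epsilon> * (4 * (1 + norm c))"
      using base(3) norm_ge_zero[of c] by (smt (verit) mult.commute mult.left_commute mult_pos_pos mult_nonneg_nonneg ring_class.ring_distribs)
    then show ?thesis by (simp add: \<epsilon>'_def divide_simps add_pos_nonneg mult.commute mult.left_commute)
  qed
  finally show ?case using g by (intro bexI[of _ ?g])
next
  case (add f g)
  obtain f' g' where f': "f' \<in> test_fields U" "(LINT z|\<nu>. norm (f z - f' z)) < \<epsilon>/2"
    and g': "g' \<in> test_fields U" "(LINT z|\<nu>. norm (g z - g' z)) < \<epsilon>/2"
    using add.IH[of "\<epsilon>/2"] add.prems by auto
  note int = add.hyps test_field_integrable[OF f'(1)] test_field_integrable[OF g'(1)]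
  have "(LINT z|\<nu>. norm (f z + g z - (f' z + g' z))) \<le> (LINT z|\<nu>. norm (f z - f' z) + norm (g z - g' z))"
    using int by (intro integral_mono) (auto intro!: norm_triangle_le simp: algebra_simps intro: order_trans[OF _ norm_triangle_ineq] order_eq_refl)
  also have "\<dots> = (LINT z|\<nu>. norm (f z - f' z)) + (LINT z|\<nu>. norm (g z - g' z))"
    using int by (intro Bochner_Integration.integral_add) auto
  also have "\<dots> < \<epsilon>" using f' g' by simp
  finally show ?case using test_field_add(1)[OF f'(1) g'(1)] by (intro bexI[of _ "\<lambda>z. f' z + g' z"])
next
  case (lim f s)
  have "(\<lambda>i. LINT z|\<nu>. norm (f z - s i z)) \<longlonglongrightarrow> (LINT z|\<nu>. 0)"
  \<comment> \<open>The induction principle provides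
    \<open>norm (s i z) \<le> 2 * norm (f z)\<close>, hence the factor 3.\<close>
  proof (rule integral_dominated_convergence[where w = "\<lambda>z. 3 * norm (f z)"])
    show "AE z in \<nu>. (\<lambda>i. norm (f z - s i z)) \<longlonglongrightarrow> 0"
    proof (rule AE_I2)
      fix z assume "z \<in> space \<nu>"
      then have "(\<lambda>i. norm (f z - s i z)) \<longlonglongrightarrow> norm (f z - f z)"
        by (intro tendsto_intros lim.hyps(2))
      then show "(\<lambda>i. norm (f z - s i z)) \<longlonglongrightarrow> 0" by simp
    qed
    show "AE z in \<nu>. norm (norm (f z - s i z)) \<le> 3 * norm (f z)" for i
    proof (rule AE_I2)
      fix z assume "z \<in> space \<nu>"
      then show "norm (norm (f z - s i z)) \<le> 3 * norm (f z)"
        using lim.hyps(3)[of z i] norm_triangle_ineq4[of "f z" "s i z"] by simp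
    qed
  qed (use lim.hyps in auto)
  then have "\<forall>\<^sub>F i in sequentially. (LINT z|\<nu>. norm (f z - s i z)) < \<epsilon>/2"
    using lim.prems by (intro order_tendstoD) auto
  then obtain i where i: "(LINT z|\<nu>. norm (f z - s i z)) < \<epsilon>/2" using eventually_happens by force
  obtain g where g: "g \<in> test_fields U" "(LINT z|\<nu>. norm (s i z - g z)) < \<epsilon>/2"
    using lim.IH[of "\<epsilon>/2" i] lim.prems by auto
  note int = lim.hyps(1)[of i] lim.hyps(4) test_field_integrable[OF g(1)]
  have "(LINT z|\<nu>. norm (f z - g z)) \<le> (LINT z|\<nu>. norm (f z - s i z) + norm (s i z - g z))"
    using int by (intro integral_mono) (auto intro: norm_diff_triangle_ineq order_trans[OF _ norm_triangle_ineq])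
  also have "\<dots> = (LINT z|\<nu>. norm (f z - s i z)) + (LINT z|\<nu>. norm (s i z - g z))"
    using int by (intro Bochner_Integration.integral_add) auto
  also have "\<dots> < \<epsilon>" using i g by simp
  finally show ?case using g by blast
qed

lemma measure_eqI_open:
  assumes "sets N = sets \<nu>" "\<And>S. open S \<Longrightarrow> S \<subseteq> U \<Longrightarrow> emeasure \<nu> S = emeasure N S"
  shows "\<nu> = N"
proof -
  obtain Q where Q: "finite_exhaustion (top_of_set U) \<nu> Q" using exhaustion by metis
  have op: "openin (top_of_set U) S \<longleftrightarrow> open S \<and> S \<subseteq> U" for S using U by (rule openin_open_eq)
  show ?thesis
  proof (rule measure_eqI_generator_eq[of "{S. openin (top_of_set U) S}" U _ _ Q])
    show "Int_stable {S. openin (top_of_set U) S}" by (auto simp: Int_stable_def)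
    show "sets \<nu> = sigma_sets U {S. openin (top_of_set U) S}"
      "sets N = sigma_sets U {S. openin (top_of_set U) S}"
      using assms(1) radon_sets[OF radon] sets_borel_on[of "top_of_set U"] by auto
    show "emeasure \<nu> (Q i) \<noteq> \<infinity>" for i using Q by (auto simp: finite_exhaustion_def less_top)
  qed (use assms Q op in \<open>auto simp: finite_exhaustion_def\<close>)
qed

end

section \<open>Duality with test fields\<close>

text \<open>Truncates an approximation of a field of norm 0 or 1 to norm at most 1 without losing smoothness.\<close>

definition squash :: "'a::real_inner \<Rightarrow> 'a" where
  "squash v = (2 * inverse (1 + v \<bullet> v)) *\<^sub>R v"

lemma squash_unit: "norm v = 0 \<or> norm v = 1 \<Longrightarrow> squash v = v"
  by (auto simp: squash_def dot_square_norm)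

lemma norm_squash: "norm (squash v) \<le> 1"
proof -
  have "2 * norm v \<le> 1 + (norm v)\<^sup>2"
    using zero_le_power2[of "norm v - 1"] by (simp add: power2_diff)
  then show ?thesis
    by (simp add: squash_def dot_square_norm divide_inverse[symmetric] divide_le_eq add_pos_nonneg)
qed

text \<open>Over the common denominator the numerator is \<open>v - w\<close> plus a vector of norm
  exactly \<open>norm v * norm w * norm (v - w)\<close>, the identity known from inversion in the
  unit sphere; and \<open>1 + norm v * norm w\<close> is at most the denominator.\<close>

lemma squash_lipschitz: "norm (squash v - squash w) \<le> 2 * norm (v - w)"
proof -
  let ?a = "norm v" and ?b = "norm w"
  let ?D = "(1 + ?a\<^sup>2) * (1 + ?b\<^sup>2)"
  have pos: "1 + ?a\<^sup>2 > 0" "1 + ?b\<^sup>2 > 0" by (auto intro: add_pos_nonneg)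
  have eq: "squash v - squash w = (2 / ?D) *\<^sub>R ((v - w) + (?b\<^sup>2 *\<^sub>R v - ?a\<^sup>2 *\<^sub>R w))"
  proof -
    have 1: "squash v = (2 / ?D) *\<^sub>R ((1 + ?b\<^sup>2) *\<^sub>R v)" "squash w = (2 / ?D) *\<^sub>R ((1 + ?a\<^sup>2) *\<^sub>R w)"
      using pos by (simp_all add: squash_def dot_square_norm divide_inverse)
    show ?thesis unfolding 1 by (simp add: scaleR_diff_right[symmetric] algebra_simps)
  qed
  have "(norm (?b\<^sup>2 *\<^sub>R v - ?a\<^sup>2 *\<^sub>R w))\<^sup>2 = (?a * ?b * norm (v - w))\<^sup>2"
    unfolding power_mult_distrib dot_square_norm[symmetric]
    by (simp add: inner_diff_left inner_diff_right inner_commute algebra_simps power2_eq_square)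
  then have n: "norm (?b\<^sup>2 *\<^sub>R v - ?a\<^sup>2 *\<^sub>R w) = ?a * ?b * norm (v - w)"
    by (rule power2_eq_imp_eq) auto
  have ab: "1 + ?a * ?b \<le> ?D"
  proof -
    have "2 * (?a * ?b) \<le> ?a\<^sup>2 + ?b\<^sup>2" using zero_le_power2[of "?a - ?b"] by (simp add: power2_diff)
    moreover have "?D = 1 + ?a\<^sup>2 + ?b\<^sup>2 + ?a\<^sup>2 * ?b\<^sup>2" by (simp add: algebra_simps)
    moreover have "0 \<le> ?a * ?b" "0 \<le> ?a\<^sup>2 * ?b\<^sup>2" by auto
    ultimately show ?thesis by linarith
  qed
  have "norm (squash v - squash w) \<le> (2 / ?D) * (norm (v - w) + ?a * ?b * norm (v - w))"
  proof -
    have "\<bar>2 / ?D\<bar> = 2 / ?D" using pos by simp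
    then show ?thesis
      unfolding eq norm_scaleR using pos norm_triangle_ineq[of "v - w" "?b\<^sup>2 *\<^sub>R v - ?a\<^sup>2 *\<^sub>R w"]
      by (simp only: n) (intro mult_left_mono, auto)
  qed
  also have "\<dots> = (1 + ?a * ?b) / ?D * (2 * norm (v - w))" by (simp add: algebra_simps)
  also have "\<dots> \<le> 1 * (2 * norm (v - w))"
    using ab pos by (intro mult_right_mono) (auto simp: divide_le_eq)
  finally show ?thesis by simp
qed

lemma test_field_squash:
  assumes "g \<in> test_fields U"
  shows "(\<lambda>z. squash (g z)) \<in> test_fields U" "closure {z. squash (g z) \<noteq> 0} \<subseteq> closure {z. g z \<noteq> 0}"
proof -
  have sm: "smooth g" by (rule test_field_smooth[OF assms])
  have "1 + g z \<bullet> g z > 0" for z by (simp add: add_pos_nonneg)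
  then have "smooth (\<lambda>z. 2 * inverse (1 + g z \<bullet> g z))"
    by (intro smooth_mult smooth_inverse smooth_add smooth_const smooth_inner sm) (simp add: less_le)
  from test_field_scale[OF this assms]
  show "(\<lambda>z. squash (g z)) \<in> test_fields U" "closure {z. squash (g z) \<noteq> 0} \<subseteq> closure {z. g z \<noteq> 0}"
    by (simp_all add: squash_def)
qed

context radon_on_open begin

lemma dual_integrable:
  assumes "g \<in> test_fields U" "\<eta> \<in> borel_measurable \<nu>" "\<And>z. z \<in> U \<Longrightarrow> norm (\<eta> z) \<le> B"
  shows "integrable \<nu> (\<lambda>z. g z \<bullet> \<eta> z)"
proof (rule Bochner_Integration.integrable_bound)
  show "integrable \<nu> (\<lambda>z. B * norm (g z))" using test_field_integrable[OF assms(1)] by auto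
  have "\<bar>g z \<bullet> \<eta> z\<bar> \<le> \<bar>B * norm (g z)\<bar>" if "z \<in> U" for z
    using Cauchy_Schwarz_ineq2[of "g z" "\<eta> z"] assms(3)[OF that] mult_left_mono[of "norm (\<eta> z)" B "norm (g z)"]
    by (simp add: mult.commute)
  then show "AE z in \<nu>. norm (g z \<bullet> \<eta> z) \<le> norm (B * norm (g z))" by auto
  show "(\<lambda>z. g z \<bullet> \<eta> z) \<in> borel_measurable \<nu>"
    using assms(2) borel_measurable[OF test_field_measurable[OF assms(1)]] by auto
qed

text \<open>Integration against \<open>\<eta>\<close> has variation with density
  \<open>norm \<eta>\<close>. From above this is Cauchy-Schwarz. From below, the optimal field
  \<open>sgn \<eta>\<close> on a compact subset of \<open>S\<close> is approximated in the mean by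
  test fields, which are then made admissible without losing the approximation.\<close>

lemma variation_open_density:
  fixes \<eta> :: "real^'n \<Rightarrow> real^'n"
  assumes \<eta>: "\<eta> \<in> borel_measurable \<nu>" and B: "\<And>z. z \<in> U \<Longrightarrow> norm (\<eta> z) \<le> B"
    and S: "open S" "S \<subseteq> U" and T: "\<And>g. g \<in> test_fields U \<Longrightarrow> T g = (LINT z|\<nu>. g z \<bullet> \<eta> z)"
  shows "variation_open U T S = (\<integral>\<^sup>+z. ennreal (norm (\<eta> z)) * indicator S z \<partial>\<nu>)" (is "_ = ?I S")
proof (rule antisym)
  show "variation_open U T S \<le> ?I S"
    unfolding variation_open_def
  proof (rule SUP_least)
    fix g assume "g \<in> {g \<in> test_fields U. closure {z. g z \<noteq> 0} \<subseteq> S \<and> (\<forall>z. norm (g z) \<le> 1)}"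
    then have g: "g \<in> test_fields U" "closure {z. g z \<noteq> 0} \<subseteq> S" "\<And>z. norm (g z) \<le> 1" by auto
    have "ennreal (T g) \<le> ennreal (norm (LINT z|\<nu>. g z \<bullet> \<eta> z))"
      by (simp add: T[OF g(1)] ennreal_leI)
    also have "\<dots> \<le> (\<integral>\<^sup>+z. ennreal (norm (g z \<bullet> \<eta> z)) \<partial>\<nu>)"
      by (rule integral_norm_bound_ennreal[OF dual_integrable[OF g(1) \<eta> B]])
    also have "\<dots> \<le> ?I S"
    proof (rule nn_integral_mono)
      fix z
      have "\<bar>g z \<bullet> \<eta> z\<bar> \<le> 1 * norm (\<eta> z)"
        using Cauchy_Schwarz_ineq2[of "g z" "\<eta> z"] mult_right_mono[OF g(3)[of z] norm_ge_zero[of "\<eta> z"]] by linarith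
      moreover have "z \<notin> S \<Longrightarrow> g z = 0" using g(2) test_field_outside[of z g] by auto
      ultimately show "ennreal (norm (g z \<bullet> \<eta> z)) \<le> ennreal (norm (\<eta> z)) * indicator S z"
        by (cases "z \<in> S") (auto intro!: ennreal_leI)
    qed
    finally show "ennreal (T g) \<le> ?I S" .
  qed
  obtain C where C: "\<And>n. compact (C n)" "\<And>n. C n \<subseteq> S" "\<And>n. C n \<subseteq> interior (C (Suc n))" "(\<Union>n::nat. C n) = S"
    using open_compact_exhaustion[OF S(1)] by metis
  have inc: "incseq C" using C(3) interior_subset by (intro incseq_SucI) blast
  have Cs: "C k \<in> sets \<nu>" for k by (rule compact_sets[OF C(1) order_trans[OF C(2) S(2)]])
  have bd: "0 \<le> B" if "z \<in> U" for z using B[OF that] norm_ge_zero order_trans by blast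
  have "?I (C k) \<le> variation_open U T S" for k
  proof (rule ennreal_le_epsilon)
    fix e :: real assume e: "0 < e"
    \<comment> \<open>At most \<open>2 * \<bar>B\<bar> * \<epsilon>\<close> is lost, the 2 coming
      from \<open>squash_lipschitz\<close>; the added 1 covers \<open>B = 0\<close>.\<close>
    define \<epsilon> where "\<epsilon> = e / (2 * (\<bar>B\<bar> + 1))"
    have \<epsilon>: "\<epsilon> > 0" using e by (simp add: \<epsilon>_def add_nonneg_pos)
    define f where "f z = indicator (C k) z *\<^sub>R sgn (\<eta> z)" for z
    have fm: "f \<in> borel_measurable \<nu>" unfolding f_def using \<eta> Cs by measurable
    have f: "integrable \<nu> f"
      using fm C(1)[of k] C(2)[of k] S
      by (intro integrable_compact_support[of _ "C k" 1]) (auto simp: f_def norm_sgn indicator_def)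
    obtain g0 where g0: "g0 \<in> test_fields U" "(LINT z|\<nu>. norm (f z - g0 z)) < \<epsilon>"
      using test_fields_dense[OF f \<epsilon>] by auto
    obtain \<theta> :: "real^'n \<Rightarrow> real" and N C' where \<theta>: "smooth \<theta>" "\<And>z. 0 \<le> \<theta> z" "\<And>z. \<theta> z \<le> 1"
      "open N" "C k \<subseteq> N" "N \<subseteq> C'" "compact C'" "C' \<subseteq> S" "\<And>z. z \<in> N \<Longrightarrow> \<theta> z = 1" "\<And>z. z \<notin> C' \<Longrightarrow> \<theta> z = 0"
      using smooth_cutoff[OF C(1) S(1) C(2)] by blast
    define g1 where "g1 = (\<lambda>z. \<theta> z *\<^sub>R g0 z)"
    have g1: "g1 \<in> test_fields U" "closure {z. g1 z \<noteq> 0} \<subseteq> C'"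
      unfolding g1_def using \<theta> S test_field_smooth[OF g0(1)]
      by (intro test_fieldI[of _ C'] smooth_scaleR; auto)+
    \<comment> \<open>Cutting off does not spoil the approximation: \<open>f\<close> lives on
      \<open>C k\<close>, where \<open>\<theta>\<close> is 1, so multiplication by
      \<open>\<theta>\<close> leaves \<open>f\<close> unchanged.\<close>
    have f1: "norm (f z - g1 z) \<le> norm (f z - g0 z)" for z
    proof -
      have "f z - g1 z = \<theta> z *\<^sub>R (f z - g0 z)"
        using \<theta>(5,9) by (cases "z \<in> C k") (auto simp: f_def g1_def scaleR_diff_right)
      then show ?thesis using \<theta>(2,3)[of z] by (simp add: mult_left_le_one_le)
    qed
    define g where "g = (\<lambda>z. squash (g1 z))"
    have g: "g \<in> test_fields U" "closure {z. g z \<noteq> 0} \<subseteq> S" "\<And>z. norm (g z) \<le> 1"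
      unfolding g_def using test_field_squash[OF g1(1)] g1(2) \<theta>(8) norm_squash by auto
    \<comment> \<open>\<open>squash\<close> fixes the values of \<open>f\<close>, so its Lipschitz
      bound compares \<open>g\<close> with \<open>f\<close> itself.\<close>
    have "norm (f z) = 0 \<or> norm (f z) = 1" for z by (auto simp: f_def norm_sgn indicator_def)
    then have fg: "norm (f z - g z) \<le> 2 * norm (f z - g0 z)" for z
      using squash_lipschitz[of "f z" "g1 z"] f1[of z] by (simp add: g_def squash_unit)
    have int: "integrable \<nu> (\<lambda>z. f z \<bullet> \<eta> z)"
    proof (rule integrable_compact_support[of _ "C k" "\<bar>B\<bar>"])
      show "norm (f z \<bullet> \<eta> z) \<le> \<bar>B\<bar>" if "z \<in> U" for z
        using B[OF that] by (auto simp: f_def indicator_def sgn_div_norm dot_square_norm power2_eq_square divide_inverse[symmetric])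
      show "(\<lambda>z. f z \<bullet> \<eta> z) \<in> borel_measurable \<nu>" using fm \<eta> by measurable
      show "f z \<bullet> \<eta> z = 0" if "z \<in> U - C k" for z using that by (simp add: f_def)
    qed (use C(1) order_trans[OF C(2) S(2)] in auto)
    have feq: "ennreal (norm (\<eta> z)) * indicator (C k) z = ennreal (f z \<bullet> \<eta> z)" for z
      by (auto simp: f_def indicator_def sgn_div_norm dot_square_norm power2_eq_square divide_inverse[symmetric])
    have "f z \<bullet> \<eta> z \<ge> 0" for z
      by (auto simp: f_def indicator_def sgn_div_norm)
    then have "?I (C k) = ennreal (LINT z|\<nu>. f z \<bullet> \<eta> z)"
      unfolding feq by (intro nn_integral_eq_integral int) auto
    also have "(LINT z|\<nu>. f z \<bullet> \<eta> z) \<le> (LINT z|\<nu>. g z \<bullet> \<eta> z) + e"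
    proof -
      note gi = dual_integrable[OF g(1) \<eta> B]
      have "(LINT z|\<nu>. f z \<bullet> \<eta> z) - (LINT z|\<nu>. g z \<bullet> \<eta> z) = (LINT z|\<nu>. f z \<bullet> \<eta> z - g z \<bullet> \<eta> z)"
        using int gi by simp
      also have "\<dots> \<le> (LINT z|\<nu>. (2 * \<bar>B\<bar>) * norm (f z - g0 z))"
      proof (rule integral_mono)
        show "f z \<bullet> \<eta> z - g z \<bullet> \<eta> z \<le> (2 * \<bar>B\<bar>) * norm (f z - g0 z)" if "z \<in> space \<nu>" for z
        proof -
          have "f z \<bullet> \<eta> z - g z \<bullet> \<eta> z \<le> norm (f z - g z) * norm (\<eta> z)"
            using norm_cauchy_schwarz[of "f z - g z" "\<eta> z"] by (simp add: inner_diff_left)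
          also have "\<dots> \<le> (2 * norm (f z - g0 z)) * \<bar>B\<bar>"
            using fg[of z] B[of z] that by (intro mult_mono) auto
          finally show ?thesis by (simp add: mult_ac)
        qed
      qed (use int gi f g0 test_field_integrable in auto)
      also have "\<dots> = (2 * \<bar>B\<bar>) * (LINT z|\<nu>. norm (f z - g0 z))" by simp
      also have "\<dots> \<le> (2 * (\<bar>B\<bar> + 1)) * \<epsilon>" using g0(2) by (intro mult_mono) auto
      also have "\<dots> = e" by (simp add: \<epsilon>_def)
      finally show ?thesis by simp
    qed
    also have "ennreal ((LINT z|\<nu>. g z \<bullet> \<eta> z) + e) \<le> ennreal (T g) + ennreal e"
      using e by (cases "T g \<ge> 0") (auto simp: T[OF g(1)] ennreal_neg simp flip: ennreal_plus intro!: ennreal_leI)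
    also have "ennreal (T g) \<le> variation_open U T S"
      unfolding variation_open_def using g by (intro SUP_upper) auto
    finally show "?I (C k) \<le> variation_open U T S + ennreal e" by (simp add: ennreal_leI)
  qed
  moreover have "?I S = (SUP k. ?I (C k))"
  proof -
    have "ennreal (norm (\<eta> z)) * indicator S z = (SUP k. ennreal (norm (\<eta> z)) * indicator (C k) z)" for z
    proof (rule antisym)
      show "ennreal (norm (\<eta> z)) * indicator S z \<le> (SUP k. ennreal (norm (\<eta> z)) * indicator (C k) z)"
      proof (cases "z \<in> S")
        case True
        then obtain k where "z \<in> C k" using C(4) by auto
        then show ?thesis using True by (intro SUP_upper2[of k]) auto
      qed simp
      show "(SUP k. ennreal (norm (\<eta> z)) * indicator (C k) z) \<le> ennreal (norm (\<eta> z)) * indicator S z"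
        using C(2) by (intro SUP_least mult_left_mono) (auto split: split_indicator)
    qed
    then have "?I S = (\<integral>\<^sup>+z. (SUP k. ennreal (norm (\<eta> z)) * indicator (C k) z) \<partial>\<nu>)" by simp
    also have "\<dots> = (SUP k. ?I (C k))"
      using Cs \<eta> inc by (intro nn_integral_monotone_convergence_SUP)
        (auto simp: incseq_def le_fun_def intro!: mult_left_mono split: split_indicator)
    finally show ?thesis .
  qed
  ultimately show "?I S \<le> variation_open U T S" by (simp add: SUP_le_iff)
qed

text \<open>The zero functional has variation 0; computed from the field
  \<open>\<eta> - \<eta>'\<close> that variation is the integral of the norm of the
  difference.\<close>

lemma test_field_integral_unique:
  fixes \<eta> \<eta>' :: "real^'n \<Rightarrow> real^'n"
  assumes "\<eta> \<in> borel_measurable \<nu>" "\<eta>' \<in> borel_measurable \<nu>"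
    "\<And>z. z \<in> U \<Longrightarrow> norm (\<eta> z) \<le> B" "\<And>z. z \<in> U \<Longrightarrow> norm (\<eta>' z) \<le> B"
    "\<And>g. g \<in> test_fields U \<Longrightarrow> (LINT z|\<nu>. g z \<bullet> \<eta> z) = (LINT z|\<nu>. g z \<bullet> \<eta>' z)"
  shows "AE z in \<nu>. \<eta> z = \<eta>' z"
proof -
  let ?\<delta> = "\<lambda>z. \<eta> z - \<eta>' z"
  have "variation_open U (\<lambda>g. 0) U = (\<integral>\<^sup>+z. ennreal (norm (?\<delta> z)) * indicator U z \<partial>\<nu>)"
  proof (rule variation_open_density[where B = "2 * B"])
    show "norm (?\<delta> z) \<le> 2 * B" if "z \<in> U" for z
      using assms(3,4)[OF that] norm_triangle_ineq4[of "\<eta> z" "\<eta>' z"] by linarith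
    show "0 = (LINT z|\<nu>. g z \<bullet> ?\<delta> z)" if "g \<in> test_fields U" for g
      using assms(5)[OF that] dual_integrable[OF that assms(1,3)] dual_integrable[OF that assms(2,4)]
      by (simp add: inner_diff_right)
  qed (use assms U in auto)
  moreover have "variation_open U (\<lambda>g. 0) U = 0"
    unfolding variation_open_def by (intro antisym SUP_least) auto
  ultimately have "(\<integral>\<^sup>+z. ennreal (norm (?\<delta> z)) * indicator U z \<partial>\<nu>) = 0" by simp
  then have "AE z in \<nu>. ennreal (norm (?\<delta> z)) * indicator U z = 0"
  proof (subst (asm) nn_integral_0_iff_AE)
    have "U \<in> sets \<nu>" using U by (simp add: sets_iff)
    then show "(\<lambda>z. ennreal (norm (?\<delta> z)) * indicator U z) \<in> borel_measurable \<nu>"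
      using assms(1,2) by measurable
  qed
  moreover have "AE z in \<nu>. z \<in> U" using AE_space[of \<nu>] by simp
  ultimately show ?thesis by eventually_elim auto
qed

end

section \<open>The total variation measure\<close>

text \<open>\<open>ennreal\<close> sends negative numbers to 0, so for arbitrary signs only
  subadditivity survives.\<close>

lemma ennreal_add_le: "ennreal (a + b) \<le> ennreal a + ennreal b"
proof (cases "0 \<le> a \<and> 0 \<le> b")
  case False
  then show ?thesis by (cases "a \<ge> 0") (auto simp: ennreal_neg intro!: ennreal_leI order_trans[OF _ add_increasing])
qed (simp add: ennreal_plus)

text \<open>Only linearity is required here, which already makes the variation a Borel measure;
  local finiteness and regularity enter with \<open>radon_functional\<close>.\<close>

locale field_functional =
  fixes U :: "(real^'n::finite) set" and T :: "(real^'n \<Rightarrow> real^'n) \<Rightarrow> real"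
  assumes U: "open U"
    and T_add: "\<And>f g. f \<in> test_fields U \<Longrightarrow> g \<in> test_fields U \<Longrightarrow> T (\<lambda>z. f z + g z) = T f + T g"
    and T_scale: "\<And>c g. g \<in> test_fields U \<Longrightarrow> T (\<lambda>z. c *\<^sub>R g z) = c * T g"
begin

abbreviation v where "v \<equiv> variation_open U T"

definition outer where "outer A = (INF S\<in>{S. openin (top_of_set U) S \<and> A \<subseteq> S}. v S)"

lemma T_zero: "T (\<lambda>z. 0) = 0"
  using T_scale[OF test_field_zero, of 0] by simp

lemma T_uminus: "g \<in> test_fields U \<Longrightarrow> T (\<lambda>z. - g z) = - T g"
  using T_scale[of g "-1"] by simp

lemma T_diff: "f \<in> test_fields U \<Longrightarrow> g \<in> test_fields U \<Longrightarrow> T (\<lambda>z. f z - g z) = T f - T g"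
  using T_add[of f "\<lambda>z. - g z"] T_uminus[of g] test_field_uminus[of g U] by simp

lemma v_upper:
  assumes "g \<in> test_fields U" "closure {z. g z \<noteq> 0} \<subseteq> S" "\<And>z. norm (g z) \<le> 1"
  shows "ennreal (T g) \<le> v S"
  unfolding variation_open_def using assms by (intro SUP_upper) auto

lemma v_least:
  assumes "\<And>g. g \<in> test_fields U \<Longrightarrow> closure {z. g z \<noteq> 0} \<subseteq> S \<Longrightarrow> (\<And>z. norm (g z) \<le> 1) \<Longrightarrow> ennreal (T g) \<le> c"
  shows "v S \<le> c"
  unfolding variation_open_def using assms by (intro SUP_least) auto

lemma v_mono: "S \<subseteq> S' \<Longrightarrow> v S \<le> v S'"
  by (rule v_least, rule v_upper) auto

lemma v_empty: "v {} = 0"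
proof -
  have "v {} \<le> 0"
  proof (rule v_least)
    fix g :: "real^'n \<Rightarrow> real^'n" assume "closure {z. g z \<noteq> 0} \<subseteq> {}"
    then have "g = (\<lambda>z. 0)" by auto
    then show "ennreal (T g) \<le> 0" by (simp add: T_zero)
  qed
  then show ?thesis by simp
qed

text \<open>A cutoff near \<open>K\<close> and its complement act as a partition of unity. The
  splitting serves both to distribute a field over two open sets and to peel off the part where it
  is large.\<close>

lemma split_field:
  assumes g: "g \<in> test_fields U" and K: "compact K" "K \<subseteq> S" "open S"
  obtains g1 g2 where "g1 \<in> test_fields U" "g2 \<in> test_fields U" "T g = T g1 + T g2"
    "closure {z. g1 z \<noteq> 0} \<subseteq> S" "closure {z. g2 z \<noteq> 0} \<subseteq> closure {z. g z \<noteq> 0} - K"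
    "\<And>z. norm (g1 z) \<le> norm (g z)" "\<And>z. norm (g2 z) \<le> norm (g z)" "\<And>z. z \<in> K \<Longrightarrow> g2 z = 0"
proof -
  obtain \<theta> :: "real^'n \<Rightarrow> real" and N C where \<theta>: "smooth \<theta>" "\<And>z. 0 \<le> \<theta> z" "\<And>z. \<theta> z \<le> 1"
    "open N" "K \<subseteq> N" "N \<subseteq> C" "compact C" "C \<subseteq> S" "\<And>z. z \<in> N \<Longrightarrow> \<theta> z = 1" "\<And>z. z \<notin> C \<Longrightarrow> \<theta> z = 0"
    using smooth_cutoff[OF K(1,3,2)] by blast
  let ?g1 = "\<lambda>z. \<theta> z *\<^sub>R g z" and ?g2 = "\<lambda>z. (1 - \<theta> z) *\<^sub>R g z"
  have g1: "?g1 \<in> test_fields U" by (rule test_field_scale(1)[OF \<theta>(1) g])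
  have sm: "smooth (\<lambda>z. 1 - \<theta> z)" by (intro smooth_diff smooth_const \<theta>(1))
  have g2: "?g2 \<in> test_fields U" by (rule test_field_scale(1)[OF sm g])
  have "g = (\<lambda>z. ?g1 z + ?g2 z)" by (simp add: scaleR_diff_left)
  then have "T g = T ?g1 + T ?g2" using T_add[OF g1 g2] by simp
  moreover have "closure {z. ?g1 z \<noteq> 0} \<subseteq> C"
    using \<theta>(10) by (intro closure_minimal compact_imp_closed \<theta>(7)) auto
  moreover have "closure {z. ?g2 z \<noteq> 0} \<subseteq> - N"
    using \<theta>(4,9) by (intro closure_minimal) auto
  moreover have "closure {z. ?g2 z \<noteq> 0} \<subseteq> closure {z. g z \<noteq> 0}"
    by (rule test_field_scale(2)[OF sm g])
  ultimately show ?thesis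
    using that[of ?g1 ?g2] g1 g2 \<theta> by (simp add: mult_left_le_one_le) blast
qed

lemma v_Un:
  assumes "open S" "open S'" shows "v (S \<union> S') \<le> v S + v S'"
proof (rule v_least)
  fix g assume g: "g \<in> test_fields U" "closure {z. g z \<noteq> 0} \<subseteq> S \<union> S'" "\<And>z. norm (g z) \<le> 1"
  \<comment> \<open>The part of the support outside \<open>S'\<close> is compact and lies in
    \<open>S\<close>; once it is cut off, the rest of the field is supported in
    \<open>S'\<close>.\<close>
  let ?K = "closure {z. g z \<noteq> 0} - S'"
  have K: "compact ?K" "?K \<subseteq> S"
    using compact_diff[OF test_field_compact[OF g(1)] assms(2)] g(2) by auto
  obtain g1 g2 where *: "g1 \<in> test_fields U" "g2 \<in> test_fields U" "T g = T g1 + T g2"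
    "closure {z. g1 z \<noteq> 0} \<subseteq> S" "closure {z. g2 z \<noteq> 0} \<subseteq> closure {z. g z \<noteq> 0} - ?K"
    "\<And>z. norm (g1 z) \<le> norm (g z)" "\<And>z. norm (g2 z) \<le> norm (g z)"
    using split_field[OF g(1) K assms(1)] by metis
  have "ennreal (T g) \<le> ennreal (T g1) + ennreal (T g2)"
    by (simp add: *(3) ennreal_add_le)
  also have "\<dots> \<le> v S + v S'"
    using * order_trans[OF *(6) g(3)] order_trans[OF *(7) g(3)] by (intro add_mono v_upper) auto
  finally show "ennreal (T g) \<le> v S + v S'" .
qed

lemma v_UN:
  fixes S :: "nat \<Rightarrow> (real^'n) set"
  assumes "\<And>j. open (S j)" shows "v (\<Union>j. S j) \<le> (\<Sum>j. v (S j))"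
proof (rule v_least)
  have fin: "v (\<Union>j<n. S j) \<le> (\<Sum>j<n. v (S j))" for n
  proof (induction n)
    case (Suc n)
    have "v (\<Union>j<Suc n. S j) \<le> v (\<Union>j<n. S j) + v (S n)"
      using v_Un[of "\<Union>j<n. S j" "S n"] assms by (simp add: lessThan_Suc Un_commute open_UN)
    with Suc show ?case by (auto intro: order_trans add_right_mono)
  qed (simp add: v_empty)
  fix g assume g: "g \<in> test_fields U" "closure {z. g z \<noteq> 0} \<subseteq> (\<Union>j. S j)" "\<And>z. norm (g z) \<le> 1"
  obtain I where I: "finite I" "closure {z. g z \<noteq> 0} \<subseteq> (\<Union>j\<in>I. S j)"
    using compactE_image[OF test_field_compact[OF g(1)], of UNIV S] assms g(2) by metis
  obtain n where "I \<subseteq> {..<n}" using finite_nat_iff_bounded I(1) by auto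
  then have "closure {z. g z \<noteq> 0} \<subseteq> (\<Union>j<n. S j)" using I(2) by blast
  then have "ennreal (T g) \<le> v (\<Union>j<n. S j)" using g by (intro v_upper) auto
  also have "\<dots> \<le> (\<Sum>j<n. v (S j))" by (rule fin)
  also have "\<dots> \<le> (\<Sum>j. v (S j))" by (intro sum_le_suminf) auto
  finally show "ennreal (T g) \<le> (\<Sum>j. v (S j))" .
qed

text \<open>For a field supported in \<open>S \<inter> Q\<close>, the complement of its support in
  \<open>S\<close> is an open set containing \<open>S - Q\<close>, and fields with disjoint supports
  add without exceeding norm 1. This is the nontrivial half of Caratheodory's condition for
  \<open>Q\<close>, tested on open sets.\<close>

lemma v_disjoint:
  assumes S: "open S" "S \<subseteq> U" and Q: "open Q"
  shows "v (S \<inter> Q) + outer (S - Q) \<le> v S"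
proof -
  let ?G = "{g \<in> test_fields U. closure {z. g z \<noteq> 0} \<subseteq> S \<inter> Q \<and> (\<forall>z. norm (g z) \<le> 1)}"
  have "(\<lambda>z. 0) \<in> ?G" using test_field_zero by simp
  then have ne: "?G \<noteq> {}" by blast
  have "ennreal (T g) + outer (S - Q) \<le> v S" if gG: "g \<in> ?G" for g
  proof -
    \<comment> \<open>The sign matters because \<open>ennreal\<close> is additive only on
      nonnegative numbers; a field with negative value is replaced by the zero field, which has the
      same \<open>ennreal\<close> value.\<close>
    have *: "ennreal (T g) + outer (S - Q) \<le> v S" if g: "g \<in> ?G" and pos: "0 \<le> T g" for g
    proof -
      let ?S' = "S - closure {z. g z \<noteq> 0}"
      let ?H = "{h \<in> test_fields U. closure {z. h z \<noteq> 0} \<subseteq> ?S' \<and> (\<forall>z. norm (h z) \<le> 1)}"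
      have "outer (S - Q) \<le> v ?S'"
        unfolding outer_def using S g U by (intro INF_lower) (auto simp: openin_open_eq open_Diff)
      then have "ennreal (T g) + outer (S - Q) \<le> ennreal (T g) + (SUP h\<in>?H. ennreal (T h))"
        unfolding variation_open_def by (rule add_left_mono)
      also have "\<dots> = (SUP h\<in>?H. ennreal (T g) + ennreal (T h))"
      proof (rule ennreal_SUP_add_right)
        have "(\<lambda>z. 0) \<in> ?H" using test_field_zero by simp
        then show "?H \<noteq> {}" by blast
      qed
      also have "\<dots> \<le> v S"
      proof (rule SUP_least)
        fix h assume h: "h \<in> ?H"
        define h' where "h' = (if T h \<ge> 0 then h else (\<lambda>z. 0))"
        have h': "h' \<in> test_fields U" "closure {z. h' z \<noteq> 0} \<subseteq> ?S'" "\<And>z. norm (h' z) \<le> 1" "0 \<le> T h'"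
          "ennreal (T h) = ennreal (T h')"
          using h test_field_zero by (auto simp: h'_def T_zero ennreal_neg)
        have gt: "g \<in> test_fields U" using g by auto
        have "ennreal (T g) + ennreal (T h) = ennreal (T (\<lambda>z. g z + h' z))"
          using pos h' gt by (simp add: T_add ennreal_plus)
        also have "\<dots> \<le> v S"
        proof (rule v_upper)
          show "(\<lambda>z. g z + h' z) \<in> test_fields U" by (rule test_field_add(1)[OF gt h'(1)])
          show "closure {z. g z + h' z \<noteq> 0} \<subseteq> S"
            using test_field_add(2)[OF gt h'(1)] h'(2) g by blast
          show "norm (g z + h' z) \<le> 1" for z
          proof (cases "z \<in> closure {z. g z \<noteq> 0}")
            case True
            then have "h' z = 0" using h'(2) test_field_outside[of z h'] by auto
            then show ?thesis using g by simp
          next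
            case False
            then have "g z = 0" by (rule test_field_outside)
            then show ?thesis using h' by simp
          qed
        qed
        finally show "ennreal (T g) + ennreal (T h) \<le> v S" .
      qed
      finally show ?thesis .
    qed
    show ?thesis
    proof (cases "0 \<le> T g")
      case True
      then show ?thesis using *[of g] gG by blast
    next
      case False
      have "(\<lambda>z. 0) \<in> ?G" using test_field_zero by auto
      from *[OF this] False show ?thesis by (simp add: T_zero ennreal_neg)
    qed
  qed
  then have "(SUP g\<in>?G. ennreal (T g) + outer (S - Q)) \<le> v S" by (intro SUP_least)
  then show ?thesis
    using ennreal_SUP_add_left[OF ne, of "\<lambda>g. ennreal (T g)"] by (simp add: variation_open_def)
qed

section \<open>The variation as an outer measure and its restriction to Borel sets\<close>

lemma outer_open: "open S \<Longrightarrow> S \<subseteq> U \<Longrightarrow> outer S = v S"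
  unfolding outer_def using U
  by (intro antisym INF_lower INF_greatest v_mono) (auto simp: openin_open_eq)

lemma outer_upper: "open S \<Longrightarrow> S \<subseteq> U \<Longrightarrow> A \<subseteq> S \<Longrightarrow> outer A \<le> v S"
  unfolding outer_def using U by (intro INF_lower) (auto simp: openin_open_eq)

lemma outer_mono: "A \<subseteq> B \<Longrightarrow> outer A \<le> outer B"
  unfolding outer_def by (intro INF_superset_mono) auto

lemma outer_near:
  assumes "outer A < \<infinity>" "e > 0"
  shows "\<exists>S. open S \<and> S \<subseteq> U \<and> A \<subseteq> S \<and> v S \<le> outer A + ennreal e"
proof -
  have "outer A < outer A + ennreal e"
    using assms by (cases "outer A") (auto simp: ennreal_less_iff simp flip: ennreal_plus)
  then have "\<exists>S\<in>{S. openin (top_of_set U) S \<and> A \<subseteq> S}. v S < outer A + ennreal e"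
    by (subst (asm) (1) outer_def) (simp only: INF_less_iff)
  then show ?thesis using U by (auto simp: openin_open_eq intro: less_imp_le)
qed

lemma outer_subadditive:
  fixes A :: "nat \<Rightarrow> (real^'n) set"
  shows "outer (\<Union>j. A j) \<le> (\<Sum>j. outer (A j))"
proof (cases "\<forall>j. outer (A j) < \<infinity>")
  case True
  show ?thesis
  proof (rule ennreal_le_epsilon)
    fix e :: real assume e: "0 < e"
    have "\<exists>S. open S \<and> S \<subseteq> U \<and> A j \<subseteq> S \<and> v S \<le> outer (A j) + ennreal (e * (1/2) ^ Suc j)" for j
      using True e by (intro outer_near) auto
    then obtain S where S: "\<And>j. open (S j)" "\<And>j. S j \<subseteq> U" "\<And>j. A j \<subseteq> S j"
        "\<And>j. v (S j) \<le> outer (A j) + ennreal (e * (1/2) ^ Suc j)"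
      by metis
    have "outer (\<Union>j. A j) \<le> v (\<Union>j. S j)"
    proof (rule outer_upper)
      show "(\<Union>j. A j) \<subseteq> (\<Union>j. S j)" by (rule UN_mono[OF order.refl S(3)])
    qed (use S(1,2) in auto)
    also have "\<dots> \<le> (\<Sum>j. v (S j))" by (rule v_UN[OF S(1)])
    also have "\<dots> \<le> (\<Sum>j. outer (A j) + ennreal (e * (1/2) ^ Suc j))"
      by (intro suminf_le S(4)) auto
    also have "\<dots> = (\<Sum>j. outer (A j)) + (\<Sum>j. ennreal (e * (1/2) ^ Suc j))"
      by (intro suminf_add[symmetric]) auto
    also have "(\<Sum>j. ennreal (e * (1/2) ^ Suc j)) = ennreal e"
    proof -
      have "(\<lambda>k. e * (1/2) ^ Suc k) sums (e * 1)" by (intro sums_mult power_half_series)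
      then show ?thesis using e by (intro suminf_ennreal_eq) auto
    qed
    finally show "outer (\<Union>j. A j) \<le> (\<Sum>j. outer (A j)) + ennreal e" .
  qed
next
  case False
  then obtain j where "outer (A j) = \<infinity>" by (auto simp: not_less top_unique)
  moreover have "outer (A j) \<le> (\<Sum>j. outer (A j))"
    using sum_le_suminf[of "\<lambda>j. outer (A j)" "{j}"] by simp
  ultimately show ?thesis by (simp add: top_unique)
qed

lemma outer_empty: "outer {} = 0"
  using outer_open[of "{}"] v_empty by simp

lemma outer_measure: "outer_measure_space (Pow U) outer"
  unfolding outer_measure_space_def positive_def increasing_def countably_subadditive_def
  using outer_empty outer_mono outer_subadditive by auto

lemma outer_Un: "outer (A \<union> B) \<le> outer A + outer B"
proof -
  interpret sigma_algebra UNIV "Pow UNIV :: (real^'n) set set" by (rule sigma_algebra_Pow)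
  have "countably_subadditive (Pow UNIV) outer"
    unfolding countably_subadditive_def using outer_subadditive by auto
  then have "subadditive (Pow UNIV) outer"
    by (rule countably_subadditive_subadditive[rotated]) (simp add: positive_def outer_empty)
  moreover have "A \<union> B = A \<union> (B - A)" by auto
  ultimately have "outer (A \<union> B) \<le> outer A + outer (B - A)"
    unfolding subadditive_def by (metis Diff_disjoint PowI top_greatest)
  also have "\<dots> \<le> outer A + outer B" by (intro add_left_mono outer_mono) auto
  finally show ?thesis .
qed

text \<open>The infimum defining \<open>outer X\<close> reduces the condition to open test sets,
  where it is \<open>v_disjoint\<close>.\<close>

lemma open_lambda_system:
  assumes Q: "open Q" "Q \<subseteq> U"
  shows "Q \<in> lambda_system U (Pow U) outer"
  unfolding lambda_system_def
proof (intro CollectI conjI ballI)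
  show "Q \<in> Pow U" using Q by auto
  fix X assume "X \<in> Pow U"
  have X: "X = Q \<inter> X \<union> (U - Q) \<inter> X" using \<open>X \<in> Pow U\<close> by auto
  show "outer (Q \<inter> X) + outer ((U - Q) \<inter> X) = outer X"
  proof (rule antisym)
    show "outer X \<le> outer (Q \<inter> X) + outer ((U - Q) \<inter> X)"
      using outer_Un[of "Q \<inter> X" "(U - Q) \<inter> X"] X by simp
    show "outer (Q \<inter> X) + outer ((U - Q) \<inter> X) \<le> outer X"
      unfolding outer_def[of X]
    proof (rule INF_greatest)
      fix S assume "S \<in> {S. openin (top_of_set U) S \<and> X \<subseteq> S}"
      then have S: "open S" "S \<subseteq> U" "X \<subseteq> S" using U by (auto simp: openin_open_eq)
      have "outer (Q \<inter> X) + outer ((U - Q) \<inter> X) \<le> v (S \<inter> Q) + outer (S - Q)"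
        using S Q by (intro add_mono outer_upper outer_mono) auto
      also have "\<dots> \<le> v S" by (rule v_disjoint[OF S(1,2) Q(1)])
      finally show "outer (Q \<inter> X) + outer ((U - Q) \<inter> X) \<le> v S" .
    qed
  qed
qed

text \<open>Caratheodory's sigma-algebra contains the open sets and hence the Borel sets. This is
  what keeps \<open>measure_of\<close> in \<open>total_variation\<close> from falling back to the
  zero measure.\<close>

lemma outer_measure_space: "measure_space U (sets (restrict_space borel U)) outer"
proof -
  interpret P: sigma_algebra U "Pow U" by (rule sigma_algebra_Pow)
  let ?L = "lambda_system U (Pow U) outer"
  have L: "measure_space U ?L outer" by (rule P.caratheodory_lemma[OF outer_measure])
  then have sa: "sigma_algebra U ?L" by (simp add: measure_space_def)
  have "sigma_sets U {S. openin (top_of_set U) S} \<subseteq> ?L"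
    using open_lambda_system U by (intro sigma_algebra.sigma_sets_subset[OF sa]) (auto simp: openin_open_eq)
  then have sub: "sets (restrict_space borel U) \<subseteq> ?L"
    using sets_borel_on_open[OF U] sets_borel_on[of "top_of_set U"] by simp
  have "sigma_algebra U (sets (restrict_space borel U))"
    using sets.sigma_algebra_axioms[of "restrict_space borel U"] U by (simp add: space_restrict_space)
  then show ?thesis
    using L sub unfolding measure_space_def positive_def countably_additive_def
    by (meson order_trans subsetD)
qed

lemma total_variation_eq: "total_variation U T = measure_of U (sets (restrict_space borel U)) outer"
  by (simp add: total_variation_def outer_def[abs_def])

lemma sets_total_variation: "sets (total_variation U T) = sets (restrict_space borel U)"
proof -
  have "sigma_algebra U (sets (restrict_space borel U))"
    using outer_measure_space by (simp add: measure_space_def)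
  then show "sets (total_variation U T) = sets (restrict_space borel U)"
    unfolding total_variation_eq by (rule sigma_algebra.sets_measure_of_eq)
qed

lemma emeasure_total_variation:
  assumes "A \<in> sets (restrict_space borel U)"
  shows "emeasure (total_variation U T) A = outer A"
  using assms outer_measure_space sets_total_variation
  by (intro emeasure_measure_of[OF total_variation_eq]) (auto simp: measure_space_def sets_restrict_borel_iff[OF U])

lemma emeasure_total_variation_open:
  "open S \<Longrightarrow> S \<subseteq> U \<Longrightarrow> emeasure (total_variation U T) S = v S"
  using U by (simp add: emeasure_total_variation sets_restrict_borel_iff outer_open)

end

text \<open>On open sets the variation is the integral of \<open>norm \<eta>\<close>, here the
  indicator of \<open>A\<close>, and a Radon measure is determined by its values there. Proper
  subsets \<open>A\<close> arise from restrictions of varifolds.\<close>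

lemma total_variation_density:
  assumes "radon_on_open U \<nu>" "field_functional U T"
    and \<eta>: "\<eta> \<in> borel_measurable \<nu>" "\<And>z. z \<in> U \<Longrightarrow> norm (\<eta> z) \<le> 1" and A: "A \<in> sets \<nu>"
    and AE: "AE z in \<nu>. norm (\<eta> z) = indicator A z"
    and T: "\<And>g. g \<in> test_fields U \<Longrightarrow> T g = (LINT z|\<nu>. g z \<bullet> \<eta> z)"
  shows "total_variation U T = density \<nu> (indicator A)"
proof -
  interpret radon_on_open U \<nu> by fact
  interpret T: field_functional U T by fact
  interpret D: radon_on_open U "density \<nu> (indicator A)" by (rule restrict[OF A])
  have "density \<nu> (indicator A) = total_variation U T"
  proof (rule D.measure_eqI_open)
    show "sets (total_variation U T) = sets (density \<nu> (indicator A))"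
      by (simp add: T.sets_total_variation sets_eq)
    fix S assume S: "open S" "S \<subseteq> U"
    then have Ss: "S \<in> sets \<nu>" by (simp add: sets_iff)
    have "emeasure (total_variation U T) S = (\<integral>\<^sup>+z. ennreal (norm (\<eta> z)) * indicator S z \<partial>\<nu>)"
      unfolding T.emeasure_total_variation_open[OF S]
      by (rule variation_open_density[OF \<eta> S T])
    also have "\<dots> = (\<integral>\<^sup>+z. indicator A z * indicator S z \<partial>\<nu>)"
      using AE by (intro nn_integral_cong_AE) (auto elim!: eventually_mono split: split_indicator)
    also have "\<dots> = emeasure (density \<nu> (indicator A)) S"
      using A Ss by (simp add: emeasure_density)
    finally show "emeasure (density \<nu> (indicator A)) S = emeasure (total_variation U T) S" by simp
  qed
  then show ?thesis by simp
qed

section \<open>Representation of functionals of bounded variation\<close>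

locale radon_functional = field_functional U T for U :: "(real^'n::finite) set" and T +
  assumes radon_T: "radon_measure (top_of_set U) (total_variation U T)"
begin

abbreviation \<nu> where "\<nu> \<equiv> total_variation U T"

sublocale radon_on_open U \<nu>
  by (rule radon_on_open.intro[OF U radon_T])

lemma T_le_measure:
  assumes g: "g \<in> test_fields U" "closure {z. g z \<noteq> 0} \<subseteq> S" "\<And>z. norm (g z) \<le> M" "M > 0"
    and S: "open S" "S \<subseteq> U" "emeasure \<nu> S < \<infinity>"
  shows "T g \<le> M * measure \<nu> S"
proof -
  let ?h = "\<lambda>z. inverse M *\<^sub>R g z"
  have h: "?h \<in> test_fields U" "closure {z. ?h z \<noteq> 0} \<subseteq> closure {z. g z \<noteq> 0}"
    by (rule test_field_scale[OF smooth_const g(1)])+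
  have "norm (?h z) \<le> 1" for z using g(3)[of z] g(4) by (simp add: field_simps)
  then have "ennreal (T ?h) \<le> v S" using h g(2) by (intro v_upper) auto
  also have "v S = emeasure \<nu> S" using S by (simp add: emeasure_total_variation_open)
  also have "\<dots> = ennreal (measure \<nu> S)" using S(3) by (simp add: emeasure_eq_ennreal_measure less_top)
  finally have "inverse M * T g \<le> measure \<nu> S"
    by (simp add: ennreal_le_iff T_scale[OF g(1)])
  then show ?thesis using g(4) by (simp add: field_simps)
qed

lemma layer_integrable:
  assumes that: "h \<in> test_fields U" "0 \<le> c"
  shows "integrable \<nu> (\<lambda>z. min (8 * norm (h z)) c)"
proof (rule Bochner_Integration.integrable_bound)
  show 1: "integrable \<nu> (\<lambda>z. 8 * norm (h z))"
    by (rule integrable_mult_right[OF integrable_norm[OF test_field_integrable[OF that(1)]]])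
  show "(\<lambda>z. min (8 * norm (h z)) c) \<in> borel_measurable \<nu>"
    using borel_measurable_integrable[OF 1] by measurable
  show "AE z in \<nu>. norm (min (8 * norm (h z)) c) \<le> norm (8 * norm (h z))"
    using that(2) by (intro AE_I2) (simp add: min_def)
qed

text \<open>
  The layers of \<^term>\<open>g\<close> where its norm is about \<open>M / 2 ^ j\<close> are cut off successively.
\<close>

lemma T_le_layers:
  assumes S: "open S" "S \<subseteq> U" "emeasure \<nu> S < \<infinity>"
  shows "g \<in> test_fields U \<Longrightarrow> closure {z. g z \<noteq> 0} \<subseteq> S \<Longrightarrow> (\<And>z. norm (g z) \<le> M) \<Longrightarrow> M > 0 \<Longrightarrow>
    T g \<le> (LINT z|\<nu>. min (8 * norm (g z)) (2 * M)) + M / 2 ^ N * measure \<nu> S"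
proof (induction N arbitrary: g M)
  case 0
  have "T g \<le> M * measure \<nu> S" using 0 S by (intro T_le_measure) auto
  moreover have "0 \<le> (LINT z|\<nu>. min (8 * norm (g z)) (2 * M))"
    using 0 by (intro integral_nonneg_AE) auto
  ultimately show ?case by simp
next
  case (Suc N)
  note g = Suc.prems(1)
  have cont: "continuous_on UNIV (\<lambda>z. norm (g z))"
    by (intro continuous_on_norm smooth_continuous_on test_field_smooth[OF g])
  let ?C = "{z. M / 2 \<le> norm (g z)}" and ?S = "{z \<in> S. M / 4 < norm (g z)}"
  have CC: "?C \<subseteq> closure {z. g z \<noteq> 0}"
    using Suc.prems(4) by (intro order_trans[OF _ closure_subset]) auto
  have "closed ?C" by (intro closed_Collect_le continuous_on_const cont)
  then have cC: "compact ?C"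
    using CC test_field_compact[OF g] by (metis compact_Int_closed inf.absorb_iff2)
  have CS: "?C \<subseteq> ?S" using CC Suc.prems(2,4) by auto
  have oS: "open ?S"
    using S(1) open_Collect_less[OF continuous_on_const[of UNIV "M/4"] cont] by (auto simp: Collect_conj_eq intro: open_Int)
  \<comment> \<open>\<open>g1\<close> carries the part where the norm of \<open>g\<close> is at
    least \<open>M / 2\<close>, with support where it exceeds \<open>M / 4\<close>; the rest has
    norm at most \<open>M / 2\<close> and is left to the induction hypothesis.\<close>
  obtain g1 g2 where *: "g1 \<in> test_fields U" "g2 \<in> test_fields U" "T g = T g1 + T g2"
    "closure {z. g1 z \<noteq> 0} \<subseteq> ?S" "closure {z. g2 z \<noteq> 0} \<subseteq> closure {z. g z \<noteq> 0} - ?C"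
    "\<And>z. norm (g1 z) \<le> norm (g z)" "\<And>z. norm (g2 z) \<le> norm (g z)" "\<And>z. z \<in> ?C \<Longrightarrow> g2 z = 0"
    by (rule split_field[OF g cC CS oS]) (rule that)
  have SU: "?S \<subseteq> U" "?S \<in> sets \<nu>" "S \<in> sets \<nu>" using S oS by (auto simp: sets_iff)
  have "emeasure \<nu> ?S \<le> emeasure \<nu> S" by (rule emeasure_mono[OF _ SU(3)]) auto
  then have finS: "emeasure \<nu> ?S < \<infinity>" using S(3) by (auto elim: le_less_trans)
  have "T g1 \<le> M * measure \<nu> ?S"
    by (rule T_le_measure[OF *(1,4) order_trans[OF *(6) Suc.prems(3)] Suc.prems(4) oS SU(1) finS])
  moreover have "T g2 \<le> (LINT z|\<nu>. min (8 * norm (g2 z)) (2 * (M/2))) + (M/2) / 2 ^ N * measure \<nu> S"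
  proof (rule Suc.IH[OF *(2)])
    show "closure {z. g2 z \<noteq> 0} \<subseteq> S" using *(5) Suc.prems(2) by auto
    show "norm (g2 z) \<le> M / 2" for z
      using *(7)[of z] *(8)[of z] Suc.prems(4) by (cases "z \<in> ?C") auto
  qed (use Suc.prems(4) in auto)
  moreover have "M * measure \<nu> ?S + (LINT z|\<nu>. min (8 * norm (g2 z)) M) \<le> (LINT z|\<nu>. min (8 * norm (g z)) (2 * M))"
  proof -
    have i1: "integrable \<nu> (\<lambda>z. M * indicator ?S z)"
      using finS SU by (intro integrable_mult_right integrable_real_indicator) auto
    have "M * measure \<nu> ?S = (LINT z|\<nu>. M * indicator ?S z)"
      using SU by (simp add: Int_absorb2)
    then have "M * measure \<nu> ?S + (LINT z|\<nu>. min (8 * norm (g2 z)) M)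
        = (LINT z|\<nu>. M * indicator ?S z + min (8 * norm (g2 z)) M)"
      using i1 layer_integrable[OF *(2)] Suc.prems(4) by (subst Bochner_Integration.integral_add) auto
    also have "\<dots> \<le> (LINT z|\<nu>. min (8 * norm (g z)) (2 * M))"
    proof (rule integral_mono)
      \<comment> \<open>Where \<open>norm (g z) > M / 4\<close> the right side is
        \<open>2 * M\<close>, room for both summands; elsewhere the indicator is 0 and
        \<open>norm (g2 z) \<le> norm (g z)\<close>. This fixes the constant 8.\<close>
      show "M * indicator ?S z + min (8 * norm (g2 z)) M \<le> min (8 * norm (g z)) (2 * M)" for z
        using *(7)[of z] Suc.prems(4) by (auto simp: indicator_def min_def)
    qed (use i1 layer_integrable[OF *(2)] layer_integrable[OF g] Suc.prems(4) in auto)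
    finally show ?thesis .
  qed
  ultimately show ?case using *(3) by simp
qed

text \<open>The remainder, \<open>M / 2 ^ k\<close> times a finite measure, disappears in the limit.
  The factor 8 is not sharp; for extending \<open>T\<close> only continuity in the mean
  matters.\<close>

lemma T_bound:
  assumes g: "g \<in> test_fields U"
  shows "\<bar>T g\<bar> \<le> 8 * (LINT z|\<nu>. norm (g z))"
proof -
  have *: "T g \<le> 8 * (LINT z|\<nu>. norm (g z))" if g: "g \<in> test_fields U" for g
  proof -
    obtain M where M: "M > 0" "\<And>z. norm (g z) \<le> M" using test_field_bounded[OF g] by metis
    obtain \<theta> :: "real^'n \<Rightarrow> real" and N C where \<theta>:
      "open N" "closure {z. g z \<noteq> 0} \<subseteq> N" "N \<subseteq> C" "compact C" "C \<subseteq> U"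
      using smooth_cutoff[OF test_field_compact[OF g] U test_field_subset[OF g]] by metis
    have Ns: "N \<subseteq> U" "C \<in> sets \<nu>" using \<theta> compact_sets by auto
    have "emeasure \<nu> N \<le> emeasure \<nu> C" by (rule emeasure_mono[OF \<theta>(3) Ns(2)])
    then have fN: "emeasure \<nu> N < \<infinity>" using finite_compact[OF \<theta>(4,5)] by (rule le_less_trans)
    have "(LINT z|\<nu>. min (8 * norm (g z)) (2 * M)) \<le> (LINT z|\<nu>. 8 * norm (g z))"
      using M(1) by (intro integral_mono layer_integrable integrable_mult_right integrable_norm
          test_field_integrable g) auto
    then have "T g \<le> 8 * (LINT z|\<nu>. norm (g z)) + M / 2 ^ k * measure \<nu> N" for k
      using T_le_layers[OF \<theta>(1) Ns(1) fN g \<theta>(2) M(2,1), of k] by simp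
    moreover have "(\<lambda>k. 8 * (LINT z|\<nu>. norm (g z)) + M / 2 ^ k * measure \<nu> N)
        \<longlonglongrightarrow> 8 * (LINT z|\<nu>. norm (g z)) + M * 0 * measure \<nu> N"
      unfolding divide_inverse power_inverse[symmetric] by (intro tendsto_intros LIMSEQ_power_zero) auto
    ultimately show ?thesis by (intro LIMSEQ_le_const) auto
  qed
  have "- T g \<le> 8 * (LINT z|\<nu>. norm (g z))"
    using *[OF test_field_uminus[OF g]] T_uminus[OF g] by simp
  with *[OF g] show ?thesis by linarith
qed

text \<open>The condition characterizes the limit of \<^term>\<open>T\<close> along test fields converging to \<^term>\<open>f\<close> in mean.\<close>

definition ext :: "(real^'n \<Rightarrow> real^'n) \<Rightarrow> real" where
  "ext f = (SOME l. \<forall>g\<in>test_fields U. \<bar>T g - l\<bar> \<le> 8 * (LINT z|\<nu>. norm (f z - g z)))"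

lemma integral_norm_triangle:
  fixes f g h :: "real^'n \<Rightarrow> real^'n"
  assumes "integrable \<nu> f" "integrable \<nu> g" "integrable \<nu> h"
  shows "(LINT z|\<nu>. norm (f z - h z)) \<le> (LINT z|\<nu>. norm (f z - g z)) + (LINT z|\<nu>. norm (g z - h z))"
proof -
  have "(LINT z|\<nu>. norm (f z - h z)) \<le> (LINT z|\<nu>. norm (f z - g z) + norm (g z - h z))"
    using assms norm_triangle_ineq[of "f z - g z" "g z - h z" for z] by (intro integral_mono) auto
  then show ?thesis using assms by simp
qed

text \<open>The values of \<open>T\<close> along an approximating sequence are Cauchy by
  \<open>T_bound\<close>, and their limit meets the condition in \<open>ext\<close>, so the choice
  is not vacuous.\<close>

lemma ext_near:
  assumes f: "integrable \<nu> f" and g: "g \<in> test_fields U"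
  shows "\<bar>T g - ext f\<bar> \<le> 8 * (LINT z|\<nu>. norm (f z - g z))"
proof -
  have "\<exists>g\<in>test_fields U. (LINT z|\<nu>. norm (f z - g z)) < inverse (real (Suc k))" for k
    by (rule test_fields_dense[OF f]) simp
  then obtain G where G: "\<And>k. G k \<in> test_fields U" "\<And>k. (LINT z|\<nu>. norm (f z - G k z)) < inverse (real (Suc k))"
    by metis
  have dist: "\<bar>T g - T h\<bar> \<le> 8 * (LINT z|\<nu>. norm (f z - g z)) + 8 * (LINT z|\<nu>. norm (f z - h z))"
    if gh: "g \<in> test_fields U" "h \<in> test_fields U" for g h
  proof -
    have "\<bar>T g - T h\<bar> \<le> 8 * (LINT z|\<nu>. norm (g z - h z))"
      using T_bound[OF test_field_diff[OF gh]] T_diff[OF gh] by simp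
    also have "(LINT z|\<nu>. norm (g z - h z)) \<le> (LINT z|\<nu>. norm (g z - f z)) + (LINT z|\<nu>. norm (f z - h z))"
      by (intro integral_norm_triangle) (use gh f test_field_integrable in auto)
    also have "(LINT z|\<nu>. norm (g z - f z)) = (LINT z|\<nu>. norm (f z - g z))" by (simp add: norm_minus_commute)
    finally show ?thesis by simp
  qed
  have "Cauchy (\<lambda>k. T (G k))"
  proof (rule CauchyI)
    fix e :: real assume e: "0 < e"
    obtain K where K: "inverse (real (Suc K)) < e / 16" using reals_Archimedean[of "e/16"] e by auto
    have small: "8 * (LINT z|\<nu>. norm (f z - G k z)) < e / 2" if "k \<ge> K" for k
    proof -
      have "inverse (real (Suc k)) \<le> inverse (real (Suc K))" using that by simp
      with G(2)[of k] K show ?thesis by linarith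
    qed
    show "\<exists>M. \<forall>m\<ge>M. \<forall>n\<ge>M. norm (T (G m) - T (G n)) < e"
    proof (intro exI[of _ K] allI impI)
      fix m n assume "K \<le> m" "K \<le> n"
      then show "norm (T (G m) - T (G n)) < e"
        using dist[OF G(1) G(1), of m n] small[of m] small[of n] by simp
    qed
  qed
  then obtain l where l: "(\<lambda>k. T (G k)) \<longlonglongrightarrow> l" using Cauchy_convergent_iff convergent_def by blast
  have "\<bar>T g - l\<bar> \<le> 8 * (LINT z|\<nu>. norm (f z - g z))" if g: "g \<in> test_fields U" for g
  proof -
    have 1: "(\<lambda>k. \<bar>T g - T (G k)\<bar>) \<longlonglongrightarrow> \<bar>T g - l\<bar>" by (intro tendsto_intros l)
    have 2: "(\<lambda>k. 8 * (LINT z|\<nu>. norm (f z - g z)) + 8 * inverse (real (Suc k)))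
        \<longlonglongrightarrow> 8 * (LINT z|\<nu>. norm (f z - g z)) + 8 * 0"
      by (intro tendsto_intros LIMSEQ_inverse_real_of_nat)
    have 3: "\<bar>T g - T (G k)\<bar> \<le> 8 * (LINT z|\<nu>. norm (f z - g z)) + 8 * inverse (real (Suc k))" for k
      using dist[OF g G(1)[of k]] G(2)[of k] by linarith
    show ?thesis using LIMSEQ_le[OF 1 2] 3 by simp
  qed
  then have "\<exists>l. \<forall>g\<in>test_fields U. \<bar>T g - l\<bar> \<le> 8 * (LINT z|\<nu>. norm (f z - g z))" by blast
  from someI_ex[OF this] g show ?thesis unfolding ext_def by blast
qed

lemma ext_test_field: "g \<in> test_fields U \<Longrightarrow> ext g = T g"
  using ext_near[OF test_field_integrable, of g g] by simp

text \<open>Arbitrarily good approximations pin down the value, so linearity of \<open>ext\<close>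
  can be checked on test fields.\<close>

lemma ext_unique:
  assumes "integrable \<nu> f"
    and "\<And>e. e > 0 \<Longrightarrow> \<exists>g\<in>test_fields U. (LINT z|\<nu>. norm (f z - g z)) \<le> e \<and> \<bar>T g - l\<bar> \<le> e"
  shows "ext f = l"
proof -
  have "\<bar>ext f - l\<bar> \<le> 0"
  proof (rule field_le_epsilon)
    fix e :: real assume e: "0 < e"
    \<comment> \<open>The constant of \<open>ext_near\<close> suggests ninths:
      \<open>8 * (e/9) + e/9 = e\<close>.\<close>
    obtain g where g: "g \<in> test_fields U" "(LINT z|\<nu>. norm (f z - g z)) \<le> e/9" "\<bar>T g - l\<bar> \<le> e/9"
      using assms(2)[of "e/9"] e by auto
    have "\<bar>T g - ext f\<bar> \<le> 8 * (e/9)"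
      using ext_near[OF assms(1) g(1)] g(2) by linarith
    then show "\<bar>ext f - l\<bar> \<le> 0 + e" using g(3) by linarith
  qed
  then show ?thesis by simp
qed

lemma ext_add:
  assumes "integrable \<nu> f" "integrable \<nu> g"
  shows "ext (\<lambda>z. f z + g z) = ext f + ext g"
proof (rule ext_unique)
  fix e :: real assume e: "0 < e"
  obtain f' where f': "f' \<in> test_fields U" "(LINT z|\<nu>. norm (f z - f' z)) < e/16"
    using test_fields_dense[OF assms(1), of "e/16"] e by auto
  obtain g' where g': "g' \<in> test_fields U" "(LINT z|\<nu>. norm (g z - g' z)) < e/16"
    using test_fields_dense[OF assms(2), of "e/16"] e by auto
  note i = assms test_field_integrable[OF f'(1)] test_field_integrable[OF g'(1)]
  have "norm (f z + g z - (f' z + g' z)) \<le> norm (f z - f' z) + norm (g z - g' z)" for z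
    using norm_triangle_ineq[of "f z - f' z" "g z - g' z"] by (simp add: algebra_simps)
  then have "(LINT z|\<nu>. norm (f z + g z - (f' z + g' z))) \<le> (LINT z|\<nu>. norm (f z - f' z) + norm (g z - g' z))"
    using i by (intro integral_mono) auto
  also have "\<dots> = (LINT z|\<nu>. norm (f z - f' z)) + (LINT z|\<nu>. norm (g z - g' z))" using i by simp
  finally have 1: "(LINT z|\<nu>. norm (f z + g z - (f' z + g' z))) \<le> e" using f' g' e by linarith
  have 2: "\<bar>T (\<lambda>z. f' z + g' z) - (ext f + ext g)\<bar> \<le> e"
    using ext_near[OF assms(1) f'(1)] ext_near[OF assms(2) g'(1)] f'(2) g'(2) T_add[OF f'(1) g'(1)] by linarith
  show "\<exists>h\<in>test_fields U. (LINT z|\<nu>. norm (f z + g z - h z)) \<le> e \<and> \<bar>T h - (ext f + ext g)\<bar> \<le> e"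
    using 1 2 test_field_add(1)[OF f'(1) g'(1)] by (intro bexI[of _ "\<lambda>z. f' z + g' z"]) auto
qed (use assms in auto)

lemma ext_scale:
  assumes f: "integrable \<nu> f"
  shows "ext (\<lambda>z. c *\<^sub>R f z) = c * ext f"
proof (rule ext_unique)
  fix e :: real assume e: "0 < e"
  define d where "d = e / (8 * (\<bar>c\<bar> + 1))"
  have d: "d > 0" "\<bar>c\<bar> * d * 8 \<le> e"
  proof -
    show "d > 0" using e by (simp add: d_def add_nonneg_pos)
    have "\<bar>c\<bar> * d * 8 \<le> (\<bar>c\<bar> + 1) * d * 8" using \<open>d > 0\<close> by simp
    also have "\<dots> = e" using abs_ge_zero[of c] by (simp add: d_def field_simps)
    finally show "\<bar>c\<bar> * d * 8 \<le> e" .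
  qed
  obtain f' where f': "f' \<in> test_fields U" "(LINT z|\<nu>. norm (f z - f' z)) < d"
    using test_fields_dense[OF f d(1)] by auto
  have "(LINT z|\<nu>. norm (c *\<^sub>R f z - c *\<^sub>R f' z)) = \<bar>c\<bar> * (LINT z|\<nu>. norm (f z - f' z))"
    by (simp add: scaleR_diff_right[symmetric])
  also have "\<dots> \<le> \<bar>c\<bar> * d" using f'(2) by (intro mult_left_mono) auto
  also have "\<dots> \<le> e" using d by (smt (verit) mult_nonneg_nonneg abs_ge_zero)
  finally have 1: "(LINT z|\<nu>. norm (c *\<^sub>R f z - c *\<^sub>R f' z)) \<le> e" .
  have "\<bar>T (\<lambda>z. c *\<^sub>R f' z) - c * ext f\<bar> = \<bar>c\<bar> * \<bar>T f' - ext f\<bar>"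
    by (simp add: T_scale[OF f'(1)] abs_mult[symmetric] algebra_simps)
  also have "\<dots> \<le> \<bar>c\<bar> * (8 * d)"
    using ext_near[OF f f'(1)] f'(2) by (intro mult_left_mono) auto
  also have "\<dots> \<le> e" using d(2) by (simp add: mult_ac)
  finally show "\<exists>h\<in>test_fields U. (LINT z|\<nu>. norm (c *\<^sub>R f z - h z)) \<le> e \<and> \<bar>T h - c * ext f\<bar> \<le> e"
    using 1 test_field_scale(1)[OF smooth_const f'(1)] by (intro bexI[of _ "\<lambda>z. c *\<^sub>R f' z"]) auto
qed (use f in auto)

lemma ext_bound:
  assumes f: "integrable \<nu> f"
  shows "\<bar>ext f\<bar> \<le> 8 * (LINT z|\<nu>. norm (f z))"
  using ext_near[OF f test_field_zero] by (simp add: T_zero)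

lemma ext_sum:
  "(\<And>i. i \<in> I \<Longrightarrow> integrable \<nu> (f i)) \<Longrightarrow> ext (\<lambda>z. \<Sum>i\<in>I. f i z) = (\<Sum>i\<in>I. ext (f i))"
proof (induction I rule: infinite_finite_induct)
  case (insert i I)
  then have "ext (\<lambda>z. f i z + (\<Sum>i\<in>I. f i z)) = ext (f i) + ext (\<lambda>z. \<Sum>i\<in>I. f i z)"
    by (intro ext_add) auto
  with insert show ?case by simp
qed (auto simp: ext_test_field[OF test_field_zero] T_zero)

lemma ext_tendsto:
  assumes "\<And>i. integrable \<nu> (s i)" "integrable \<nu> f" "(\<lambda>i. LINT z|\<nu>. norm (s i z - f z)) \<longlonglongrightarrow> 0"
  shows "(\<lambda>i. ext (s i)) \<longlonglongrightarrow> ext f"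
proof (rule LIM_zero_cancel, rule Lim_null_comparison)
  show "\<forall>\<^sub>F i in sequentially. norm (ext (s i) - ext f) \<le> 8 * (LINT z|\<nu>. norm (s i z - f z))"
  proof (rule always_eventually, rule allI)
    fix i
    have "ext (\<lambda>z. s i z + (-1) *\<^sub>R f z) = ext (s i) + (-1) * ext f"
      using assms by (subst ext_add, simp, simp, subst ext_scale) auto
    then show "norm (ext (s i) - ext f) \<le> 8 * (LINT z|\<nu>. norm (s i z - f z))"
      using ext_bound[of "\<lambda>z. s i z + (-1) *\<^sub>R f z"] assms by simp
  qed
  show "(\<lambda>i. 8 * (LINT z|\<nu>. norm (s i z - f z))) \<longlonglongrightarrow> 0"
    using tendsto_mult_right_zero[OF assms(3)] by simp
qed

section \<open>Radon-Nikodym densities for the extended functional\<close>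

lemma integrable_indicator_scaleR:
  assumes "integrable \<nu> w" "A \<in> sets \<nu>"
  shows "integrable \<nu> (\<lambda>z. (indicator A z * w z) *\<^sub>R b)" "integrable \<nu> (\<lambda>z. indicator A z * w z :: real)"
proof -
  show 1: "integrable \<nu> (\<lambda>z. indicator A z * w z :: real)"
    using integrable_mult_indicator[OF assms(2,1)] by simp
  then show "integrable \<nu> (\<lambda>z. (indicator A z * w z) *\<^sub>R b)" by (rule integrable_scaleR_left)
qed

text \<open>
  Adding a multiple of the weighted measure makes the set function induced by the extension positive,
  so that the Radon-Nikodym theorem applies.
\<close>

lemma density_component:
  assumes w: "integrable \<nu> w" "\<And>z. z \<in> U \<Longrightarrow> 0 < w z" and b: "norm b = 1"
  shows "\<exists>k\<in>borel_measurable \<nu>. (\<forall>z\<in>U. \<bar>k z\<bar> \<le> (8::real)) \<and>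
    (\<forall>A\<in>sets \<nu>. ext (\<lambda>z. (indicator A z * w z) *\<^sub>R b) = (LINT z|\<nu>. indicator A z * w z * k z))"
proof -
  define I where "I A = (LINT z|\<nu>. indicator A z * w z)" for A
  \<comment> \<open>By \<open>ext_bound\<close> the second summand lies between
    \<open>- 8 * I A\<close> and \<open>8 * I A\<close>, so \<open>F A\<close> lies between 0 and
    \<open>16 * I A\<close>.\<close>
  define F where "F A = 8 * I A + ext (\<lambda>z. (indicator A z * w z) *\<^sub>R b)" for A
  note iw = integrable_indicator_scaleR[OF w(1)]
  have Eb: "\<bar>ext (\<lambda>z. (indicator A z * w z) *\<^sub>R b)\<bar> \<le> 8 * I A" if A: "A \<in> sets \<nu>" for A
  proof -
    have "(LINT z|\<nu>. norm ((indicator A z * w z) *\<^sub>R b)) = I A"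
      unfolding I_def using w(2) b by (intro Bochner_Integration.integral_cong) (auto simp: abs_mult less_imp_le)
    with ext_bound[OF iw(1)[OF A], of b] show ?thesis by simp
  qed
  have F: "0 \<le> F A" "F A \<le> 16 * I A" if A: "A \<in> sets \<nu>" for A
    using Eb[OF A] by (auto simp: F_def)
  have ind: "indicator (A \<union> B) z = (indicator A z + indicator B z :: real)" if "A \<inter> B = {}" for A B and z :: "real^'n"
    using that by (auto simp: indicator_def)
  have Fadd: "F (A \<union> B) = F A + F B" if A: "A \<in> sets \<nu>" and B: "B \<in> sets \<nu>" and d: "A \<inter> B = {}" for A B
  proof -
    have "I (A \<union> B) = I A + I B"
      unfolding I_def ind[OF d] using iw(2)[OF A] iw(2)[OF B] by (simp add: ring_distribs)
    moreover have "ext (\<lambda>z. (indicator (A \<union> B) z * w z) *\<^sub>R b)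
        = ext (\<lambda>z. (indicator A z * w z) *\<^sub>R b) + ext (\<lambda>z. (indicator B z * w z) *\<^sub>R b)"
      unfolding ind[OF d] using ext_add[OF iw(1)[OF A, of b] iw(1)[OF B, of b]] by (simp add: ring_distribs scaleR_add_left)
    ultimately show ?thesis by (simp add: F_def)
  qed
  \<comment> \<open>Finite additivity and continuity at the empty set suffice; the latter holds
    because \<open>F\<close> is dominated by 16 times an integral.\<close>
  have ca: "countably_additive (sets \<nu>) (\<lambda>A. ennreal (F A))"
  proof (rule sets.empty_continuous_imp_countably_additive)
    have F0: "F {} = 0" using Fadd[of "{}" "{}"] by simp
    then show "positive (sets \<nu>) (\<lambda>A. ennreal (F A))" by (simp add: positive_def)
    show "additive (sets \<nu>) (\<lambda>A. ennreal (F A))" using Fadd F by (simp add: additive_def)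
    fix A :: "nat \<Rightarrow> (real^'n) set" assume A: "range A \<subseteq> sets \<nu>" "decseq A" "(\<Inter>i. A i) = {}"
    have "(\<lambda>i. I (A i)) \<longlonglongrightarrow> (LINT z|\<nu>. 0)"
      unfolding I_def
    proof (rule integral_dominated_convergence[where w = w])
      show "AE z in \<nu>. (\<lambda>i. indicator (A i) z * w z) \<longlonglongrightarrow> 0"
      proof (rule AE_I2)
        fix z
        obtain j where j: "z \<notin> A j" using A(3) by auto
        have out: "z \<notin> A i" if "i \<ge> j" for i using j decseqD[OF A(2) that] by auto
        have "\<forall>\<^sub>F i in sequentially. indicator (A i) z * w z = 0"
          by (rule eventually_mono[OF eventually_ge_at_top[of j]]) (simp add: out)
        then show "(\<lambda>i. indicator (A i) z * w z) \<longlonglongrightarrow> 0" by (rule tendsto_eventually)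
      qed
      show "AE z in \<nu>. norm (indicator (A i) z * w z) \<le> w z" for i
        using w(2) by (auto simp: indicator_def less_imp_le)
    qed (use A w(1) in \<open>auto intro!: borel_measurable_times borel_measurable_indicator\<close>)
    then have "(\<lambda>i. 16 * I (A i)) \<longlonglongrightarrow> 16 * 0" by (intro tendsto_intros) simp
    then have up: "(\<lambda>i. 16 * I (A i)) \<longlonglongrightarrow> 0" by simp
    have As: "A i \<in> sets \<nu>" for i using A(1) by blast
    have "(\<lambda>i. F (A i)) \<longlonglongrightarrow> 0"
      by (rule tendsto_sandwich[OF _ _ tendsto_const up]; rule always_eventually; simp add: F[OF As])
    then show "(\<lambda>i. ennreal (F (A i))) \<longlonglongrightarrow> 0" using tendsto_ennrealI by fastforce
  qed auto
  define M where "M = measure_of U (sets \<nu>) (\<lambda>A. ennreal (F A))"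
  have sM: "sets M = sets \<nu>"
    unfolding M_def using sets.sigma_algebra_axioms[of \<nu>] by (simp add: sigma_algebra.sets_measure_of_eq)
  have eM: "emeasure M A = ennreal (F A)" if "A \<in> sets \<nu>" for A
  proof (rule emeasure_measure_of[OF M_def])
    show "positive (sets M) (\<lambda>A. ennreal (F A))" using Fadd[of "{}" "{}"] by (simp add: positive_def)
  qed (use that ca sM sets.sets_into_space[of _ \<nu>] in auto)
  have "absolutely_continuous \<nu> M"
    unfolding absolutely_continuous_def
  proof
    fix A assume A: "A \<in> null_sets \<nu>"
    then have "I A = 0"
      unfolding I_def using AE_not_in[OF A] by (intro integral_eq_zero_AE) (auto elim: eventually_mono)
    then show "A \<in> null_sets M" using A F[of A] eM[of A] by (auto simp: null_sets_def sM)
  qed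
  then obtain h where h: "h \<in> borel_measurable \<nu>" "density \<nu> h = M"
    using Radon_Nikodym[OF _ sM] by auto
  have hF: "(\<integral>\<^sup>+z. h z * indicator A z \<partial>\<nu>) = ennreal (F A)" if "A \<in> sets \<nu>" for A
    using emeasure_density[OF h(1) that] h(2) eM[OF that] by simp
  have wm: "w \<in> borel_measurable \<nu>" using w(1) by auto
  have wI: "(\<integral>\<^sup>+z. ennreal (16 * w z) * indicator A z \<partial>\<nu>) = ennreal (16 * I A)" if A: "A \<in> sets \<nu>" for A
  proof -
    have "(\<integral>\<^sup>+z. ennreal (16 * w z) * indicator A z \<partial>\<nu>) = (\<integral>\<^sup>+z. ennreal (16 * (indicator A z * w z)) \<partial>\<nu>)"
      by (intro nn_integral_cong) (auto simp: indicator_def)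
    also have "\<dots> = ennreal (LINT z|\<nu>. 16 * (indicator A z * w z))"
      using iw(2)[OF A] w(2) by (intro nn_integral_eq_integral) (auto simp: indicator_def less_imp_le)
    finally show ?thesis by (simp add: I_def)
  qed
  have hle: "AE z in \<nu>. h z \<le> ennreal (16 * w z)"
  proof -
    define A where "A = {z \<in> space \<nu>. ennreal (16 * w z) < h z}"
    have A: "A \<in> sets \<nu>" unfolding A_def using h(1) wm by measurable
    have ms: "(\<lambda>z. h z * indicator A z) \<in> borel_measurable \<nu>"
      "(\<lambda>z. ennreal (16 * w z) * indicator A z) \<in> borel_measurable \<nu>"
      "(\<lambda>z. h z * indicator A z - ennreal (16 * w z) * indicator A z) \<in> borel_measurable \<nu>"
      using h(1) wm A by measurable
    have "(\<integral>\<^sup>+z. h z * indicator A z - ennreal (16 * w z) * indicator A z \<partial>\<nu>)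
        = (\<integral>\<^sup>+z. h z * indicator A z \<partial>\<nu>) - (\<integral>\<^sup>+z. ennreal (16 * w z) * indicator A z \<partial>\<nu>)"
    proof (rule nn_integral_diff[OF ms(1,2)])
      show "(\<integral>\<^sup>+z. ennreal (16 * w z) * indicator A z \<partial>\<nu>) \<noteq> \<infinity>" using wI[OF A] by simp
      show "AE z in \<nu>. ennreal (16 * w z) * indicator A z \<le> h z * indicator A z"
        by (intro AE_I2) (auto simp: A_def indicator_def less_imp_le)
    qed
    also have "\<dots> = 0" unfolding hF[OF A] wI[OF A] using F[OF A] by (simp add: ennreal_minus ennreal_eq_0_iff)
    finally have "AE z in \<nu>. h z * indicator A z - ennreal (16 * w z) * indicator A z = 0"
      by (subst (asm) nn_integral_0_iff_AE[OF ms(3)])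
    moreover have "AE z in \<nu>. z \<in> space \<nu>" by (rule AE_space)
    ultimately show ?thesis
    proof eventually_elim
      case (elim z)
      then show ?case
        by (cases "z \<in> A") (auto simp: A_def diff_eq_0_iff_ennreal not_less)
    qed
  qed
  \<comment> \<open>The shift by 8 is undone. Clipping changes values only on a null set and makes
    the bound hold at every point.\<close>
  define k where "k z = max (-8) (min 8 (enn2real (h z) / w z - 8))" for z
  have km: "k \<in> borel_measurable \<nu>" unfolding k_def using h(1) wm by measurable
  have "ext (\<lambda>z. (indicator A z * w z) *\<^sub>R b) = (LINT z|\<nu>. indicator A z * w z * k z)" if A: "A \<in> sets \<nu>" for A
  proof -
    have hk: "AE z in \<nu>. indicator A z * w z * k z = indicator A z * enn2real (h z) - 8 * (indicator A z * w z)"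
      using hle AE_space
    proof eventually_elim
      case (elim z)
      then have wz: "0 < w z" using w(2) by simp
      have "enn2real (h z) \<le> 16 * w z" using elim(1) wz by (intro enn2real_leI) auto
      then have "enn2real (h z) / w z \<le> 16" using wz by (simp add: divide_le_eq)
      moreover have "0 \<le> enn2real (h z) / w z" using wz by simp
      ultimately have "k z = enn2real (h z) / w z - 8" by (simp add: k_def)
      then show ?case using wz by (cases "z \<in> A") (auto simp: field_simps)
    qed
    have heq: "AE z in \<nu>. ennreal (indicator A z * enn2real (h z)) = h z * indicator A z"
      using hle by eventually_elim (auto simp: indicator_def ennreal_enn2real_if top_unique)
    have "(\<integral>\<^sup>+z. ennreal (indicator A z * enn2real (h z)) \<partial>\<nu>) = ennreal (F A)"
      using hF[OF A] nn_integral_cong_AE[OF heq] by simp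
    then have i: "has_bochner_integral \<nu> (\<lambda>z. indicator A z * enn2real (h z)) (F A)"
      using h(1) A F(1)[OF A] by (intro has_bochner_integral_nn_integral) auto
    have "(LINT z|\<nu>. indicator A z * w z * k z) = (LINT z|\<nu>. indicator A z * enn2real (h z) - 8 * (indicator A z * w z))"
    proof (rule integral_cong_AE[OF _ _ hk])
      show "(\<lambda>z. indicator A z * w z * k z) \<in> borel_measurable \<nu>"
        "(\<lambda>z. indicator A z * enn2real (h z) - 8 * (indicator A z * w z)) \<in> borel_measurable \<nu>"
        using km wm h(1) A by measurable
    qed
    also have "\<dots> = F A - 8 * I A"
      using i iw(2)[OF A] by (simp add: has_bochner_integral_iff I_def)
    finally show ?thesis by (simp add: F_def)
  qed
  then show ?thesis using km by (intro bexI[of _ k]) (auto simp: k_def)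
qed

text \<open>The weight turns all indicators into integrable functions although \<open>\<nu>\<close>
  may be infinite. The hypothesis is the case of indicators for the measure with density
  \<open>w\<close>; induction over its integrable functions reaches \<open>u / w\<close>, and
  multiplying by \<open>w\<close> gives back \<open>u\<close>.\<close>

lemma ext_component:
  assumes w: "integrable \<nu> w" "\<And>z. z \<in> U \<Longrightarrow> 0 < w z"
    and k: "k \<in> borel_measurable \<nu>" "\<And>z. z \<in> U \<Longrightarrow> \<bar>k z\<bar> \<le> (8::real)"
    and eq: "\<And>A. A \<in> sets \<nu> \<Longrightarrow> ext (\<lambda>z. (indicator A z * w z) *\<^sub>R b) = (LINT z|\<nu>. indicator A z * w z * k z)"
    and u: "integrable \<nu> u"
  shows "ext (\<lambda>z. u z *\<^sub>R b) = (LINT z|\<nu>. u z * k z)"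
proof -
  have wm: "w \<in> borel_measurable \<nu>" using w(1) by auto
  have wpos: "AE z in \<nu>. 0 \<le> w z" using w(2) by (auto simp: less_imp_le)
  let ?L = "density \<nu> (\<lambda>z. ennreal (w z))"
  have il: "integrable ?L f \<longleftrightarrow> integrable \<nu> (\<lambda>z. f z * w z)" if "f \<in> borel_measurable \<nu>" for f :: "real^'n \<Rightarrow> real"
    using integrable_real_density[OF wm wpos that] by (simp add: mult.commute)
  have um: "u \<in> borel_measurable \<nu>" using u by auto
  have fm: "f \<in> borel_measurable \<nu>" if "integrable ?L f" for f :: "real^'n \<Rightarrow> real"
    using borel_measurable_integrable[OF that] by simp
  have ik: "integrable \<nu> (\<lambda>z. f z * w z * k z)" if "integrable \<nu> (\<lambda>z. f z * w z)" for f
  proof (rule Bochner_Integration.integrable_bound[OF integrable_mult_right[OF that, of 8]])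
    show "(\<lambda>z. f z * w z * k z) \<in> borel_measurable \<nu>"
      by (rule borel_measurable_times[OF borel_measurable_integrable[OF that] k(1)])
    show "AE z in \<nu>. norm (f z * w z * k z) \<le> norm (8 * (f z * w z))"
    proof (rule AE_I2)
      fix z assume "z \<in> space \<nu>"
      then have "\<bar>f z * w z\<bar> * \<bar>k z\<bar> \<le> \<bar>f z * w z\<bar> * 8" using k(2)[of z] by (intro mult_left_mono) auto
      then show "norm (f z * w z * k z) \<le> norm (8 * (f z * w z))" by (simp add: abs_mult mult_ac)
    qed
  qed
  have "integrable ?L (\<lambda>z. u z / w z)"
  proof (subst il)
    show "integrable \<nu> (\<lambda>z. u z / w z * w z)"
      using u w(2) by (subst Bochner_Integration.integrable_cong[where g = u]) (auto simp: less_le)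
  qed (use um wm in measurable)
  then have "ext (\<lambda>z. (u z / w z * w z) *\<^sub>R b) = (LINT z|\<nu>. u z / w z * w z * k z)"
  proof (induction rule: integrable_induct)
    case (base A c)
    then have A: "A \<in> sets \<nu>" by simp
    have "ext (\<lambda>z. (indicator A z *\<^sub>R c * w z) *\<^sub>R b) = ext (\<lambda>z. c *\<^sub>R ((indicator A z * w z) *\<^sub>R b))"
      by (simp add: mult_ac)
    also have "\<dots> = c * (LINT z|\<nu>. indicator A z * w z * k z)"
      using eq[OF A] ext_scale[OF integrable_indicator_scaleR(1)[OF w(1) A, of b], of c] by simp
    finally show ?case
      using integral_mult_right_zero[of \<nu> c "\<lambda>z. indicator A z * w z * k z"] by (simp add: mult_ac)
  next
    case (add f g)
    have i: "integrable \<nu> (\<lambda>z. f z * w z)" "integrable \<nu> (\<lambda>z. g z * w z)"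
      using il[OF fm[OF add.hyps(1)]] il[OF fm[OF add.hyps(2)]] add.hyps by auto
    have "ext (\<lambda>z. ((f z + g z) * w z) *\<^sub>R b) = ext (\<lambda>z. (f z * w z) *\<^sub>R b) + ext (\<lambda>z. (g z * w z) *\<^sub>R b)"
      using ext_add[OF integrable_scaleR_left[OF i(1), of b] integrable_scaleR_left[OF i(2), of b]]
      by (simp add: ring_distribs scaleR_add_left)
    also have "\<dots> = (LINT z|\<nu>. f z * w z * k z + g z * w z * k z)"
      using add.IH ik[OF i(1)] ik[OF i(2)] by simp
    finally show ?case by (simp add: ring_distribs)
  next
    case (lim f s)
    have i: "integrable \<nu> (\<lambda>z. f z * w z)" "\<And>i. integrable \<nu> (\<lambda>z. s i z * w z)"
      using il[OF fm[OF lim.hyps(1)]] il[OF fm[OF lim.hyps(4)]] lim.hyps(1,4) by auto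
    have sf: "\<bar>s i z\<bar> \<le> 2 * \<bar>f z\<bar>" if "z \<in> U" for i z using lim.hyps(3)[of z i] that by simp
    have conv: "(\<lambda>i. s i z) \<longlonglongrightarrow> f z" if "z \<in> U" for z using lim.hyps(2)[of z] that by simp
    have b: "norm (s i z * w z) \<le> 2 * \<bar>f z * w z\<bar>" if "z \<in> U" for i z
      using mult_right_mono[OF sf[OF that], of "\<bar>w z\<bar>"] by (simp add: abs_mult mult_ac)
    have "(\<lambda>i. LINT z|\<nu>. norm ((s i z * w z) *\<^sub>R b - (f z * w z) *\<^sub>R b)) \<longlonglongrightarrow> (LINT z|\<nu>. 0)"
    proof (rule integral_dominated_convergence[where w = "\<lambda>z. 3 * \<bar>f z * w z\<bar> * norm b"])
      show "AE z in \<nu>. (\<lambda>i. norm ((s i z * w z) *\<^sub>R b - (f z * w z) *\<^sub>R b)) \<longlonglongrightarrow> 0"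
      proof (rule AE_I2)
        fix z assume "z \<in> space \<nu>"
        then have "(\<lambda>i. norm ((s i z * w z) *\<^sub>R b - (f z * w z) *\<^sub>R b)) \<longlonglongrightarrow> norm ((f z * w z) *\<^sub>R b - (f z * w z) *\<^sub>R b)"
          by (intro tendsto_intros conv) simp
        then show "(\<lambda>i. norm ((s i z * w z) *\<^sub>R b - (f z * w z) *\<^sub>R b)) \<longlonglongrightarrow> 0" by simp
      qed
      show "AE z in \<nu>. norm (norm ((s i z * w z) *\<^sub>R b - (f z * w z) *\<^sub>R b)) \<le> 3 * \<bar>f z * w z\<bar> * norm b" for i
      proof (rule AE_I2)
        fix z assume "z \<in> space \<nu>"
        then have "\<bar>s i z * w z - f z * w z\<bar> \<le> 3 * \<bar>f z * w z\<bar>" using b[of z i] by simp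
        then show "norm (norm ((s i z * w z) *\<^sub>R b - (f z * w z) *\<^sub>R b)) \<le> 3 * \<bar>f z * w z\<bar> * norm b"
          unfolding scaleR_diff_left[symmetric] by (simp add: mult_right_mono)
      qed
    qed (use i in \<open>auto intro!: integrable_mult_left integrable_mult_right integrable_abs\<close>)
    then have "(\<lambda>i. ext (\<lambda>z. (s i z * w z) *\<^sub>R b)) \<longlonglongrightarrow> ext (\<lambda>z. (f z * w z) *\<^sub>R b)"
      by (intro ext_tendsto integrable_scaleR_left i) simp
    moreover have "(\<lambda>i. LINT z|\<nu>. s i z * w z * k z) \<longlonglongrightarrow> (LINT z|\<nu>. f z * w z * k z)"
    proof (rule integral_dominated_convergence[where w = "\<lambda>z. 16 * \<bar>f z * w z\<bar>"])
      show "AE z in \<nu>. (\<lambda>i. s i z * w z * k z) \<longlonglongrightarrow> f z * w z * k z"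
        using conv by (auto intro!: tendsto_intros)
      show "AE z in \<nu>. norm (s i z * w z * k z) \<le> 16 * \<bar>f z * w z\<bar>" for i
      proof (rule AE_I2)
        fix z assume z: "z \<in> space \<nu>"
        then have "norm (s i z * w z) * \<bar>k z\<bar> \<le> (2 * \<bar>f z * w z\<bar>) * 8"
          using b[of z i] k(2)[of z] by (intro mult_mono) auto
        then show "norm (s i z * w z * k z) \<le> 16 * \<bar>f z * w z\<bar>" by (simp add: abs_mult)
      qed
    qed (use i ik in auto)
    ultimately show ?case using lim.IH LIMSEQ_unique by simp
  qed
  \<comment> \<open>Outside \<open>U\<close> the weight may vanish and the two fields may differ;
    \<open>ext\<close> depends on a field only through integrals over \<open>U\<close>.\<close>
  moreover have "ext (\<lambda>z. (u z / w z * w z) *\<^sub>R b) = ext (\<lambda>z. u z *\<^sub>R b)"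
  proof (rule ext_unique)
    have e: "(LINT z|\<nu>. norm ((u z / w z * w z) *\<^sub>R b - g z)) = (LINT z|\<nu>. norm (u z *\<^sub>R b - g z))" for g
      using w(2) by (intro Bochner_Integration.integral_cong) (auto simp: less_le)
    show "integrable \<nu> (\<lambda>z. (u z / w z * w z) *\<^sub>R b)"
      using u w(2) by (subst Bochner_Integration.integrable_cong[where g = "\<lambda>z. u z *\<^sub>R b"]) (auto simp: less_le)
    fix e :: real assume "0 < e"
    have iu: "integrable \<nu> (\<lambda>z. u z *\<^sub>R b)" using u by (rule integrable_scaleR_left)
    obtain g where g: "g \<in> test_fields U" "(LINT z|\<nu>. norm (u z *\<^sub>R b - g z)) < e/8"
      using test_fields_dense[OF iu, of "e/8"] \<open>0 < e\<close> by auto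
    then show "\<exists>g\<in>test_fields U. (LINT z|\<nu>. norm ((u z / w z * w z) *\<^sub>R b - g z)) \<le> e \<and> \<bar>T g - ext (\<lambda>z. u z *\<^sub>R b)\<bar> \<le> e"
      using ext_near[OF iu g(1)] \<open>0 < e\<close> unfolding e by (intro bexI[OF _ g(1)]) auto
  qed
  moreover have "(LINT z|\<nu>. u z / w z * w z * k z) = (LINT z|\<nu>. u z * k z)"
    using w(2) by (intro Bochner_Integration.integral_cong) (auto simp: less_le)
  ultimately show ?thesis by simp
qed

text \<open>The components give a bounded field representing \<open>T\<close>. Its variation on open
  sets is both \<open>\<nu>\<close> and the integral of its norm, so the norm is a density of
  \<open>\<nu>\<close> with respect to itself, hence 1 almost everywhere; a fixed unit vector
  repairs the null set.\<close>

theorem representation: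
  "\<exists>\<eta>\<in>borel_measurable \<nu>. (\<forall>z\<in>U. norm (\<eta> z) = 1) \<and>
     (\<forall>g\<in>test_fields U. T g = (LINT z|\<nu>. g z \<bullet> \<eta> z))"
proof -
  \<comment> \<open>Sigma-finiteness provides a positive weight with finite integral.\<close>
  obtain h where h: "h \<in> borel_measurable \<nu>" "integral\<^sup>N \<nu> h \<noteq> \<infinity>" "\<forall>x\<in>space \<nu>. 0 < h x \<and> h x < \<infinity>"
    using Ex_finite_integrable_function by blast
  define w where "w z = enn2real (h z)" for z
  have w: "integrable \<nu> w" "\<And>z. z \<in> U \<Longrightarrow> 0 < w z"
  proof -
    have "(\<integral>\<^sup>+z. ennreal (norm (w z)) \<partial>\<nu>) = integral\<^sup>N \<nu> h"
      using h(3) by (intro nn_integral_cong) (auto simp: w_def)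
    then show "integrable \<nu> w"
      using h(1,2) unfolding w_def by (intro integrableI_bounded) (auto simp: less_top)
    show "0 < w z" if "z \<in> U" for z using h(3) that by (auto simp: w_def enn2real_positive_iff less_top)
  qed
  have "\<forall>b\<in>Basis. \<exists>k\<in>borel_measurable \<nu>. (\<forall>z\<in>U. \<bar>k z\<bar> \<le> 8) \<and>
    (\<forall>A\<in>sets \<nu>. ext (\<lambda>z. (indicator A z * w z) *\<^sub>R b) = (LINT z|\<nu>. indicator A z * w z * k z))"
    by (intro ballI density_component[OF w] norm_Basis)
  then obtain k where k0: "\<forall>b\<in>Basis. k b \<in> borel_measurable \<nu> \<and> (\<forall>z\<in>U. \<bar>k b z\<bar> \<le> 8) \<and>
    (\<forall>A\<in>sets \<nu>. ext (\<lambda>z. (indicator A z * w z) *\<^sub>R b) = (LINT z|\<nu>. indicator A z * w z * k b z))"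
    unfolding Bex_def bchoice_iff by blast
  have k: "k b \<in> borel_measurable \<nu>" "z \<in> U \<Longrightarrow> \<bar>k b z\<bar> \<le> 8"
    "A \<in> sets \<nu> \<Longrightarrow> ext (\<lambda>z. (indicator A z * w z) *\<^sub>R b) = (LINT z|\<nu>. indicator A z * w z * k b z)"
    if "b \<in> Basis" for b z A
    using bspec[OF k0 that] by simp_all
  define \<eta> where "\<eta> z = (\<Sum>b\<in>Basis. k b z *\<^sub>R b)" for z
  have \<eta>m: "\<eta> \<in> borel_measurable \<nu>" unfolding \<eta>_def using k(1) by (intro borel_measurable_sum borel_measurable_scaleR) auto
  have \<eta>b: "norm (\<eta> z) \<le> 8 * real (card (Basis :: (real^'n) set))" if "z \<in> U" for z
  proof -
    have "norm (\<eta> z) \<le> (\<Sum>b\<in>(Basis :: (real^'n) set). 8)"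
      unfolding \<eta>_def using k(2)[OF _ that] by (intro sum_norm_le) auto
    then show ?thesis by (simp add: mult.commute)
  qed
  have T\<eta>: "T g = (LINT z|\<nu>. g z \<bullet> \<eta> z)" if g: "g \<in> test_fields U" for g
  proof -
    have gi: "integrable \<nu> (\<lambda>z. g z \<bullet> b)" for b using test_field_integrable[OF g] by (rule integrable_inner_left)
    have gk: "integrable \<nu> (\<lambda>z. (g z \<bullet> b) * k b z)" if "b \<in> Basis" for b
      using gi k(1)[OF that] k(2)[OF that] borel_measurable_integrable[OF gi] mult_left_mono[of "\<bar>k b z\<bar>" 8 "\<bar>g z \<bullet> b\<bar>" for z]
      by (intro Bochner_Integration.integrable_bound[OF integrable_mult_right[OF gi, of 8 b]]) (auto simp: abs_mult mult_ac)
    have "T g = ext (\<lambda>z. \<Sum>b\<in>Basis. (g z \<bullet> b) *\<^sub>R b)" by (simp add: ext_test_field[OF g] euclidean_representation)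
    also have "\<dots> = (\<Sum>b\<in>Basis. ext (\<lambda>z. (g z \<bullet> b) *\<^sub>R b))" by (intro ext_sum integrable_scaleR_left gi)
    also have "\<dots> = (\<Sum>b\<in>Basis. (LINT z|\<nu>. (g z \<bullet> b) * k b z))"
      by (intro sum.cong refl ext_component[OF w k(1,2,3) gi]) auto
    also have "\<dots> = (LINT z|\<nu>. (\<Sum>b\<in>Basis. (g z \<bullet> b) * k b z))"
      by (rule Bochner_Integration.integral_sum[symmetric, OF gk])
    also have "\<dots> = (LINT z|\<nu>. g z \<bullet> \<eta> z)" by (simp add: \<eta>_def inner_sum_right mult.commute)
    finally show ?thesis .
  qed
  have "density \<nu> (\<lambda>z. ennreal (norm (\<eta> z))) = \<nu>"
  proof (rule measure_eqI_open[symmetric])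
    fix S assume S: "open S" "S \<subseteq> U"
    have "emeasure \<nu> S = (\<integral>\<^sup>+z. ennreal (norm (\<eta> z)) * indicator S z \<partial>\<nu>)"
      unfolding emeasure_total_variation_open[OF S] by (rule variation_open_density[OF \<eta>m \<eta>b S T\<eta>])
    then show "emeasure \<nu> S = emeasure (density \<nu> (\<lambda>z. ennreal (norm (\<eta> z)))) S"
      using \<eta>m S by (simp add: emeasure_density sets_iff)
  qed simp
  then have "AE z in \<nu>. ennreal (norm (\<eta> z)) = 1"
    using \<eta>m by (intro density_unique) (auto simp: density_1)
  then have ae: "AE z in \<nu>. norm (\<eta> z) = 1" by (auto elim!: eventually_mono simp: ennreal_eq_1)
  define e :: "real^'n" where "e = axis undefined 1"
  define \<eta>' where "\<eta>' z = (if norm (\<eta> z) = 1 then \<eta> z else e)" for z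
  have "\<eta>' \<in> borel_measurable \<nu>" unfolding \<eta>'_def using \<eta>m by measurable
  moreover have "\<forall>z\<in>U. norm (\<eta>' z) = 1" by (simp add: \<eta>'_def e_def)
  moreover have "T g = (LINT z|\<nu>. g z \<bullet> \<eta>' z)" if g: "g \<in> test_fields U" for g
    unfolding T\<eta>[OF g] using ae \<eta>m \<open>\<eta>' \<in> borel_measurable \<nu>\<close> borel_measurable[OF test_field_measurable[OF g]]
    by (intro integral_cong_AE) (auto simp: \<eta>'_def elim!: eventually_mono)
  ultimately show ?thesis by blast
qed

end

section \<open>Varifolds whose first variation is Radon\<close>

text \<open>Countable additivity asks for sequences; indices outside the image of
  \<open>to_nat_on\<close> receive the empty set, which treats finite and infinite families
  alike.\<close>

lemma countable_disjoint_enumeration: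
  assumes "countable \<A>" "disjoint \<A>"
  obtains B :: "nat \<Rightarrow> 'a set" where "disjoint_family B" "(\<Union>n. B n) = \<Union>\<A>" "\<And>n. B n \<in> insert {} \<A>"
    "\<And>A. A \<in> \<A> \<Longrightarrow> B (to_nat_on \<A> A) = A" "\<And>n. n \<notin> to_nat_on \<A> ` \<A> \<Longrightarrow> B n = {}"
proof -
  let ?J = "to_nat_on \<A> ` \<A>"
  define B where "B n = (if n \<in> ?J then from_nat_into \<A> n else {})" for n
  have Bto: "B (to_nat_on \<A> A) = A" if "A \<in> \<A>" for A
    using that assms(1) by (simp add: B_def)
  have Bcases: "B n = {} \<or> (\<exists>A\<in>\<A>. n = to_nat_on \<A> A \<and> B n = A)" for n
    using Bto by (cases "n \<in> ?J") (auto simp: B_def)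
  show ?thesis
  proof (rule that[of B])
    show "disjoint_family B"
      unfolding disjoint_family_on_def
    proof (intro ballI impI)
      fix i j :: nat assume "i \<noteq> j"
      show "B i \<inter> B j = {}"
      proof (rule ccontr)
        assume ne: "B i \<inter> B j \<noteq> {}"
        then have "B i \<noteq> {}" "B j \<noteq> {}" by auto
        with Bcases[of i] Bcases[of j] have "\<exists>A\<in>\<A>. i = to_nat_on \<A> A \<and> B i = A"
          "\<exists>A\<in>\<A>. j = to_nat_on \<A> A \<and> B j = A" by blast+
        then obtain A A' where A: "A \<in> \<A>" "i = to_nat_on \<A> A" "B i = A"
          and A': "A' \<in> \<A>" "j = to_nat_on \<A> A'" "B j = A'" by blast
        have "A \<noteq> A'" using \<open>i \<noteq> j\<close> A A' by auto
        with disjointD[OF assms(2) A(1) A'(1)] show False using ne A A' by simp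
      qed
    qed
    show "(\<Union>n. B n) = \<Union>\<A>"
    proof
      show "(\<Union>n. B n) \<subseteq> \<Union>\<A>" using Bcases by fastforce
      show "\<Union>\<A> \<subseteq> (\<Union>n. B n)" using Bto by blast
    qed
    show "B n \<in> insert {} \<A>" for n using Bcases[of n] by auto
    show "B (to_nat_on \<A> A) = A" if "A \<in> \<A>" for A by (rule Bto[OF that])
    show "B n = {}" if "n \<notin> to_nat_on \<A> ` \<A>" for n using that by (simp add: B_def)
  qed
qed

lemma continuous_map_borel_measurable:
  assumes "continuous_map X euclidean f" "space M = topspace X" "\<And>S. openin X S \<Longrightarrow> S \<in> sets M"
  shows "f \<in> borel_measurable M"
proof (rule borel_measurableI)
  fix S :: "'b set" assume "open S"
  have "{x \<in> topspace X. f x \<in> S} = f -` S \<inter> space M" using assms(2) by auto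
  moreover have "openin X {x \<in> topspace X. f x \<in> S}"
    by (rule openin_continuous_map_preimage[OF assms(1)]) (simp add: \<open>open S\<close>)
  ultimately show "f -` S \<inter> space M \<in> sets M" using assms(3) by metis
qed

text \<open>A locale, because it is interpreted a second time for the restriction of the varifold to
  a balanced set.\<close>

locale radon_varifold =
  fixes m :: nat and U :: "(real^'n::finite) set" and V :: "'n varifold"
  assumes U: "open U" and varifold: "varifold m U V" and radon_fv: "radon_first_variation U V"
begin

abbreviation X :: "((real^'n) \<times> (real^'n) set) topology" where "X \<equiv> varifold_space m U"
abbreviation G :: "(real^'n) set set" where "G \<equiv> grassmannian m"
abbreviation \<delta> :: "(real^'n \<Rightarrow> real^'n) \<Rightarrow> real" where "\<delta> \<equiv> first_variation V"
abbreviation \<nu> :: "(real^'n) measure" where "\<nu> \<equiv> variation_measure U V"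
abbreviation \<mu> :: "(real^'n) measure" where "\<mu> \<equiv> weight U V"

lemma radon_V: "radon_measure X V" using varifold by (simp add: varifold_def)

lemma space_V: "space V = U \<times> G" using radon_space[OF radon_V] by simp

lemma openin_sets_V: "openin X S \<Longrightarrow> S \<in> sets V" by (rule radon_openin[OF radon_V])

lemma measurable_V: "continuous_map X euclidean f \<Longrightarrow> f \<in> borel_measurable V"
  by (rule continuous_map_borel_measurable) (auto simp: space_V openin_sets_V)

lemma fst_measurable: "fst \<in> measurable V (restrict_space borel U)"
proof (rule measurable_sigma_sets[where \<Omega> = U and A = "{S. openin (top_of_set U) S}"])
  show "sets (restrict_space borel U) = sigma_sets U {S. openin (top_of_set U) S}"
    using sets_borel_on_open[OF U] sets_borel_on[of "top_of_set U"] by simp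
  show "{S. openin (top_of_set U) S} \<subseteq> Pow U" using openin_subset by fastforce
  show "fst \<in> space V \<rightarrow> U" by (auto simp: space_V)
  fix S assume "S \<in> {S. openin (top_of_set U) S}"
  then have "openin X {p \<in> topspace X. fst p \<in> S}"
    by (intro openin_continuous_map_preimage[OF continuous_map_varifold_fst]) auto
  moreover have "{p \<in> topspace X. fst p \<in> S} = fst -` S \<inter> space V" by (auto simp: space_V)
  ultimately show "fst -` S \<inter> space V \<in> sets V" using openin_sets_V by metis
qed

lemma times_sets_V: "S \<in> sets (restrict_space borel U) \<Longrightarrow> S \<times> G \<in> sets V"
proof -
  assume S: "S \<in> sets (restrict_space borel U)"
  have "fst -` S \<inter> space V = S \<times> G"
    using S by (auto simp: space_V sets_restrict_borel_iff[OF U])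
  then show ?thesis using measurable_sets[OF fst_measurable S] by simp
qed

lemma sets_\<mu> [simp]: "sets \<mu> = sets (restrict_space borel U)" and space_\<mu> [simp]: "space \<mu> = U"
  by (simp_all add: weight_def space_restrict_space)

lemma emeasure_\<mu>: "S \<in> sets (restrict_space borel U) \<Longrightarrow> emeasure \<mu> S = emeasure V (S \<times> G)"
proof -
  assume S: "S \<in> sets (restrict_space borel U)"
  have "fst -` S \<inter> space V = S \<times> G"
    using S by (auto simp: space_V sets_restrict_borel_iff[OF U])
  then show ?thesis unfolding weight_def by (subst emeasure_distr[OF fst_measurable S]) simp
qed

lemma finite_V: "compact K \<Longrightarrow> K \<subseteq> U \<Longrightarrow> emeasure V (K \<times> G) < \<infinity>"
  using radon_V compactin_varifold_space[of K U m] by (simp add: radon_measure_def)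

text \<open>The integrand is bounded and carried by the support of \<open>g\<close> times the
  compact Grassmannian, a set of finite measure.\<close>

lemma integrable_vdiv:
  assumes g: "g \<in> test_fields U"
  shows "integrable V (vdiv g)"
proof -
  let ?K = "closure {z. g z \<noteq> 0}"
  have K: "compact ?K" "?K \<subseteq> U" using test_field_compact[OF g] test_field_subset[OF g] by auto
  obtain B where B: "\<And>p. snd p \<in> G \<Longrightarrow> \<bar>vdiv g p\<bar> \<le> B" using vdiv_bounded[OF g] by blast
  show ?thesis
  proof (rule integrableI_bounded_set[where A = "?K \<times> G" and B = B])
    show "?K \<times> G \<in> sets V" using K by (intro times_sets_V) (auto simp: sets_restrict_borel_iff[OF U])
    show "vdiv g \<in> borel_measurable V" by (rule measurable_V[OF vdiv_continuous[OF test_field_smooth[OF g]]])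
    show "emeasure V (?K \<times> G) < \<infinity>" by (rule finite_V[OF K])
    show "AE p in V. p \<in> ?K \<times> G \<longrightarrow> norm (vdiv g p) \<le> B" using B by (intro AE_I2) (auto simp: space_V)
    show "AE p in V. p \<notin> ?K \<times> G \<longrightarrow> vdiv g p = 0"
    proof (intro AE_I2 impI)
      fix p assume "p \<in> space V" "p \<notin> ?K \<times> G"
      then show "vdiv g p = 0" by (intro vdiv_outside) (cases p; simp add: space_V)
    qed
  qed
qed

lemma integrable_cc:
  assumes "f \<in> cc_functions X" shows "integrable V f"
proof -
  let ?K = "X closure_of {x \<in> topspace X. f x \<noteq> 0}"
  have f: "continuous_map X euclideanreal f" and K: "compactin X ?K"
    using assms by (auto simp: cc_functions_def)
  have sub: "{x \<in> topspace X. f x \<noteq> 0} \<subseteq> ?K" by (rule closure_of_subset) auto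
  have "compact (f ` ?K)" using image_compactin[OF K f] by simp
  then have "bounded (f ` ?K)" by (rule compact_imp_bounded)
  then obtain B where B: "B > 0" "\<forall>y\<in>f ` ?K. norm y \<le> B"
    unfolding bounded_pos by blast
  have op: "openin X (topspace X - ?K)" by (rule openin_diff[OF openin_topspace closedin_closure_of])
  have "topspace X - (topspace X - ?K) \<in> sets V"
    by (rule sets.Diff[OF openin_sets_V[OF openin_topspace] openin_sets_V[OF op]])
  then have Ks: "?K \<in> sets V" unfolding double_diff[OF closure_of_subset_topspace order.refl] .
  show ?thesis
  proof (rule integrableI_bounded_set[OF Ks measurable_V[OF f], where B = B])
    show "emeasure V ?K < \<infinity>" using radon_V K by (simp add: radon_measure_def)
    show "AE p in V. p \<in> ?K \<longrightarrow> norm (f p) \<le> B" using B(2) by (intro AE_I2) auto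
    show "AE p in V. p \<notin> ?K \<longrightarrow> f p = 0" using sub by (intro AE_I2) (auto simp: space_V)
  qed
qed

sublocale T: radon_functional U \<delta>
proof unfold_locales
  show "open U" by (rule U)
  show "\<delta> (\<lambda>z. f z + g z) = \<delta> f + \<delta> g" if "f \<in> test_fields U" "g \<in> test_fields U" for f g
    using that by (simp add: first_variation_vdiv vdiv_add test_field_smooth integrable_vdiv)
  show "\<delta> (\<lambda>z. c *\<^sub>R g z) = c * \<delta> g" if "g \<in> test_fields U" for c g
    using that by (simp add: first_variation_vdiv vdiv_scale test_field_smooth)
  show "radon_measure (top_of_set U) (total_variation U \<delta>)"
    using radon_fv by (simp add: radon_first_variation_def variation_measure_def)
qed

section \<open>The unit field of the first variation and a Borel representative\<close>

lemma total_variation_\<nu>: "total_variation U \<delta> = \<nu>" by (simp add: variation_measure_def)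

lemma radon_\<nu>: "radon_on_open U \<nu>"
  using T.radon_on_open_axioms by (simp add: total_variation_\<nu>)

lemma sets_\<nu> [simp]: "sets \<nu> = sets (restrict_space borel U)" and space_\<nu> [simp]: "space \<nu> = U"
  using radon_on_open.sets_eq[OF radon_\<nu>] radon_on_open.space_eq[OF radon_\<nu>] by auto

text \<open>The Borel field from \<open>representation\<close> is measurable for the completion with
  the same integrals, so the choice in \<open>variation_direction\<close> is not vacuous.\<close>

lemma variation_direction_spec:
  "variation_direction U V \<in> borel_measurable (completion \<nu>)"
  "z \<in> U \<Longrightarrow> norm (variation_direction U V z) = 1"
  "g \<in> test_fields U \<Longrightarrow> \<delta> g = (LINT z|completion \<nu>. g z \<bullet> variation_direction U V z)"
proof -
  obtain \<eta> where \<eta>: "\<eta> \<in> borel_measurable \<nu>" "\<forall>z\<in>U. norm (\<eta> z) = 1"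
     "\<forall>g\<in>test_fields U. \<delta> g = (LINT z|\<nu>. g z \<bullet> \<eta> z)"
    using T.representation unfolding total_variation_\<nu> by blast
  have "(LINT z|completion \<nu>. g z \<bullet> \<eta> z) = (LINT z|\<nu>. g z \<bullet> \<eta> z)" if "g \<in> test_fields U" for g
    using \<eta>(1) radon_on_open.borel_measurable[OF radon_\<nu> test_field_measurable[OF that]]
    by (intro integral_completion borel_measurable_inner)
  then have "\<exists>\<eta>. \<eta> \<in> borel_measurable (completion \<nu>) \<and> (\<forall>z\<in>U. norm (\<eta> z) = 1) \<and>
      (\<forall>g\<in>test_fields U. \<delta> g = (LINT z|completion \<nu>. g z \<bullet> \<eta> z))"
    using \<eta> by (intro exI[of _ \<eta>]) (auto intro: measurable_completion)
  from someI_ex[OF this] show "variation_direction U V \<in> borel_measurable (completion \<nu>)"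
    "z \<in> U \<Longrightarrow> norm (variation_direction U V z) = 1"
    "g \<in> test_fields U \<Longrightarrow> \<delta> g = (LINT z|completion \<nu>. g z \<bullet> variation_direction U V z)"
    unfolding variation_direction_def by auto
qed

text \<open>Borel representatives modulo null sets are taken for the real coordinates; replacing the
  values that are not unit vectors then changes a null set only.\<close>

lemma eta_exists:
  "\<exists>\<eta>\<in>borel_measurable \<nu>. (\<forall>z\<in>U. norm (\<eta> z) = 1) \<and> (AE z in \<nu>. variation_direction U V z = \<eta> z)"
proof -
  let ?d = "variation_direction U V"
  have "\<forall>b\<in>Basis. \<exists>k\<in>borel_measurable \<nu>. AE z in \<nu>. ?d z \<bullet> b = k z"
    using variation_direction_spec(1) by (intro ballI completion_ex_borel_measurable_real) auto
  then obtain k where k: "\<forall>b\<in>Basis. k b \<in> borel_measurable \<nu> \<and> (AE z in \<nu>. ?d z \<bullet> b = k b z)"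
    unfolding Bex_def bchoice_iff by blast
  define \<eta> where "\<eta> z = (\<Sum>b\<in>Basis. k b z *\<^sub>R b)" for z
  have \<eta>m: "\<eta> \<in> borel_measurable \<nu>"
    unfolding \<eta>_def using k by (intro borel_measurable_sum borel_measurable_scaleR) auto
  have "AE z in \<nu>. \<forall>b\<in>Basis. ?d z \<bullet> b = k b z" using k by (subst AE_finite_all) auto
  then have ae: "AE z in \<nu>. ?d z = \<eta> z"
  proof eventually_elim
    case (elim z)
    have "?d z = (\<Sum>b\<in>Basis. (?d z \<bullet> b) *\<^sub>R b)" by (simp add: euclidean_representation)
    also have "\<dots> = \<eta> z" unfolding \<eta>_def using elim by (intro sum.cong) auto
    finally show ?case .
  qed
  define e :: "real^'n" where "e = axis undefined 1"
  define \<eta>' where "\<eta>' z = (if norm (\<eta> z) = 1 then \<eta> z else e)" for z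
  have "\<eta>' \<in> borel_measurable \<nu>" unfolding \<eta>'_def using \<eta>m by measurable
  moreover have "\<forall>z\<in>U. norm (\<eta>' z) = 1" by (simp add: \<eta>'_def e_def)
  moreover have "AE z in \<nu>. ?d z = \<eta>' z"
    using ae AE_space
  proof eventually_elim
    case (elim z)
    then show ?case using variation_direction_spec(2)[of z] by (simp add: \<eta>'_def)
  qed
  ultimately show ?thesis by blast
qed

definition eta where
  "eta = (SOME \<eta>. \<eta> \<in> borel_measurable \<nu> \<and> (\<forall>z\<in>U. norm (\<eta> z) = 1) \<and> (AE z in \<nu>. variation_direction U V z = \<eta> z))"

lemma eta: "eta \<in> borel_measurable \<nu>" "z \<in> U \<Longrightarrow> norm (eta z) = 1"
  "AE z in \<nu>. variation_direction U V z = eta z"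
proof -
  have "\<exists>\<eta>. \<eta> \<in> borel_measurable \<nu> \<and> (\<forall>z\<in>U. norm (\<eta> z) = 1) \<and> (AE z in \<nu>. variation_direction U V z = \<eta> z)"
    using eta_exists by blast
  from someI_ex[OF this] show "eta \<in> borel_measurable \<nu>" "z \<in> U \<Longrightarrow> norm (eta z) = 1"
    "AE z in \<nu>. variation_direction U V z = eta z"
    unfolding eta_def by auto
qed

lemma integrable_eta:
  assumes "g \<in> test_fields U" shows "integrable \<nu> (\<lambda>z. g z \<bullet> eta z)"
  by (rule radon_on_open.dual_integrable[OF radon_\<nu> assms eta(1), of 1]) (simp add: eta(2))

lemma eta_inner_measurable:
  "g \<in> test_fields U \<Longrightarrow> (\<lambda>z. g z \<bullet> eta z) \<in> borel_measurable \<nu>"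
  using borel_measurable_integrable[OF integrable_eta] .

text \<open>Changing the set and the field almost everywhere leaves the integral unchanged; this
  removes the completion and the chosen field from later arguments.\<close>

lemma restricted_variation_eta:
  assumes E: "E \<in> sets (completion \<nu>)" and S: "S \<in> sets \<nu>" and ae: "AE z in \<nu>. z \<in> E \<longleftrightarrow> z \<in> S"
    and g: "g \<in> test_fields U"
  shows "restricted_variation U V E g = (LINT z|\<nu>. indicator S z * (g z \<bullet> eta z))"
proof -
  have gm: "g \<in> borel_measurable \<nu>"
    by (rule radon_on_open.borel_measurable[OF radon_\<nu> test_field_measurable[OF g]])
  have "restricted_variation U V E g = (LINT z|completion \<nu>. indicator E z * (g z \<bullet> variation_direction U V z))"
    by (simp add: restricted_variation_def set_lebesgue_integral_def)
  also have "\<dots> = (LINT z|completion \<nu>. indicator S z * (g z \<bullet> eta z))"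
  proof (rule integral_cong_AE)
    show "(\<lambda>z. indicator E z * (g z \<bullet> variation_direction U V z)) \<in> borel_measurable (completion \<nu>)"
      using E variation_direction_spec(1) measurable_completion[OF gm]
      by (intro borel_measurable_times borel_measurable_indicator borel_measurable_inner)
    show "(\<lambda>z. indicator S z * (g z \<bullet> eta z)) \<in> borel_measurable (completion \<nu>)"
      using S eta_inner_measurable[OF g] by (intro measurable_completion borel_measurable_times borel_measurable_indicator)
    show "AE z in completion \<nu>. indicator E z * (g z \<bullet> variation_direction U V z) = indicator S z * (g z \<bullet> eta z)"
      by (rule AE_completion) (use ae eta(3) in \<open>eventually_elim, simp add: indicator_def\<close>)
  qed
  also have "\<dots> = (LINT z|\<nu>. indicator S z * (g z \<bullet> eta z))"
    using S eta_inner_measurable[OF g] by (intro integral_completion borel_measurable_times borel_measurable_indicator)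
  finally show ?thesis .
qed

lemma repr_eta:
  assumes g: "g \<in> test_fields U" shows "\<delta> g = (LINT z|\<nu>. g z \<bullet> eta z)"
proof -
  have gm: "g \<in> borel_measurable \<nu>"
    by (rule radon_on_open.borel_measurable[OF radon_\<nu> test_field_measurable[OF g]])
  have "\<delta> g = (LINT z|completion \<nu>. g z \<bullet> eta z)"
    unfolding variation_direction_spec(3)[OF g]
  proof (rule integral_cong_AE)
    show "(\<lambda>z. g z \<bullet> variation_direction U V z) \<in> borel_measurable (completion \<nu>)"
      using variation_direction_spec(1) measurable_completion[OF gm] by (intro borel_measurable_inner)
    show "AE z in completion \<nu>. g z \<bullet> variation_direction U V z = g z \<bullet> eta z"
      by (rule AE_completion) (use eta(3) in \<open>eventually_elim, simp\<close>)
  qed (use eta_inner_measurable[OF g] in \<open>rule measurable_completion\<close>)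
  also have "\<dots> = (LINT z|\<nu>. g z \<bullet> eta z)"
    using eta_inner_measurable[OF g] by (rule integral_completion)
  finally show ?thesis .
qed

subsection \<open>Measurable sets and their boundary\<close>

abbreviation total where "total \<equiv> sum_measure \<mu> \<nu>"

lemma sets_total [simp]: "sets total = sets (restrict_space borel U)" and space_total [simp]: "space total = U"
  by (simp_all add: sum_measure_def space_restrict_space sets.sigma_algebra_axioms
      sigma_algebra.sets_measure_of_eq[OF sets.sigma_algebra_axioms[of "restrict_space borel U", unfolded space_restrict_space, simplified]]
      sets.space_closed space_measure_of_conv)

lemma emeasure_total:
  assumes "A \<in> sets (restrict_space borel U)"
  shows "emeasure total A = emeasure \<mu> A + emeasure \<nu> A"
proof (rule emeasure_measure_of[OF sum_measure_def])
  show "countably_additive (sets total) (\<lambda>A. emeasure \<mu> A + emeasure \<nu> A)"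
    unfolding countably_additive_def
  proof (intro allI impI)
    fix A :: "nat \<Rightarrow> _" assume A: "range A \<subseteq> sets total" "disjoint_family A"
    have "(\<Sum>i. emeasure \<mu> (A i) + emeasure \<nu> (A i)) = (\<Sum>i. emeasure \<mu> (A i)) + (\<Sum>i. emeasure \<nu> (A i))"
      by (intro suminf_add[symmetric]) auto
    then show "(\<Sum>i. emeasure \<mu> (A i) + emeasure \<nu> (A i)) = emeasure \<mu> (\<Union> (range A)) + emeasure \<nu> (\<Union> (range A))"
      using A by (simp add: suminf_emeasure)
  qed
qed (use assms in \<open>auto simp: positive_def sets_restrict_borel_iff[OF U]\<close>)

lemma sets_measurable_sets: "A \<in> sets (restrict_space borel U) \<Longrightarrow> A \<in> measurable_sets U V"
  by (simp add: measurable_sets_def)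

text \<open>A member of the completion is a Borel set up to part of a Borel null set, and a null set
  of the sum is null for the weight and for the variation at once.\<close>

lemma measurable_setsE:
  assumes "E \<in> measurable_sets U V"
  obtains S N where "S \<in> sets (restrict_space borel U)" "N \<in> sets (restrict_space borel U)"
    "emeasure \<mu> N = 0" "emeasure \<nu> N = 0" "S \<subseteq> E" "E \<subseteq> S \<union> N"
proof -
  from assms have "E \<in> {S \<union> N | S N N'. S \<in> sets total \<and> N' \<in> null_sets total \<and> N \<subseteq> N'}"
    by (simp add: measurable_sets_def sets_completion)
  then obtain S N N' where *: "E = S \<union> N" "S \<in> sets total" "N' \<in> null_sets total" "N \<subseteq> N'"
    by blast
  have N': "N' \<in> sets (restrict_space borel U)" "emeasure total N' = 0" using *(3) by (auto simp: null_sets_def)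
  then have "emeasure \<mu> N' = 0" "emeasure \<nu> N' = 0" using emeasure_total[OF N'(1)] by auto
  with * N' show ?thesis by (intro that[of S N']) auto
qed

lemma sets_completionI:
  assumes "S \<in> sets M" "N \<in> sets M" "emeasure M N = 0" "S \<subseteq> E" "E \<subseteq> S \<union> N"
  shows "E \<in> sets (completion M)" "emeasure (completion M) E = emeasure M S"
    and "AE z in M. z \<in> E \<longleftrightarrow> z \<in> S"
proof -
  have N: "N \<in> null_sets M" using assms by auto
  have D: "E - S \<in> null_sets (completion M)"
    by (rule null_sets_completion_subset[OF _ null_sets_completionI[OF N]]) (use assms in auto)
  have E: "E = S \<union> (E - S)" using assms by auto
  show "E \<in> sets (completion M)"
    by (subst E) (use D assms(1) in \<open>auto simp del: Un_Diff_cancel\<close>)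
  have "emeasure (completion M) (S \<union> (E - S)) = emeasure (completion M) S"
    by (rule emeasure_Un_null_set[OF _ D]) (use assms(1) in auto)
  then show "emeasure (completion M) E = emeasure M S" using E assms(1) by simp
  show "AE z in M. z \<in> E \<longleftrightarrow> z \<in> S"
    using AE_not_in[OF N] by eventually_elim (use assms in auto)
qed

text \<open>The \<open>V\<close> measure of \<open>N \<times> G\<close> is the weight of
  \<open>N\<close>, so the completion does not distinguish \<open>E\<close> from
  \<open>S\<close>.\<close>

lemma varifold_restriction_eq:
  assumes S: "S \<in> sets (restrict_space borel U)" "N \<in> sets (restrict_space borel U)"
    "emeasure \<mu> N = 0" "S \<subseteq> E" "E \<subseteq> S \<union> N"
  shows "varifold_restriction m V E = density V (indicator (S \<times> G))"
proof -
  have "emeasure (completion V) (B \<inter> (E \<times> G)) = emeasure V (S \<times> G \<inter> B)" if B: "B \<in> sets V" for B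
  proof (rule sets_completionI(2)[where N = "N \<times> G"])
    show "emeasure V (N \<times> G) = 0" using S(3) emeasure_\<mu>[OF S(2)] by simp
  qed (use S B times_sets_V in auto)
  then have "varifold_restriction m V E = measure_of (space V) (sets V) (\<lambda>B. emeasure V (S \<times> G \<inter> B))"
    unfolding varifold_restriction_def measure_restriction_def
    by (intro measure_of_eq sets.space_closed) (simp add: sets.sigma_sets_eq)
  also have "\<dots> = measure_of (space V) (sets V) (\<lambda>B. \<integral>\<^sup>+p. indicator (S \<times> G) p * indicator B p \<partial>V)"
  proof (intro measure_of_eq sets.space_closed)
    fix B assume "B \<in> sigma_sets (space V) (sets V)"
    then have B: "B \<in> sets V" by (simp add: sets.sigma_sets_eq)
    show "emeasure V (S \<times> G \<inter> B) = (\<integral>\<^sup>+p. indicator (S \<times> G) p * indicator B p \<partial>V)"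
      using times_sets_V[OF S(1)] B by (simp add: indicator_inter_arith[symmetric])
  qed
  finally show ?thesis by (simp add: density_def)
qed

lemma first_variation_density:
  assumes S: "S \<in> sets (restrict_space borel U)" and g: "g \<in> test_fields U"
  shows "first_variation (density V (indicator (S \<times> G))) g = (LINT p|V. indicator (S \<times> G) p * vdiv g p)"
proof -
  have "density V (indicator (S \<times> G)) = density V (\<lambda>p. ennreal (indicator (S \<times> G) p))"
    by (intro density_cong) (use times_sets_V[OF S] in \<open>auto split: split_indicator\<close>)
  then show ?thesis
    unfolding first_variation_vdiv
    using times_sets_V[OF S] borel_measurable_integrable[OF integrable_vdiv[OF g]]
    by (simp add: integral_density)
qed

text \<open>Vanishing distributional boundary for Borel sets, free of completions and choices: the
  first variation of the restriction is the restriction of the first variation.\<close>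

definition balanced where
  "balanced S \<longleftrightarrow> S \<in> sets (restrict_space borel U) \<and> (\<forall>g\<in>test_fields U.
     (LINT z|\<nu>. indicator S z * (g z \<bullet> eta z)) = (LINT p|V. indicator (S \<times> G) p * vdiv g p))"

lemma zero_boundary_iff_balanced:
  assumes S: "S \<in> sets (restrict_space borel U)" "N \<in> sets (restrict_space borel U)"
    "emeasure \<mu> N = 0" "emeasure \<nu> N = 0" "S \<subseteq> E" "E \<subseteq> S \<union> N"
  shows "zero_boundary m U V E \<longleftrightarrow> balanced S"
proof -
  have E: "E \<in> sets (completion \<nu>)" "AE z in \<nu>. z \<in> E \<longleftrightarrow> z \<in> S"
    using sets_completionI[of S \<nu> N E] S by auto
  have "distributional_boundary m U V E g =
      (LINT z|\<nu>. indicator S z * (g z \<bullet> eta z)) - (LINT p|V. indicator (S \<times> G) p * vdiv g p)"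
    if g: "g \<in> test_fields U" for g
    unfolding distributional_boundary_def varifold_restriction_eq[OF S(1,2,3,5,6)] first_variation_density[OF S(1) g]
    using restricted_variation_eta[OF E(1) _ E(2) g] S(1) by simp
  then show ?thesis using S(1) by (simp add: zero_boundary_def balanced_def)
qed

lemma balanced_sets: "balanced S \<Longrightarrow> S \<in> sets (restrict_space borel U)"
  by (simp add: balanced_def)

lemma integrable_indicator_eta:
  "S \<in> sets (restrict_space borel U) \<Longrightarrow> g \<in> test_fields U \<Longrightarrow> integrable \<nu> (\<lambda>z. indicator S z * (g z \<bullet> eta z))"
  using integrable_mult_indicator[OF _ integrable_eta, of S g] by simp

lemma integrable_indicator_vdiv:
  "S \<in> sets (restrict_space borel U) \<Longrightarrow> g \<in> test_fields U \<Longrightarrow> integrable V (\<lambda>p. indicator (S \<times> G) p * vdiv g p)"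
  using integrable_mult_indicator[OF times_sets_V integrable_vdiv, of S g] by simp

lemma balanced_U: "balanced U"
proof -
  have Us: "U \<in> sets (restrict_space borel U)" using U by (simp add: sets_restrict_borel_iff)
  have "(LINT z|\<nu>. indicator U z * (g z \<bullet> eta z)) = (LINT p|V. indicator (U \<times> G) p * vdiv g p)"
    if g: "g \<in> test_fields U" for g
  proof -
    have "(LINT z|\<nu>. indicator U z * (g z \<bullet> eta z)) = (LINT z|\<nu>. g z \<bullet> eta z)"
      by (intro Bochner_Integration.integral_cong) auto
    also have "\<dots> = (LINT p|V. vdiv g p)" by (simp add: repr_eta[OF g, symmetric] first_variation_vdiv)
    also have "\<dots> = (LINT p|V. indicator (U \<times> G) p * vdiv g p)"
      by (intro Bochner_Integration.integral_cong) (auto simp: space_V)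
    finally show ?thesis .
  qed
  then show ?thesis using Us by (simp add: balanced_def)
qed

text \<open>The defining identity is linear in the indicator, and for nested sets the indicator of
  the difference is the difference of the indicators. An intersection of two sets has no such linear
  formula.\<close>

lemma balanced_Diff:
  assumes A: "balanced A" and B: "balanced B" and sub: "B \<subseteq> A"
  shows "balanced (A - B)"
proof -
  have s: "A \<in> sets (restrict_space borel U)" "B \<in> sets (restrict_space borel U)"
    using A B balanced_sets by auto
  have i1: "indicator (A - B) z = (indicator A z - indicator B z :: real)" for z
    using sub by (auto simp: indicator_def)
  have i2: "indicator ((A - B) \<times> G) p = (indicator (A \<times> G) p - indicator (B \<times> G) p :: real)" for p
    using sub by (cases p) (auto simp: indicator_def)
  show ?thesis
    unfolding balanced_def
  proof (intro conjI ballI)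
    fix g assume g: "g \<in> test_fields U"
    show "(LINT z|\<nu>. indicator (A - B) z * (g z \<bullet> eta z)) = (LINT p|V. indicator ((A - B) \<times> G) p * vdiv g p)"
      unfolding i1 i2 left_diff_distrib
      using A B g integrable_indicator_eta[OF s(1) g] integrable_indicator_eta[OF s(2) g]
        integrable_indicator_vdiv[OF s(1) g] integrable_indicator_vdiv[OF s(2) g]
      by (simp add: balanced_def)
  qed (use s in auto)
qed

text \<open>Dominated convergence: by disjointness the partial sums of the indicators are at most
  1.\<close>

lemma integral_disjoint_UN:
  fixes f :: "'b \<Rightarrow> real"
  assumes "integrable M f" "\<And>i. A i \<in> sets M" "disjoint_family A"
  shows "(\<lambda>i. LINT x|M. indicator (A i) x * f x) sums (LINT x|M. indicator (\<Union>i. A i) x * f x)"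
proof -
  have dis: "A i \<inter> A j = {}" if "i \<noteq> j" for i j
    using assms(3) that by (auto simp: disjoint_family_on_def)
  have sm: "(\<lambda>i. indicator (A i) x :: real) sums indicator (\<Union>i. A i) x" for x
    by (rule indicator_sums[OF dis])
  have ii: "integrable M (\<lambda>x. indicator (A i) x * f x)" for i
    using integrable_mult_indicator[OF assms(2,1)] by simp
  have fm: "f \<in> borel_measurable M" using assms(1) by simp
  have "(\<lambda>n. LINT x|M. (\<Sum>i<n. indicator (A i) x * f x)) \<longlonglongrightarrow> (LINT x|M. indicator (\<Union>i. A i) x * f x)"
  proof (rule integral_dominated_convergence[where w = "\<lambda>x. \<bar>f x\<bar>"])
    show "(\<lambda>x. indicator (\<Union>i. A i) x * f x) \<in> borel_measurable M"
      using assms(2) fm by (intro borel_measurable_times borel_measurable_indicator) auto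
    show "(\<lambda>x. \<Sum>i<n. indicator (A i) x * f x) \<in> borel_measurable M" for n
      using ii by (intro borel_measurable_sum) simp
    show "AE x in M. (\<lambda>n. \<Sum>i<n. indicator (A i) x * f x) \<longlonglongrightarrow> indicator (\<Union>i. A i) x * f x"
      using sums_mult2[OF sm] unfolding sums_def by (intro AE_I2)
    show "AE x in M. norm (\<Sum>i<n. indicator (A i) x * f x) \<le> \<bar>f x\<bar>" for n
    proof (rule AE_I2)
      fix x
      have "(\<Sum>i<n. indicator (A i) x :: real) \<le> indicator (\<Union>i. A i) x"
        using sum_le_suminf[OF sums_summable[OF sm], of "{..<n}" x] sums_unique[OF sm, of x] by simp
      also have "\<dots> \<le> 1" by (simp add: indicator_def)
      finally have "\<bar>\<Sum>i<n. indicator (A i) x :: real\<bar> * \<bar>f x\<bar> \<le> 1 * \<bar>f x\<bar>"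
        by (intro mult_right_mono) (auto simp: abs_of_nonneg sum_nonneg)
      then show "norm (\<Sum>i<n. indicator (A i) x * f x) \<le> \<bar>f x\<bar>"
        by (simp add: sum_distrib_right[symmetric] abs_mult)
    qed
  qed (use assms(1) in auto)
  moreover have "(LINT x|M. (\<Sum>i<n. indicator (A i) x * f x)) = (\<Sum>i<n. LINT x|M. indicator (A i) x * f x)" for n
    by (rule Bochner_Integration.integral_sum[OF ii])
  ultimately show ?thesis by (simp only: sums_def)
qed

lemma balanced_UN:
  assumes A: "\<And>i::nat. balanced (A i)" and d: "disjoint_family A"
  shows "balanced (\<Union>i. A i)"
proof -
  have s: "A i \<in> sets (restrict_space borel U)" for i using A balanced_sets by auto
  have d2: "disjoint_family (\<lambda>i. A i \<times> G)" using d by (auto simp: disjoint_family_on_def)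
  show ?thesis
    unfolding balanced_def
  proof (intro conjI ballI)
    fix g assume g: "g \<in> test_fields U"
    have "(\<lambda>i. LINT z|\<nu>. indicator (A i) z * (g z \<bullet> eta z)) sums (LINT z|\<nu>. indicator (\<Union>i. A i) z * (g z \<bullet> eta z))"
      by (rule integral_disjoint_UN[OF integrable_eta[OF g] _ d]) (simp add: s)
    moreover have "(\<lambda>i. LINT p|V. indicator (A i \<times> G) p * vdiv g p) sums (LINT p|V. indicator (\<Union>i. A i \<times> G) p * vdiv g p)"
      by (rule integral_disjoint_UN[OF integrable_vdiv[OF g] times_sets_V[OF s] d2])
    moreover have "(\<Union>i. A i \<times> G) = (\<Union>i. A i) \<times> G" by auto
    moreover have "(LINT z|\<nu>. indicator (A i) z * (g z \<bullet> eta z)) = (LINT p|V. indicator (A i \<times> G) p * vdiv g p)" for i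
      using A[of i] g by (simp add: balanced_def)
    ultimately show "(LINT z|\<nu>. indicator (\<Union>i. A i) z * (g z \<bullet> eta z)) = (LINT p|V. indicator ((\<Union>i. A i) \<times> G) p * vdiv g p)"
      by (simp add: sums_unique2)
  qed (use s in auto)
qed

text \<open>The intersection is \<open>F 0\<close> minus the disjoint union of the steps
  \<open>F i - F (Suc i)\<close>, so nested differences and disjoint unions suffice.\<close>

lemma balanced_INT:
  assumes F: "\<And>i::nat. balanced (F i)" and dec: "decseq F"
  shows "balanced (\<Inter>i. F i)"
proof -
  let ?D = "\<lambda>i. F i - F (Suc i)"
  have D: "balanced (\<Union>i. ?D i)"
  proof (rule balanced_UN)
    show "balanced (?D i)" for i using F dec by (intro balanced_Diff) (auto simp: decseq_Suc_iff)
    show "disjoint_family ?D"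
      unfolding disjoint_family_on_def
    proof (intro ballI impI)
      fix i j :: nat assume "i \<noteq> j"
      then consider "Suc i \<le> j" | "Suc j \<le> i" by linarith
      then show "?D i \<inter> ?D j = {}"
        by cases (use decseqD[OF dec] in fastforce)+
    qed
  qed
  have "x \<in> F n" if "x \<in> F 0" "x \<notin> (\<Union>i. ?D i)" for x n
    using that by (induction n) auto
  moreover have "F n \<subseteq> F 0" for n using decseqD[OF dec, of 0 n] by simp
  ultimately have "(\<Inter>i. F i) = F 0 - (\<Union>i. ?D i)" by fast
  moreover have "balanced (F 0 - (\<Union>i. ?D i))"
    using decseqD[OF dec, of 0] by (intro balanced_Diff[OF F D]) auto
  ultimately show ?thesis by simp
qed

lemma finite_exhaustion_V: "\<exists>Q. finite_exhaustion X V Q"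
proof -
  obtain C Q where Q: "\<And>k. compact (C k)" "\<And>k. C k \<subseteq> U" "\<And>k. Q k \<subseteq> C k" "\<And>k. open (Q k)"
    "incseq Q" "(\<Union>k. Q k) = U"
    using radon_on_open.exhaustion[OF radon_\<nu>] by metis
  have "finite_exhaustion X V (\<lambda>k. Q k \<times> G)"
    unfolding finite_exhaustion_def
  proof (intro conjI allI)
    fix k
    have QU: "Q k \<subseteq> U" using Q(2,3) by blast
    have "openin X {p \<in> topspace X. fst p \<in> Q k}"
      using Q(4)[of k] QU U by (intro openin_continuous_map_preimage[OF continuous_map_varifold_fst]) (simp add: openin_open_eq)
    moreover have "{p \<in> topspace X. fst p \<in> Q k} = Q k \<times> G" using QU by auto
    ultimately show "openin X (Q k \<times> G)" by simp
    have "emeasure V (Q k \<times> G) \<le> emeasure V (C k \<times> G)"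
      using Q(1,2,3)[of k] by (intro emeasure_mono times_sets_V) (auto simp: sets_restrict_borel_iff[OF U] borel_compact)
    then show "emeasure V (Q k \<times> G) < \<infinity>" using finite_V[OF Q(1,2)] by (rule le_less_trans)
  qed (use Q(5,6) in \<open>auto simp: incseq_def dest: subsetD\<close>)
  then show ?thesis by blast
qed

subsection \<open>Restriction to balanced sets\<close>

text \<open>For balanced \<open>A\<close> the first variation of the restriction is integration
  against \<open>eta\<close> times the indicator of \<open>A\<close>. The norm of this field is that
  indicator, so \<open>total_variation_density\<close> identifies the total variation, which is
  therefore Radon again.\<close>

lemma restriction:
  assumes A: "balanced A"
  shows "radon_varifold m U (density V (indicator (A \<times> G)))"
    and "variation_measure U (density V (indicator (A \<times> G))) = density \<nu> (indicator A)"
proof -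
  let ?W = "density V (indicator (A \<times> G))"
  have As: "A \<in> sets (restrict_space borel U)" using A balanced_sets by auto
  obtain Q where Q: "finite_exhaustion X V Q" using finite_exhaustion_V by blast
  have W: "varifold m U ?W"
    unfolding varifold_def by (rule radon_density_indicator[OF radon_V Q times_sets_V[OF As]])
  have dW: "first_variation ?W g = (LINT z|\<nu>. g z \<bullet> (indicator A z *\<^sub>R eta z))" if g: "g \<in> test_fields U" for g
    using A g by (simp add: first_variation_density[OF As g] balanced_def)
  have "total_variation U (first_variation ?W) = density \<nu> (indicator A)"
  proof (rule total_variation_density[OF radon_\<nu>])
    show "field_functional U (first_variation ?W)"
    proof unfold_locales
      have i: "integrable V (\<lambda>p. indicator (A \<times> G) p * vdiv g p)" if "g \<in> test_fields U" for g
        using integrable_indicator_vdiv[OF As that] .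
      show "first_variation ?W (\<lambda>z. f z + g z) = first_variation ?W f + first_variation ?W g"
        if fg: "f \<in> test_fields U" "g \<in> test_fields U" for f g
        unfolding first_variation_density[OF As test_field_add(1)[OF fg]] first_variation_density[OF As fg(1)]
          first_variation_density[OF As fg(2)]
        using i[OF fg(1)] i[OF fg(2)] by (simp add: vdiv_add test_field_smooth[OF fg(1)] test_field_smooth[OF fg(2)] distrib_left)
      show "first_variation ?W (\<lambda>z. c *\<^sub>R g z) = c * first_variation ?W g" if g: "g \<in> test_fields U" for c g
        unfolding first_variation_density[OF As test_field_scale(1)[OF smooth_const g]] first_variation_density[OF As g]
          integral_mult_right_zero[symmetric]
        by (simp add: vdiv_scale[OF test_field_smooth[OF g]] mult_ac)
    qed (rule U)
    show "(\<lambda>z. indicator A z *\<^sub>R eta z) \<in> borel_measurable \<nu>" using As eta(1) by (intro borel_measurable_scaleR borel_measurable_indicator) auto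
    show "norm (indicator A z *\<^sub>R eta z) \<le> 1" if "z \<in> U" for z using eta(2)[OF that] by (simp add: indicator_def)
    show "A \<in> sets \<nu>" using As by simp
    show "AE z in \<nu>. norm (indicator A z *\<^sub>R eta z) = indicator A z"
      using eta(2) by (intro AE_I2) (simp add: indicator_def)
  qed (rule dW)
  then show eq: "variation_measure U ?W = density \<nu> (indicator A)"
    by (simp add: variation_measure_def)
  have "radon_on_open U (density \<nu> (indicator A))"
    using As by (intro radon_on_open.restrict[OF radon_\<nu>]) simp
  then have "radon_first_variation U ?W"
    by (simp add: radon_first_variation_def eq radon_on_open_def)
  then show "radon_varifold m U ?W" using U W by (simp add: radon_varifold_def)
qed

lemma restriction_weight:
  assumes "A \<in> sets (restrict_space borel U)" "S \<in> sets (restrict_space borel U)"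
    "radon_varifold m U (density V (indicator (A \<times> G)))"
  shows "emeasure (weight U (density V (indicator (A \<times> G)))) S = emeasure \<mu> (S \<inter> A)"
proof -
  have "A \<times> G \<inter> S \<times> G = (S \<inter> A) \<times> G" by auto
  then show ?thesis
    using assms times_sets_V
    by (simp add: radon_varifold.emeasure_\<mu>[OF assms(3,2)] emeasure_density_indicator emeasure_\<mu> sets.Int)
qed

lemma integral_density_indicator:
  fixes f :: "'b \<Rightarrow> real"
  assumes "A \<in> sets M" "f \<in> borel_measurable M"
  shows "(LINT x|density M (indicator A). f x) = (LINT x|M. indicator A x * f x)"
proof -
  have "density M (indicator A) = density M (\<lambda>p. ennreal (indicator A p))"
    by (intro density_cong) (use assms in \<open>auto split: split_indicator\<close>)
  then show ?thesis using assms by (simp add: integral_density)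
qed

text \<open>The unit fields of \<open>V\<close> and of the restriction agree almost everywhere for
  the restricted variation, since both represent the same first variation. The identity for
  \<open>S\<close> in the restriction then becomes the one for \<open>S \<inter> A\<close> in
  \<open>V\<close>.\<close>

lemma restriction_balanced:
  assumes A: "balanced A" and S: "S \<in> sets (restrict_space borel U)"
  shows "radon_varifold.balanced m U (density V (indicator (A \<times> G))) S \<longleftrightarrow> balanced (S \<inter> A)"
proof -
  let ?W = "density V (indicator (A \<times> G))"
  have As: "A \<in> sets (restrict_space borel U)" using A balanced_sets by auto
  interpret W: radon_varifold m U ?W by (rule restriction(1)[OF A])
  note \<nu>W = restriction(2)[OF A]
  have "AE z in W.\<nu>. W.eta z = eta z"
  proof (rule radon_on_open.test_field_integral_unique[OF W.radon_\<nu> W.eta(1)])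
    show "eta \<in> borel_measurable W.\<nu>" using eta(1) by (simp add: \<nu>W)
    show "norm (W.eta z) \<le> 1" "norm (eta z) \<le> 1" if "z \<in> U" for z using that W.eta(2) eta(2) by auto
    fix g assume g: "g \<in> test_fields U"
    have "(LINT z|W.\<nu>. g z \<bullet> W.eta z) = first_variation ?W g" by (rule W.repr_eta[OF g, symmetric])
    also have "\<dots> = (LINT z|\<nu>. indicator A z * (g z \<bullet> eta z))"
      using A g by (simp add: first_variation_density[OF As g] balanced_def)
    also have "\<dots> = (LINT z|W.\<nu>. g z \<bullet> eta z)"
      unfolding \<nu>W using As eta_inner_measurable[OF g] by (simp add: integral_density_indicator)
    finally show "(LINT z|W.\<nu>. g z \<bullet> W.eta z) = (LINT z|W.\<nu>. g z \<bullet> eta z)" .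
  qed
  note ae = this
  have 1: "(LINT z|W.\<nu>. indicator S z * (g z \<bullet> W.eta z)) = (LINT z|\<nu>. indicator (S \<inter> A) z * (g z \<bullet> eta z))"
    if g: "g \<in> test_fields U" for g
  proof -
    have ms: "(\<lambda>z. indicator S z * (g z \<bullet> eta z)) \<in> borel_measurable \<nu>"
      using S eta_inner_measurable[OF g] by (intro borel_measurable_times borel_measurable_indicator) auto
    have "(LINT z|W.\<nu>. indicator S z * (g z \<bullet> W.eta z)) = (LINT z|W.\<nu>. indicator S z * (g z \<bullet> eta z))"
    proof (rule integral_cong_AE)
      show "(\<lambda>z. indicator S z * (g z \<bullet> W.eta z)) \<in> borel_measurable W.\<nu>"
        using S W.eta_inner_measurable[OF g] by (intro borel_measurable_times borel_measurable_indicator) auto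
      show "(\<lambda>z. indicator S z * (g z \<bullet> eta z)) \<in> borel_measurable W.\<nu>" using ms by (simp add: \<nu>W)
      show "AE z in W.\<nu>. indicator S z * (g z \<bullet> W.eta z) = indicator S z * (g z \<bullet> eta z)"
        using ae by eventually_elim simp
    qed
    also have "\<dots> = (LINT z|\<nu>. indicator A z * (indicator S z * (g z \<bullet> eta z)))"
      unfolding \<nu>W by (rule integral_density_indicator[OF _ ms]) (use As in auto)
    also have "\<dots> = (LINT z|\<nu>. indicator (S \<inter> A) z * (g z \<bullet> eta z))"
      by (simp add: indicator_inter_arith mult_ac)
    finally show ?thesis .
  qed
  have 2: "(LINT p|?W. indicator (S \<times> G) p * vdiv g p) = (LINT p|V. indicator ((S \<inter> A) \<times> G) p * vdiv g p)"
    if g: "g \<in> test_fields U" for g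
  proof -
    have i: "indicator ((S \<inter> A) \<times> G) p = (indicator (A \<times> G) p * indicator (S \<times> G) p :: real)" for p :: "(real^'n) \<times> (real^'n) set"
      by (cases p) (auto simp: indicator_def)
    show ?thesis
      using times_sets_V[OF As] borel_measurable_integrable[OF integrable_indicator_vdiv[OF S g]]
      by (simp add: integral_density_indicator i mult.assoc)
  qed
  show ?thesis
    using S As by (auto simp: W.balanced_def balanced_def 1 2)
qed

section \<open>Atoms and the components they determine\<close>

definition atomic where
  "atomic A \<longleftrightarrow> balanced A \<and> emeasure \<mu> A \<noteq> 0 \<and>
     (\<forall>S. balanced S \<longrightarrow> S \<subseteq> A \<longrightarrow> emeasure \<mu> S = 0 \<or> emeasure \<mu> (A - S) = 0)"

lemma varifold_restriction_sets:
  "S \<in> sets (restrict_space borel U) \<Longrightarrow> varifold_restriction m V S = density V (indicator (S \<times> G))"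
  by (rule varifold_restriction_eq[where N = "{}"]) auto

lemma balanced_zero_boundary: "balanced S \<Longrightarrow> zero_boundary m U V S"
  using zero_boundary_iff_balanced[of S "{}" S] balanced_sets by auto

text \<open>A set splitting the restriction is, up to null sets, a Borel set \<open>S\<close>
  balanced for the restriction; then \<open>S \<inter> A\<close> is balanced for \<open>V\<close>
  and would split the atom.\<close>

lemma atomic_component:
  assumes A: "atomic A"
  shows "varifold_component m U V (density V (indicator (A \<times> G)))"
proof -
  let ?W = "density V (indicator (A \<times> G))"
  have bA: "balanced A" and As: "A \<in> sets (restrict_space borel U)"
    using A balanced_sets by (auto simp: atomic_def)
  interpret W: radon_varifold m U ?W by (rule restriction(1)[OF bA])
  have AG: "A \<times> G \<inter> U \<times> G = A \<times> G" using As by (auto simp: sets_restrict_borel_iff[OF U])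
  have UG: "U \<times> G \<in> sets V" using sets.top[of V] by (simp add: space_V)
  have "emeasure ?W (space ?W) = emeasure \<mu> A"
    using times_sets_V[OF As] UG by (simp add: space_V emeasure_density_indicator AG emeasure_\<mu>[OF As])
  then have ne: "emeasure ?W (space ?W) \<noteq> 0" using A by (simp add: atomic_def)
  have "\<not> (\<exists>B\<in>measurable_sets U ?W. emeasure (completion W.\<mu>) B > 0 \<and>
      emeasure (completion W.\<mu>) (U - B) > 0 \<and> zero_boundary m U ?W B)"
  proof
    assume "\<exists>B\<in>measurable_sets U ?W. emeasure (completion W.\<mu>) B > 0 \<and>
      emeasure (completion W.\<mu>) (U - B) > 0 \<and> zero_boundary m U ?W B"
    then obtain B where B: "B \<in> measurable_sets U ?W" "emeasure (completion W.\<mu>) B > 0"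
      "emeasure (completion W.\<mu>) (U - B) > 0" "zero_boundary m U ?W B" by blast
    obtain S N where S: "S \<in> sets (restrict_space borel U)" "N \<in> sets (restrict_space borel U)"
      "emeasure W.\<mu> N = 0" "emeasure W.\<nu> N = 0" "S \<subseteq> B" "B \<subseteq> S \<union> N"
      by (rule W.measurable_setsE[OF B(1)]) (rule that)
    have US: "U - S - N \<in> sets (restrict_space borel U)" "U - S \<in> sets (restrict_space borel U)"
      using S U by (auto simp: sets_restrict_borel_iff[OF U])
    have "balanced (S \<inter> A)"
      using W.zero_boundary_iff_balanced[OF S] B(4) restriction_balanced[OF bA S(1)] by simp
    then have "emeasure \<mu> (S \<inter> A) = 0 \<or> emeasure \<mu> (A - S \<inter> A) = 0"
      using A by (auto simp: atomic_def)
    moreover have "emeasure \<mu> (S \<inter> A) \<noteq> 0"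
    proof -
      have "emeasure (completion W.\<mu>) B = emeasure W.\<mu> S"
        by (rule sets_completionI(2)[of S _ N]) (use S in auto)
      then show ?thesis using B(2) restriction_weight[OF As S(1) W.radon_varifold_axioms] by simp
    qed
    moreover have "emeasure \<mu> (A - S \<inter> A) \<noteq> 0"
    proof -
      \<comment> \<open>The complement of \<open>B\<close> lies between \<open>U - S - N\<close> and
        \<open>U - S\<close>, and \<open>N\<close> is null.\<close>
      have "emeasure (completion W.\<mu>) (U - B) = emeasure W.\<mu> (U - S - N)"
        by (rule sets_completionI(2)[of "U - S - N" _ N]) (use S US in auto)
      also have "\<dots> = emeasure \<mu> ((U - S - N) \<inter> A)"
        by (rule restriction_weight[OF As US(1) W.radon_varifold_axioms])
      also have "\<dots> \<le> emeasure \<mu> (A - S \<inter> A)"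
        using As S by (intro emeasure_mono) auto
      finally show ?thesis using B(3) by auto
    qed
    ultimately show False by blast
  qed
  then have "indecomposable m U ?W"
    using W.varifold W.radon_fv by (simp add: indecomposable_def)
  then show ?thesis
    unfolding varifold_component_def
    using ne sets_measurable_sets[OF As] varifold_restriction_sets[OF As] balanced_zero_boundary[OF bA]
    by metis
qed

theorem decomposition_of_atoms:
  assumes cnt: "countable \<A>" and at: "\<And>A. A \<in> \<A> \<Longrightarrow> atomic A" and dis: "disjoint \<A>"
    and null: "emeasure \<mu> (U - \<Union>\<A>) = 0"
  shows "\<exists>G. decomposition m U V G"
proof -
  define r where "r A = density V (indicator (A \<times> G))" for A
  have s: "A \<in> sets (restrict_space borel U)" "balanced A" "emeasure \<mu> A \<noteq> 0" if "A \<in> \<A>" for A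
    using at[OF that] balanced_sets by (auto simp: atomic_def)
  have rA: "r A = varifold_restriction m V A" if "A \<in> \<A>" for A
    using varifold_restriction_sets[OF s(1)[OF that]] by (simp add: r_def)
  \<comment> \<open>A decomposition is a set of measures, so distinct atoms must give distinct
    restrictions for the sum over the image to count each of them once.\<close>
  have inj: "inj_on r \<A>"
  proof (rule inj_onI, rule ccontr)
    fix A B assume AB: "A \<in> \<A>" "B \<in> \<A>" "r A = r B" "A \<noteq> B"
    then have "A \<inter> B = {}" by (intro disjointD[OF dis])
    then have d: "B \<times> G \<inter> A \<times> G = {}" by auto
    have "emeasure (r A) (A \<times> G) = emeasure \<mu> A"
      using times_sets_V[OF s(1)[OF AB(1)]] by (simp add: r_def emeasure_density_indicator emeasure_\<mu>[OF s(1)[OF AB(1)]])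
    moreover have "emeasure (r B) (A \<times> G) = 0"
      using times_sets_V[OF s(1)[OF AB(1)]] times_sets_V[OF s(1)[OF AB(2)]] d by (simp add: r_def emeasure_density_indicator)
    ultimately show False using AB(3) s(3)[OF AB(1)] by simp
  qed
  have sum: "((\<lambda>W. LINT p|W. f p) has_sum (LINT p|V. f p)) (r ` \<A>)" if f: "f \<in> cc_functions X" for f
  proof -
    have fi: "integrable V f" by (rule integrable_cc[OF f])
    let ?J = "to_nat_on \<A> ` \<A>"
    have injJ: "inj_on (to_nat_on \<A>) \<A>" using cnt by (rule inj_on_to_nat_on)
    obtain B where Bd: "disjoint_family B" and BU: "(\<Union>n. B n) = \<Union>\<A>" and Bin: "\<And>n. B n \<in> insert {} \<A>"
      and Bto: "\<And>A. A \<in> \<A> \<Longrightarrow> B (to_nat_on \<A> A) = A" and Bout: "\<And>n. n \<notin> ?J \<Longrightarrow> B n = {}"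
      by (rule countable_disjoint_enumeration[OF cnt dis]) (rule that)
    have Bs: "B n \<in> sets (restrict_space borel U)" for n using Bin[of n] s(1) by auto
    have Bd2: "disjoint_family (\<lambda>n. B n \<times> G)" using Bd by (auto simp: disjoint_family_on_def)
    have "(\<Union>n. B n) \<in> sets (restrict_space borel U)" using Bs by blast
    then have UA: "\<Union>\<A> \<in> sets (restrict_space borel U)" "U - \<Union>\<A> \<in> sets (restrict_space borel U)"
      using sets.Diff[OF balanced_sets[OF balanced_U]] by (auto simp: BU)
    have eq: "(LINT p|V. indicator (\<Union>n. B n \<times> G) p * h p) = (LINT p|V. h p)" if h: "integrable V h" for h :: "_ \<Rightarrow> real"
    proof (rule integral_cong_AE)
      have "(\<Union>n. B n \<times> G) = \<Union>\<A> \<times> G" using BU by auto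
      then show "(\<lambda>p. indicator (\<Union>n. B n \<times> G) p * h p) \<in> borel_measurable V"
        using times_sets_V[OF UA(1)] borel_measurable_integrable[OF h] by simp
      have "(U - \<Union>\<A>) \<times> G \<in> null_sets V"
        using null times_sets_V[OF UA(2)] emeasure_\<mu>[OF UA(2)] by (simp add: null_sets_def)
      from AE_not_in[OF this] AE_space show "AE p in V. indicator (\<Union>n. B n \<times> G) p * h p = h p"
      proof eventually_elim
        case (elim p)
        then have "p \<in> \<Union>\<A> \<times> G" by (cases p) (auto simp: space_V)
        then show ?case using \<open>(\<Union>n. B n \<times> G) = \<Union>\<A> \<times> G\<close> by simp
      qed
    qed (use borel_measurable_integrable[OF h] in auto)
    have ib: "integrable V (\<lambda>p. indicator (B n \<times> G) p * h p)" if h: "integrable V h" for n and h :: "_ \<Rightarrow> real"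
      using integrable_mult_indicator[OF times_sets_V[OF Bs] h] by simp
    let ?F = "\<lambda>n. LINT p|V. indicator (B n \<times> G) p * f p"
    have "?F sums (LINT p|V. f p)"
      using integral_disjoint_UN[OF fi times_sets_V[OF Bs] Bd2] eq[OF fi] by simp
    \<comment> \<open>The sum in a decomposition is unordered, which calls for absolute convergence;
      this is the same series for the absolute value of \<open>f\<close>.\<close>
    moreover have "summable (\<lambda>n. norm (?F n))"
    proof (rule summable_comparison_test[OF exI[of _ 0]])
      have fa: "integrable V (\<lambda>p. \<bar>f p\<bar>)" using fi by simp
      show "summable (\<lambda>n. LINT p|V. indicator (B n \<times> G) p * \<bar>f p\<bar>)"
        using integral_disjoint_UN[OF fa times_sets_V[OF Bs] Bd2] sums_summable by blast
      have "\<bar>?F n\<bar> \<le> (LINT p|V. \<bar>indicator (B n \<times> G) p * f p\<bar>)" for n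
        by (rule integral_abs_bound)
      then show "\<forall>n\<ge>0. norm (norm (?F n)) \<le> (LINT p|V. indicator (B n \<times> G) p * \<bar>f p\<bar>)"
        by (simp add: abs_mult)
    qed
    ultimately have "(?F has_sum (LINT p|V. f p)) UNIV"
      by (intro norm_summable_imp_has_sum)
    \<comment> \<open>The remaining indices contribute integrals over the empty set.\<close>
    then have "(?F has_sum (LINT p|V. f p)) ?J"
      by (rule has_sum_cong_neutral[THEN iffD1, rotated -1]) (auto simp: Bout)
    then have "((?F \<circ> to_nat_on \<A>) has_sum (LINT p|V. f p)) \<A>"
      using has_sum_reindex[OF injJ] by blast
    then have "(((\<lambda>W. LINT p|W. f p) \<circ> r) has_sum (LINT p|V. f p)) \<A>"
    proof (rule has_sum_cong[THEN iffD1, rotated])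
      fix A assume A: "A \<in> \<A>"
      show "(?F \<circ> to_nat_on \<A>) A = ((\<lambda>W. LINT p|W. f p) \<circ> r) A"
        using times_sets_V[OF s(1)[OF A]] borel_measurable_integrable[OF fi]
        by (simp add: Bto[OF A] r_def integral_density_indicator)
    qed
    then show ?thesis using has_sum_reindex[OF inj] by blast
  qed
  have "decomposition m U V (r ` \<A>)"
    unfolding decomposition_def
  proof (intro conjI ballI impI)
    fix W assume "W \<in> r ` \<A>"
    then show "varifold_component m U V W" using atomic_component[OF at] by (auto simp: r_def)
  next
    fix W Y assume "W \<in> r ` \<A>" "Y \<in> r ` \<A>" "W \<noteq> Y"
    then obtain A B where AB: "A \<in> \<A>" "B \<in> \<A>" "W = r A" "Y = r B" "A \<noteq> B" by auto
    then have "A \<inter> B = {}" by (intro disjointD[OF dis])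
    then show "\<exists>A\<in>measurable_sets U V. \<exists>B\<in>measurable_sets U V. A \<inter> B = {} \<and>
      zero_boundary m U V A \<and> zero_boundary m U V B \<and>
      W = varifold_restriction m V A \<and> Y = varifold_restriction m V B"
      using AB s rA balanced_zero_boundary by (intro bexI[of _ A] bexI[of _ B] conjI sets_measurable_sets) auto
  qed (rule sum)
  then show ?thesis by blast
qed

end

section \<open>Existence of atoms\<close>

text \<open>Only finitely many disjoint sets can have measure above
  \<open>inverse (real (Suc n))\<close> when the total is finite.\<close>

lemma (in finite_measure) disjoint_positive_countable:
  assumes A: "\<And>A. A \<in> \<A> \<Longrightarrow> A \<in> sets M" "\<And>A. A \<in> \<A> \<Longrightarrow> measure M A > 0" and d: "disjoint \<A>"
  shows "countable \<A>"
proof -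
  let ?F = "\<lambda>n::nat. {A \<in> \<A>. inverse (real (Suc n)) < measure M A}"
  have "finite (?F n)" for n
  proof (rule finite_if_finite_subsets_card_bdd[rule_format, THEN conjunct1])
    fix B assume B: "B \<subseteq> ?F n" "finite B"
    have "real (card B) * inverse (real (Suc n)) = (\<Sum>A\<in>B. inverse (real (Suc n)))" by simp
    also have "\<dots> \<le> (\<Sum>A\<in>B. measure M A)" using B(1) by (intro sum_mono) (auto simp: subset_iff less_imp_le)
    also have "\<dots> = measure M (\<Union>A\<in>B. A)"
    proof (rule finite_measure_finite_Union[symmetric, OF B(2)])
      show "(\<lambda>A. A) ` B \<subseteq> sets M" using A(1) B(1) by auto
      show "disjoint_family_on (\<lambda>A. A) B"
        using B(1) disjointD[OF d] unfolding disjoint_family_on_def by blast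
    qed
    also have "\<dots> \<le> measure M (space M)" by (rule bounded_measure)
    finally have "real (card B) \<le> measure M (space M) * real (Suc n)" by (simp add: field_simps)
    then show "card B \<le> nat \<lceil>measure M (space M) * real (Suc n)\<rceil>" by linarith
  qed
  then have "countable (?F n)" for n by (rule countable_finite)
  then have "countable (\<Union>n. ?F n)" by (rule countable_UN[OF countableI_type])
  moreover have "\<A> \<subseteq> (\<Union>n. ?F n)" using reals_Archimedean[OF A(2)] by blast
  ultimately show ?thesis by (rule countable_subset[rotated])
qed

context radon_varifold begin

lemma finite_\<mu>: "compact K \<Longrightarrow> K \<subseteq> U \<Longrightarrow> emeasure \<mu> K < \<infinity>"
  using finite_V[of K] by (simp add: emeasure_\<mu> sets_restrict_borel_iff[OF U] borel_compact)

lemma sigma_finite_\<mu>: "sigma_finite_measure \<mu>"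
proof
  obtain C where C: "\<And>n. compact (C n)" "\<And>n. C n \<subseteq> U" "(\<Union>n::nat. C n) = U"
    using open_compact_exhaustion[OF U] by metis
  have "C n \<in> sets \<mu>" for n
    using C(1,2)[of n] by (simp add: sets_restrict_borel_iff[OF U] borel_compact)
  then show "\<exists>A. countable A \<and> A \<subseteq> sets \<mu> \<and> \<Union> A = space \<mu> \<and> (\<forall>a\<in>A. emeasure \<mu> a \<noteq> \<infinity>)"
    using C finite_\<mu>[OF C(1,2)] by (intro exI[of _ "range C"]) (auto simp: less_top)
qed

lemma balanced_empty: "balanced {}"
  using balanced_Diff[OF balanced_U balanced_U] by simp

lemma balanced_Union:
  assumes "countable \<A>" "disjoint \<A>" "\<And>A. A \<in> \<A> \<Longrightarrow> balanced A"
  shows "balanced (\<Union>\<A>)"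
proof -
  obtain B :: "nat \<Rightarrow> (real^'n) set" where B: "disjoint_family B" "(\<Union>n. B n) = \<Union>\<A>" "\<And>n. B n \<in> insert {} \<A>"
    by (rule countable_disjoint_enumeration[OF assms(1,2)]) (rule that)
  have "balanced (B n)" for n using B(3)[of n] assms(3) balanced_empty by auto
  from balanced_UN[OF this B(1)] show ?thesis by (simp add: B(2))
qed

text \<open>The weight of \<open>U\<close> may be infinite, so minimal sets are sought and atoms are
  counted with a finite measure having the same null sets: the weight times a positive integrable
  density.\<close>

lemma equivalent_finite_measure:
  "\<exists>\<kappa>. finite_measure \<kappa> \<and> sets \<kappa> = sets \<mu> \<and> (\<forall>A\<in>sets \<mu>. measure \<kappa> A = 0 \<longleftrightarrow> emeasure \<mu> A = 0)"
proof -
  interpret \<mu>: sigma_finite_measure \<mu> by (rule sigma_finite_\<mu>)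
  obtain h where h: "h \<in> borel_measurable \<mu>" "integral\<^sup>N \<mu> h \<noteq> \<infinity>" "\<forall>x\<in>space \<mu>. 0 < h x \<and> h x < \<infinity>"
    using \<mu>.Ex_finite_integrable_function by blast
  let ?l = "density \<mu> h"
  have "emeasure ?l (space ?l) = (\<integral>\<^sup>+x. h x * indicator (space \<mu>) x \<partial>\<mu>)"
    unfolding space_density by (rule emeasure_density[OF h(1) sets.top])
  also have "\<dots> = integral\<^sup>N \<mu> h" by (intro nn_integral_cong) simp
  finally have "emeasure ?l (space ?l) = integral\<^sup>N \<mu> h" .
  then interpret l: finite_measure ?l using h(2) by (intro finite_measureI) simp
  have "measure ?l A = 0 \<longleftrightarrow> emeasure \<mu> A = 0" if A: "A \<in> sets \<mu>" for A
  proof -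
    have "measure ?l A = 0 \<longleftrightarrow> emeasure ?l A = 0" by (simp add: l.emeasure_eq_measure)
    also have "\<dots> \<longleftrightarrow> (AE x in \<mu>. h x * indicator A x = 0)"
      unfolding emeasure_density[OF h(1) A]
      by (rule nn_integral_0_iff_AE[OF borel_measurable_times_ennreal[OF h(1) borel_measurable_indicator[OF A]]])
    also have "\<dots> \<longleftrightarrow> (AE x in \<mu>. x \<notin> A)"
      using h(3) by (intro AE_cong) (auto simp: indicator_def)
    also have "\<dots> \<longleftrightarrow> emeasure \<mu> A = 0"
      using A sets.sets_into_space[OF A] by (subst AE_iff_measurable[OF A]) auto
    finally show ?thesis .
  qed
  then show ?thesis using l.finite_measure_axioms by (intro exI[of _ ?l]) auto
qed

lemma null_mono: "emeasure \<mu> B = 0 \<Longrightarrow> B \<in> sets \<mu> \<Longrightarrow> A \<subseteq> B \<Longrightarrow> emeasure \<mu> A = 0"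
  using emeasure_mono[of A B \<mu>] by simp

text \<open>First \<open>F\<close> is chosen with \<open>\<phi> F\<close> less than \<open>c\<close>
  above the infimum. If it split into two balanced parts both charging \<open>D\<close>, one part
  would have at least the infimum and the other at least \<open>c\<close>, too much together. Then
  \<open>A\<close> is a balanced subset of \<open>F\<close> that carries all of the charge on
  \<open>D\<close> and is minimal for \<open>\<kappa>\<close>. A balanced
  \<open>S \<subseteq> A\<close> either carries the charge, and minimality makes
  \<open>A - S\<close> null, or misses it; then \<open>A - S\<close> carries it and \<open>S\<close>
  is null.\<close>

lemma atomic_subset:
  assumes D: "D \<in> sets \<mu>" and K: "K \<in> sets \<mu>" "emeasure \<mu> K < \<infinity>" and c: "c > 0"
    and lower: "\<And>E. balanced E \<Longrightarrow> emeasure \<mu> (E \<inter> D) \<noteq> 0 \<Longrightarrow> c \<le> measure \<mu> (E \<inter> K)"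
    and E: "balanced E" "emeasure \<mu> (E \<inter> D) \<noteq> 0"
  shows "\<exists>A\<subseteq>E. atomic A"
proof -
  have bs: "balanced S \<Longrightarrow> S \<in> sets \<mu>" for S using balanced_sets by simp
  define \<C> where "\<C> = {F. balanced F \<and> F \<subseteq> E \<and> emeasure \<mu> (F \<inter> D) \<noteq> 0}"
  define \<phi> where "\<phi> F = measure \<mu> (F \<inter> K)" for F
  have fin: "emeasure \<mu> (F \<inter> K) \<noteq> \<infinity>" for F
    using emeasure_mono[of "F \<inter> K" K \<mu>] K by (auto simp: top_unique less_top)
  have "E \<in> \<C>" using E by (simp add: \<C>_def)
  then have ne: "\<phi> ` \<C> \<noteq> {}" by auto
  have bdd: "bdd_below (\<phi> ` \<C>)" by (auto simp: \<phi>_def intro!: bdd_belowI[of _ 0])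
  have "Inf (\<phi> ` \<C>) < Inf (\<phi> ` \<C>) + c" using c by simp
  then obtain F where F: "F \<in> \<C>" "\<phi> F < Inf (\<phi> ` \<C>) + c"
    using cInf_less_iff[OF ne bdd] by blast
  have bF: "balanced F" "F \<subseteq> E" "emeasure \<mu> (F \<inter> D) \<noteq> 0" using F(1) by (auto simp: \<C>_def)
  have split: "emeasure \<mu> (S \<inter> D) = 0 \<or> emeasure \<mu> ((F - S) \<inter> D) = 0" if S: "balanced S" "S \<subseteq> F" for S
  proof (rule ccontr)
    assume a: "\<not> ?thesis"
    have FS: "balanced (F - S)" by (rule balanced_Diff[OF bF(1) S])
    have "S \<in> \<C>" using S bF a by (auto simp: \<C>_def)
    then have "Inf (\<phi> ` \<C>) \<le> \<phi> S" by (intro cInf_lower bdd) auto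
    moreover have "c \<le> \<phi> (F - S)" unfolding \<phi>_def using FS a by (intro lower) auto
    moreover have "\<phi> F = \<phi> S + \<phi> (F - S)"
    proof -
      have "measure \<mu> ((S \<inter> K) \<union> ((F - S) \<inter> K)) = measure \<mu> (S \<inter> K) + measure \<mu> ((F - S) \<inter> K)"
        using fin bs[OF S(1)] bs[OF FS] K by (intro measure_Union) auto
      moreover have "(S \<inter> K) \<union> ((F - S) \<inter> K) = F \<inter> K" using S(2) by auto
      ultimately show ?thesis by (simp add: \<phi>_def)
    qed
    ultimately show False using F(2) by linarith
  qed
  obtain \<kappa> where l: "finite_measure \<kappa>" "sets \<kappa> = sets \<mu>" "\<forall>A\<in>sets \<mu>. measure \<kappa> A = 0 \<longleftrightarrow> emeasure \<mu> A = 0"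
    using equivalent_finite_measure by blast
  interpret l: finite_measure \<kappa> by (rule l(1))
  define \<D> where "\<D> S \<longleftrightarrow> balanced S \<and> S \<subseteq> F \<and> emeasure \<mu> ((F - S) \<inter> D) = 0" for S
  \<comment> \<open>Each set nearly minimises \<open>\<kappa>\<close> among the admissible subsets
    of its predecessor, with errors tending to 0, so the intersection is exactly minimal;
    \<open>balanced_INT\<close> keeps it balanced.\<close>
  have "\<exists>f. \<forall>n. \<D> (f n) \<and> (f (Suc n) \<subseteq> f n \<and> (\<forall>S. \<D> S \<longrightarrow> S \<subseteq> f n \<longrightarrow> measure \<kappa> (f (Suc n)) \<le> measure \<kappa> S + (1/2)^n))"
  proof (rule dependent_nat_choice)
    show "\<exists>x. \<D> x" using bF by (intro exI[of _ F]) (simp add: \<D>_def)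
    fix S :: "(real^'n) set" and n :: nat assume S: "\<D> S"
    let ?I = "measure \<kappa> ` {S'. \<D> S' \<and> S' \<subseteq> S}"
    have ne: "?I \<noteq> {}" using S by auto
    have bd: "bdd_below ?I" by (auto intro!: bdd_belowI[of _ 0])
    have "Inf ?I < Inf ?I + (1/2)^n" by simp
    then obtain v where "v \<in> ?I" "v < Inf ?I + (1/2)^n"
      using cInf_lessD[OF ne] by blast
    then obtain S' where S': "\<D> S'" "S' \<subseteq> S" "measure \<kappa> S' < Inf ?I + (1/2)^n" by auto
    have "measure \<kappa> S' \<le> measure \<kappa> S'' + (1/2)^n" if "\<D> S''" "S'' \<subseteq> S" for S''
      using cInf_lower[OF _ bd, of "measure \<kappa> S''"] that S'(3) by fastforce
    then show "\<exists>y. \<D> y \<and> y \<subseteq> S \<and> (\<forall>S''. \<D> S'' \<longrightarrow> S'' \<subseteq> S \<longrightarrow> measure \<kappa> y \<le> measure \<kappa> S'' + (1/2)^n)"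
      using S' by blast
  qed
  then obtain f where f: "\<And>n. \<D> (f n)" "\<And>n. f (Suc n) \<subseteq> f n"
    "\<And>n S. \<D> S \<Longrightarrow> S \<subseteq> f n \<Longrightarrow> measure \<kappa> (f (Suc n)) \<le> measure \<kappa> S + (1/2)^n"
    by blast
  define A where "A = (\<Inter>n. f n)"
  have fb: "balanced (f n)" "f n \<subseteq> F" "emeasure \<mu> ((F - f n) \<inter> D) = 0" for n using f(1)[of n] by (auto simp: \<D>_def)
  have bA: "balanced A" unfolding A_def using fb(1) f(2) by (intro balanced_INT) (auto simp: decseq_Suc_iff)
  have AF: "A \<subseteq> F" unfolding A_def using fb(2) by blast
  have nA: "emeasure \<mu> ((F - A) \<inter> D) = 0"
  proof -
    have "(F - A) \<inter> D = (\<Union>n. (F - f n) \<inter> D)" by (auto simp: A_def)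
    moreover have "emeasure \<mu> (\<Union>n. (F - f n) \<inter> D) = 0"
      using fb(3) bs[OF fb(1)] bs[OF bF(1)] D by (intro emeasure_UN_eq_0) auto
    ultimately show ?thesis by simp
  qed
  have minimal: "emeasure \<mu> (A - S) = 0" if S: "\<D> S" "S \<subseteq> A" for S
  proof -
    have bS: "balanced S" using S by (simp add: \<D>_def)
    have "measure \<kappa> A \<le> measure \<kappa> S + (1/2)^n" for n
    proof -
      have "measure \<kappa> A \<le> measure \<kappa> (f (Suc n))"
        using bs[OF fb(1)] l(2) by (intro l.finite_measure_mono) (auto simp: A_def)
      also have "\<dots> \<le> measure \<kappa> S + (1/2)^n" using S by (intro f(3)) (auto simp: A_def)
      finally show ?thesis .
    qed
    moreover have "(\<lambda>n. measure \<kappa> S + (1/2)^n) \<longlonglongrightarrow> measure \<kappa> S + 0"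
      by (intro tendsto_intros LIMSEQ_power_zero) auto
    ultimately have "measure \<kappa> A \<le> measure \<kappa> S" by (intro LIMSEQ_le_const[of _ "measure \<kappa> S"]) auto
    moreover have "measure \<kappa> (A - S) = measure \<kappa> A - measure \<kappa> S"
      using bs[OF bA] bs[OF bS] S(2) l(2) by (intro l.finite_measure_Diff) auto
    ultimately have "measure \<kappa> (A - S) = 0" using measure_nonneg[of \<kappa> "A - S"] by linarith
    then show ?thesis using l(3) bs[OF bA] bs[OF bS] by auto
  qed
  have "atomic A"
    unfolding atomic_def
  proof (intro conjI allI impI)
    show "balanced A" by (rule bA)
    have "(F \<inter> D) \<subseteq> ((F - A) \<inter> D) \<union> A" by auto
    then have "emeasure \<mu> (F \<inter> D) \<le> emeasure \<mu> ((F - A) \<inter> D) + emeasure \<mu> A"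
      using bs[OF bA] bs[OF bF(1)] D
      by (intro order_trans[OF emeasure_mono emeasure_subadditive]) auto
    then show "emeasure \<mu> A \<noteq> 0" using bF(3) nA by auto
    fix S assume S: "balanced S" "S \<subseteq> A"
    have sets: "S \<in> sets \<mu>" "A \<in> sets \<mu>" "F \<in> sets \<mu>" using bs S bA bF by auto
    consider "emeasure \<mu> (S \<inter> D) = 0" | "emeasure \<mu> ((F - S) \<inter> D) = 0"
      using split[OF S(1)] S(2) AF by auto
    then show "emeasure \<mu> S = 0 \<or> emeasure \<mu> (A - S) = 0"
    proof cases
      case 1
      have "emeasure \<mu> ((F - (A - S)) \<inter> D) \<le> emeasure \<mu> (((F - A) \<inter> D) \<union> (S \<inter> D))"
        using sets D by (intro emeasure_mono) auto
      also have "\<dots> \<le> emeasure \<mu> ((F - A) \<inter> D) + emeasure \<mu> (S \<inter> D)"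
        using sets D by (intro emeasure_subadditive) auto
      finally have "\<D> (A - S)" using 1 nA AF balanced_Diff[OF bA S] by (auto simp: \<D>_def)
      then have "emeasure \<mu> (A - (A - S)) = 0" by (rule minimal) auto
      then show ?thesis using S(2) by (simp add: double_diff)
    next
      case 2
      then have "\<D> S" using S AF by (auto simp: \<D>_def)
      then show ?thesis using minimal S(2) by blast
    qed
  qed
  then show ?thesis using AF bF(2) by blast
qed

text \<open>A maximal disjoint family of atoms is countable, each member having positive mass for a
  finite measure; so its union and the remainder \<open>N\<close> are balanced. If \<open>N\<close>
  had positive weight it would charge some \<open>D i\<close>, and \<open>atomic_subset\<close>
  would find a further atom inside \<open>N\<close>.\<close>

theorem decomposition_exists:
  fixes D K :: "nat \<Rightarrow> (real^'n) set" and c :: "nat \<Rightarrow> real"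
  assumes D: "\<And>i. D i \<in> sets \<mu>" and K: "\<And>i. K i \<in> sets \<mu>" "\<And>i. emeasure \<mu> (K i) < \<infinity>" and c: "\<And>i. c i > 0"
    and lower: "\<And>i E. balanced E \<Longrightarrow> emeasure \<mu> (E \<inter> D i) \<noteq> 0 \<Longrightarrow> c i \<le> measure \<mu> (E \<inter> K i)"
    and null: "emeasure \<mu> (U - (\<Union>i. D i)) = 0"
  shows "\<exists>G. decomposition m U V G"
proof -
  define \<F> where "\<F> = {\<A>. (\<forall>A\<in>\<A>. atomic A) \<and> disjoint \<A>}"
  have "\<exists>\<M>\<in>\<F>. \<forall>\<X>\<in>\<F>. \<M> \<subseteq> \<X> \<longrightarrow> \<X> = \<M>"
  proof (rule subset_Zorn')
    fix \<C> assume C: "subset.chain \<F> \<C>"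
    show "\<Union>\<C> \<in> \<F>"
      unfolding \<F>_def
    proof (intro CollectI conjI ballI disjointI)
      fix A assume "A \<in> \<Union>\<C>" then show "atomic A" using C by (auto simp: \<F>_def subset.chain_def)
    next
      fix A B assume AB: "A \<in> \<Union>\<C>" "B \<in> \<Union>\<C>" "A \<noteq> B"
      then obtain X Y where XY: "X \<in> \<C>" "Y \<in> \<C>" "A \<in> X" "B \<in> Y" by blast
      then have "X \<subseteq> Y \<or> Y \<subseteq> X" using C by (auto simp: subset.chain_def)
      then obtain Z where "Z \<in> \<C>" "A \<in> Z" "B \<in> Z" using XY by blast
      moreover then have "disjoint Z" using C by (auto simp: \<F>_def subset.chain_def)
      ultimately show "A \<inter> B = {}" using AB(3) disjointD by blast
    qed
  qed
  then obtain \<A> where A: "\<A> \<in> \<F>" "\<And>\<X>. \<X> \<in> \<F> \<Longrightarrow> \<A> \<subseteq> \<X> \<Longrightarrow> \<X> = \<A>" by blast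
  have at: "\<And>A. A \<in> \<A> \<Longrightarrow> atomic A" and dis: "disjoint \<A>" using A(1) by (auto simp: \<F>_def)
  have bs: "A \<in> \<A> \<Longrightarrow> A \<in> sets \<mu>" for A using at balanced_sets by (auto simp: atomic_def)
  have cnt: "countable \<A>"
  proof -
    obtain \<kappa> where l: "finite_measure \<kappa>" "sets \<kappa> = sets \<mu>" "\<forall>A\<in>sets \<mu>. measure \<kappa> A = 0 \<longleftrightarrow> emeasure \<mu> A = 0"
      using equivalent_finite_measure by blast
    interpret l: finite_measure \<kappa> by (rule l(1))
    show ?thesis
    proof (rule l.disjoint_positive_countable[OF _ _ dis])
      fix A assume "A \<in> \<A>"
      then show "A \<in> sets \<kappa>" "0 < measure \<kappa> A"
        using bs[of A] at[of A] l(2,3) by (auto simp: atomic_def zero_less_measure_iff less_le)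
    qed
  qed
  have bU: "balanced (\<Union>\<A>)" using at by (intro balanced_Union cnt dis) (simp add: atomic_def)
  define N where "N = U - \<Union>\<A>"
  have bN: "balanced N"
    unfolding N_def using balanced_sets[OF bU] by (intro balanced_Diff balanced_U bU) (auto simp: sets_restrict_borel_iff[OF U])
  have "emeasure \<mu> N = 0"
  proof (rule ccontr)
    assume ne: "emeasure \<mu> N \<noteq> 0"
    have Ns: "N \<in> sets \<mu>" using balanced_sets[OF bN] by simp
    have "\<exists>i. emeasure \<mu> (N \<inter> D i) \<noteq> 0"
    proof (rule ccontr)
      assume "\<not> ?thesis"
      then have z: "emeasure \<mu> (N \<inter> D i) = 0" for i by blast
      have "emeasure \<mu> (\<Union>i. N \<inter> D i) = 0" using z Ns D by (intro emeasure_UN_eq_0) auto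
      moreover have Us: "U - (\<Union>i. D i) \<in> sets \<mu>" using D sets.top[of \<mu>] by auto
      moreover have "emeasure \<mu> N \<le> emeasure \<mu> ((U - (\<Union>i. D i)) \<union> (\<Union>i. N \<inter> D i))"
        using Us Ns D by (intro emeasure_mono) (auto simp: N_def)
      moreover have "\<dots> \<le> emeasure \<mu> (U - (\<Union>i. D i)) + emeasure \<mu> (\<Union>i. N \<inter> D i)"
        using Us Ns D by (intro emeasure_subadditive) auto
      ultimately show False using ne null by auto
    qed
    then obtain i where i: "emeasure \<mu> (N \<inter> D i) \<noteq> 0" by blast
    obtain B where B: "B \<subseteq> N" "atomic B"
      using atomic_subset[OF D K c lower bN i] by blast
    have "insert B \<A> \<in> \<F>"
      unfolding \<F>_def
    proof (intro CollectI conjI ballI)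
      show "atomic A" if "A \<in> insert B \<A>" for A using that B at by auto
      show "disjoint (insert B \<A>)"
        using dis B(1) unfolding N_def by (auto simp: pairwise_insert disjnt_def)
    qed
    \<comment> \<open>By maximality \<open>B\<close> is a member, yet it is disjoint from the union
      of all members; so it is empty and has no weight.\<close>
    then have "B \<in> \<A>" using A(2) by blast
    then have "B = {}" using B(1) by (auto simp: N_def)
    then show False using B(2) by (simp add: atomic_def)
  qed
  then show ?thesis
    using decomposition_of_atoms[OF cnt at dis] by (simp add: N_def)
qed

end

section \<open>Monotonicity\<close>

text \<open>The mean value theorem bounds the difference quotients by \<open>w\<close>, and
  dominated convergence is applied along sequences tending to \<open>r\<close>.\<close>

lemma has_derivative_integral_parameter:
  fixes f f' :: "real \<Rightarrow> 'a \<Rightarrow> real"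
  assumes S: "open S" "convex S" "r \<in> S"
    and f: "\<And>t. t \<in> S \<Longrightarrow> integrable M (f t)"
    and d: "\<And>t x. t \<in> S \<Longrightarrow> x \<in> space M \<Longrightarrow> ((\<lambda>t. f t x) has_real_derivative f' t x) (at t)"
    and b: "\<And>t x. t \<in> S \<Longrightarrow> x \<in> space M \<Longrightarrow> \<bar>f' t x\<bar> \<le> w x" and w: "integrable M w"
    and m: "f' r \<in> borel_measurable M"
  shows "((\<lambda>t. LINT x|M. f t x) has_real_derivative (LINT x|M. f' r x)) (at r)"
proof -
  have "((\<lambda>y. ((LINT x|M. f y x) - (LINT x|M. f r x)) / (y - r)) \<longlongrightarrow> (LINT x|M. f' r x)) (at r within S)"
    unfolding tendsto_at_iff_sequentially
  proof (intro allI impI)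
    fix X :: "nat \<Rightarrow> real" assume X: "\<forall>i. X i \<in> S - {r}" "X \<longlonglongrightarrow> r"
    have "(\<lambda>i. LINT x|M. (f (X i) x - f r x) / (X i - r)) \<longlonglongrightarrow> (LINT x|M. f' r x)"
    proof (rule integral_dominated_convergence[OF m _ w])
      show "(\<lambda>x. (f (X i) x - f r x) / (X i - r)) \<in> borel_measurable M" for i
        using f[of "X i"] f[OF S(3)] X by (intro borel_measurable_divide borel_measurable_diff) auto
      show "AE x in M. (\<lambda>i. (f (X i) x - f r x) / (X i - r)) \<longlonglongrightarrow> f' r x"
      proof (rule AE_I2)
        fix x assume x: "x \<in> space M"
        have "((\<lambda>y. (f y x - f r x) / (y - r)) \<longlongrightarrow> f' r x) (at r within S)"
          using has_field_derivative_at_within[OF d[OF S(3) x]] unfolding has_field_derivative_iff .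
        then show "(\<lambda>i. (f (X i) x - f r x) / (X i - r)) \<longlonglongrightarrow> f' r x"
          using X unfolding tendsto_at_iff_sequentially by (auto simp: o_def)
      qed
      show "AE x in M. norm ((f (X i) x - f r x) / (X i - r)) \<le> w x" for i
      proof (rule AE_I2)
        fix x assume x: "x \<in> space M"
        have "norm (f (X i) x - f r x) \<le> w x * norm (X i - r)"
        proof (rule field_differentiable_bound[OF S(2)])
          show "((\<lambda>t. f t x) has_field_derivative f' t x) (at t within S)" if "t \<in> S" for t
            by (rule has_field_derivative_at_within[OF d[OF that x]])
          show "norm (f' t x) \<le> w x" if "t \<in> S" for t using b[OF that x] by simp
        qed (use X S in auto)
        then show "norm ((f (X i) x - f r x) / (X i - r)) \<le> w x"
          using X by (simp add: norm_divide divide_le_eq)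
      qed
    qed
    moreover have "(LINT x|M. (f (X i) x - f r x) / (X i - r)) = ((LINT x|M. f (X i) x) - (LINT x|M. f r x)) / (X i - r)" for i
      using f[of "X i"] f[OF S(3)] X by simp
    ultimately show "((\<lambda>y. ((LINT x|M. f y x) - (LINT x|M. f r x)) / (y - r)) \<circ> X) \<longlonglongrightarrow> (LINT x|M. f' r x)"
      by (simp only: o_def)
  qed
  then show ?thesis
    using at_within_open[OF S(3,1)] by (simp add: has_field_derivative_iff)
qed

context radon_varifold begin

lemma fst_borel_measurable:
  assumes "h \<in> borel_measurable borel" shows "(\<lambda>p. h (fst p)) \<in> borel_measurable V"
  by (rule measurable_compose[OF fst_measurable measurable_restrict_space1[OF assms]])

section \<open>The smoothed weight of a balanced set in balls about one point\<close>

context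
  fixes E :: "(real^'n) set" and a :: "real^'n" and R j :: real
  assumes E: "balanced E" and R: "cball a R \<subseteq> U" and j: "j \<ge> 0"
    and growth: "\<And>r. 0 < r \<Longrightarrow> r < R \<Longrightarrow> measure \<nu> (ball a r) \<le> j * r ^ m"
begin

definition radial :: "real \<Rightarrow> (real^'n) \<Rightarrow> real" where
  "radial r z = (z - a) \<bullet> (z - a) * inverse (r\<^sup>2)"

text \<open>A substitute for the weight of \<open>E\<close> in \<open>ball a r\<close> that is
  differentiable in \<open>r\<close>; \<open>drift\<close> is the integral that its derivative
  produces.\<close>

definition mass where "mass r = (LINT p|V. indicator (E \<times> G) p * profile (radial r (fst p)))"
definition drift where "drift r = (LINT p|V. indicator (E \<times> G) p * (profile' (radial r (fst p)) * radial r (fst p)))"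

lemma radial_eq: "radial r z = (dist a z / r)\<^sup>2"
  by (simp add: radial_def dot_square_norm dist_norm norm_minus_commute power_mult_distrib power_inverse divide_inverse)

lemma radial_ge: "0 < r \<Longrightarrow> z \<notin> ball a r \<Longrightarrow> 1 \<le> radial r z"
  by (simp add: radial_eq power_divide le_divide_eq power_mono)

lemma radial_gt: "0 < r \<Longrightarrow> z \<notin> cball a r \<Longrightarrow> 1 < radial r z"
  by (simp add: radial_eq power_divide less_divide_eq power_strict_mono)

lemma radial_le: "0 < r \<Longrightarrow> z \<in> ball a s \<Longrightarrow> 2 * s \<le> r \<Longrightarrow> radial r z \<le> 1 / 4"
proof -
  assume *: "0 < r" "z \<in> ball a s" "2 * s \<le> r"
  then have "dist a z / r \<le> 1 / 2" by (simp add: divide_le_eq)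
  then have "(dist a z / r)\<^sup>2 \<le> (1 / 2)\<^sup>2" using * by (intro power_mono) auto
  then show ?thesis by (simp add: radial_eq power_divide)
qed

lemma E_sets: "E \<in> sets (restrict_space borel U)" by (rule balanced_sets[OF E])

lemma radial_measurable [measurable]: "radial r \<in> borel_measurable borel"
  unfolding radial_def[abs_def] by measurable

lemma profile_measurable: "profile \<in> borel_measurable borel" "profile' \<in> borel_measurable borel"
  using smooth_continuous_on[OF smooth_profile] profile'_continuous by (auto intro: borel_measurable_continuous_onI)

lemma cball_sets: "r \<le> R \<Longrightarrow> cball a r \<in> sets (restrict_space borel U)"
  using R by (auto simp: sets_restrict_borel_iff[OF U])

lemma ball_sets: "r \<le> R \<Longrightarrow> ball a r \<in> sets (restrict_space borel U)"
  using R by (force simp: sets_restrict_borel_iff[OF U])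

lemma finite_cball: "r \<le> R \<Longrightarrow> emeasure V (cball a r \<times> G) < \<infinity>"
  using R by (intro finite_V) auto

lemma integrable_radial:
  assumes h: "h \<in> borel_measurable borel" "\<And>t. 0 \<le> t \<Longrightarrow> t \<le> 1 \<Longrightarrow> \<bar>h t\<bar> \<le> B" "\<And>t. 1 < t \<Longrightarrow> h t = (0::real)"
    and r: "0 < r" "r \<le> R"
  shows "integrable V (\<lambda>p. indicator (E \<times> G) p * h (radial r (fst p)))"
proof -
  have "integrable V (\<lambda>p. h (radial r (fst p)))"
  proof (rule integrableI_bounded_set[where A = "cball a r \<times> G" and B = B])
    show "cball a r \<times> G \<in> sets V" by (rule times_sets_V[OF cball_sets[OF r(2)]])
    show "(\<lambda>p. h (radial r (fst p))) \<in> borel_measurable V"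
      by (rule fst_borel_measurable) (use h(1) in measurable)
    show "emeasure V (cball a r \<times> G) < \<infinity>" by (rule finite_cball[OF r(2)])
    have "radial r z \<ge> 0" for z by (simp add: radial_eq)
    then show "AE p in V. p \<in> cball a r \<times> G \<longrightarrow> norm (h (radial r (fst p))) \<le> B"
    proof (intro AE_I2 impI)
      fix p :: "(real^'n) \<times> (real^'n) set" assume "p \<in> cball a r \<times> G"
      then have "dist a (fst p) / r \<le> 1" using r by (auto simp: divide_le_eq)
      then have "radial r (fst p) \<le> 1" using r unfolding radial_eq by (intro power_le_one) auto
      then show "norm (h (radial r (fst p))) \<le> B" using h(2) by (simp add: radial_eq)
    qed
    show "AE p in V. p \<notin> cball a r \<times> G \<longrightarrow> h (radial r (fst p)) = 0"
    proof (intro AE_I2 impI)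
      fix p assume "p \<in> space V" "p \<notin> cball a r \<times> G"
      then have "fst p \<notin> cball a r" by (cases p) (auto simp: space_V)
      then show "h (radial r (fst p)) = 0" using h(3) radial_gt[OF r(1)] by blast
    qed
  qed
  from integrable_mult_indicator[OF times_sets_V[OF E_sets] this] show ?thesis by simp
qed

text \<open>The derivative is continuous on the unit interval and vanishes beyond 1. Negative
  arguments, which \<open>radial\<close> never takes, are set aside by the last disjunct.\<close>

lemma profile'_bounded: "\<exists>B>0. \<forall>t. \<bar>profile' t\<bar> \<le> B \<and> \<bar>profile' t * t\<bar> \<le> B \<or> t < 0"
proof -
  have "compact (profile' ` {0..1})"
    by (intro compact_continuous_image profile'_continuous) auto
  then have "bounded (profile' ` {0..1})" by (rule compact_imp_bounded)
  then obtain B where B: "B > 0" "\<forall>y\<in>profile' ` {0..1}. norm y \<le> B" unfolding bounded_pos by blast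
  have "\<bar>profile' t\<bar> \<le> B \<and> \<bar>profile' t * t\<bar> \<le> B" if "0 \<le> t" for t
  proof (cases "t \<le> 1")
    case True
    then have *: "\<bar>profile' t\<bar> \<le> B" using B that by auto
    have "\<bar>profile' t\<bar> * \<bar>t\<bar> \<le> B * 1" using * True that B(1) by (intro mult_mono) auto
    with * show ?thesis by (simp add: abs_mult)
  next
    case False
    then show ?thesis using B(1) by (simp add: profile'_0)
  qed
  then show ?thesis using B(1) by (metis not_le)
qed

lemma mass_integrable: "0 < r \<Longrightarrow> r \<le> R \<Longrightarrow> integrable V (\<lambda>p. indicator (E \<times> G) p * profile (radial r (fst p)))"
  using profile_range profile_0 profile_measurable by (intro integrable_radial[where B = 1]) auto

lemma drift_integrable:
  "0 < r \<Longrightarrow> r \<le> R \<Longrightarrow> integrable V (\<lambda>p. indicator (E \<times> G) p * (profile' (radial r (fst p)) * radial r (fst p)))"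
proof -
  assume r: "0 < r" "r \<le> R"
  obtain B where B: "B > 0" "\<forall>t. \<bar>profile' t\<bar> \<le> B \<and> \<bar>profile' t * t\<bar> \<le> B \<or> t < 0"
    using profile'_bounded by blast
  show ?thesis
    by (rule integrable_radial[where h = "\<lambda>t. profile' t * t" and B = B])
       (use r B profile'_0 profile_measurable in \<open>auto simp: not_less[symmetric]\<close>)
qed

lemma mass_has_derivative:
  assumes r: "0 < r" "r < R"
  shows "(mass has_real_derivative - (2 / r) * drift r) (at r)"
proof -
  obtain B where B: "B > 0" "\<forall>t. \<bar>profile' t\<bar> \<le> B \<and> \<bar>profile' t * t\<bar> \<le> B \<or> t < 0"
    using profile'_bounded by blast
  let ?f' = "\<lambda>t p. indicator (E \<times> G) p * (profile' (radial t (fst p)) * (- (2 / t) * radial t (fst p)))"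
  have "((\<lambda>t. LINT p|V. indicator (E \<times> G) p * profile (radial t (fst p))) has_real_derivative (LINT p|V. ?f' r p)) (at r)"
  \<comment> \<open>Staying above \<open>r/2\<close> bounds the factor \<open>2 / t\<close> by
    \<open>4 / r\<close>; staying below \<open>R\<close> keeps all supports in
    \<open>cball a R\<close>.\<close>
  proof (rule has_derivative_integral_parameter[where S = "{r/2<..<R}" and w = "\<lambda>p. (4 * B / r) * indicator (cball a R \<times> G) p"])
    show "integrable V (\<lambda>p. indicator (E \<times> G) p * profile (radial t (fst p)))" if "t \<in> {r/2<..<R}" for t
      using that r by (intro mass_integrable) auto
    show "((\<lambda>t. indicator (E \<times> G) p * profile (radial t (fst p))) has_real_derivative ?f' t p) (at t)"
      if "t \<in> {r/2<..<R}" for t p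
    proof -
      have t: "0 < t" using that r by simp
      have "((\<lambda>t. radial t (fst p)) has_real_derivative (- (2 / t) * radial t (fst p))) (at t)"
        unfolding radial_def using t
        by (auto intro!: derivative_eq_intros simp: field_simps power2_eq_square)
      from DERIV_chain2[OF profile_has_derivative this] show ?thesis
        by (rule DERIV_cmult)
    qed
    show "\<bar>?f' t p\<bar> \<le> (4 * B / r) * indicator (cball a R \<times> G) p" if t: "t \<in> {r/2<..<R}" and p: "p \<in> space V" for t p
    proof (cases "p \<in> cball a R \<times> G")
      case True
      have "\<bar>profile' (radial t (fst p)) * radial t (fst p)\<bar> \<le> B"
        using B(2) by (metis radial_eq not_less zero_le_power2)
      moreover have "\<bar>2 / t\<bar> \<le> 4 / r" using t r by (simp add: field_simps)
      ultimately have "\<bar>profile' (radial t (fst p)) * radial t (fst p)\<bar> * \<bar>2 / t\<bar> \<le> B * (4 / r)"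
        using B(1) by (intro mult_mono) auto
      then have "\<bar>profile' (radial t (fst p)) * (- (2 / t) * radial t (fst p))\<bar> \<le> 4 * B / r"
        by (simp add: abs_mult mult_ac)
      moreover have "0 \<le> 4 * B / r" using B(1) r by simp
      ultimately show ?thesis using True by (auto simp: indicator_def)
    next
      case False
      then have "fst p \<notin> cball a t" using t p by (cases p) (auto simp: space_V)
      then have "profile' (radial t (fst p)) = 0" using t r by (intro profile'_0 radial_gt) auto
      then show ?thesis using False by simp
    qed
    show "integrable V (\<lambda>p. (4 * B / r) * indicator (cball a R \<times> G) p)"
      using finite_cball[of R] times_sets_V[OF cball_sets[of R]] by (intro integrable_mult_right integrable_real_indicator) auto
    have "(\<lambda>p. - (2 / r) * (indicator (E \<times> G) p * (profile' (radial r (fst p)) * radial r (fst p)))) \<in> borel_measurable V"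
      by (rule borel_measurable_times[OF borel_measurable_const borel_measurable_integrable[OF drift_integrable]])
         (use r in auto)
    then show "?f' r \<in> borel_measurable V" by (simp add: mult_ac)
  qed (use r in auto)
  moreover have "(LINT p|V. ?f' r p) = - (2 / r) * drift r"
    unfolding drift_def integral_mult_right_zero[symmetric] by (simp add: mult_ac)
  ultimately show ?thesis by (simp only: mass_def[abs_def])
qed

text \<open>The balanced identity is tested with the field \<open>z - a\<close> times the profile.
  In its divergence the nonpositive \<open>profile'\<close> multiplies the squared length of the
  projection of \<open>z - a\<close>, which is enlarged to the full squared length. The other side
  is at most \<open>r\<close> times the variation of \<open>ball a r\<close> for the whole varifold,
  so \<open>j\<close> does not depend on \<open>E\<close>.\<close>

lemma mass_drift_inequality:
  assumes r: "0 < r" "r < R"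
  shows "m * mass r + 2 * drift r \<le> j * r ^ Suc m"
proof -
  let ?g = "\<lambda>z. profile ((z - a) \<bullet> (z - a) * inverse (r\<^sup>2)) *\<^sub>R (z - a)"
  have zero: "?g z = 0" if "z \<notin> ball a r" for z
    using radial_ge[OF r(1) that] by (simp add: radial_def profile_0)
  have g: "?g \<in> test_fields U"
  proof (rule test_fieldI(1)[of _ "cball a r"])
    show "smooth ?g" by (intro smooth_scaleR smooth_radial smooth_profile smooth_diff smooth_id smooth_const)
    show "cball a r \<subseteq> U" using R r by auto
    show "?g z = 0" if "z \<notin> cball a r" for z using that by (intro zero) auto
  qed auto
  have vd: "m * profile (radial r z) + 2 * (profile' (radial r z) * radial r z) \<le> vdiv ?g (z, S)" if S: "S \<in> G" for z S
  proof -
    have sub: "subspace S" using S by (simp add: grassmannian_def)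
    have "(z - a) \<bullet> orth_proj S (z - a) \<le> (z - a) \<bullet> (z - a)" by (rule orth_proj_inner(4)[OF sub])
    then have "inverse (r\<^sup>2) * ((z - a) \<bullet> orth_proj S (z - a)) \<le> radial r z"
      unfolding radial_def by (simp add: mult_left_mono mult.commute)
    then have "2 * profile' (radial r z) * radial r z \<le> 2 * profile' (radial r z) * (inverse (r\<^sup>2) * ((z - a) \<bullet> orth_proj S (z - a)))"
      using profile'_nonpos[of "radial r z"] by (intro mult_left_mono_neg) auto
    moreover have "vdiv ?g (z, S) = m * profile (radial r z) + 2 * inverse (r\<^sup>2) * profile' (radial r z) * ((z - a) \<bullet> orth_proj S (z - a))"
      unfolding radial_def by (rule vdiv_radial[OF smooth_profile profile_has_derivative S])
    ultimately show ?thesis by (simp add: mult_ac)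
  qed
  note mi = mass_integrable[OF r(1) less_imp_le[OF r(2)]] and di = drift_integrable[OF r(1) less_imp_le[OF r(2)]]
  have "m * mass r + 2 * drift r = (LINT p|V. m * (indicator (E \<times> G) p * profile (radial r (fst p)))
      + 2 * (indicator (E \<times> G) p * (profile' (radial r (fst p)) * radial r (fst p))))"
    unfolding mass_def drift_def using mi di by simp
  also have "\<dots> \<le> (LINT p|V. indicator (E \<times> G) p * vdiv ?g p)"
  proof (rule integral_mono)
    fix p assume "p \<in> space V"
    then have "snd p \<in> G" by (auto simp: space_V)
    from vd[OF this, of "fst p"] show "m * (indicator (E \<times> G) p * profile (radial r (fst p)))
      + 2 * (indicator (E \<times> G) p * (profile' (radial r (fst p)) * radial r (fst p))) \<le> indicator (E \<times> G) p * vdiv ?g p"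
      by (auto simp: indicator_def)
  qed (use mi di integrable_indicator_vdiv[OF E_sets g] in auto)
  also have "\<dots> = (LINT z|\<nu>. indicator E z * (?g z \<bullet> eta z))"
    by (rule bspec[OF conjunct2[OF E[unfolded balanced_def]] g, symmetric])
  also have "\<dots> \<le> (LINT z|\<nu>. r * indicator (ball a r) z)"
  proof (rule integral_mono[OF integrable_indicator_eta[OF E_sets g]])
    have bs: "ball a r \<in> sets \<nu>" using ball_sets[of r] r by simp
    have cs: "cball a r \<in> sets \<nu>" using cball_sets[of r] r by simp
    have "emeasure \<nu> (ball a r) \<le> emeasure \<nu> (cball a r)" by (intro emeasure_mono cs) auto
    also have "\<dots> < \<infinity>" using R r by (intro radon_on_open.finite_compact[OF radon_\<nu>]) auto
    finally show "integrable \<nu> (\<lambda>z. r * indicator (ball a r) z)"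
      using bs by (intro integrable_mult_right integrable_real_indicator) auto
    fix z assume "z \<in> space \<nu>"
    then have z: "norm (eta z) = 1" using eta(2) by simp
    show "indicator E z * (?g z \<bullet> eta z) \<le> r * indicator (ball a r) z"
    proof (cases "z \<in> ball a r")
      case True
      have "norm (?g z) \<le> 1 * r"
        unfolding norm_scaleR using profile_range True
        by (intro mult_mono) (auto simp: dist_norm norm_minus_commute)
      then have "?g z \<bullet> eta z \<le> r" using norm_cauchy_schwarz[of "?g z" "eta z"] z by simp
      then show ?thesis using True r by (auto simp: indicator_def)
    next
      case False
      have e: "?g z \<bullet> eta z = 0" by (subst zero[OF False]) simp
      show ?thesis unfolding e using False by simp
    qed
  qed
  also have "\<dots> = r * measure \<nu> (ball a r)"
    using ball_sets[of r] r by (simp add: Int_absorb2 sets_restrict_borel_iff[OF U])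
  also have "\<dots> \<le> r * (j * r ^ m)" using growth[OF r] r by (intro mult_left_mono) auto
  finally show ?thesis by (simp add: mult_ac)
qed

text \<open>The derivative of \<open>mass x / x ^ m + j * x\<close> is
  \<open>j - (m * mass x + 2 * drift x) / x ^ Suc m\<close>, which
  \<open>mass_drift_inequality\<close> makes nonnegative.\<close>

lemma mass_monotone:
  assumes "0 < s" "s \<le> r" "r < R"
  shows "mass s / s ^ m + j * s \<le> mass r / r ^ m + j * r"
proof (rule DERIV_nonneg_imp_nondecreasing[OF assms(2)])
  fix x assume x: "s \<le> x" "x \<le> r"
  then have x0: "0 < x" "x < R" using assms by auto
  let ?d = "(- (2 / x) * drift x * x ^ m - mass x * (m * x ^ (m - Suc 0))) / (x ^ m * x ^ m) + j"
  have "((\<lambda>x. mass x / x ^ m + j * x) has_real_derivative ?d) (at x)"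
    using x0 by (auto intro!: derivative_eq_intros mass_has_derivative)
  moreover have "0 \<le> ?d"
  proof -
    have xm: "m * x ^ (m - Suc 0) = m * x ^ m / x" using x0 by (cases m) auto
    have "?d = j - (m * mass x + 2 * drift x) / (x ^ Suc m)"
      unfolding xm using x0 by (simp add: field_simps)
    moreover have "(m * mass x + 2 * drift x) / (x ^ Suc m) \<le> j"
      using mass_drift_inequality[OF x0] x0 by (simp add: divide_le_eq)
    ultimately show ?thesis by simp
  qed
  ultimately show "\<exists>y. ((\<lambda>x. mass x / x ^ m + j * x) has_real_derivative y) (at x) \<and> 0 \<le> y" by blast
qed

lemma measure_V_indicator:
  assumes "S \<in> sets (restrict_space borel U)" "emeasure V (S \<times> G) < \<infinity>"
  shows "measure \<mu> S = (LINT p|V. indicator (S \<times> G) p)" "integrable V (indicator (S \<times> G) :: _ \<Rightarrow> real)"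
proof -
  have "S \<times> G \<in> sets V" by (rule times_sets_V[OF assms(1)])
  then show "measure \<mu> S = (LINT p|V. indicator (S \<times> G) p)"
    using sets.sets_into_space[of "S \<times> G" V] by (simp add: measure_def emeasure_\<mu>[OF assms(1)] Int_absorb2)
  show "integrable V (indicator (S \<times> G) :: _ \<Rightarrow> real)"
    using \<open>S \<times> G \<in> sets V\<close> assms(2) by (intro integrable_real_indicator) auto
qed

text \<open>Smoothing costs a factor 2 in the smaller radius: \<open>profile\<close> is 1 up to half
  the radius, so \<open>mass (2 * s)\<close> dominates the weight of \<open>E\<close> in
  \<open>ball a s\<close>, whereas \<open>mass r\<close> is at most the weight of \<open>E\<close>
  in \<open>ball a r\<close>.\<close>

theorem density_monotone:
  assumes "0 < s" "2 * s \<le> r" "r < R"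
  shows "measure \<mu> (E \<inter> ball a s) / (2 * s) ^ m \<le> measure \<mu> (E \<inter> ball a r) / r ^ m + j * r"
proof -
  have fin: "emeasure V ((E \<inter> ball a t) \<times> G) < \<infinity>" and st: "E \<inter> ball a t \<in> sets (restrict_space borel U)"
    if "t \<le> R" for t
  proof -
    show "E \<inter> ball a t \<in> sets (restrict_space borel U)" using ball_sets[OF that] E_sets by auto
    have "emeasure V ((E \<inter> ball a t) \<times> G) \<le> emeasure V (cball a t \<times> G)"
      by (intro emeasure_mono times_sets_V cball_sets that) auto
    then show "emeasure V ((E \<inter> ball a t) \<times> G) < \<infinity>" using finite_cball[OF that] by (rule le_less_trans)
  qed
  have s: "s \<le> R" "2 * s \<le> R" "r \<le> R" "0 < r" using assms by auto
  have low: "measure \<mu> (E \<inter> ball a s) \<le> mass (2 * s)"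
    unfolding mass_def measure_V_indicator(1)[OF st[OF s(1)] fin[OF s(1)]]
  proof (rule integral_mono)
    fix p :: "(real^'n) \<times> (real^'n) set"
    show "indicator ((E \<inter> ball a s) \<times> G) p \<le> indicator (E \<times> G) p * profile (radial (2 * s) (fst p))"
    proof (cases "p \<in> (E \<inter> ball a s) \<times> G")
      case True
      then have "profile (radial (2 * s) (fst p)) = 1" using assms by (intro profile_1 radial_le[of _ _ s]) auto
      then show ?thesis using True by (auto simp: indicator_def)
    qed (simp add: profile_range)
  qed (use mass_integrable assms s measure_V_indicator(2)[OF st[OF s(1)] fin[OF s(1)]] in auto)
  have up: "mass r \<le> measure \<mu> (E \<inter> ball a r)"
    unfolding mass_def measure_V_indicator(1)[OF st[OF s(3)] fin[OF s(3)]]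
  proof (rule integral_mono)
    fix p :: "(real^'n) \<times> (real^'n) set"
    show "indicator (E \<times> G) p * profile (radial r (fst p)) \<le> indicator ((E \<inter> ball a r) \<times> G) p"
    proof (cases "fst p \<in> ball a r")
      case True
      then show ?thesis by (cases p) (auto simp: indicator_def profile_range)
    next
      case False
      then have "profile (radial r (fst p)) = 0" by (intro profile_0 radial_ge s)
      then show ?thesis by simp
    qed
  qed (use mass_integrable s measure_V_indicator(2)[OF st[OF s(3)] fin[OF s(3)]] in auto)
  have "measure \<mu> (E \<inter> ball a s) / (2 * s) ^ m \<le> mass (2 * s) / (2 * s) ^ m"
    using low assms by (intro divide_right_mono) auto
  also have "\<dots> \<le> mass (2 * s) / (2 * s) ^ m + j * (2 * s)" using j assms by simp
  also have "\<dots> \<le> mass r / r ^ m + j * r" using assms by (intro mass_monotone) auto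
  also have "mass r / r ^ m \<le> measure \<mu> (E \<inter> ball a r) / r ^ m"
    using up s by (intro divide_right_mono) auto
  finally show ?thesis by simp
qed

end

end

section \<open>Hausdorff measure and densities\<close>

lemma sets_hausdorff [simp]: "sets (hausdorff m :: 'a::metric_space measure) = sets borel"
  and space_hausdorff [simp]: "space (hausdorff m :: 'a::metric_space measure) = UNIV"
proof -
  have "sigma_algebra UNIV (sets (borel :: 'a measure))"
    using sets.sigma_algebra_axioms[of "borel :: 'a measure"] by simp
  then show "sets (hausdorff m :: 'a measure) = sets borel"
    unfolding hausdorff_def by (rule sigma_algebra.sets_measure_of_eq)
  show "space (hausdorff m :: 'a measure) = UNIV"
    unfolding hausdorff_def by (rule space_measure_of) simp
qed

text \<open>
  By the definition of \<^const>\<open>measure_of\<close>, the measure \<^term>\<open>hausdorff m\<close> either agrees with the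
  outer measure on Borel sets or vanishes identically. Both cases serve the argument below, so the
  countable additivity of the outer measure is not needed.
\<close>

lemma hausdorff_cases:
  "(\<forall>A\<in>sets borel. emeasure (hausdorff m :: 'a::metric_space measure) A = hausdorff_outer m A) \<or>
   (\<forall>A. emeasure (hausdorff m :: 'a measure) A = 0)"
proof -
  have eq: "sigma_sets UNIV (sets (borel :: 'a measure)) = sets borel"
    using sets.sigma_sets_eq[of "borel :: 'a measure"] by simp
  show ?thesis
    unfolding hausdorff_def by (auto simp: emeasure_measure_of_conv eq)
qed

lemma hausdorff_le_outer: "emeasure (hausdorff m) A \<le> hausdorff_outer m A"
  using hausdorff_cases[of m] emeasure_notin_sets[of A "hausdorff m"]
  by (cases "A \<in> sets borel") auto

text \<open>An open ball is an increasing union of smaller concentric balls, and each of these lies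
  in the ball of the original radius about every nearby centre; so the measure of
  \<open>ball a r\<close> is lower semicontinuous in \<open>a\<close>. This yields measurability of
  sets defined by density bounds.\<close>

lemma closed_measure_ball_le:
  fixes N :: "'a::metric_space measure"
  assumes "\<And>a r. ball a r \<in> sets N"
  shows "closed {a. \<forall>r. 0 < r \<and> r < \<rho> \<longrightarrow> emeasure N (ball a r) \<le> f r}"
proof -
  have "closed {a. emeasure N (ball a r) \<le> c}" for r c
  proof -
    have "open {a. c < emeasure N (ball a r)}"
      unfolding open_dist
    proof (intro ballI)
      fix a assume "a \<in> {a. c < emeasure N (ball a r)}"
      then have a: "c < emeasure N (ball a r)" by simp
      have beq: "ball a r = (\<Union>k. ball a (r - inverse (real (Suc k))))"
      proof (intro equalityI subsetI)
        fix x assume "x \<in> ball a r"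
        then obtain k where "inverse (real (Suc k)) < r - dist a x"
          using reals_Archimedean[of "r - dist a x"] by auto
        then show "x \<in> (\<Union>k. ball a (r - inverse (real (Suc k))))" by (auto intro!: exI[of _ k])
      next
        fix x assume "x \<in> (\<Union>k. ball a (r - inverse (real (Suc k))))"
        then obtain k where "dist a x < r - inverse (real (Suc k))" by auto
        moreover have "0 < inverse (real (Suc k))" by simp
        ultimately have "dist a x < r" by linarith
        then show "x \<in> ball a r" by simp
      qed
      have inc: "incseq (\<lambda>k. ball a (r - inverse (real (Suc k))))"
        by (intro incseq_SucI subset_ball) (simp add: field_simps)
      have "emeasure N (ball a r) = (SUP k. emeasure N (ball a (r - inverse (real (Suc k)))))"
        by (subst beq, rule SUP_emeasure_incseq[symmetric, OF _ inc]) (use assms in auto)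
      with a have "c < (SUP k. emeasure N (ball a (r - inverse (real (Suc k)))))" by (simp only:)
      then obtain k where k: "c < emeasure N (ball a (r - inverse (real (Suc k))))"
        unfolding less_SUP_iff by blast
      have "c < emeasure N (ball y r)" if "dist y a < inverse (real (Suc k))" for y
      proof -
        have "dist y x < r" if "dist a x < r - inverse (real (Suc k))" for x
          using dist_triangle[of y x a] that \<open>dist y a < _\<close> by linarith
        then have "ball a (r - inverse (real (Suc k))) \<subseteq> ball y r" by auto
        then have "emeasure N (ball a (r - inverse (real (Suc k)))) \<le> emeasure N (ball y r)"
          by (rule emeasure_mono[OF _ assms])
        with k show ?thesis by simp
      qed
      then show "\<exists>e>0. \<forall>y. dist y a < e \<longrightarrow> y \<in> {a. c < emeasure N (ball a r)}"
        by (intro exI[of _ "inverse (real (Suc k))"]) auto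
    qed
    then show ?thesis by (simp add: closed_def Collect_neg_eq[symmetric] not_le)
  qed
  then have "closed (\<Inter>r\<in>{0<..<\<rho>}. {a. emeasure N (ball a r) \<le> f r})" by (intro closed_INT) auto
  moreover have "(\<Inter>r\<in>{0<..<\<rho>}. {a. emeasure N (ball a r) \<le> f r}) = {a. \<forall>r. 0 < r \<and> r < \<rho> \<longrightarrow> emeasure N (ball a r) \<le> f r}"
    by auto
  ultimately show ?thesis by simp
qed

section \<open>Comparison of densities with Hausdorff measure\<close>

lemma hausdorff_outer_leI:
  fixes A :: "'a::metric_space set"
  assumes "\<And>\<delta>. \<delta> > 0 \<Longrightarrow> \<exists>C :: nat \<Rightarrow> 'a set. A \<subseteq> (\<Union>i. C i) \<and> (\<forall>i. bounded (C i) \<and> diameter (C i) \<le> \<delta>) \<and>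
     (\<Sum>i. ennreal (unit_ball_vol (real m) * (diameter (C i) / 2) ^ m)) \<le> c"
  shows "hausdorff_outer m A \<le> c"
  unfolding hausdorff_outer_def
proof (rule SUP_least)
  fix \<delta> :: real assume "\<delta> \<in> {0<..}"
  then obtain C :: "nat \<Rightarrow> 'a set" where "A \<subseteq> (\<Union>i. C i) \<and> (\<forall>i. bounded (C i) \<and> diameter (C i) \<le> \<delta>)"
     "(\<Sum>i. ennreal (unit_ball_vol (real m) * (diameter (C i) / 2) ^ m)) \<le> c"
    using assms[of \<delta>] by auto
  then show "(INF C\<in>{C :: nat \<Rightarrow> 'a set. A \<subseteq> (\<Union>i. C i) \<and> (\<forall>i. bounded (C i) \<and> diameter (C i) \<le> \<delta>)}.
        \<Sum>i. ennreal (unit_ball_vol (real m) * (diameter (C i) / 2) ^ m)) \<le> c"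
    by (intro INF_lower2[of C]) auto
qed

lemma diameter_ball_le: "0 \<le> r \<Longrightarrow> diameter (ball (a::'a::euclidean_space) r) \<le> 2 * r"
  using diameter_ball[of a r] by (cases "r = 0") auto

text \<open>Vitali's covering lemma selects disjoint balls of large measure whose fivefold
  enlargements cover \<open>A\<close>; disjointness bounds the sum of their measures by that of
  \<open>K\<close>, and the enlargement costs \<open>5 ^ m\<close>.\<close>

lemma hausdorff_outer_le_of_density:
  fixes N :: "'a::euclidean_space measure" and A :: "'a set"
  assumes m: "1 \<le> m" and t: "t > 0"
    and balls: "\<And>a \<rho>. a \<in> A \<Longrightarrow> \<rho> > 0 \<Longrightarrow> \<exists>r>0. r < \<rho> \<and> cball a r \<subseteq> K \<and> cball a r \<in> sets N \<and> ennreal (t * r ^ m) \<le> emeasure N (cball a r)"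
    and K: "K \<in> sets N"
  shows "hausdorff_outer m A \<le> ennreal (unit_ball_vol (real m) * 5 ^ m / t) * emeasure N K"
proof (rule hausdorff_outer_leI)
  fix \<delta> :: real assume \<delta>: "\<delta> > 0"
  \<comment> \<open>With radius below \<open>\<delta>/10\<close> the enlarged ball has diameter
    below \<open>\<delta>\<close>.\<close>
  have "\<forall>a\<in>A. \<exists>r. r > 0 \<and> r < \<delta>/10 \<and> cball a r \<subseteq> K \<and> cball a r \<in> sets N \<and> ennreal (t * r ^ m) \<le> emeasure N (cball a r)"
    using balls[of _ "\<delta>/10"] \<delta> by auto
  from bchoice[OF this] obtain r where r: "\<forall>a\<in>A. r a > 0 \<and> r a < \<delta>/10 \<and> cball a (r a) \<subseteq> K \<and> cball a (r a) \<in> sets N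
      \<and> ennreal (t * r a ^ m) \<le> emeasure N (cball a (r a))" by blast
  have rB: "0 < r a \<and> r a \<le> \<delta>/10" if "a \<in> A" for a using r that by auto
  obtain C where C: "countable C" "C \<subseteq> A" "pairwise (\<lambda>i j. disjnt (cball i (r i)) (cball j (r j))) C"
    "\<And>i. i \<in> A \<Longrightarrow> \<exists>j. j \<in> C \<and> \<not> disjnt (cball i (r i)) (cball j (r j)) \<and> cball i (r i) \<subseteq> ball j (5 * r j)"
    by (rule Vitali_covering_lemma_cballs_balls[of A r "\<delta>/10" "\<lambda>a. a", OF rB], assumption) (rule that)
  let ?J = "to_nat_on C ` C"
  define D where "D n = (if n \<in> ?J then ball (from_nat_into C n) (5 * r (from_nat_into C n)) else {})" for n
  define D' where "D' n = (if n \<in> ?J then cball (from_nat_into C n) (r (from_nat_into C n)) else {})" for n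
  have Dto: "D (to_nat_on C a) = ball a (5 * r a)" "D' (to_nat_on C a) = cball a (r a)" if "a \<in> C" for a
    using that C(1) by (simp_all add: D_def D'_def)
  have cases: "D n = {} \<and> D' n = {} \<or> (\<exists>a\<in>C. n = to_nat_on C a \<and> D n = ball a (5 * r a) \<and> D' n = cball a (r a))" for n
    using Dto by (cases "n \<in> ?J") (auto simp: D_def D'_def)
  have rC: "r a > 0" "r a < \<delta>/10" "cball a (r a) \<subseteq> K" "cball a (r a) \<in> sets N"
      "ennreal (t * r a ^ m) \<le> emeasure N (cball a (r a))" if "a \<in> C" for a
    using r C(2) that by auto
  have D's: "D' n \<in> sets N" "D' n \<subseteq> K" for n
  proof -
    show "D' n \<in> sets N" using cases[of n] rC(4) by auto
    show "D' n \<subseteq> K" using cases[of n] rC(3) by blast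
  qed
  have dis: "disjoint_family D'"
    unfolding disjoint_family_on_def
  proof (intro ballI impI)
    fix i j :: nat assume ij: "i \<noteq> j"
    show "D' i \<inter> D' j = {}"
    proof (rule ccontr)
      assume ne: "D' i \<inter> D' j \<noteq> {}"
      then have "D' i \<noteq> {}" "D' j \<noteq> {}" by auto
      with cases[of i] cases[of j] have "\<exists>a\<in>C. i = to_nat_on C a \<and> D' i = cball a (r a)"
        "\<exists>a\<in>C. j = to_nat_on C a \<and> D' j = cball a (r a)" by blast+
      then obtain a b where ab: "a \<in> C" "i = to_nat_on C a" "D' i = cball a (r a)"
        "b \<in> C" "j = to_nat_on C b" "D' j = cball b (r b)" by blast
      then have "a \<noteq> b" using ij by auto
      then have "disjnt (cball a (r a)) (cball b (r b))" using C(3) ab by (auto simp: pairwise_def)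
      then show False using ne ab by (simp add: disjnt_def)
    qed
  qed
  have ball_term: "ennreal (unit_ball_vol (real m) * (diameter (D n) / 2) ^ m)
      \<le> ennreal (unit_ball_vol (real m) * 5 ^ m / t) * emeasure N (D' n)" for n
  proof (cases "D n = {}")
    \<comment> \<open>Padding with empty sets is free because \<open>0 ^ m = 0\<close> for
      \<open>m \<ge> 1\<close>.\<close>
    case True
    then show ?thesis using m by (simp add: power_0_left)
  next
    case False
    then obtain a where a: "a \<in> C" "D n = ball a (5 * r a)" "D' n = cball a (r a)" using cases[of n] by blast
    have "diameter (D n) / 2 \<le> 5 * r a" using diameter_ball_le[of "5 * r a" a] rC(1)[OF a(1)] a(2) by simp
    then have "(diameter (D n) / 2) ^ m \<le> (5 * r a) ^ m"
      using a(2) by (intro power_mono) (auto simp: diameter_ge_0)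
    then have "unit_ball_vol (real m) * (diameter (D n) / 2) ^ m \<le> unit_ball_vol (real m) * (5 * r a) ^ m"
      by (intro mult_left_mono) auto
    also have "\<dots> = (unit_ball_vol (real m) * 5 ^ m / t) * (t * r a ^ m)"
      using t by (simp add: power_mult_distrib)
    finally have "ennreal (unit_ball_vol (real m) * (diameter (D n) / 2) ^ m)
        \<le> ennreal (unit_ball_vol (real m) * 5 ^ m / t) * ennreal (t * r a ^ m)"
      using t by (subst ennreal_mult'[symmetric]) (auto intro!: ennreal_leI)
    also have "\<dots> \<le> ennreal (unit_ball_vol (real m) * 5 ^ m / t) * emeasure N (D' n)"
      unfolding a(3) by (intro mult_left_mono rC(5) a(1)) auto
    finally show ?thesis .
  qed
  have "(\<Sum>n. ennreal (unit_ball_vol (real m) * (diameter (D n) / 2) ^ m))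
      \<le> (\<Sum>n. ennreal (unit_ball_vol (real m) * 5 ^ m / t) * emeasure N (D' n))"
    by (intro suminf_le ball_term) auto
  also have "\<dots> = ennreal (unit_ball_vol (real m) * 5 ^ m / t) * (\<Sum>n. emeasure N (D' n))" by simp
  also have "(\<Sum>n. emeasure N (D' n)) = emeasure N (\<Union>n. D' n)"
    using D's dis by (intro suminf_emeasure) auto
  also have "\<dots> \<le> emeasure N K" using D's K by (intro emeasure_mono) auto
  finally have sum: "(\<Sum>n. ennreal (unit_ball_vol (real m) * (diameter (D n) / 2) ^ m))
      \<le> ennreal (unit_ball_vol (real m) * 5 ^ m / t) * emeasure N K" by (simp add: mult_left_mono)
  have cov: "A \<subseteq> (\<Union>n. D n)"
  proof
    fix a assume a: "a \<in> A"
    then obtain j where j: "j \<in> C" "cball a (r a) \<subseteq> ball j (5 * r j)" using C(4) by blast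
    have "a \<in> cball a (r a)" using rB[OF a] by simp
    then have "a \<in> D (to_nat_on C j)" using j Dto(1)[OF j(1)] by blast
    then show "a \<in> (\<Union>n. D n)" by blast
  qed
  have "bounded (D n) \<and> diameter (D n) \<le> \<delta>" for n
  proof (cases "D n = {}")
    case False
    then obtain a where a: "a \<in> C" "D n = ball a (5 * r a)" using cases[of n] by blast
    then show ?thesis using diameter_ball_le[of "5 * r a" a] rC(1,2)[OF a(1)] by simp
  qed (use \<delta> in simp)
  then show "\<exists>C :: nat \<Rightarrow> 'a set. A \<subseteq> (\<Union>i. C i) \<and> (\<forall>i. bounded (C i) \<and> diameter (C i) \<le> \<delta>) \<and>
     (\<Sum>i. ennreal (unit_ball_vol (real m) * (diameter (C i) / 2) ^ m)) \<le> ennreal (unit_ball_vol (real m) * 5 ^ m / t) * emeasure N K"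
    using cov sum by (intro exI[of _ D]) auto
qed

text \<open>A covering set of diameter \<open>d > 0\<close> that meets \<open>A\<close> lies in the
  open ball of radius \<open>2 * d\<close> about a point of \<open>A\<close>, and
  \<open>t * (2 * d) ^ m\<close> is \<open>4 ^ m * t\<close> times \<open>(d / 2) ^ m\<close>; this
  explains the constant.\<close>

lemma measure_le_hausdorff_outer:
  fixes N :: "'a::euclidean_space measure" and A :: "'a set"
  assumes m: "1 \<le> m" and t: "t > 0" and \<rho>: "\<rho> > 0" and sN: "sets N = sets borel"
    and ub: "\<And>a s. a \<in> A \<Longrightarrow> 0 < s \<Longrightarrow> s < \<rho> \<Longrightarrow> emeasure N (ball a s) \<le> ennreal (t * s ^ m)"
    and A: "A \<in> sets borel"
  shows "emeasure N A \<le> ennreal (4 ^ m * t / unit_ball_vol (real m)) * hausdorff_outer m A"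
proof -
  let ?\<alpha> = "unit_ball_vol (real m)"
  have \<alpha>: "?\<alpha> > 0" by simp
  then have \<alpha>0: "?\<alpha> \<noteq> 0" by linarith
  \<comment> \<open>Diameters up to \<open>\<rho> / 4\<close> keep the radii \<open>2 * d\<close>
    below \<open>\<rho>\<close>.\<close>
  have main: "emeasure N A \<le> ennreal (4 ^ m * t / ?\<alpha>) * (\<Sum>i. ennreal (?\<alpha> * (diameter (C i) / 2) ^ m))"
    if C: "A \<subseteq> (\<Union>i. C i)" "\<And>i. bounded (C i)" "\<And>i. diameter (C i) \<le> \<rho> / 4" for C :: "nat \<Rightarrow> 'a set"
  proof -
    define B where "B i = (if C i \<inter> A = {} then {} else cball (SOME a. a \<in> C i \<inter> A) (diameter (C i)))" for i
    have Bs: "B i \<in> sets N" for i by (simp add: B_def sN)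
    have CB: "C i \<inter> A \<subseteq> B i" for i
    proof (cases "C i \<inter> A = {}")
      case False
      then have a: "(SOME a. a \<in> C i \<inter> A) \<in> C i \<inter> A" by (simp only: some_in_eq) simp
      show ?thesis
      proof
        fix x assume "x \<in> C i \<inter> A"
        then have "dist (SOME a. a \<in> C i \<inter> A) x \<le> diameter (C i)"
          using a by (intro diameter_bounded_bound[OF C(2)]) blast+
        then show "x \<in> B i" unfolding B_def using False by (simp only: if_False mem_cball)
      qed
    qed simp
    have meas: "emeasure N (B i) \<le> ennreal (4 ^ m * t / ?\<alpha>) * ennreal (?\<alpha> * (diameter (C i) / 2) ^ m)" for i
    proof (cases "C i \<inter> A = {}")
      case False
      define a where "a = (SOME a. a \<in> C i \<inter> A)"
      have "a \<in> C i \<inter> A" unfolding a_def some_in_eq by (rule False)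
      then have a: "a \<in> A" by simp
      let ?d = "diameter (C i)"
      have B: "B i = cball a ?d" using False by (simp add: B_def a_def)
      have d0: "0 \<le> ?d" by (rule diameter_ge_0[OF C(2)])
      have eq: "ennreal (4 ^ m * t / ?\<alpha>) * ennreal (?\<alpha> * (?d / 2) ^ m) = ennreal (t * (2 * ?d) ^ m)"
      proof -
        have "(4::real) ^ m = 2 ^ m * 2 ^ m" by (simp add: power_mult_distrib[symmetric])
        then have F: "4 ^ m * t / ?\<alpha> * (?\<alpha> * (?d / 2) ^ m) = t * (2 * ?d) ^ m"
          using \<alpha>0 by (simp add: power_mult_distrib power_divide)
        have "ennreal (4 ^ m * t / ?\<alpha>) * ennreal (?\<alpha> * (?d / 2) ^ m) = ennreal (4 ^ m * t / ?\<alpha> * (?\<alpha> * (?d / 2) ^ m))"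
          using t by (intro ennreal_mult'[symmetric]) simp
        then show ?thesis unfolding F .
      qed
      show ?thesis
      proof (cases "?d = 0")
        case False
        then have d: "0 < ?d" using d0 by simp
        have "emeasure N (B i) \<le> emeasure N (ball a (2 * ?d))"
          unfolding B using d sN by (intro emeasure_mono) auto
        also have "\<dots> \<le> ennreal (t * (2 * ?d) ^ m)"
          using d C(3)[of i] \<rho> by (intro ub a) auto
        finally show ?thesis by (simp add: eq)
      next
        \<comment> \<open>A covering set of diameter 0 meeting \<open>A\<close> is a single point,
          to which the density bound is applied with radii tending to 0; \<open>m \<ge> 1\<close>
          makes the bound tend to 0.\<close>
        case True
        have "emeasure N (B i) \<le> 0"
        proof (rule ennreal_le_epsilon)
          fix e :: real assume e: "0 < e"
          define s where "s = min (\<rho> / 2) (min 1 (e / t))"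
          have s: "0 < s" "s < \<rho>" "s \<le> 1" "s \<le> e / t" using \<rho> e t by (auto simp: s_def)
          have "emeasure N (B i) \<le> emeasure N (ball a s)"
            unfolding B True using s sN by (intro emeasure_mono) auto
          also have "\<dots> \<le> ennreal (t * s ^ m)" using s by (intro ub a)
          also have "\<dots> \<le> ennreal e"
          proof (rule ennreal_leI)
            have "s ^ m \<le> s ^ 1" using s m by (intro power_decreasing) auto
            then have "t * s ^ m \<le> t * (e / t)" using s(4) t by (intro mult_left_mono) auto
            then show "t * s ^ m \<le> e" using t by simp
          qed
          finally show "emeasure N (B i) \<le> 0 + ennreal e" by simp
        qed
        then show ?thesis by simp
      qed
    qed (simp add: B_def)
    have "A \<subseteq> (\<Union>i. B i)" using C(1) CB by blast
    then have "emeasure N A \<le> emeasure N (\<Union>i. B i)" using Bs by (intro emeasure_mono) auto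
    also have "\<dots> \<le> (\<Sum>i. emeasure N (B i))" using Bs by (intro emeasure_subadditive_countably) auto
    also have "\<dots> \<le> (\<Sum>i. ennreal (4 ^ m * t / ?\<alpha>) * ennreal (?\<alpha> * (diameter (C i) / 2) ^ m))"
      by (intro suminf_le meas) auto
    also have "\<dots> = ennreal (4 ^ m * t / ?\<alpha>) * (\<Sum>i. ennreal (?\<alpha> * (diameter (C i) / 2) ^ m))" by simp
    finally show ?thesis .
  qed
  let ?c = "4 ^ m * t / ?\<alpha>"
  have c: "?c > 0" using t \<alpha> by simp
  let ?I = "INF C\<in>{C :: nat \<Rightarrow> 'a set. A \<subseteq> (\<Union>i. C i) \<and> (\<forall>i. bounded (C i) \<and> diameter (C i) \<le> \<rho> / 4)}.
        \<Sum>i. ennreal (?\<alpha> * (diameter (C i) / 2) ^ m)"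
  \<comment> \<open>The constant is moved to the other side as an inverse, so that the infimum can
    be treated covering by covering.\<close>
  have "ennreal ?c * ennreal (inverse ?c) = ennreal (?c * inverse ?c)"
    by (rule ennreal_mult'[symmetric, OF less_imp_le[OF c]])
  also have "?c * inverse ?c = 1" by (rule right_inverse[OF less_imp_neq[OF c, symmetric]])
  finally have cc: "ennreal ?c * ennreal (inverse ?c) = 1" by simp
  have "ennreal (inverse ?c) * emeasure N A \<le> ?I"
  proof (rule INF_greatest)
    fix C :: "nat \<Rightarrow> 'a set" assume "C \<in> {C. A \<subseteq> (\<Union>i. C i) \<and> (\<forall>i. bounded (C i) \<and> diameter (C i) \<le> \<rho> / 4)}"
    then have "emeasure N A \<le> ennreal ?c * (\<Sum>i. ennreal (?\<alpha> * (diameter (C i) / 2) ^ m))" by (intro main) auto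
    then have "ennreal (inverse ?c) * emeasure N A \<le> ennreal (inverse ?c) * (ennreal ?c * (\<Sum>i. ennreal (?\<alpha> * (diameter (C i) / 2) ^ m)))"
      by (rule mult_left_mono) simp
    also have "\<dots> = (\<Sum>i. ennreal (?\<alpha> * (diameter (C i) / 2) ^ m))"
      unfolding mult.assoc[symmetric] mult.commute[of "ennreal (inverse ?c)"] cc by simp
    finally show "ennreal (inverse ?c) * emeasure N A \<le> (\<Sum>i. ennreal (?\<alpha> * (diameter (C i) / 2) ^ m))" .
  qed
  also have "?I \<le> hausdorff_outer m A"
    unfolding hausdorff_outer_def using \<rho> by (intro SUP_upper2[of "\<rho> / 4"]) auto
  finally have "ennreal ?c * (ennreal (inverse ?c) * emeasure N A) \<le> ennreal ?c * hausdorff_outer m A"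
    by (rule mult_left_mono) simp
  then show ?thesis unfolding mult.assoc[symmetric] cc by simp
qed

section \<open>The weight of a rectifiable varifold as a sum of Hausdorff measures\<close>

context radon_varifold begin

text \<open>A function of the point alone has compact support in the product because the
  Grassmannian is compact. For such functions the tangent planes drop out of the rectifiability
  formula.\<close>

lemma cc_compose_fst:
  assumes "continuous_on UNIV \<phi>" "compact C" "C \<subseteq> U" "\<And>z. z \<notin> C \<Longrightarrow> \<phi> z = (0::real)"
  shows "(\<lambda>p. \<phi> (fst p)) \<in> cc_functions X"
proof -
  have f: "continuous_map X euclidean fst"
    by (rule continuous_map_into_fulltopology[OF continuous_map_varifold_fst])
  have "continuous_map X euclideanreal (\<phi> \<circ> fst)"
    using assms(1) by (intro continuous_map_compose[OF f]) auto
  then have c: "continuous_map X euclideanreal (\<lambda>p. \<phi> (fst p))" by (simp add: o_def)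
  have "C \<times> G = {p \<in> topspace X. fst p \<in> C}" using assms(3) by auto
  then have cl: "closedin X (C \<times> G)"
    using closedin_continuous_map_preimage[OF f, of C] assms(2) by (simp add: compact_imp_closed)
  have "X closure_of {p \<in> topspace X. \<phi> (fst p) \<noteq> 0} \<subseteq> C \<times> G"
  proof (rule closure_of_minimal[OF _ cl])
    show "{p \<in> topspace X. \<phi> (fst p) \<noteq> 0} \<subseteq> C \<times> G" using assms(4) by fastforce
  qed
  then have "compactin X (X closure_of {p \<in> topspace X. \<phi> (fst p) \<noteq> 0})"
    by (rule closed_compactin[OF compactin_varifold_space[OF assms(2,3)]]) simp
  with c show ?thesis by (simp add: cc_functions_def)
qed

end

text \<open>The existential data of rectifiability become parameters, so that sets and constants
  derived from them can be definitions.\<close>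

locale rectifiable_radon_varifold = radon_varifold m U V
  for m :: nat and U :: "(real^'b::finite) set" and V :: "'b varifold" +
  fixes c :: "nat \<Rightarrow> real" and E M :: "nat \<Rightarrow> (real^'b) set"
  assumes c: "\<And>i. c i > 0" and Eb: "\<And>i. E i \<in> sets borel" and EU: "\<And>i. E i \<subseteq> U"
    and int: "\<And>k i. k \<in> cc_functions (varifold_space m U) \<Longrightarrow> set_integrable (hausdorff m) (E i) (\<lambda>z. k (z, tangent_cone (M i) z))"
    and rep: "\<And>k. k \<in> cc_functions (varifold_space m U) \<Longrightarrow>
       (\<lambda>i. c i * (LINT z:E i|hausdorff m. k (z, tangent_cone (M i) z))) sums (LINT p|V. k p)"
    and m1: "1 \<le> m"
begin

abbreviation H :: "(real^'b) measure" where "H \<equiv> hausdorff m"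

text \<open>The weight as the rectifiability formula predicts it; it turns out to equal
  \<open>\<mu>\<close>.\<close>

definition \<mu>' :: "(real^'b) measure" where
  "\<mu>' = measure_of U (sets (restrict_space borel U)) (\<lambda>A. \<Sum>i. ennreal (c i) * emeasure H (A \<inter> E i))"

lemma sets_\<mu>': "sets \<mu>' = sets (restrict_space borel U)"
  using sets.sigma_algebra_axioms[of "restrict_space borel U"] U
  unfolding \<mu>'_def by (intro sigma_algebra.sets_measure_of_eq) (simp add: space_restrict_space)

lemma emeasure_\<mu>':
  assumes "A \<in> sets (restrict_space borel U)"
  shows "emeasure \<mu>' A = (\<Sum>i. ennreal (c i) * emeasure H (A \<inter> E i))"
proof (rule emeasure_measure_of[OF \<mu>'_def])
  show "countably_additive (sets \<mu>') (\<lambda>A. \<Sum>i. ennreal (c i) * emeasure H (A \<inter> E i))"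
    unfolding countably_additive_def
  proof (intro allI impI)
    fix A :: "nat \<Rightarrow> _" assume A: "range A \<subseteq> sets \<mu>'" "disjoint_family A"
    have As: "A n \<in> sets borel" for n
      using A(1) unfolding sets_\<mu>' using sets_restrict_borel_iff[OF U] by blast
    have "(\<Sum>n. \<Sum>i. ennreal (c i) * emeasure H (A n \<inter> E i)) = (\<Sum>n. \<integral>\<^sup>+i. ennreal (c i) * emeasure H (A n \<inter> E i) \<partial>count_space UNIV)"
      by (simp add: nn_integral_count_space_nat)
    also have "\<dots> = (\<integral>\<^sup>+i. (\<Sum>n. ennreal (c i) * emeasure H (A n \<inter> E i)) \<partial>count_space UNIV)"
      by (rule nn_integral_suminf[symmetric]) auto
    also have "\<dots> = (\<Sum>i. \<Sum>n. ennreal (c i) * emeasure H (A n \<inter> E i))"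
      by (simp add: nn_integral_count_space_nat)
    also have "\<dots> = (\<Sum>i. ennreal (c i) * emeasure H ((\<Union>n. A n) \<inter> E i))"
    proof (intro suminf_cong)
      fix i
      have "(\<Sum>n. emeasure H (A n \<inter> E i)) = emeasure H (\<Union>n. A n \<inter> E i)"
      proof (rule suminf_emeasure)
        show "disjoint_family (\<lambda>n. A n \<inter> E i)" using A(2) unfolding disjoint_family_on_def by blast
      qed (use As Eb in auto)
      then show "(\<Sum>n. ennreal (c i) * emeasure H (A n \<inter> E i)) = ennreal (c i) * emeasure H ((\<Union>n. A n) \<inter> E i)"
        by (simp add: Int_UN_distrib2)
    qed
    finally show "(\<Sum>n. \<Sum>i. ennreal (c i) * emeasure H (A n \<inter> E i)) = (\<Sum>i. ennreal (c i) * emeasure H ((\<Union>n. A n) \<inter> E i))" .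
  qed
qed (use assms sets_\<mu>' in \<open>auto simp: positive_def sets_restrict_borel_iff[OF U]\<close>)

lemma integral_\<mu>:
  assumes "continuous_on UNIV \<phi>" "compact C" "C \<subseteq> U" "\<And>z. z \<notin> C \<Longrightarrow> \<phi> z = 0" "\<And>z. (0::real) \<le> \<phi> z"
  shows "(\<integral>\<^sup>+p. ennreal (\<phi> (fst p)) \<partial>V) = (\<Sum>i. ennreal (c i) * (\<integral>\<^sup>+z. ennreal (\<phi> z) * indicator (E i) z \<partial>H))"
proof -
  note cc = cc_compose_fst[OF assms(1-4)]
  have "ennreal (c i) * (\<integral>\<^sup>+z. ennreal (\<phi> z) * indicator (E i) z \<partial>H) = ennreal (c i * (LINT z:E i|H. \<phi> z))" for i
  proof -
    have i: "integrable H (\<lambda>z. indicator (E i) z * \<phi> z)"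
      using int[OF cc, of i] by (simp add: set_integrable_def)
    have "(\<integral>\<^sup>+z. ennreal (\<phi> z) * indicator (E i) z \<partial>H) = (\<integral>\<^sup>+z. ennreal (indicator (E i) z * \<phi> z) \<partial>H)"
      by (intro nn_integral_cong) (auto simp: indicator_def)
    also have "\<dots> = ennreal (LINT z|H. indicator (E i) z * \<phi> z)"
      using assms(5) by (intro nn_integral_eq_integral i) auto
    finally show ?thesis using c[of i] by (simp add: set_lebesgue_integral_def ennreal_mult')
  qed
  moreover have "(\<Sum>i. ennreal (c i * (LINT z:E i|H. \<phi> z))) = ennreal (LINT p|V. \<phi> (fst p))"
  proof (rule suminf_ennreal_eq)
    show "(\<lambda>i. c i * (LINT z:E i|H. \<phi> z)) sums (LINT p|V. \<phi> (fst p))" using rep[OF cc] by simp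
    show "0 \<le> c i * (LINT z:E i|H. \<phi> z)" for i
      using c[of i] assms(5) by (auto simp: set_lebesgue_integral_def intro!: mult_nonneg_nonneg Bochner_Integration.integral_nonneg)
  qed
  moreover have "(\<integral>\<^sup>+p. ennreal (\<phi> (fst p)) \<partial>V) = ennreal (LINT p|V. \<phi> (fst p))"
    using integrable_cc[OF cc] assms(5) by (intro nn_integral_eq_integral) auto
  ultimately show ?thesis by simp
qed

text \<open>A cutoff between a compact \<open>C n\<close> and \<open>S\<close> turns the identity of
  integrals into inequalities in both directions; exhausting \<open>S\<close> by the sets
  \<open>C n\<close> gives equality.\<close>

lemma \<mu>_eq_open:
  assumes S: "open S" "S \<subseteq> U" shows "emeasure \<mu> S = emeasure \<mu>' S"
proof -
  have Ss: "S \<in> sets (restrict_space borel U)" using S by (simp add: sets_restrict_borel_iff[OF U])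
  obtain C where C: "\<And>n. compact (C n)" "\<And>n. C n \<subseteq> S" "\<And>n. C n \<subseteq> interior (C (Suc n))" "(\<Union>n::nat. C n) = S"
    using open_compact_exhaustion[OF S(1)] by metis
  have inc: "incseq C" using order_trans[OF C(3) interior_subset] by (intro incseq_SucI)
  have Cs: "C n \<in> sets (restrict_space borel U)" for n
    using C(1,2)[of n] S(2) by (auto simp: sets_restrict_borel_iff[OF U] borel_compact)
  have sup: "emeasure N S = (SUP n. emeasure N (C n))" if "sets N = sets (restrict_space borel U)" for N
  proof -
    have "range C \<subseteq> sets N" using Cs that by auto
    from SUP_emeasure_incseq[OF this inc] show ?thesis by (simp add: C(4))
  qed
  have both: "emeasure \<mu> (C n) \<le> emeasure \<mu>' S \<and> emeasure \<mu>' (C n) \<le> emeasure \<mu> S" for n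
  proof -
    obtain \<theta> :: "real^'b \<Rightarrow> real" and N C' where \<theta>: "smooth \<theta>" "\<And>z. 0 \<le> \<theta> z" "\<And>z. \<theta> z \<le> 1"
      "open N" "C n \<subseteq> N" "N \<subseteq> C'" "compact C'" "C' \<subseteq> S" "\<And>z. z \<in> N \<Longrightarrow> \<theta> z = 1" "\<And>z. z \<notin> C' \<Longrightarrow> \<theta> z = 0"
      by (rule smooth_cutoff[OF C(1) S(1) C(2)]) (rule that)
    have \<theta>C: "z \<in> C n \<Longrightarrow> \<theta> z = 1" and \<theta>S: "z \<notin> S \<Longrightarrow> \<theta> z = 0" for z using \<theta>(5,8,9,10) by auto
    have eq: "(\<integral>\<^sup>+p. ennreal (\<theta> (fst p)) \<partial>V) = (\<Sum>i. ennreal (c i) * (\<integral>\<^sup>+z. ennreal (\<theta> z) * indicator (E i) z \<partial>H))"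
      using \<theta>(8) S(2) by (intro integral_\<mu>[of _ C'] smooth_continuous_on \<theta>(1,2,7,10)) auto
    have HS: "(\<integral>\<^sup>+z. ennreal (\<theta> z) * indicator (E i) z \<partial>H) \<le> emeasure H (S \<inter> E i)" for i
    proof -
      have "(\<integral>\<^sup>+z. ennreal (\<theta> z) * indicator (E i) z \<partial>H) \<le> (\<integral>\<^sup>+z. indicator (S \<inter> E i) z \<partial>H)"
        using \<theta>(3) \<theta>S by (intro nn_integral_mono) (auto simp: indicator_def)
      then show ?thesis using S Eb by simp
    qed
    have HC: "emeasure H (C n \<inter> E i) \<le> (\<integral>\<^sup>+z. ennreal (\<theta> z) * indicator (E i) z \<partial>H)" for i
    proof -
      have "(\<integral>\<^sup>+z. indicator (C n \<inter> E i) z \<partial>H) \<le> (\<integral>\<^sup>+z. ennreal (\<theta> z) * indicator (E i) z \<partial>H)"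
        using \<theta>C by (intro nn_integral_mono) (auto simp: indicator_def)
      moreover have "C n \<inter> E i \<in> sets H" using C(1)[of n] Eb by (simp add: borel_compact sets.Int)
      ultimately show ?thesis by simp
    qed
    have VC: "emeasure \<mu> (C n) \<le> (\<integral>\<^sup>+p. ennreal (\<theta> (fst p)) \<partial>V)"
    proof -
      have "(\<integral>\<^sup>+p. indicator (C n \<times> G) p \<partial>V) \<le> (\<integral>\<^sup>+p. ennreal (\<theta> (fst p)) \<partial>V)"
        using \<theta>C by (intro nn_integral_mono) (auto simp: indicator_def)
      then show ?thesis using times_sets_V[OF Cs] by (simp add: emeasure_\<mu>[OF Cs])
    qed
    have VS: "(\<integral>\<^sup>+p. ennreal (\<theta> (fst p)) \<partial>V) \<le> emeasure \<mu> S"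
    proof -
      have "(\<integral>\<^sup>+p. ennreal (\<theta> (fst p)) \<partial>V) \<le> (\<integral>\<^sup>+p. indicator (S \<times> G) p \<partial>V)"
      proof (rule nn_integral_mono)
        fix p assume "p \<in> space V"
        then show "ennreal (\<theta> (fst p)) \<le> indicator (S \<times> G) p"
          using \<theta>(3)[of "fst p"] \<theta>S[of "fst p"]
          by (cases "fst p \<in> S"; cases p) (auto simp: indicator_def space_V)
      qed
      then show ?thesis using times_sets_V[OF Ss] by (simp add: emeasure_\<mu>[OF Ss])
    qed
    have "(\<Sum>i. ennreal (c i) * (\<integral>\<^sup>+z. ennreal (\<theta> z) * indicator (E i) z \<partial>H)) \<le> emeasure \<mu>' S"
      unfolding emeasure_\<mu>'[OF Ss] by (intro suminf_le mult_left_mono HS) auto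
    moreover have "emeasure \<mu>' (C n) \<le> (\<Sum>i. ennreal (c i) * (\<integral>\<^sup>+z. ennreal (\<theta> z) * indicator (E i) z \<partial>H))"
      unfolding emeasure_\<mu>'[OF Cs] by (intro suminf_le mult_left_mono HC) auto
    ultimately show ?thesis using VC VS eq by auto
  qed
  show ?thesis
  proof (rule antisym)
    show "emeasure \<mu> S \<le> emeasure \<mu>' S" using sup[OF sets_\<mu>] both by (auto intro: SUP_least)
    show "emeasure \<mu>' S \<le> emeasure \<mu> S" using sup[OF sets_\<mu>'] both by (auto intro: SUP_least)
  qed
qed

lemma \<mu>_eq: "\<mu> = \<mu>'"
proof -
  obtain C Q where Q: "\<And>k. compact (C k)" "\<And>k. C k \<subseteq> U" "\<And>k. Q k \<subseteq> C k" "\<And>k. open (Q k)"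
    "incseq Q" "(\<Union>k. Q k) = U"
    using radon_on_open.exhaustion[OF radon_\<nu>] by metis
  have op: "openin (top_of_set U) S \<longleftrightarrow> open S \<and> S \<subseteq> U" for S using U by (rule openin_open_eq)
  have s: "sets (restrict_space borel U) = sigma_sets U {S. openin (top_of_set U) S}"
    using sets_borel_on_open[OF U] sets_borel_on[of "top_of_set U"] by simp
  show ?thesis
  proof (rule measure_eqI_generator_eq[of "{S. openin (top_of_set U) S}" U _ _ Q])
    show "Int_stable {S. openin (top_of_set U) S}" by (auto simp: Int_stable_def)
    show "sets \<mu> = sigma_sets U {S. openin (top_of_set U) S}" "sets \<mu>' = sigma_sets U {S. openin (top_of_set U) S}"
      using s sets_\<mu>' by auto
    show "range Q \<subseteq> {S. openin (top_of_set U) S}" using Q(2-4) op by blast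
    show "emeasure \<mu> (Q k) \<noteq> \<infinity>" for k
    proof -
      have "emeasure \<mu> (Q k) \<le> emeasure \<mu> (C k)"
        using Q(1-3)[of k] by (intro emeasure_mono) (auto simp: sets_restrict_borel_iff[OF U] borel_compact)
      then show ?thesis using finite_\<mu>[OF Q(1,2), of k] by (auto simp: less_top[symmetric] top_unique)
    qed
    show "emeasure \<mu> S = emeasure \<mu>' S" if "S \<in> {S. openin (top_of_set U) S}" for S
      using that op by (intro \<mu>_eq_open) auto
  qed (use op Q(6) in auto)
qed

lemma \<mu>_hausdorff:
  "A \<in> sets (restrict_space borel U) \<Longrightarrow> emeasure \<mu> A = (\<Sum>i. ennreal (c i) * emeasure H (A \<inter> E i))"
  by (simp add: \<mu>_eq emeasure_\<mu>')

lemma \<mu>_null: "A \<in> sets (restrict_space borel U) \<Longrightarrow> hausdorff_outer m A = 0 \<Longrightarrow> emeasure \<mu> A = 0"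
proof -
  assume A: "A \<in> sets (restrict_space borel U)" "hausdorff_outer m A = 0"
  have "emeasure H (A \<inter> E i) = 0" for i
  proof -
    have "emeasure H (A \<inter> E i) \<le> emeasure H A"
      using A Eb by (intro emeasure_mono) (auto simp: sets_restrict_borel_iff[OF U])
    then show ?thesis using hausdorff_le_outer[of m A] A(2) by simp
  qed
  then show ?thesis by (simp add: \<mu>_hausdorff[OF A(1)])
qed

lemma \<mu>_lower: "A \<in> sets borel \<Longrightarrow> A \<subseteq> E i \<Longrightarrow> ennreal (c i) * emeasure H A \<le> emeasure \<mu> A"
proof -
  assume A: "A \<in> sets borel" "A \<subseteq> E i"
  have "ennreal (c i) * emeasure H (A \<inter> E i) \<le> (\<Sum>i. ennreal (c i) * emeasure H (A \<inter> E i))"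
    using sum_le_suminf[of "\<lambda>i. ennreal (c i) * emeasure H (A \<inter> E i)" "{i}"] by simp
  then show ?thesis using A EU[of i] by (subst \<mu>_hausdorff) (auto simp: sets_restrict_borel_iff[OF U] Int_absorb2)
qed

section \<open>Uniform growth bounds for the variation measure, outside a null set\<close>

definition L :: "nat \<Rightarrow> (real^'b) set" where
  "L p = {a. norm a \<le> real p \<and> ball a (2 / real (Suc p)) \<subseteq> U}"

text \<open>The scales match those of \<open>L p\<close>: balls of radius at most
  \<open>1 / real (Suc p)\<close> about points of \<open>L p\<close> stay in the compact set
  \<open>L' p\<close>, where weight and variation are finite.\<close>

definition L' :: "nat \<Rightarrow> (real^'b) set" where
  "L' p = {a. norm a \<le> real (Suc p) \<and> ball a (1 / real (Suc p)) \<subseteq> U}"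

lemma compact_inner_set:
  assumes "r > 0" shows "compact {a. norm a \<le> R \<and> ball a r \<subseteq> U}" "{a. norm a \<le> R \<and> ball a r \<subseteq> U} \<subseteq> U"
proof -
  have "closed {a. ball a r \<subseteq> U}"
    unfolding closed_def open_dist
  proof (intro ballI)
    fix a assume "a \<in> - {a. ball a r \<subseteq> U}"
    then have "\<not> ball a r \<subseteq> U" by simp
    then obtain x where "x \<in> ball a r" "x \<notin> U" by blast
    then have x: "dist a x < r" "x \<notin> U" by auto
    have "y \<in> - {a. ball a r \<subseteq> U}" if "dist y a < r - dist a x" for y
    proof -
      have "x \<in> ball y r" using dist_triangle[of y x a] that by simp
      then show ?thesis using x(2) by blast
    qed
    then show "\<exists>e>0. \<forall>y. dist y a < e \<longrightarrow> y \<in> - {a. ball a r \<subseteq> U}"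
      using x by (intro exI[of _ "r - dist a x"]) auto
  qed
  moreover have "{a. norm a \<le> R \<and> ball a r \<subseteq> U} = cball 0 R \<inter> {a. ball a r \<subseteq> U}" by auto
  ultimately show "compact {a. norm a \<le> R \<and> ball a r \<subseteq> U}" by (simp add: compact_Int_closed)
  show "{a. norm a \<le> R \<and> ball a r \<subseteq> U} \<subseteq> U" using assms by force
qed

lemma L: "compact (L p)" "L p \<subseteq> U" "compact (L' p)" "L' p \<subseteq> U"
  unfolding L_def L'_def by (rule compact_inner_set; simp)+

lemma L_sets: "L p \<in> sets (restrict_space borel U)" "L' p \<in> sets (restrict_space borel U)"
  using L[of p] by (auto simp: sets_restrict_borel_iff[OF U] borel_compact)

lemma L_cball:
  assumes "a \<in> L p" "r \<le> 1 / real (Suc p)" shows "cball a r \<subseteq> L' p"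
proof
  fix z assume "z \<in> cball a r"
  then have z: "dist a z \<le> 1 / real (Suc p)" using assms(2) by simp
  have p1: "1 / real (Suc p) \<le> 1" by simp
  have "norm z \<le> norm a + dist a z" using norm_triangle_sub[of z a] by (simp add: dist_norm norm_minus_commute)
  moreover have "norm a \<le> real p" using assms(1) by (simp add: L_def)
  moreover have "real (Suc p) = real p + 1" by simp
  ultimately have "norm z \<le> real (Suc p)" using z p1 by linarith
  moreover have "ball z (1 / real (Suc p)) \<subseteq> ball a (2 / real (Suc p))"
  proof
    fix x assume "x \<in> ball z (1 / real (Suc p))"
    moreover have "2 / real (Suc p) = 1 / real (Suc p) + 1 / real (Suc p)" by (simp add: field_simps)
    ultimately show "x \<in> ball a (2 / real (Suc p))" using z dist_triangle[of a x z] by auto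
  qed
  ultimately show "z \<in> L' p" using assms(1) unfolding L_def L'_def by auto
qed

lemma L_mono: "p \<le> q \<Longrightarrow> L p \<subseteq> L q"
proof
  fix a assume *: "p \<le> q" "a \<in> L p"
  have "2 / real (Suc q) \<le> 2 / real (Suc p)" using *(1) by (simp add: frac_le)
  then have "ball a (2 / real (Suc q)) \<subseteq> ball a (2 / real (Suc p))" by (rule subset_ball)
  then show "a \<in> L q" using * unfolding L_def by auto
qed

lemma L_Union: "(\<Union>p. L p) = U"
proof
  show "(\<Union>p. L p) \<subseteq> U" using L(2) by blast
  show "U \<subseteq> (\<Union>p. L p)"
  proof
    fix a assume "a \<in> U"
    then obtain e where e: "e > 0" "ball a e \<subseteq> U" using U open_contains_ball by blast
    obtain p1 where p1: "inverse (real (Suc p1)) < e / 2" using reals_Archimedean[of "e/2"] e(1) by auto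
    obtain p2 where p2: "norm a \<le> real p2" using real_arch_simple by blast
    define p where "p = max p1 p2"
    have "inverse (real (Suc p)) \<le> inverse (real (Suc p1))" by (simp add: p_def)
    moreover have "2 / real (Suc p) = 2 * inverse (real (Suc p))" by (rule divide_inverse)
    ultimately have "2 / real (Suc p) \<le> e" using p1 by linarith
    then have "ball a (2 / real (Suc p)) \<subseteq> U" by (rule order_trans[OF subset_ball e(2)])
    moreover have "norm a \<le> real p" using p2 by (simp add: p_def)
    ultimately show "a \<in> (\<Union>p. L p)" by (auto simp: L_def)
  qed
qed

text \<open>On the whole space every ball is measurable, also one that leaves
  \<open>U\<close>.\<close>

definition extend :: "(real^'b) measure \<Rightarrow> (real^'b) measure" where
  "extend N = distr N borel (\<lambda>z. z)"

lemma extend: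
  assumes N: "sets N = sets (restrict_space borel U)"
  shows "sets (extend N) = sets borel" "A \<in> sets borel \<Longrightarrow> emeasure (extend N) A = emeasure N (A \<inter> U)"
proof -
  show "sets (extend N) = sets borel" by (simp add: extend_def)
  have sp: "space N = U" using sets_eq_imp_space_eq[OF N] by (simp add: space_restrict_space)
  have "(\<lambda>z. z) \<in> measurable N borel"
    unfolding measurable_cong_sets[OF N refl] by (rule measurable_restrict_space1) simp
  then show "A \<in> sets borel \<Longrightarrow> emeasure (extend N) A = emeasure N (A \<inter> U)"
    by (simp add: extend_def emeasure_distr sp)
qed

text \<open>One constant \<open>p\<close> for all small radii, and not only a bound in the limit, is
  what makes the later lower bound uniform on \<open>D p\<close>.\<close>

definition D :: "nat \<Rightarrow> (real^'b) set" where
  "D p = {a \<in> L p. \<forall>r. 0 < r \<and> r < 1 / real (Suc p) \<longrightarrow> emeasure (extend \<nu>) (ball a r) \<le> ennreal (real p * r ^ m)}"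

lemma D_sets: "D p \<in> sets (restrict_space borel U)"
proof -
  have "closed {a. \<forall>r. 0 < r \<and> r < 1 / real (Suc p) \<longrightarrow> emeasure (extend \<nu>) (ball a r) \<le> ennreal (real p * r ^ m)}"
    by (rule closed_measure_ball_le) (simp add: extend(1))
  then have "compact (D p)"
    unfolding D_def using compact_Int_closed[OF L(1)] by (simp add: Collect_conj_eq)
  moreover have "D p \<subseteq> U" using L(2) by (auto simp: D_def)
  ultimately show ?thesis by (simp add: sets_restrict_borel_iff[OF U] borel_compact)
qed

text \<open>A point of \<open>L q\<close> outside every \<open>D p\<close> has, for each
  \<open>J\<close>, arbitrarily small balls on which the variation is at least
  \<open>J * r ^ m\<close>. The covering argument bounds the Hausdorff measure by a constant over
  \<open>J\<close>, and \<open>J\<close> is arbitrary.\<close>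

lemma outside_D_null: "hausdorff_outer m (L q - (\<Union>p. D p)) = 0"
proof -
  let ?A = "L q - (\<Union>p. D p)" and ?\<alpha> = "unit_ball_vol (real m)"
  have L's: "L' q \<in> sets (extend \<nu>)" using L(3) by (simp add: extend(1) borel_compact)
  have L'e: "emeasure (extend \<nu>) (L' q) = emeasure \<nu> (L' q)"
    using L(3,4) by (subst extend(2)) (auto simp: borel_compact Int_absorb2)
  have fin: "emeasure \<nu> (L' q) < \<infinity>" by (rule radon_on_open.finite_compact[OF radon_\<nu> L(3,4)])
  define K where "K = measure \<nu> (L' q)"
  have K: "emeasure (extend \<nu>) (L' q) = ennreal K" using fin by (simp add: L'e K_def emeasure_eq_ennreal_measure less_top)
  have bound: "hausdorff_outer m ?A \<le> ennreal (?\<alpha> * 5 ^ m / real J) * ennreal K" if J: "1 \<le> J" for J :: nat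
    unfolding K[symmetric]
  proof (rule hausdorff_outer_le_of_density[OF m1 _ _ L's])
    show "0 < real J" using J by simp
    fix a :: "real^'b" and \<rho> :: real assume a: "a \<in> ?A" and \<rho>: "0 < \<rho>"
    obtain p1 where p1: "inverse (real (Suc p1)) < \<rho>" using reals_Archimedean[OF \<rho>] by auto
    \<comment> \<open>\<open>p1\<close> makes the radius smaller than \<open>\<rho>\<close>,
      \<open>q\<close> puts the ball inside \<open>L' q\<close>, and \<open>J\<close> bounds the
      ratio from below.\<close>
    define p where "p = max p1 (max q J)"
    have "q \<le> p" by (simp add: p_def)
    then have "a \<in> L p" using a L_mono[of q p] by blast
    moreover have "a \<notin> D p" using a by auto
    ultimately obtain r where r: "0 < r" "r < 1 / real (Suc p)" "ennreal (real p * r ^ m) < emeasure (extend \<nu>) (ball a r)"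
      by (auto simp: D_def not_le)
    have le: "1 / real (Suc p) \<le> 1 / real (Suc p1)" "1 / real (Suc p) \<le> 1 / real (Suc q)"
      by (auto simp: p_def frac_le)
    have r1: "r < \<rho>" "r \<le> 1 / real (Suc q)"
      using r(2) p1 le unfolding inverse_eq_divide by linarith+
    have "ennreal (real J * r ^ m) \<le> ennreal (real p * r ^ m)"
      using r(1) by (intro ennreal_leI mult_right_mono) (auto simp: p_def)
    also have "\<dots> \<le> emeasure (extend \<nu>) (ball a r)" using r(3) by simp
    also have "\<dots> \<le> emeasure (extend \<nu>) (cball a r)" by (intro emeasure_mono) (auto simp: extend(1))
    finally show "\<exists>r>0. r < \<rho> \<and> cball a r \<subseteq> L' q \<and> cball a r \<in> sets (extend \<nu>) \<and> ennreal (real J * r ^ m) \<le> emeasure (extend \<nu>) (cball a r)"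
      using r(1) r1 L_cball[of a q r] a by (intro exI[of _ r]) (auto simp: extend(1))
  qed
  have "(\<lambda>J. ennreal (?\<alpha> * 5 ^ m * K * inverse (real (Suc J)))) \<longlonglongrightarrow> ennreal (?\<alpha> * 5 ^ m * K * 0)"
    by (intro tendsto_ennrealI tendsto_intros LIMSEQ_inverse_real_of_nat)
  moreover have "hausdorff_outer m ?A \<le> ennreal (?\<alpha> * 5 ^ m * K * inverse (real (Suc J)))" for J
  proof -
    have "0 \<le> K" by (simp add: K_def)
    then have "ennreal (?\<alpha> * 5 ^ m / real (Suc J)) * ennreal K = ennreal (?\<alpha> * 5 ^ m * K * inverse (real (Suc J)))"
      by (subst ennreal_mult'[symmetric]) (auto simp: divide_inverse mult_ac)
    then show ?thesis using bound[of "Suc J"] by simp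
  qed
  ultimately have "hausdorff_outer m ?A \<le> ennreal (?\<alpha> * 5 ^ m * K * 0)"
    by (intro LIMSEQ_le_const) auto
  then show ?thesis by simp
qed

lemma D_null: "emeasure \<mu> (U - (\<Union>p. D p)) = 0"
proof -
  have s: "L q - (\<Union>p. D p) \<in> sets \<mu>" for q using L_sets D_sets by auto
  have "U - (\<Union>p. D p) = (\<Union>q. L q - (\<Union>p. D p))" using L_Union by auto
  moreover have "emeasure \<mu> (\<Union>q. L q - (\<Union>p. D p)) = 0"
    using s outside_D_null by (intro emeasure_UN_eq_0 \<mu>_null) auto
  ultimately show ?thesis by simp
qed

lemma E_null: "emeasure \<mu> (U - (\<Union>i. E i)) = 0"
proof -
  have s: "U - (\<Union>i. E i) \<in> sets (restrict_space borel U)" using Eb U by (auto simp: sets_restrict_borel_iff[OF U])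
  have "(U - (\<Union>i. E i)) \<inter> E j = {}" for j by auto
  then show ?thesis by (simp add: \<mu>_hausdorff[OF s])
qed

text \<open>
  The positive constant is dictated by the comparison with the Hausdorff measure: a set whose
  density is smaller everywhere would have less than half of its own measure.
\<close>

definition low :: "nat \<Rightarrow> real" where
  "low i = c i * unit_ball_vol (real m) / (2 * 4 ^ m)"

section \<open>The lower bound for balanced sets at a fixed scale\<close>

lemma low_pos: "low i > 0" using c[of i] by (simp add: low_def)

text \<open>Otherwise the set is a countable union of sets \<open>Z k\<close> on which
  \<open>\<mu>\<close> restricted to \<open>B\<close> has ratios at most \<open>low i\<close> below
  a fixed radius. There \<open>\<mu>\<close> is at most \<open>c i / 2\<close> times the Hausdorff
  outer measure, whereas on \<open>E i\<close> it is at least \<open>c i\<close> times the Hausdorff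
  measure; finiteness then forces \<open>Z k\<close> to be null.\<close>

lemma density_point:
  assumes B: "B \<in> sets (restrict_space borel U)" and pos: "emeasure \<mu> (B \<inter> (D p \<inter> E i)) \<noteq> 0"
  shows "\<exists>a \<in> B \<inter> (D p \<inter> E i). \<forall>\<rho>>0. \<exists>s. 0 < s \<and> s < \<rho> \<and> ennreal (low i * s ^ m) < emeasure \<mu> (B \<inter> ball a s)"
proof (rule ccontr)
  assume neg: "\<not> ?thesis"
  let ?A = "B \<inter> (D p \<inter> E i)"
  let ?N = "extend (density \<mu> (indicator B))"
  have sd: "sets (density \<mu> (indicator B)) = sets (restrict_space borel U)" by simp
  have sN: "sets ?N = sets borel" by (rule extend(1)[OF sd])
  have N: "emeasure ?N A = emeasure \<mu> (B \<inter> A)" if "A \<in> sets borel" for A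
  proof -
    have "A \<inter> U \<in> sets \<mu>" using that U by (simp add: sets_restrict_borel_iff[OF U])
    then have "emeasure ?N A = emeasure \<mu> (B \<inter> (A \<inter> U))"
      using B by (simp add: extend(2)[OF sd that] emeasure_density_indicator)
    moreover have "B \<inter> (A \<inter> U) = B \<inter> A" using B by (auto simp: sets_restrict_borel_iff[OF U])
    ultimately show ?thesis by simp
  qed
  define Z where "Z k = ?A \<inter> {a. \<forall>s. 0 < s \<and> s < inverse (real (Suc k)) \<longrightarrow> emeasure ?N (ball a s) \<le> ennreal (low i * s ^ m)}" for k
  have As: "?A \<in> sets borel" "?A \<subseteq> U" using B D_sets[of p] Eb by (auto simp: sets_restrict_borel_iff[OF U])
  have Zs: "Z k \<in> sets borel" for k
    unfolding Z_def by (rule sets.Int[OF As(1) borel_closed[OF closed_measure_ball_le]]) (simp add: sN)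
  have ZU: "Z k \<in> sets (restrict_space borel U)" for k
    using Zs As(2) by (auto simp: sets_restrict_borel_iff[OF U] Z_def)
  have "emeasure \<mu> (Z k) = 0" for k
  proof -
    have le: "emeasure \<mu> (Z k) \<le> ennreal (c i / 2) * hausdorff_outer m (Z k)"
    proof -
      have "emeasure ?N (Z k) \<le> ennreal (4 ^ m * low i / unit_ball_vol (real m)) * hausdorff_outer m (Z k)"
        by (rule measure_le_hausdorff_outer[OF m1 low_pos _ sN _ Zs, where \<rho> = "inverse (real (Suc k))"])
           (auto simp: Z_def)
      moreover have "4 ^ m * low i / unit_ball_vol (real m) = c i / 2"
        by (simp add: low_def less_imp_neq[OF unit_ball_vol_pos, symmetric])
      moreover have "emeasure ?N (Z k) = emeasure \<mu> (Z k)"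
      proof -
        have "B \<inter> Z k = Z k" by (auto simp: Z_def)
        then show ?thesis by (simp add: N[OF Zs])
      qed
      ultimately show ?thesis by simp
    qed
    \<comment> \<open>If \<open>hausdorff m\<close> vanishes identically, so does
      \<open>\<mu>\<close>; otherwise measure and outer measure agree and the two bounds can be
      compared.\<close>
    from hausdorff_cases[of m, where 'a = "real^'b"] show ?thesis
    proof
      assume "\<forall>A. emeasure (hausdorff m :: (real^'b) measure) A = 0"
      then show ?thesis by (simp add: \<mu>_hausdorff[OF ZU])
    next
      assume "\<forall>A\<in>sets borel. emeasure (hausdorff m :: (real^'b) measure) A = hausdorff_outer m A"
      then have eq: "hausdorff_outer m (Z k) = emeasure H (Z k)" using Zs by simp
      have low: "ennreal (c i) * emeasure H (Z k) \<le> emeasure \<mu> (Z k)"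
        using Zs by (intro \<mu>_lower) (auto simp: Z_def)
      \<comment> \<open>Comparing a quantity with half of itself is conclusive only if it is finite;
        \<open>D p\<close> lies in the compact set \<open>L p\<close>.\<close>
      have "emeasure \<mu> (Z k) \<le> emeasure \<mu> (L p)"
        using L_sets by (intro emeasure_mono) (auto simp: Z_def D_def)
      then have finm: "emeasure \<mu> (Z k) < \<infinity>" using finite_\<mu>[OF L(1,2)] by (rule le_less_trans)
      have finH: "emeasure H (Z k) < \<infinity>"
      proof (rule ccontr)
        assume "\<not> ?thesis"
        then have "emeasure H (Z k) = top" by (simp add: not_less top_unique)
        then have "ennreal (c i) * emeasure H (Z k) = top" using c[of i] by (simp add: ennreal_mult_eq_top_iff)
        then show False using low finm by (simp add: top_unique)
      qed
      define x where "x = enn2real (emeasure H (Z k))"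
      have x: "emeasure H (Z k) = ennreal x" "0 \<le> x" using finH by (auto simp: x_def less_top)
      have "ennreal (c i) * ennreal x \<le> ennreal (c i / 2) * ennreal x"
        using low le by (simp add: eq x(1))
      moreover have "ennreal (c i) * ennreal x = ennreal (c i * x)" "ennreal (c i / 2) * ennreal x = ennreal (c i / 2 * x)"
        using c[of i] by (intro ennreal_mult'[symmetric]; simp)+
      ultimately have "ennreal (c i * x) \<le> ennreal (c i / 2 * x)" by (simp only:)
      then have "c i * x \<le> c i / 2 * x" using c[of i] x(2) by (subst (asm) ennreal_le_iff) auto
      then have "x = 0" using c[of i] x(2) by (simp add: mult_le_0_iff)
      then show ?thesis using le by (simp add: eq x(1))
    qed
  qed
  then have "emeasure \<mu> (\<Union>k. Z k) = 0" using ZU by (intro emeasure_UN_eq_0) auto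
  moreover have "?A \<subseteq> (\<Union>k. Z k)"
  proof
    fix a assume a: "a \<in> ?A"
    then have "\<not> (\<forall>\<rho>>0. \<exists>s. 0 < s \<and> s < \<rho> \<and> ennreal (low i * s ^ m) < emeasure \<mu> (B \<inter> ball a s))"
      using neg by blast
    then obtain \<rho> where \<rho>: "\<rho> > 0" "\<not> (\<exists>s. 0 < s \<and> s < \<rho> \<and> ennreal (low i * s ^ m) < emeasure \<mu> (B \<inter> ball a s))"
      by blast
    then have small: "emeasure \<mu> (B \<inter> ball a s) \<le> ennreal (low i * s ^ m)" if "0 < s" "s < \<rho>" for s
      using that not_less by blast
    obtain k where k: "inverse (real (Suc k)) < \<rho>" using reals_Archimedean[OF \<rho>(1)] by auto
    have "emeasure ?N (ball a s) \<le> ennreal (low i * s ^ m)" if "0 < s" "s < inverse (real (Suc k))" for s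
      using small[of s] that k by (simp add: N)
    then have "a \<in> Z k" using a by (simp add: Z_def)
    then show "a \<in> (\<Union>k. Z k)" by blast
  qed
  ultimately have "emeasure \<mu> ?A = 0" using ZU null_mono[of "\<Union>k. Z k" ?A] by auto
  then show False using pos by simp
qed

text \<open>The first bound keeps the ball within the range where \<open>D p\<close> and
  \<open>L p\<close> give control; the second makes the error \<open>p * r\<close> of the
  monotonicity formula at most half of the density \<open>low i / 2 ^ m\<close>. The summand 1
  avoids a division by 0 for \<open>p = 0\<close>.\<close>

definition radius :: "nat \<Rightarrow> nat \<Rightarrow> real" where
  "radius p i = min (1 / (2 * real (Suc p))) (low i / (2 * 2 ^ m * (real p + 1)))"

lemma radius: "0 < radius p i" "radius p i < 1 / real (Suc p)" "real p * radius p i \<le> low i / (2 * 2 ^ m)"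
proof -
  show r0: "0 < radius p i" using low_pos[of i] by (simp add: radius_def add_nonneg_pos)
  have "radius p i \<le> 1 / (2 * real (Suc p))" by (simp add: radius_def)
  also have "\<dots> < 1 / real (Suc p)" by (simp add: field_simps)
  finally show "radius p i < 1 / real (Suc p)" .
  have "(real p + 1) * radius p i \<le> (real p + 1) * (low i / (2 * 2 ^ m * (real p + 1)))"
    by (intro mult_left_mono) (auto simp: radius_def)
  also have "\<dots> = low i / (2 * 2 ^ m)"
    unfolding divide_divide_eq_left[symmetric] by (simp add: add_nonneg_pos less_imp_neq[symmetric])
  finally show "real p * radius p i \<le> low i / (2 * 2 ^ m)" using r0 by (simp add: algebra_simps)
qed

text \<open>By \<open>density_point\<close> some small ball has ratio above \<open>low i\<close>;
  \<open>density_monotone\<close> carries at least half of \<open>low i / 2 ^ m\<close> up to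
  \<open>radius p i\<close>. The bound depends on \<open>p\<close> and \<open>i\<close> but not on
  \<open>B\<close>.\<close>

lemma balanced_lower_bound:
  assumes B: "balanced B" and pos: "emeasure \<mu> (B \<inter> (D p \<inter> E i)) \<noteq> 0"
  shows "low i / (2 * 2 ^ m) * radius p i ^ m \<le> measure \<mu> (B \<inter> L' p)"
proof -
  have Bs: "B \<in> sets (restrict_space borel U)" by (rule balanced_sets[OF B])
  obtain a where a: "a \<in> D p" "\<forall>\<rho>>0. \<exists>s. 0 < s \<and> s < \<rho> \<and> ennreal (low i * s ^ m) < emeasure \<mu> (B \<inter> ball a s)"
    using density_point[OF Bs pos] by blast
  have aL: "a \<in> L p" using a(1) by (simp add: D_def)
  define r where "r = radius p i"
  have r: "0 < r" "r < 1 / real (Suc p)" "real p * r \<le> low i / (2 * 2 ^ m)" using radius by (auto simp: r_def)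
  \<comment> \<open>Below \<open>r / 2\<close>, as \<open>density_monotone\<close> asks for
    \<open>2 * s \<le> r\<close>; the same factor 2 accounts for \<open>2 ^ m\<close>.\<close>
  obtain s where s: "0 < s" "s < r / 2" "ennreal (low i * s ^ m) < emeasure \<mu> (B \<inter> ball a s)"
    using a(2)[rule_format, of "r / 2"] r(1) by auto
  have sub: "cball a t \<subseteq> L' p" if "t \<le> 1 / real (Suc p)" for t by (rule L_cball[OF aL that])
  have ball_sub: "ball a t \<subseteq> L' p" if "t \<le> 1 / real (Suc p)" for t
    using sub[OF that] ball_subset_cball[of a t] by blast
  have bs: "B \<inter> ball a t \<in> sets \<mu>" if "t \<le> 1 / real (Suc p)" for t
    using Bs by (auto simp: sets_restrict_borel_iff[OF U])
  have fin: "emeasure \<mu> (B \<inter> L' p) < \<infinity>"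
    using emeasure_mono[of "B \<inter> L' p" "L' p" \<mu>] L_sets finite_\<mu>[OF L(3,4), of p] by (auto intro: le_less_trans)
  have fb: "emeasure \<mu> (B \<inter> ball a t) < \<infinity>" if "t \<le> 1 / real (Suc p)" for t
    using emeasure_mono[of "B \<inter> ball a t" "B \<inter> L' p" \<mu>] ball_sub[OF that] Bs L_sets fin by (auto intro: le_less_trans)
  have growth: "measure \<nu> (ball a t) \<le> real p * t ^ m" if t: "0 < t" "t < 1 / real (Suc p)" for t
  proof -
    have bU: "ball a t \<subseteq> U" using ball_sub[of t] t L(4) by (meson less_imp_le order_trans)
    have "emeasure (extend \<nu>) (ball a t) \<le> ennreal (real p * t ^ m)" using a(1) t by (simp add: D_def)
    then have "emeasure \<nu> (ball a t) \<le> ennreal (real p * t ^ m)"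
      using bU by (simp add: extend(2) Int_absorb2)
    then show ?thesis using t by (simp add: measure_def enn2real_leI)
  qed
  have "measure \<mu> (B \<inter> ball a s) / (2 * s) ^ m \<le> measure \<mu> (B \<inter> ball a r) / r ^ m + real p * r"
  proof (rule density_monotone[OF B _ _ growth, of "1 / real (Suc p)"])
    show "cball a (1 / real (Suc p)) \<subseteq> U" using sub[of "1 / real (Suc p)"] L(4) by auto
  qed (use s r in auto)
  moreover have "low i / 2 ^ m \<le> measure \<mu> (B \<inter> ball a s) / (2 * s) ^ m"
  proof -
    have "ennreal (low i * s ^ m) \<le> ennreal (measure \<mu> (B \<inter> ball a s))"
      using s(3) fb[of s] s r by (simp add: emeasure_eq_ennreal_measure less_top less_imp_le)
    then have "low i * s ^ m \<le> measure \<mu> (B \<inter> ball a s)" by (simp add: ennreal_le_iff)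
    then show ?thesis using s(1) by (simp add: power_mult_distrib field_simps)
  qed
  moreover have "low i / 2 ^ m = low i / (2 * 2 ^ m) + low i / (2 * 2 ^ m)" by simp
  ultimately have "low i / (2 * 2 ^ m) \<le> measure \<mu> (B \<inter> ball a r) / r ^ m" using r(3) by linarith
  then have "low i / (2 * 2 ^ m) * r ^ m \<le> measure \<mu> (B \<inter> ball a r)" using r(1) by (simp add: le_divide_eq)
  also have "\<dots> \<le> measure \<mu> (B \<inter> L' p)"
  proof (rule measure_mono_fmeasurable)
    show "B \<inter> ball a r \<subseteq> B \<inter> L' p" using ball_sub[of r] r(2) by auto
    show "B \<inter> ball a r \<in> sets \<mu>" using bs[of r] r(2) by simp
    show "B \<inter> L' p \<in> fmeasurable \<mu>" using Bs L_sets fin by (auto simp: fmeasurable_def)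
  qed
  finally show ?thesis by (simp add: r_def)
qed

theorem decomposition: "\<exists>G. decomposition m U V G"
proof -
  let ?f = "\<lambda>n. fst (prod_decode n)" and ?s = "\<lambda>n. snd (prod_decode n)"
  show ?thesis
  \<comment> \<open>Growth constants and rectifiable pieces are enumerated jointly as pairs; almost
    every point lies in some \<open>D p\<close> and in some \<open>E i\<close>.\<close>
  proof (rule decomposition_exists[where D = "\<lambda>n. D (?f n) \<inter> E (?s n)" and K = "\<lambda>n. L' (?f n)"
        and c = "\<lambda>n. low (?s n) / (2 * 2 ^ m) * radius (?f n) (?s n) ^ m"])
    have DE: "D p \<inter> E i \<in> sets \<mu>" for p i
      using D_sets[of p] Eb[of i] EU[of i] by (auto simp: sets_restrict_borel_iff[OF U])
    show "D (?f n) \<inter> E (?s n) \<in> sets \<mu>" for n by (rule DE)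
    show "L' (?f n) \<in> sets \<mu>" for n using L_sets by simp
    show "emeasure \<mu> (L' (?f n)) < \<infinity>" for n by (rule finite_\<mu>[OF L(3,4)])
    show "0 < low (?s n) / (2 * 2 ^ m) * radius (?f n) (?s n) ^ m" for n using low_pos radius(1) by simp
    show "low (?s n) / (2 * 2 ^ m) * radius (?f n) (?s n) ^ m \<le> measure \<mu> (B \<inter> L' (?f n))"
      if "balanced B" "emeasure \<mu> (B \<inter> (D (?f n) \<inter> E (?s n))) \<noteq> 0" for n B
      by (rule balanced_lower_bound[OF that])
    have Db: "D p \<in> sets borel" for p using D_sets[of p] by (simp add: sets_restrict_borel_iff[OF U])
    have "(\<Union>p. D p) \<in> sets borel" "(\<Union>i. E i) \<in> sets borel"
      using Db Eb by (intro sets.countable_UN; auto)+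
    then have s: "U - (\<Union>p. D p) \<in> sets \<mu>" "U - (\<Union>i. E i) \<in> sets \<mu>"
      using U by (auto simp: sets_restrict_borel_iff[OF U])
    have "U - (\<Union>n. D (?f n) \<inter> E (?s n)) \<subseteq> (U - (\<Union>p. D p)) \<union> (U - (\<Union>i. E i))"
    proof
      fix z assume z: "z \<in> U - (\<Union>n. D (?f n) \<inter> E (?s n))"
      have "\<not> (z \<in> D p \<and> z \<in> E i)" for p i
      proof
        assume "z \<in> D p \<and> z \<in> E i"
        then have "z \<in> D (?f (prod_encode (p, i))) \<inter> E (?s (prod_encode (p, i)))" by simp
        then show False using z by blast
      qed
      then show "z \<in> (U - (\<Union>p. D p)) \<union> (U - (\<Union>i. E i))" using z by auto
    qed
    moreover have "emeasure \<mu> ((U - (\<Union>p. D p)) \<union> (U - (\<Union>i. E i))) = 0"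
      using emeasure_subadditive[OF s] D_null E_null by simp
    ultimately show "emeasure \<mu> (U - (\<Union>n. D (?f n) \<inter> E (?s n))) = 0"
      using null_mono[OF _ sets.Un[OF s]] by blast
  qed
qed

end

theorem theorem5p18:
  fixes m :: nat and U :: "(real^'n::finite) set" and V :: "'n varifold"
  assumes "1 \<le> m" and "m \<le> CARD('n)"
    and "open U"
    and "rectifiable_varifold m U V"
    and "radon_first_variation U V"
  shows "\<exists>G. decomposition m U V G"
proof -
  obtain c :: "nat \<Rightarrow> real" and E M :: "nat \<Rightarrow> (real^'n) set"
    where *: "\<forall>i. 0 < c i \<and> C1_submanifold m (M i) \<and> E i \<in> sets borel \<and> E i \<subseteq> M i \<inter> U"
      "\<forall>k\<in>cc_functions (varifold_space m U).
           (\<forall>i. set_integrable (hausdorff m) (E i) (\<lambda>z. k (z, tangent_cone (M i) z))) \<and>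
           (\<lambda>i. c i * (LINT z:E i|hausdorff m. k (z, tangent_cone (M i) z))) sums (LINT p|V. k p)"
    using assms(4) unfolding rectifiable_varifold_def by blast
  interpret rectifiable_radon_varifold m U V c E M
    by unfold_locales (use assms * in \<open>auto simp: rectifiable_varifold_def\<close>)
  show ?thesis by (rule decomposition)
qed

end
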